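(* Let $(X,\rho,\mu)$ be a space of homogeneous type (with the standing assumptions listed in the context), $q\in(1,\infty)$, $\gamma_1,\gamma_2,\gamma_3\in(0,1)$, and $\omega$ be a weight. Then the following statements are equivalent. (i) $\omega\in A^+_q(\gamma_1)$. (ii) $\mathcal M^{\gamma_2+}$ is bounded from $L^q(X\times\mathbb R,\omega)$ to $L^{q,\infty}(X\times\mathbb R,\omega)$. (iii) $\mathcal M^{\gamma_3+}$ is bounded from $L^q(X\times\mathbb R,\omega)$ to $L^q(X\times\mathbb R,\omega)$.
   Context: Setting. $(X,\rho)$ is a quasi-metric space: $\rho:X\times X\to[0,\infty)$, $\rho(x,y)=0$ iff $x=y$, $\rho(x,y)=\rho(y,x)$, and $\rho(x,y)\le K_0[\rho(x,z)+\rho(z,y)]$ for all $x,y,z\in X$, with a constant $K_0\in[1,\infty)$. Balls are $B(x,r)=\{y\in X:\rho(x,y)<r\}$. $\mu$ is a nonnegative measure on a $\sigma$-algebra containing the balls which is doubling: $\mu(B(x,2r))\le C_\mu\mu(B(x,r))$ for all $x\in X$, $r\in(0,\infty)$; then $(X,\rho,\mu)$ is called a space of homogeneous type. Standing assumptions: (a) for each $x$ the balls $\{B(x,r)\}_{r>0}$ form a basis of open neighborhoods of $x$; (b) $\mu$ is Borel regular (open sets are measurable and every $A\subset X$ lies in a Borel set $E$ with $\mu(A)=\mu(E)$); (c) $0<\mu(B(x,r))<\infty$ for all balls; (d) $\operatorname{diam}(X)=\infty$ and $\mu(\{x\})=0$ for all $x$; (e) monotone geodesic property: there is a constant $\widetilde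 K>0$ such that for all $s\in(0,\infty)$ and $x,y\in X$ with $\rho(x,y)\ge s$ there are $m\in\mathbb N$ and points $x_0=x,x_1,\dots,x_m=y$ with $\rho(x_i,x_{i+1})\le\widetilde K s$ and $\rho(x_{i+1},x_m)\le\rho(x_i,x_m)-s$ for $i=0,\dots,m-1$. Fix $p\in(1,\infty)$. $X\times\mathbb R$ carries the quasi-metric $d((x,t),(y,s))=\max\{\rho(x,y),|t-s|^{1/p}\}$ and the product measure $\lambda=\mu\times m$, $m$ being Lebesgue measure on $\mathbb R$; the same basic assumptions (a)-(d) are made for $(X\times\mathbb R,d,\lambda)$. All integrals are with respect to $\lambda$, and $⨍_E f:=\frac1{\lambda(E)}\int_E f$ denotes the average. Parabolic cylinders. For $x\in X$, $t\in\mathbb R$, $l\in(0,\infty)$, $\gamma\in[0,1)$ put $R=R(x,t,l)=B(x,l)\times(t-l^p,t+l^p)$, $R^-(\gamma)=B(x,l)\times(t-l^p,t-\gamma l^p)$, $R^+(\gamma)=B(x,l)\times(t+\gamma l^p,t+l^p)$. Weights. A weight is a real-valued, $\lambda$-almost everywhere positive, locally integrable function on $X\times\mathbb R$ (integrable on some cylinder $R(x,t,r)$ around each point). For $q\in(1,\infty)$, with $1/q+1/q'=1$, and $\gamma\in[0,1)$, a weight $\omega$ belongs to $A^+_q(\gamma)$ if $\sup_{R}\left[⨍_{R^-(\gamma)}\omega\right]\left[⨍_{R^+(\gamma)}\omega^{1-q'}\right]^{q-1}<\infty$, the supremum being over all parabolic cylinders $R(x,t,l)$. Adjacent dyadic systems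 and parabolic rectangles. Fix $\delta\in(0,1)$ with $96K_0^6\delta\le1$ and constants $0<c_0\le C_0<\infty$ with $12K_0^3C_0\delta\le c_0$; let $c_1=(3K_0^2)^{-1}c_0$, $C_1=2K_0C_0$. Fix (they exist by a theorem of Hytönen and Kairema) $K\in\mathbb N$ and, for $\tau\in\{1,\dots,K\}$, points $\{z^{k,\tau}_\alpha\}$ and families $\mathfrak D^\tau=\{Q^{k,\tau}_\alpha: k\in\mathbb Z,\alpha\in I_{k,\tau}\}$ of subsets of $X$ (dyadic cubes) such that for each $\tau$: $\rho(z^{k,\tau}_\alpha,z^{k,\tau}_\beta)\ge c_0\delta^k$ for $\alpha\ne\beta$ and $\min_\alpha\rho(x,z^{k,\tau}_\alpha)<C_0\delta^k$ for all $x\in X$; if $l\ge k$, then either $Q^{l,\tau}_\beta\subset Q^{k,\tau}_\alpha$ or they are disjoint; for each $k$, $X$ is the disjoint union of $Q^{k,\tau}_\alpha$, $\alpha\in I_{k,\tau}$; $B(z^{k,\tau}_\alpha,c_1\delta^k)\subset Q^{k,\tau}_\alpha\subset B(z^{k,\tau}_\alpha,C_1\delta^k)$; if $l\ge k$ and $Q^{l,\tau}_\beta\subset Q^{k,\tau}_\alpha$, then $B(z^{l,\tau}_\beta,C_1\delta^l)\subset B(z^{k,\tau}_\alpha,C_1\delta^k)$; moreover there is a constant $C_*>0$ such that every ball $B(x,r)$ is contained in some $Q^{k,\tau}_\alpha$ (for some $\tau$) with $\operatorname{diam}(Q^{k,\tau}_\alpha)\le C_*r$. A parabolic rectangle is $P=P(\tau,k,\alpha,t)=Q^{k,\tau}_\alpha\times(t-\delta^{kp},t+\delta^{kp})$,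 with $P^+(\gamma)=Q^{k,\tau}_\alpha\times(t+\gamma\delta^{kp},t+\delta^{kp})$. Maximal function. For $f\in L^1_{\rm loc}(X\times\mathbb R)$, $\mathcal M^{\gamma+}f(x,t)=\sup ⨍_{P^+(\gamma)}|f|$, the supremum being over all $\tau,k,\alpha$ with $(x,t)\in P=P(\tau,k,\alpha,t)$ (i.e. $x\in Q^{k,\tau}_\alpha$; the same $t$). Spaces. $\|f\|_{L^q(X\times\mathbb R,\omega)}=(\int|f|^q\omega)^{1/q}$ and $\|f\|_{L^{q,\infty}(X\times\mathbb R,\omega)}=\sup_{\xi>0}\xi\,[\omega(\{|f|>\xi\})]^{1/q}$, where $\omega(E)=\int_E\omega$. *)

theory Defs
  imports "HOL-Analysis.Analysis"
begin

text \<open>The space \<open>X\<close> is a whole type. The quasi-metric is an explicit function, so that the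
  library's metric type classes play no role.\<close>

subsection \<open>Quasi-metric measure spaces\<close>

definition quasi_metric :: "('a \<Rightarrow> 'a \<Rightarrow> real) \<Rightarrow> real \<Rightarrow> bool" where
  "quasi_metric \<rho> K0 \<longleftrightarrow>
     1 \<le> K0 \<and>
     (\<forall>x y. 0 \<le> \<rho> x y) \<and>
     (\<forall>x y. \<rho> x y = 0 \<longleftrightarrow> x = y) \<and>
     (\<forall>x y. \<rho> x y = \<rho> y x) \<and>
     (\<forall>x y z. \<rho> x y \<le> K0 * (\<rho> x z + \<rho> z y))"

definition qball :: "('a \<Rightarrow> 'a \<Rightarrow> real) \<Rightarrow> 'a \<Rightarrow> real \<Rightarrow> 'a set" where
  "qball \<rho> x r = {y. \<rho> x y < r}"

definition qdiam :: "('a \<Rightarrow> 'a \<Rightarrow> real) \<Rightarrow> 'a set \<Rightarrow> ennreal" where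
  "qdiam \<rho> A = (SUP (x, y) \<in> A \<times> A. ennreal (\<rho> x y))"

text \<open>Balls of a quasi-metric need not be open in the topology below; that they are is part of
  \<open>basic_assumptions\<close>. Given that, this is the only topology in which the balls centred
  at each point form a basis of open neighbourhoods of that point.\<close>

definition qopen :: "('a \<Rightarrow> 'a \<Rightarrow> real) \<Rightarrow> 'a set \<Rightarrow> bool" where
  "qopen \<rho> U \<longleftrightarrow> (\<forall>x\<in>U. \<exists>r>0. qball \<rho> x r \<subseteq> U)"

definition qborel_sets :: "('a \<Rightarrow> 'a \<Rightarrow> real) \<Rightarrow> 'a set set" where
  "qborel_sets \<rho> = sigma_sets UNIV {U. qopen \<rho> U}"

definition homogeneous_type :: "('a \<Rightarrow> 'a \<Rightarrow> real) \<Rightarrow> real \<Rightarrow> 'a measure \<Rightarrow> bool" where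
  "homogeneous_type \<rho> K0 \<mu> \<longleftrightarrow>
     quasi_metric \<rho> K0 \<and>
     space \<mu> = UNIV \<and>
     (\<forall>x. \<forall>r>0. qball \<rho> x r \<in> sets \<mu>) \<and>
     (\<exists>C::real. \<forall>x. \<forall>r>0.
        emeasure \<mu> (qball \<rho> x (2 * r)) \<le> ennreal C * emeasure \<mu> (qball \<rho> x r))"

text \<open>In the Borel regularity clause \<open>A\<close> is an arbitrary, possibly non-measurable set; its
  measure is then the outer measure, which agrees with \<open>emeasure\<close> on measurable sets.\<close>

definition basic_assumptions :: "('a \<Rightarrow> 'a \<Rightarrow> real) \<Rightarrow> 'a measure \<Rightarrow> bool" where
  "basic_assumptions \<rho> \<mu> \<longleftrightarrow>
     (\<forall>x. \<forall>r>0. qopen \<rho> (qball \<rho> x r)) \<and>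
     (\<forall>U. qopen \<rho> U \<longrightarrow> U \<in> sets \<mu>) \<and>
     (\<forall>A. \<exists>E\<in>qborel_sets \<rho>. A \<subseteq> E \<and> outer_measure_of \<mu> A = emeasure \<mu> E) \<and>
     (\<forall>x. \<forall>r>0. 0 < emeasure \<mu> (qball \<rho> x r) \<and> emeasure \<mu> (qball \<rho> x r) < \<infinity>) \<and>
     qdiam \<rho> UNIV = \<infinity> \<and>
     (\<forall>x. emeasure \<mu> {x} = 0)"

definition monotone_geodesic :: "('a \<Rightarrow> 'a \<Rightarrow> real) \<Rightarrow> bool" where
  "monotone_geodesic \<rho> \<longleftrightarrow>
     (\<exists>Kt>0. \<forall>s>0. \<forall>x y. s \<le> \<rho> x y \<longrightarrow>
        (\<exists>(m::nat) u. u 0 = x \<and> u m = y \<and>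
           (\<forall>i<m. \<rho> (u i) (u (Suc i)) \<le> Kt * s \<and>
                  \<rho> (u (Suc i)) (u m) \<le> \<rho> (u i) (u m) - s)))"

definition parabolic_dist ::
  "('a \<Rightarrow> 'a \<Rightarrow> real) \<Rightarrow> real \<Rightarrow> 'a \<times> real \<Rightarrow> 'a \<times> real \<Rightarrow> real" where
  "parabolic_dist \<rho> p = (\<lambda>(x, t) (y, s). max (\<rho> x y) (\<bar>t - s\<bar> powr (1 / p)))"

definition parabolic_measure :: "'a measure \<Rightarrow> ('a \<times> real) measure" where
  "parabolic_measure \<mu> = \<mu> \<Otimes>\<^sub>M lebesgue"

subsection \<open>Averages and norms\<close>

text \<open>Power of an extended nonnegative real, for exponents \<open>a > 0\<close> only.\<close>

definition epowr :: "ennreal \<Rightarrow> real \<Rightarrow> ennreal" where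
  "epowr x a = (if x = \<infinity> then \<infinity> else ennreal (enn2real x powr a))"

definition average :: "'b measure \<Rightarrow> 'b set \<Rightarrow> ('b \<Rightarrow> ennreal) \<Rightarrow> ennreal" where
  "average M E g = (\<integral>\<^sup>+z\<in>E. g z \<partial>M) / emeasure M E"

text \<open>The norms are defined for \<open>[0,\<infinity>]\<close>-valued functions, since maximal functions may be
  infinite; they are applied to \<open>\<bar>f\<bar>\<close> when \<open>f\<close> is real-valued.\<close>

definition Lq_norm :: "'b measure \<Rightarrow> ('b \<Rightarrow> real) \<Rightarrow> real \<Rightarrow> ('b \<Rightarrow> ennreal) \<Rightarrow> ennreal" where
  "Lq_norm M \<omega> q g = epowr (\<integral>\<^sup>+z. epowr (g z) q * ennreal (\<omega> z) \<partial>M) (1 / q)"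

definition weak_Lq_norm :: "'b measure \<Rightarrow> ('b \<Rightarrow> real) \<Rightarrow> real \<Rightarrow> ('b \<Rightarrow> ennreal) \<Rightarrow> ennreal" where
  "weak_Lq_norm M \<omega> q g =
     (SUP \<xi>\<in>{0<..}. ennreal \<xi> *
        epowr (\<integral>\<^sup>+z\<in>{z. ennreal \<xi> < g z}. ennreal (\<omega> z) \<partial>M) (1 / q))"

definition Lq_space :: "'b measure \<Rightarrow> ('b \<Rightarrow> real) \<Rightarrow> real \<Rightarrow> ('b \<Rightarrow> real) set" where
  "Lq_space M \<omega> q =
     {f \<in> borel_measurable M. Lq_norm M \<omega> q (\<lambda>z. ennreal \<bar>f z\<bar>) < \<infinity>}"

definition bounded_Lq_Lq ::
  "'b measure \<Rightarrow> ('b \<Rightarrow> real) \<Rightarrow> real \<Rightarrow> (('b \<Rightarrow> real) \<Rightarrow> 'b \<Rightarrow> ennreal) \<Rightarrow> bool" where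
  "bounded_Lq_Lq M \<omega> q T \<longleftrightarrow>
     (\<exists>C::real. \<forall>f\<in>Lq_space M \<omega> q.
        Lq_norm M \<omega> q (T f) \<le> ennreal C * Lq_norm M \<omega> q (\<lambda>z. ennreal \<bar>f z\<bar>))"

definition bounded_Lq_weak_Lq ::
  "'b measure \<Rightarrow> ('b \<Rightarrow> real) \<Rightarrow> real \<Rightarrow> (('b \<Rightarrow> real) \<Rightarrow> 'b \<Rightarrow> ennreal) \<Rightarrow> bool" where
  "bounded_Lq_weak_Lq M \<omega> q T \<longleftrightarrow>
     (\<exists>C::real. \<forall>f\<in>Lq_space M \<omega> q.
        weak_Lq_norm M \<omega> q (T f) \<le> ennreal C * Lq_norm M \<omega> q (\<lambda>z. ennreal \<bar>f z\<bar>))"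

subsection \<open>Parabolic cylinders and weights\<close>

definition cylinder ::
  "('a \<Rightarrow> 'a \<Rightarrow> real) \<Rightarrow> real \<Rightarrow> 'a \<Rightarrow> real \<Rightarrow> real \<Rightarrow> ('a \<times> real) set" where
  "cylinder \<rho> p x t l = qball \<rho> x l \<times> {t - l powr p <..< t + l powr p}"

definition cylinder_minus ::
  "('a \<Rightarrow> 'a \<Rightarrow> real) \<Rightarrow> real \<Rightarrow> real \<Rightarrow> 'a \<Rightarrow> real \<Rightarrow> real \<Rightarrow> ('a \<times> real) set" where
  "cylinder_minus \<rho> p \<gamma> x t l = qball \<rho> x l \<times> {t - l powr p <..< t - \<gamma> * l powr p}"

definition cylinder_plus ::
  "('a \<Rightarrow> 'a \<Rightarrow> real) \<Rightarrow> real \<Rightarrow> real \<Rightarrow> 'a \<Rightarrow> real \<Rightarrow> real \<Rightarrow> ('a \<times> real) set" where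
  "cylinder_plus \<rho> p \<gamma> x t l = qball \<rho> x l \<times> {t + \<gamma> * l powr p <..< t + l powr p}"

definition weight ::
  "('a \<Rightarrow> 'a \<Rightarrow> real) \<Rightarrow> 'a measure \<Rightarrow> real \<Rightarrow> ('a \<times> real \<Rightarrow> real) \<Rightarrow> bool" where
  "weight \<rho> \<mu> p \<omega> \<longleftrightarrow>
     \<omega> \<in> borel_measurable (parabolic_measure \<mu>) \<and>
     (AE z in parabolic_measure \<mu>. 0 < \<omega> z) \<and>
     (\<forall>x t. \<exists>r>0. set_integrable (parabolic_measure \<mu>) (cylinder \<rho> p x t r) \<omega>)"

definition conjugate_exponent :: "real \<Rightarrow> real" where
  "conjugate_exponent q = q / (q - 1)"

definition A_plus ::
  "('a \<Rightarrow> 'a \<Rightarrow> real) \<Rightarrow> 'a measure \<Rightarrow> real \<Rightarrow> real \<Rightarrow> real \<Rightarrow> ('a \<times> real \<Rightarrow> real) set" where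
  "A_plus \<rho> \<mu> p q \<gamma> =
     {\<omega>. weight \<rho> \<mu> p \<omega> \<and>
       (SUP (x, t, l) \<in> UNIV \<times> UNIV \<times> {0<..}.
          average (parabolic_measure \<mu>) (cylinder_minus \<rho> p \<gamma> x t l) (\<lambda>z. ennreal (\<omega> z)) *
          epowr (average (parabolic_measure \<mu>) (cylinder_plus \<rho> p \<gamma> x t l)
                   (\<lambda>z. ennreal (\<omega> z powr (1 - conjugate_exponent q)))) (q - 1)) < \<infinity>}"

subsection \<open>Adjacent dyadic systems and the maximal function\<close>

text \<open>The arguments of \<open>I\<close>, \<open>zc\<close> (centres) and \<open>Q\<close> (cubes) are the system \<open>\<tau>\<close>, the generation \<open>k\<close>
  and, for the latter two, the index \<open>\<alpha>\<close> in \<open>I \<tau> k\<close>. Measurability of the cubes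
  does not follow from the other clauses; it is needed for averages over them to make sense, and
  holds for the Hytonen-Kairema cubes.\<close>

definition adjacent_dyadic_systems ::
  "('a \<Rightarrow> 'a \<Rightarrow> real) \<Rightarrow> real \<Rightarrow> 'a measure \<Rightarrow> real \<Rightarrow> real \<Rightarrow> real \<Rightarrow> nat \<Rightarrow>
   (nat \<Rightarrow> int \<Rightarrow> 'i set) \<Rightarrow> (nat \<Rightarrow> int \<Rightarrow> 'i \<Rightarrow> 'a) \<Rightarrow> (nat \<Rightarrow> int \<Rightarrow> 'i \<Rightarrow> 'a set) \<Rightarrow> bool" where
  "adjacent_dyadic_systems \<rho> K0 \<mu> \<delta> c0 C0 K I zc Q \<longleftrightarrow>
     (let c1 = c0 / (3 * K0^2); C1 = 2 * K0 * C0 in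
       0 < \<delta> \<and> \<delta> < 1 \<and> 96 * K0^6 * \<delta> \<le> 1 \<and>
       0 < c0 \<and> c0 \<le> C0 \<and> 12 * K0^3 * C0 * \<delta> \<le> c0 \<and>
       (\<forall>\<tau>\<in>{1..K}.
         (\<forall>k. \<forall>\<alpha>\<in>I \<tau> k. Q \<tau> k \<alpha> \<in> sets \<mu>) \<and>
         (\<forall>k. \<forall>\<alpha>\<in>I \<tau> k. \<forall>\<beta>\<in>I \<tau> k. \<alpha> \<noteq> \<beta> \<longrightarrow> c0 * \<delta> powi k \<le> \<rho> (zc \<tau> k \<alpha>) (zc \<tau> k \<beta>)) \<and>
         (\<forall>k x. \<exists>\<alpha>\<in>I \<tau> k. \<rho> x (zc \<tau> k \<alpha>) < C0 * \<delta> powi k) \<and>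
         (\<forall>k l. k \<le> l \<longrightarrow> (\<forall>\<alpha>\<in>I \<tau> k. \<forall>\<beta>\<in>I \<tau> l.
             Q \<tau> l \<beta> \<subseteq> Q \<tau> k \<alpha> \<or> Q \<tau> l \<beta> \<inter> Q \<tau> k \<alpha> = {})) \<and>
         (\<forall>k. (\<Union>\<alpha>\<in>I \<tau> k. Q \<tau> k \<alpha>) = UNIV \<and> disjoint_family_on (Q \<tau> k) (I \<tau> k)) \<and>
         (\<forall>k. \<forall>\<alpha>\<in>I \<tau> k.
             qball \<rho> (zc \<tau> k \<alpha>) (c1 * \<delta> powi k) \<subseteq> Q \<tau> k \<alpha> \<and>
             Q \<tau> k \<alpha> \<subseteq> qball \<rho> (zc \<tau> k \<alpha>) (C1 * \<delta> powi k)) \<and>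
         (\<forall>k l. k \<le> l \<longrightarrow> (\<forall>\<alpha>\<in>I \<tau> k. \<forall>\<beta>\<in>I \<tau> l.
             Q \<tau> l \<beta> \<subseteq> Q \<tau> k \<alpha> \<longrightarrow>
             qball \<rho> (zc \<tau> l \<beta>) (C1 * \<delta> powi l) \<subseteq> qball \<rho> (zc \<tau> k \<alpha>) (C1 * \<delta> powi k)))) \<and>
       (\<exists>Cs>0. \<forall>x. \<forall>r>0. \<exists>\<tau>\<in>{1..K}. \<exists>k. \<exists>\<alpha>\<in>I \<tau> k.
           qball \<rho> x r \<subseteq> Q \<tau> k \<alpha> \<and> qdiam \<rho> (Q \<tau> k \<alpha>) \<le> ennreal (Cs * r)))"

definition rectangle_plus ::
  "real \<Rightarrow> real \<Rightarrow> (nat \<Rightarrow> int \<Rightarrow> 'i \<Rightarrow> 'a set) \<Rightarrow> real \<Rightarrow> nat \<Rightarrow> int \<Rightarrow> 'i \<Rightarrow> real \<Rightarrow> ('a \<times> real) set"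
where
  "rectangle_plus p \<delta> Q \<gamma> \<tau> k \<alpha> t =
     Q \<tau> k \<alpha> \<times> {t + \<gamma> * \<delta> powr (of_int k * p) <..< t + \<delta> powr (of_int k * p)}"

text \<open>The averages are Lebesgue integrals of \<open>\<bar>f\<bar>\<close> with values in
  \<open>[0,\<infinity>]\<close>, so the definition makes sense for every measurable \<open>f\<close>, in particular for all of
  \<open>L\<^sup>q(\<omega>)\<close>.\<close>

definition parabolic_maximal ::
  "'a measure \<Rightarrow> real \<Rightarrow> real \<Rightarrow> nat \<Rightarrow> (nat \<Rightarrow> int \<Rightarrow> 'i set) \<Rightarrow> (nat \<Rightarrow> int \<Rightarrow> 'i \<Rightarrow> 'a set) \<Rightarrow>
   real \<Rightarrow> ('a \<times> real \<Rightarrow> real) \<Rightarrow> 'a \<times> real \<Rightarrow> ennreal" where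
  "parabolic_maximal \<mu> p \<delta> K I Q \<gamma> f = (\<lambda>(x, t).
     (SUP (\<tau>, k, \<alpha>) \<in> {(\<tau>, k, \<alpha>). \<tau> \<in> {1..K} \<and> \<alpha> \<in> I \<tau> k \<and> x \<in> Q \<tau> k \<alpha>}.
        average (parabolic_measure \<mu>) (rectangle_plus p \<delta> Q \<gamma> \<tau> k \<alpha> t) (\<lambda>z. ennreal \<bar>f z\<bar>)))"

end

(* The one-sided condition with lag gamma implies the same condition for every other lag: a monotone
   chain of balls of radius eps r crosses B(x,r) in O(1/eps) steps, which cost time of order
   eps^(p-1) r^p, and p > 1. Testing the weak type inequality on truncations of the dual weight
   sigma = omega^(-1/(q-1)) yields the condition for some lag, so only its sufficiency for the
   strong type inequality is difficult.

   For this, the maximal function is dominated by finitely many dyadic ones, in which the average over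
   a rectangle of a nested grid is replaced by the average over its translate by m steps forward in
   time. The dual weight need not be doubling, but on at least half of the past of a rectangle it
   exceeds a fixed fraction of its average. A covering argument for laminar families, whose counting
   function has bounded mean, turns this into a Gehring type self-improvement for sigma times a power
   of the distance to the bottom of a column. Hence the dyadic condition holds with an exponent
   r < q, and summing the resulting level set estimates gives the strong type inequality. *)
theory Submission imports Defs begin

section \<open>Weighted inequalities and laminar families\<close>

text \<open>The three statements meet in \<open>wide_conds\<close>, a one-sided condition for boxes
  of every relative length and gap, in which no lag parameter is left. The obstacle to sufficiency
  is that the condition compares a rectangle only with later translates, never with itself. Selected
  rectangles are disjoint, but their translates may overlap arbitrarily often; disjointness controls
  the overlap only on average, so only a part of each translate that still carries half of the mass
  is used. In the Gehring argument information passes from a selected rectangle to its translate two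
  steps back, which must not leave the column. Per generation the averages grow by a factor at most
  \<open>cd \<le> 2 ^ gdim\<close>, while the time sides at least halve; hence the power
  \<open>gdim\<close> of the height is what excludes rectangles near the bottom. Averaging
  \<open>\<sigma>\<close> over the cells of one generation \<open>n\<close> makes it locally
  bounded, so that the absorption starts from a finite quantity. The gain of an exponent
  \<open>r < q\<close> is what makes the sum over all levels converge, with no loss at small
  levels.\<close>

lemma power_split_le:
  fixes f w u q :: real
  assumes "1 < q" "0 \<le> f" "0 < w" "0 < u"
  shows "f \<le> u * (f powr q * w) + u powr (-1 / (q - 1)) * w powr (-1 / (q - 1))"
proof -
  define c where "c = u * w"
  have c: "c > 0" using assms by (simp add: c_def)
  have e: "u powr (-1 / (q - 1)) * w powr (-1 / (q - 1)) = c powr (-1 / (q - 1))"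
    using assms by (simp add: c_def powr_mult)
  show ?thesis
  proof (cases "f \<le> c powr (-1 / (q - 1))")
    case True
    moreover have "0 \<le> u * (f powr q * w)" using assms by simp
    ultimately show ?thesis using e by simp
  next
    case False
    then have f: "c powr (-1 / (q - 1)) < f" by simp
    have "0 \<le> c powr (-1 / (q - 1))" by simp
    with f have f0: "0 < f" by linarith
    have "(c powr (-1 / (q - 1))) powr (q - 1) \<le> f powr (q - 1)"
      using f assms by (intro powr_mono2) auto
    moreover have "(c powr (-1 / (q - 1))) powr (q - 1) = inverse c"
    proof -
      have "-1 / (q - 1) * (q - 1) = -1" using assms by simp
      then show ?thesis using c by (simp only: powr_powr powr_minus) simp
    qed
    ultimately have "inverse c \<le> f powr (q - 1)" by simp
    then have "1 \<le> c * f powr (q - 1)" using c by (simp add: field_simps)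
    then have "f * 1 \<le> f * (c * f powr (q - 1))"
      using f0 by (intro mult_left_mono) auto
    also have "\<dots> = c * (f powr 1 * f powr (q - 1))"
      using f0 by simp
    also have "f powr 1 * f powr (q - 1) = f powr q"
      by (subst powr_add [symmetric]) simp
    finally have "f \<le> u * (f powr q * w)" by (simp add: c_def mult_ac)
    moreover have "0 \<le> u powr (-1 / (q - 1)) * w powr (-1 / (q - 1))" by simp
    ultimately show ?thesis by linarith
  qed
qed

text \<open>The choice \<open>u = (S / A) powr ((q - 1) / q)\<close> makes the two terms on the
  right equal, whence the factor \<open>2 powr q\<close>. If \<open>A\<close> or \<open>S\<close>
  vanishes, a suitable \<open>u\<close> makes the remaining term equal to \<open>X / 2\<close>, so
  \<open>X\<close> vanishes too.\<close>

lemma split_bound_imp_powr_le: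
  fixes X A S q :: real
  assumes q: "1 < q" and X: "0 \<le> X" and A: "0 \<le> A" and S: "0 \<le> S"
    and le: "\<And>u. 0 < u \<Longrightarrow> X \<le> u * A + u powr (-1 / (q - 1)) * S"
  shows "X powr q \<le> 2 powr q * A * S powr (q - 1)"
proof (cases "X = 0 \<or> (0 < A \<and> 0 < S)")
  case False
  then have X0: "0 < X" and "A = 0 \<or> S = 0" using X A S by auto
  then show ?thesis
  proof (elim disjE)
    assume S0: "S = 0"
    have "0 < A" using le[of 1] X0 S0 A by auto
    then show ?thesis using le[of "X / (2 * A)"] X0 S0 by (simp add: field_simps)
  next
    assume A0: "A = 0"
    have S1: "0 < S" using le[of 1] X0 A0 S by auto
    define u where "u = (X / (2 * S)) powr (- (q - 1))"
    have u: "0 < u" using X0 S1 by (simp add: u_def)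
    have "u powr (-1 / (q - 1)) = X / (2 * S)"
    proof -
      have "- (q - 1) * (-1 / (q - 1)) = 1" using q by (simp add: field_simps)
      then show ?thesis using X0 S1 unfolding u_def powr_powr by simp
    qed
    then have "X \<le> X / 2" using le[OF u] A0 S1 by (simp add: field_simps)
    then show ?thesis using X0 by simp
  qed
next
  case True
  then show ?thesis
  proof (elim disjE conjE)
    assume "X = 0" then show ?thesis using A by simp
  next
    assume A0: "0 < A" and S0: "0 < S"
    define u where "u = (S / A) powr ((q - 1) / q)"
    have u: "0 < u" using A0 S0 by (simp add: u_def)
    have e1: "u * A = A powr (1 / q) * S powr ((q - 1) / q)"
    proof -
      have "u * A = S powr ((q - 1) / q) * (A powr (- ((q - 1) / q)) * A powr 1)"
        using A0 S0 by (simp add: u_def powr_divide powr_minus field_simps)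
      also have "A powr (- ((q - 1) / q)) * A powr 1 = A powr (1 / q)"
        using q by (subst powr_add [symmetric]) (simp add: field_simps)
      finally show ?thesis by (simp add: mult_ac)
    qed
    have e2: "u powr (-1 / (q - 1)) * S = A powr (1 / q) * S powr ((q - 1) / q)"
    proof -
      have "u powr (-1 / (q - 1)) = (S / A) powr (- (1 / q))"
        using q unfolding u_def by (subst powr_powr) (simp add: divide_simps)
      also have "\<dots> = A powr (1 / q) * S powr (- (1 / q))"
        using A0 S0 by (simp add: powr_divide powr_minus field_simps)
      finally have "u powr (-1 / (q - 1)) * S = A powr (1 / q) * (S powr (- (1 / q)) * S powr 1)"
        using S0 by simp
      also have "S powr (- (1 / q)) * S powr 1 = S powr ((q - 1) / q)"
        using q by (subst powr_add [symmetric]) (simp add: field_simps)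
      finally show ?thesis .
    qed
    have "X \<le> 2 * (A powr (1 / q) * S powr ((q - 1) / q))"
      using le[OF u] e1 e2 by linarith
    then have "X powr q \<le> (2 * (A powr (1 / q) * S powr ((q - 1) / q))) powr q"
      using X q by (intro powr_mono2) auto
    also have "\<dots> = 2 powr q * A * S powr (q - 1)"
      using A0 S0 q by (simp add: powr_mult powr_powr)
    finally show ?thesis .
  qed
qed

text \<open>Integrating the pointwise splitting with \<open>u\<close> still free avoids dividing by
  integrals that are not yet known to be finite and positive.\<close>

lemma nn_integral_split_le:
  fixes f w s :: "'b \<Rightarrow> real"
  assumes q: "1 < q" and u: "0 < u" and E: "E \<in> sets M"
    and meas: "f \<in> borel_measurable M" "w \<in> borel_measurable M" "s \<in> borel_measurable M"
    and f: "\<And>z. 0 \<le> f z" and w: "AE z in M. 0 < w z" and s: "AE z in M. s z = w z powr (-1 / (q - 1))"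
  shows "(\<integral>\<^sup>+z\<in>E. ennreal (f z) \<partial>M)
    \<le> ennreal u * (\<integral>\<^sup>+z\<in>E. ennreal (f z powr q * w z) \<partial>M)
      + ennreal (u powr (-1 / (q - 1))) * (\<integral>\<^sup>+z\<in>E. ennreal (s z) \<partial>M)"
proof -
  have "(\<integral>\<^sup>+z\<in>E. ennreal (f z) \<partial>M) \<le>
     (\<integral>\<^sup>+z. ennreal u * (ennreal (f z powr q * w z) * indicator E z) +
        ennreal (u powr (-1 / (q - 1))) * (ennreal (s z) * indicator E z) \<partial>M)"
  proof (rule nn_integral_mono_AE)
    show "AE z in M. ennreal (f z) * indicator E z \<le> ennreal u * (ennreal (f z powr q * w z) * indicator E z) +
        ennreal (u powr (-1 / (q - 1))) * (ennreal (s z) * indicator E z)"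
    using w s
  proof eventually_elim
    case (elim z)
    have "f z \<le> u * (f z powr q * w z) + u powr (-1 / (q - 1)) * s z"
      using power_split_le[OF q f[of z] elim(1) u] elim(2) by simp
    then have "ennreal (f z) \<le> ennreal u * ennreal (f z powr q * w z)
        + ennreal (u powr (-1 / (q - 1))) * ennreal (s z)"
      using elim u by (simp add: ennreal_mult'[symmetric] ennreal_plus[symmetric] del: ennreal_plus)
    then show ?case by (auto split: split_indicator)
  qed
  qed
  also have "\<dots> = ennreal u * (\<integral>\<^sup>+z\<in>E. ennreal (f z powr q * w z) \<partial>M)
      + ennreal (u powr (-1 / (q - 1))) * (\<integral>\<^sup>+z\<in>E. ennreal (s z) \<partial>M)"
    using E meas by (subst nn_integral_add; (subst nn_integral_cmult)?; measurable?) (simp_all add: nn_integral_cmult)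
  finally show ?thesis .
qed

text \<open>Hoelder's inequality, up to the factor \<open>2 powr q\<close>, in the form that suits
  A_q conditions: \<open>s\<close> is the weight dual to \<open>w\<close>. Finiteness is a separate
  claim because \<open>enn2real\<close> sends infinity to 0.\<close>

lemma weighted_Holder:
  fixes f w s :: "'b \<Rightarrow> real"
  assumes q: "1 < q" and E: "E \<in> sets M"
    and meas: "f \<in> borel_measurable M" "w \<in> borel_measurable M" "s \<in> borel_measurable M"
    and f: "\<And>z. 0 \<le> f z" and w: "AE z in M. 0 < w z" and s: "AE z in M. s z = w z powr (-1 / (q - 1))"
    and A: "(\<integral>\<^sup>+z\<in>E. ennreal (f z powr q * w z) \<partial>M) < \<infinity>"
    and S: "(\<integral>\<^sup>+z\<in>E. ennreal (s z) \<partial>M) < \<infinity>"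
  shows "(\<integral>\<^sup>+z\<in>E. ennreal (f z) \<partial>M) < \<infinity>"
    and "enn2real (\<integral>\<^sup>+z\<in>E. ennreal (f z) \<partial>M) powr q
      \<le> 2 powr q * enn2real (\<integral>\<^sup>+z\<in>E. ennreal (f z powr q * w z) \<partial>M)
        * enn2real (\<integral>\<^sup>+z\<in>E. ennreal (s z) \<partial>M) powr (q - 1)"
proof -
  let ?X = "\<integral>\<^sup>+z\<in>E. ennreal (f z) \<partial>M" and ?A = "\<integral>\<^sup>+z\<in>E. ennreal (f z powr q * w z) \<partial>M"
    and ?S = "\<integral>\<^sup>+z\<in>E. ennreal (s z) \<partial>M"
  note le = nn_integral_split_le[OF q _ E meas f w s]
  obtain a where a: "0 \<le> a" "?A = ennreal a" using A by (cases ?A) auto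
  obtain b where b: "0 \<le> b" "?S = ennreal b" using S by (cases ?S) auto
  show fin: "?X < \<infinity>" using le[of 1] a b
    by (simp add: ennreal_plus[symmetric] ennreal_mult'[symmetric] le_less_trans del: ennreal_plus)
  then obtain x where x: "0 \<le> x" "?X = ennreal x" by (cases ?X) auto
  have "x powr q \<le> 2 powr q * a * b powr (q - 1)"
  proof (rule split_bound_imp_powr_le[OF q x(1) a(1) b(1)])
    fix u :: real assume "0 < u"
    with le[of u] show "x \<le> u * a + u powr (-1 / (q - 1)) * b"
      using a b x by (simp add: ennreal_plus[symmetric] ennreal_mult'[symmetric] del: ennreal_plus)
  qed
  then show "enn2real ?X powr q \<le> 2 powr q * enn2real ?A * enn2real ?S powr (q - 1)"
    using a b x by simp
qed

section \<open>Countable families of sets with overlap that is bounded on average\<close>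

lemma borel_measurable_nn_integral_count_space:
  fixes f :: "'j \<Rightarrow> 'b \<Rightarrow> ennreal"
  assumes J: "countable J" and f: "\<And>j. j \<in> J \<Longrightarrow> f j \<in> borel_measurable M"
  shows "(\<lambda>z. \<integral>\<^sup>+j. f j z \<partial>count_space J) \<in> borel_measurable M"
proof -
  interpret sigma_finite_measure "count_space J"
    by (rule sigma_finite_measure_count_space_countable[OF J])
  have "(\<lambda>(z, j). f j z) \<in> borel_measurable (M \<Otimes>\<^sub>M count_space J)"
    unfolding case_prod_beta
    by (rule measurable_compose_countable'[where I = J and g = snd])
      (use J f in \<open>auto intro: measurable_compose[OF measurable_fst]\<close>)
  then show ?thesis by (rule borel_measurable_nn_integral)
qed

text \<open>Finite subfamilies are what laminarity can handle, since they have a maximal member; an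
  infinite set would contain finite subsets of more than \<open>L\<close> elements.\<close>

lemma nn_integral_count_space_card_le:
  assumes "\<And>F. finite F \<Longrightarrow> F \<subseteq> Z \<Longrightarrow> F \<noteq> {} \<Longrightarrow> real (card F) \<le> L" and "0 \<le> L"
  shows "emeasure (count_space UNIV) Z \<le> ennreal L"
proof (cases "finite Z")
  case True
  then show ?thesis using assms(1)[of Z] assms(2)
    by (cases "Z = {}") (auto simp: emeasure_count_space ennreal_of_nat_eq_real_of_nat)
next
  case False
  obtain F where F: "finite F" "F \<subseteq> Z" "card F = Suc (nat \<lceil>L\<rceil>)"
    using infinite_arbitrarily_large[OF False] by blast
  have "real (card F) \<le> L" using F(3) by (intro assms(1)[OF F(1,2)]) auto
  with F(3) show ?thesis by linarith
qed

text \<open>The counting function \<open>N j z\<close>, the number of indices \<open>i\<close> with \<open>z \<in> B i \<subseteq> B j\<close>, has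
  bounded average over \<open>B j\<close> with respect to \<open>f\<close>, since the sets \<open>A i\<close> are disjoint; hence at
  least half of the \<open>f\<close>-mass of \<open>B j\<close> lies in \<open>{N j \<le> L}\<close>. By laminarity no point lies in more
  than \<open>L\<close> of these sets.\<close>

lemma laminar_bounded_overlap:
  fixes A B :: "'j \<Rightarrow> 'b set" and f :: "'b \<Rightarrow> ennreal"
  assumes J: "countable J"
    and A: "\<And>j. j \<in> J \<Longrightarrow> A j \<in> sets M" and B: "\<And>j. j \<in> J \<Longrightarrow> B j \<in> sets M"
    and disj: "disjoint_family_on A J"
    and laminar: "\<And>i j. i \<in> J \<Longrightarrow> j \<in> J \<Longrightarrow> B i \<subseteq> B j \<or> B j \<subseteq> B i \<or> B i \<inter> B j = {}"
    and AB: "\<And>j. j \<in> J \<Longrightarrow> emeasure M (A j) = emeasure M (B j)"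
    and fin: "\<And>j. j \<in> J \<Longrightarrow> emeasure M (A j) < \<infinity>"
    and As: "\<And>j. j \<in> J \<Longrightarrow> \<exists>D\<in>sets M. (\<Union>i\<in>{i\<in>J. B i \<subseteq> B j}. A i) \<subseteq> D \<and>
        emeasure M D \<le> ennreal c * emeasure M (A j)"
    and f: "f \<in> borel_measurable M"
    and lower: "\<And>j. j \<in> J \<Longrightarrow> ennreal b * emeasure M (B j) \<le> (\<integral>\<^sup>+z\<in>B j. f z \<partial>M)"
    and upper: "\<And>j. j \<in> J \<Longrightarrow> (\<integral>\<^sup>+z\<in>B j. f z \<partial>M) \<le> ennreal a * emeasure M (B j)"
    and pos: "0 < b" "0 \<le> a" "0 \<le> c" and L: "2 * a * c / b \<le> L" "0 < L"
  obtains G where "\<And>j. j \<in> J \<Longrightarrow> G j \<in> sets M" "\<And>j. j \<in> J \<Longrightarrow> G j \<subseteq> B j"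
    "\<And>j. j \<in> J \<Longrightarrow> (\<integral>\<^sup>+z\<in>B j. f z \<partial>M) \<le> 2 * (\<integral>\<^sup>+z\<in>G j. f z \<partial>M)"
    "\<And>h. h \<in> borel_measurable M \<Longrightarrow>
       (\<integral>\<^sup>+j. (\<integral>\<^sup>+z\<in>G j. h z \<partial>M) \<partial>count_space J) \<le> ennreal L * (\<integral>\<^sup>+z. h z \<partial>M)"
proof -
  define Jj where "Jj j = {i\<in>J. B i \<subseteq> B j}" for j
  have Jj: "Jj j \<subseteq> J" "countable (Jj j)" for j
    using J by (auto simp: Jj_def intro: countable_subset)
  define N where "N j z = (\<integral>\<^sup>+i. indicator (B i) z \<partial>count_space (Jj j))" for j z
  define G where "G j = {z\<in>B j. N j z \<le> ennreal L}" for j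
  have N_meas [measurable]: "N j \<in> borel_measurable M" for j
  proof -
    have "N j = (\<lambda>z. \<integral>\<^sup>+i. indicator (B i) z \<partial>count_space (Jj j))" by (auto simp: N_def)
    moreover have "(\<lambda>z. \<integral>\<^sup>+i. indicator (B i) z \<partial>count_space (Jj j)) \<in> borel_measurable M"
      using B Jj(1)[of j] Jj(2)[of j] by (intro borel_measurable_nn_integral_count_space borel_measurable_indicator) auto
    ultimately show ?thesis by simp
  qed
  have G_eq: "G j = B j \<inter> (N j -` {.. ennreal L} \<inter> space M)" if "j \<in> J" for j
    using sets.sets_into_space[OF B[OF that]] by (auto simp: G_def)
  have G: "G j \<in> sets M" if "j \<in> J" for j
    unfolding G_eq[OF that] using B[OF that] by (intro sets.Int measurable_sets[OF N_meas]) auto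
  have GB: "G j \<subseteq> B j" for j by (auto simp: G_def)
  have mass: "(\<integral>\<^sup>+z\<in>B j. f z \<partial>M) \<le> 2 * (\<integral>\<^sup>+z\<in>G j. f z \<partial>M)" if j: "j \<in> J" for j
  proof -
    let ?F = "\<integral>\<^sup>+z\<in>B j. f z \<partial>M"
    have Ffin: "?F < \<infinity>"
      using upper[OF j] fin[OF j] AB[OF j]
      by (simp add: ennreal_mult_less_top le_less_trans)
    \<comment> \<open>Integrated against \<open>f\<close>, the counting function becomes the sum of
      the \<open>f\<close>-masses of the \<open>B i\<close>. \<open>upper\<close> trades these for
      the measures of the disjoint sets \<open>A i\<close>, and \<open>As\<close> confines their
      union to a set of measure at most \<open>c\<close> times that of \<open>A j\<close>.\<close>
    have "(\<integral>\<^sup>+z. f z * N j z \<partial>M) = (\<integral>\<^sup>+z. \<integral>\<^sup>+i. f z * indicator (B i) z \<partial>count_space (Jj j) \<partial>M)"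
      unfolding N_def by (intro nn_integral_cong) (simp add: nn_integral_cmult)
    also have "\<dots> = (\<integral>\<^sup>+i. (\<integral>\<^sup>+z\<in>B i. f z \<partial>M) \<partial>count_space (Jj j))"
      using f B Jj(1)[of j] Jj(2)[of j]
      by (intro nn_integral_count_space_nn_integral borel_measurable_times_ennreal borel_measurable_indicator) auto
    also have "\<dots> \<le> (\<integral>\<^sup>+i. ennreal a * emeasure M (A i) \<partial>count_space (Jj j))"
      using upper AB Jj by (intro nn_integral_mono) (auto simp: subset_iff)
    also have "\<dots> = ennreal a * emeasure M (\<Union>i\<in>Jj j. A i)"
      using A Jj disj by (subst emeasure_UN_countable)
         (auto simp: nn_integral_cmult disjoint_family_on_def subset_iff)
    also have "\<dots> \<le> ennreal a * (ennreal c * emeasure M (A j))"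
    proof -
      obtain D where "D \<in> sets M" "(\<Union>i\<in>Jj j. A i) \<subseteq> D" "emeasure M D \<le> ennreal c * emeasure M (A j)"
        using As[OF j] by (auto simp: Jj_def)
      then have "emeasure M (\<Union>i\<in>Jj j. A i) \<le> ennreal c * emeasure M (A j)"
        using emeasure_mono order_trans by blast
      then show ?thesis by (intro mult_left_mono) auto
    qed
    also have "\<dots> \<le> ennreal (a * c / b) * ?F"
    proof -
      have "ennreal a * (ennreal c * emeasure M (A j)) = ennreal (a * c / b) * (ennreal b * emeasure M (B j))"
        using pos AB[OF j] by (simp add: mult.assoc[symmetric] ennreal_mult'[symmetric])
      also have "\<dots> \<le> ennreal (a * c / b) * ?F" using lower[OF j] by (intro mult_left_mono) auto
      finally show ?thesis .
    qed
    finally have int: "(\<integral>\<^sup>+z. f z * N j z \<partial>M) \<le> ennreal (a * c / b) * ?F" .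
    have DG: "B j - G j \<in> sets M" using B[OF j] G[OF j] by auto
    \<comment> \<open>Chebyshev's inequality: the counting function exceeds \<open>L\<close> on
      \<open>B j - G j\<close>.\<close>
    have "ennreal L * (\<integral>\<^sup>+z\<in>B j - G j. f z \<partial>M) = (\<integral>\<^sup>+z. ennreal L * (f z * indicator (B j - G j) z) \<partial>M)"
      using f DG by (simp add: nn_integral_cmult)
    also have "\<dots> \<le> (\<integral>\<^sup>+z. f z * N j z \<partial>M)"
    proof (rule nn_integral_mono)
      fix z
      show "ennreal L * (f z * indicator (B j - G j) z) \<le> f z * N j z"
      proof (cases "z \<in> B j - G j")
        case True
        then have "ennreal L \<le> N j z" by (auto simp: G_def)
        then show ?thesis using True by (simp add: mult.commute[of "ennreal L"] mult_left_mono)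
      qed simp
    qed
    also note int
    also have "ennreal (a * c / b) * ?F \<le> ennreal (L / 2) * ?F"
      using L pos by (intro mult_right_mono ennreal_leI) (auto simp: field_simps)
    finally have *: "ennreal L * (\<integral>\<^sup>+z\<in>B j - G j. f z \<partial>M) \<le> ennreal (L / 2) * ?F" .
    have split: "?F = (\<integral>\<^sup>+z\<in>G j. f z \<partial>M) + (\<integral>\<^sup>+z\<in>B j - G j. f z \<partial>M)"
    proof -
      have "?F = (\<integral>\<^sup>+z. f z * indicator (G j) z + f z * indicator (B j - G j) z \<partial>M)"
        using GB by (intro nn_integral_cong) (auto split: split_indicator)
      then show ?thesis using f G[OF j] DG by (simp add: nn_integral_add)
    qed
    obtain x where x: "0 \<le> x" "?F = ennreal x" using Ffin by (cases ?F) auto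
    obtain y where y: "0 \<le> y" "(\<integral>\<^sup>+z\<in>G j. f z \<partial>M) = ennreal y"
      using split Ffin by (cases "\<integral>\<^sup>+z\<in>G j. f z \<partial>M") auto
    obtain v where v: "0 \<le> v" "(\<integral>\<^sup>+z\<in>B j - G j. f z \<partial>M) = ennreal v"
      using split Ffin by (cases "\<integral>\<^sup>+z\<in>B j - G j. f z \<partial>M") auto
    have "x = y + v" using split x y v by (simp add: ennreal_plus[symmetric] del: ennreal_plus)
    moreover have "L * v \<le> L / 2 * x" using * x v L by (simp add: ennreal_mult'[symmetric])
    then have "v \<le> x / 2" using L by (simp add: field_simps)
    ultimately have "x \<le> 2 * y" by linarith
    then show ?thesis unfolding x y using y
      by (metis ennreal_leI ennreal_mult' ennreal_numeral zero_le_numeral)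
  qed
  have overlap: "(\<integral>\<^sup>+j. indicator (G j) z \<partial>count_space J) \<le> ennreal L" for z
  proof -
    have "(\<integral>\<^sup>+j. indicator (G j) z \<partial>count_space J)
        = (\<integral>\<^sup>+j. indicator {j\<in>J. z \<in> G j} j \<partial>count_space J)"
      by (intro nn_integral_cong) (auto split: split_indicator)
    also have "\<dots> = emeasure (count_space UNIV) {j\<in>J. z \<in> G j}"
      by (subst nn_integral_indicator) (auto simp: emeasure_count_space)
    also have "\<dots> \<le> ennreal L"
    proof (rule nn_integral_count_space_card_le)
      fix F assume F: "finite F" "F \<subseteq> {j\<in>J. z \<in> G j}" "F \<noteq> {}"
      \<comment> \<open>All sets \<open>B i\<close> with \<open>i \<in> F\<close> contain
        \<open>z\<close>, so by laminarity a maximal one contains the others, and the whole of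
        \<open>F\<close> is counted by its \<open>N j\<close>. The maximum is taken in the image
        because several indices may have the same set.\<close>
      obtain X where X: "X \<in> B ` F" "\<And>Y. Y \<in> B ` F \<Longrightarrow> X \<subseteq> Y \<Longrightarrow> Y = X"
        using finite_has_maximal[of "B ` F"] F by (metis finite_imageI image_is_empty)
      then obtain j where j: "j \<in> F" "X = B j" by auto
      have "B i \<subseteq> B j" if "i \<in> F" for i
      proof -
        have "z \<in> B i" "z \<in> B j" "i \<in> J" "j \<in> J" using that j F GB by auto
        then show ?thesis using laminar[of i j] X(2)[of "B i"] that j by auto
      qed
      then have FJ: "F \<subseteq> Jj j" using F by (auto simp: Jj_def)
      have "ennreal (real (card F)) = (\<integral>\<^sup>+i. indicator F i \<partial>count_space (Jj j))"
        using FJ F by (subst nn_integral_indicator)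
          (auto simp: emeasure_count_space ennreal_of_nat_eq_real_of_nat)
      also have "\<dots> \<le> N j z"
        unfolding N_def using F GB by (intro nn_integral_mono) (auto split: split_indicator)
      also have "\<dots> \<le> ennreal L" using F j by (auto simp: G_def)
      finally show "real (card F) \<le> L" using L by (simp add: ennreal_le_iff)
    qed (use L in simp)
    finally show ?thesis .
  qed
  have total: "(\<integral>\<^sup>+j. (\<integral>\<^sup>+z\<in>G j. h z \<partial>M) \<partial>count_space J) \<le> ennreal L * (\<integral>\<^sup>+z. h z \<partial>M)"
    if h: "h \<in> borel_measurable M" for h
  proof -
    have "(\<integral>\<^sup>+j. (\<integral>\<^sup>+z\<in>G j. h z \<partial>M) \<partial>count_space J)
        = (\<integral>\<^sup>+z. \<integral>\<^sup>+j. h z * indicator (G j) z \<partial>count_space J \<partial>M)"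
      using h G J by (intro nn_integral_count_space_nn_integral[symmetric]) auto
    also have "\<dots> = (\<integral>\<^sup>+z. h z * (\<integral>\<^sup>+j. indicator (G j) z \<partial>count_space J) \<partial>M)"
      by (intro nn_integral_cong) (simp add: nn_integral_cmult)
    also have "\<dots> \<le> (\<integral>\<^sup>+z. h z * ennreal L \<partial>M)"
      using overlap by (intro nn_integral_mono mult_left_mono) auto
    also have "\<dots> = ennreal L * (\<integral>\<^sup>+z. h z \<partial>M)" using h by (simp add: nn_integral_multc) (simp add: mult.commute)
    finally show ?thesis .
  qed
  from that[OF G GB mass total] show thesis by blast
qed

text \<open>Hoelder's inequality for the dual pair \<open>v\<close>, \<open>s\<close> is applied on
  the half-mass set \<open>G j\<close> only, so that the resulting integrals of
  \<open>g powr r * v\<close> can be added up with bounded overlap. \<open>WS\<close>, an A_r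
  condition from \<open>A j\<close> to \<open>B j\<close>, exchanges the integral of
  \<open>s\<close> for the \<open>W\<close>-mass of \<open>A j\<close>. The factor
  \<open>4 powr r\<close> consists of \<open>2 powr r\<close> for the lost half and
  \<open>2 powr r\<close> from Hoelder.\<close>

lemma laminar_level_estimate:
  fixes A B :: "'j \<Rightarrow> 'b set" and g v s :: "'b \<Rightarrow> real"
  assumes J: "countable J"
    and A: "\<And>j. j \<in> J \<Longrightarrow> A j \<in> sets M" and B: "\<And>j. j \<in> J \<Longrightarrow> B j \<in> sets M"
    and disj: "disjoint_family_on A J"
    and laminar: "\<And>i j. i \<in> J \<Longrightarrow> j \<in> J \<Longrightarrow> B i \<subseteq> B j \<or> B j \<subseteq> B i \<or> B i \<inter> B j = {}"
    and AB: "\<And>j. j \<in> J \<Longrightarrow> emeasure M (A j) = emeasure M (B j)"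
    and fin: "\<And>j. j \<in> J \<Longrightarrow> emeasure M (A j) < \<infinity>"
    and pos: "\<And>j. j \<in> J \<Longrightarrow> 0 < emeasure M (A j)"
    and As: "\<And>j. j \<in> J \<Longrightarrow> \<exists>D\<in>sets M. (\<Union>i\<in>{i\<in>J. B i \<subseteq> B j}. A i) \<subseteq> D \<and>
        emeasure M D \<le> ennreal c * emeasure M (A j)"
    and g: "g \<in> borel_measurable M" "\<And>z. 0 \<le> g z"
    and vs: "v \<in> borel_measurable M" "s \<in> borel_measurable M"
      "AE z in M. 0 < v z" "AE z in M. s z = v z powr (-1 / (r - 1))"
    and lower: "\<And>j. j \<in> J \<Longrightarrow> ennreal b * emeasure M (B j) \<le> (\<integral>\<^sup>+z\<in>B j. g z \<partial>M)"
    and upper: "\<And>j. j \<in> J \<Longrightarrow> (\<integral>\<^sup>+z\<in>B j. g z \<partial>M) \<le> ennreal (a * b) * emeasure M (B j)"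
    and W: "\<And>j. j \<in> J \<Longrightarrow> emeasure W (A j) < \<infinity>"
    and S: "\<And>j. j \<in> J \<Longrightarrow> (\<integral>\<^sup>+z\<in>B j. s z \<partial>M) < \<infinity>"
    and WS: "\<And>j. j \<in> J \<Longrightarrow> measure W (A j) * enn2real (\<integral>\<^sup>+z\<in>B j. s z \<partial>M) powr (r - 1)
        \<le> C * measure M (B j) powr r"
    and const: "0 < b" "0 \<le> a" "0 \<le> c" "1 < r" "0 < C"
  shows "ennreal (b powr r) * (\<integral>\<^sup>+j. emeasure W (A j) \<partial>count_space J)
    \<le> ennreal (4 powr r * C * (2 * a * c + 1)) * (\<integral>\<^sup>+z. ennreal (g z powr r * v z) \<partial>M)"
proof -
  define L where "L = 2 * a * c + 1"
  \<comment> \<open>The averages lie between \<open>b\<close> and \<open>a * b\<close>, so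
    \<open>b\<close> cancels from the overlap constant; the added 1 keeps \<open>L\<close> positive
    when \<open>a * c = 0\<close>.\<close>
  have L: "2 * (a * b) * c / b \<le> L" "0 < L" using const by (auto simp: L_def add_nonneg_pos)
  have gm: "(\<lambda>z. ennreal (g z)) \<in> borel_measurable M" using g by simp
  have "0 \<le> a * b" using const by simp
  from laminar_bounded_overlap[OF J A B disj laminar AB fin As gm lower upper const(1) this const(3) L]
  obtain G where G: "\<And>j. j \<in> J \<Longrightarrow> G j \<in> sets M" "\<And>j. j \<in> J \<Longrightarrow> G j \<subseteq> B j"
    "\<And>j. j \<in> J \<Longrightarrow> (\<integral>\<^sup>+z\<in>B j. ennreal (g z) \<partial>M) \<le> 2 * (\<integral>\<^sup>+z\<in>G j. ennreal (g z) \<partial>M)"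
    "\<And>h. h \<in> borel_measurable M \<Longrightarrow>
       (\<integral>\<^sup>+j. (\<integral>\<^sup>+z\<in>G j. h z \<partial>M) \<partial>count_space J) \<le> ennreal L * (\<integral>\<^sup>+z. h z \<partial>M)"
    by blast
  have each: "ennreal (b powr r) * emeasure W (A j)
      \<le> ennreal (4 powr r * C) * (\<integral>\<^sup>+z\<in>G j. ennreal (g z powr r * v z) \<partial>M)" if j: "j \<in> J" for j
  proof (cases "(\<integral>\<^sup>+z\<in>G j. ennreal (g z powr r * v z) \<partial>M) < \<infinity>")
    case False
    then have "(\<integral>\<^sup>+z\<in>G j. ennreal (g z powr r * v z) \<partial>M) = \<infinity>" by (simp add: less_top[symmetric])
    then show ?thesis using const by (simp add: ennreal_mult_top)
  next
    case True
    have SG: "(\<integral>\<^sup>+z\<in>G j. ennreal (s z) \<partial>M) \<le> (\<integral>\<^sup>+z\<in>B j. ennreal (s z) \<partial>M)"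
      using G(2)[OF j] by (intro nn_integral_mono) (auto split: split_indicator)
    then have SGf: "(\<integral>\<^sup>+z\<in>G j. ennreal (s z) \<partial>M) < \<infinity>" using S[OF j] by (rule le_less_trans)
    note H = weighted_Holder[OF const(4) G(1)[OF j] g(1) vs(1,2) g(2) vs(3,4) True SGf]
    define X where "X = enn2real (\<integral>\<^sup>+z\<in>G j. ennreal (g z) \<partial>M)"
    define Y where "Y = enn2real (\<integral>\<^sup>+z\<in>G j. ennreal (g z powr r * v z) \<partial>M)"
    define \<sigma> where "\<sigma> = enn2real (\<integral>\<^sup>+z\<in>B j. ennreal (s z) \<partial>M)"
    define m where "m = measure M (B j)"
    have Y: "(\<integral>\<^sup>+z\<in>G j. ennreal (g z powr r * v z) \<partial>M) = ennreal Y" "0 \<le> Y"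
      using True by (simp_all add: Y_def)
    have X: "(\<integral>\<^sup>+z\<in>G j. ennreal (g z) \<partial>M) = ennreal X" "0 \<le> X"
      using H(1) by (simp_all add: X_def)
    have m: "emeasure M (B j) = ennreal m" "0 < m"
      using fin[OF j] pos[OF j] AB[OF j] unfolding m_def
      by (simp_all add: emeasure_eq_ennreal_measure[symmetric] measure_def enn2real_positive_iff)
    have Wm: "emeasure W (A j) = ennreal (measure W (A j))"
      using W[OF j] by (simp add: emeasure_eq_ennreal_measure less_top)
    have "ennreal b * ennreal m \<le> 2 * ennreal X"
      using lower[OF j] G(3)[OF j] m X by simp
    then have "ennreal (b * m) \<le> ennreal (2 * X)" using const X
      by (simp add: ennreal_mult')
    then have "b * m \<le> 2 * X" using X(2) by (simp add: ennreal_le_iff)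
    then have "(b * m) powr r \<le> (2 * X) powr r"
      using const m by (intro powr_mono2) auto
    also have "\<dots> = 2 powr r * X powr r" using X by (simp add: powr_mult)
    also have "X powr r \<le> 2 powr r * Y * \<sigma> powr (r - 1)"
    proof -
      have "enn2real (\<integral>\<^sup>+z\<in>G j. ennreal (s z) \<partial>M) \<le> \<sigma>"
        unfolding \<sigma>_def using SG S[OF j] by (intro enn2real_mono) auto
      then have "enn2real (\<integral>\<^sup>+z\<in>G j. ennreal (s z) \<partial>M) powr (r - 1) \<le> \<sigma> powr (r - 1)"
        using const by (intro powr_mono2) auto
      then show ?thesis using H(2) Y(2) unfolding X_def[symmetric] Y_def[symmetric]
        by (meson mult_left_mono order_trans mult_nonneg_nonneg powr_ge_zero)
    qed
    finally have "(b * m) powr r \<le> 4 powr r * Y * \<sigma> powr (r - 1)"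
      by (simp add: powr_mult[symmetric] mult.assoc[symmetric])
    then have "measure W (A j) * (b * m) powr r \<le> measure W (A j) * (4 powr r * Y * \<sigma> powr (r - 1))"
      by (intro mult_left_mono) auto
    also have "\<dots> = 4 powr r * Y * (measure W (A j) * \<sigma> powr (r - 1))" by (simp add: mult_ac)
    also have "\<dots> \<le> 4 powr r * Y * (C * m powr r)"
      using WS[OF j] Y(2) unfolding \<sigma>_def m_def by (intro mult_left_mono) auto
    finally have "m powr r * (b powr r * measure W (A j)) \<le> m powr r * (4 powr r * C * Y)"
      using const m by (simp add: powr_mult mult_ac)
    then have "b powr r * measure W (A j) \<le> 4 powr r * C * Y" using m by simp
    then show ?thesis unfolding Wm Y using const Y(2)
      by (simp add: ennreal_mult'[symmetric] ennreal_leI)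
  qed
  have "ennreal (b powr r) * (\<integral>\<^sup>+j. emeasure W (A j) \<partial>count_space J)
      = (\<integral>\<^sup>+j. ennreal (b powr r) * emeasure W (A j) \<partial>count_space J)"
    by (simp add: nn_integral_cmult)
  also have "\<dots> \<le> (\<integral>\<^sup>+j. ennreal (4 powr r * C) * (\<integral>\<^sup>+z\<in>G j. ennreal (g z powr r * v z) \<partial>M) \<partial>count_space J)"
    using each by (intro nn_integral_mono) auto
  also have "\<dots> = ennreal (4 powr r * C) * (\<integral>\<^sup>+j. (\<integral>\<^sup>+z\<in>G j. ennreal (g z powr r * v z) \<partial>M) \<partial>count_space J)"
    by (simp add: nn_integral_cmult)
  also have "\<dots> \<le> ennreal (4 powr r * C) * (ennreal L * (\<integral>\<^sup>+z. ennreal (g z powr r * v z) \<partial>M))"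
    using g vs by (intro mult_left_mono G(4)) auto
  also have "\<dots> = ennreal (4 powr r * C * (2 * a * c + 1)) * (\<integral>\<^sup>+z. ennreal (g z powr r * v z) \<partial>M)"
    using const L unfolding L_def[symmetric] by (simp add: ennreal_mult' mult.assoc)
  finally show ?thesis .
qed

section \<open>Dyadic layers and Gehring's lemma\<close>

lemma dyadic_layer_powr:
  fixes y a0 \<eta> :: real
  assumes "0 < a0" "0 < \<eta>" "0 \<le> y"
  shows "ennreal (y powr (1 + \<eta>)) \<le> ennreal (a0 powr \<eta> * y)
    + (\<Sum>i. ennreal ((2 powr \<eta> - 1) * (2 ^ i * a0) powr \<eta>) * (ennreal y * indicator {2 ^ i * a0 <..} y))"
proof -
  define t where "t i = (2 powr \<eta> - 1) * (2 ^ i * a0) powr \<eta>" for i :: nat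
  have t0: "0 \<le> t i" for i using assms by (simp add: t_def ge_one_powr_ge_zero)
  have step: "(2 ^ Suc i * a0) powr \<eta> = 2 powr \<eta> * (2 ^ i * a0) powr \<eta>" for i :: nat
    using assms by (simp add: powr_mult mult.assoc)
  \<comment> \<open>The coefficients of the layers telescope, and only the layers below the first
    \<open>2 ^ n * a0\<close> that reaches \<open>y\<close> are needed.\<close>
  have tele: "(\<Sum>i<n. t i) = (2 ^ n * a0) powr \<eta> - a0 powr \<eta>" for n
  proof (induction n)
    case 0 then show ?case by simp
  next
    case (Suc n)
    have "t n = (2 ^ Suc n * a0) powr \<eta> - (2 ^ n * a0) powr \<eta>"
      unfolding step t_def by (simp add: algebra_simps)
    then show ?case using Suc by simp
  qed
  have "\<exists>n. y \<le> 2 ^ n * a0"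
  proof -
    obtain n :: nat where "y / a0 < 2 ^ n" using real_arch_pow[of 2 "y / a0"] by auto
    then show ?thesis using assms by (intro exI[of _ n]) (simp add: field_simps)
  qed
  define n where "n = (LEAST n. y \<le> 2 ^ n * a0)"
  have n: "y \<le> 2 ^ n * a0" unfolding n_def using \<open>\<exists>n. _\<close> by (rule LeastI_ex)
  have lt: "2 ^ i * a0 < y" if "i < n" for i
    using not_less_Least[of i "\<lambda>n. y \<le> 2 ^ n * a0"] that unfolding n_def by simp
  have "y powr \<eta> \<le> a0 powr \<eta> + (\<Sum>i<n. t i)"
    using n assms by (subst tele) (simp add: powr_mono2)
  then have "y powr \<eta> * y \<le> a0 powr \<eta> * y + (\<Sum>i<n. t i * y)"
    using assms by (simp add: sum_distrib_right[symmetric] distrib_right[symmetric] mult_right_mono)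
  moreover have "y powr (1 + \<eta>) = y powr \<eta> * y"
    using assms by (cases "y = 0") (simp_all add: powr_add mult.commute)
  ultimately have "ennreal (y powr (1 + \<eta>)) \<le> ennreal (a0 powr \<eta> * y + (\<Sum>i<n. t i * y))"
    by (simp add: ennreal_leI)
  also have "\<dots> = ennreal (a0 powr \<eta> * y) + (\<Sum>i<n. ennreal (t i) * (ennreal y * indicator {2 ^ i * a0 <..} y))"
    using assms t0 lt by (simp add: ennreal_plus sum_nonneg sum_ennreal[symmetric] ennreal_mult' )
  also have "\<dots> \<le> ennreal (a0 powr \<eta> * y) + (\<Sum>i. ennreal (t i) * (ennreal y * indicator {2 ^ i * a0 <..} y))"
    by (intro add_left_mono sum_le_suminf) auto
  finally show ?thesis by (simp add: t_def)
qed

text \<open>As \<open>1 \<le> p\<close>, each term is at least twice its predecessor, so twice the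
  last one bounds the sum.\<close>

lemma dyadic_sum_powr_le:
  fixes y a0 p :: real
  assumes "0 < a0" "1 \<le> p" "0 \<le> y"
  shows "(\<Sum>i. ennreal ((2 ^ i * a0) powr p) * indicator {2 ^ i * a0 <..} y) \<le> ennreal (2 * y powr p)"
proof (rule suminf_le_const)
  have step: "2 * (2 ^ i * a0) powr p \<le> (2 ^ Suc i * a0) powr p" for i :: nat
  proof -
    have "2 powr 1 \<le> (2::real) powr p" using assms by (intro powr_mono) auto
    then have "2 * (2 ^ i * a0) powr p \<le> 2 powr p * (2 ^ i * a0) powr p"
      by (intro mult_right_mono) auto
    also have "\<dots> = (2 ^ Suc i * a0) powr p" using assms by (simp add: powr_mult mult.assoc)
    finally show ?thesis .
  qed
  have sums: "(\<Sum>i<Suc n. (2 ^ i * a0) powr p) \<le> 2 * (2 ^ n * a0) powr p" for n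
  proof (induction n)
    case 0 then show ?case by simp
  next
    case (Suc n)
    then show ?case using step[of n] by simp
  qed
  have mono: "2 ^ i * a0 \<le> 2 ^ n * a0" if "i \<le> n" for i n :: nat
    using that assms by (intro mult_right_mono power_increasing) auto
  show "(\<Sum>i<n. ennreal ((2 ^ i * a0) powr p) * indicator {2 ^ i * a0 <..} y) \<le> ennreal (2 * y powr p)" for n
  proof (induction n)
    case 0 then show ?case by simp
  next
    case (Suc n)
    show ?case
    proof (cases "2 ^ n * a0 < y")
      case False
      then show ?thesis using Suc by simp
    next
      case True
      have "(\<Sum>i<Suc n. ennreal ((2 ^ i * a0) powr p) * indicator {2 ^ i * a0 <..} y)
          = (\<Sum>i<Suc n. ennreal ((2 ^ i * a0) powr p))"
      proof (rule sum.cong)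
        fix i assume "i \<in> {..<Suc n}"
        then have "2 ^ i * a0 < y" using True mono[of i n] by simp
        then show "ennreal ((2 ^ i * a0) powr p) * indicator {2 ^ i * a0 <..} y = ennreal ((2 ^ i * a0) powr p)"
          by simp
      qed simp
      also have "\<dots> = ennreal (\<Sum>i<Suc n. (2 ^ i * a0) powr p)" by (subst sum_ennreal) auto
      also have "\<dots> \<le> ennreal (2 * y powr p)"
      proof (rule ennreal_leI)
        have "(2 ^ n * a0) powr p \<le> y powr p" using True assms by (intro powr_mono2) auto
        with sums[of n] show "(\<Sum>i<Suc n. (2 ^ i * a0) powr p) \<le> 2 * y powr p" by linarith
      qed
      finally show ?thesis .
    qed
  qed
qed simp

text \<open>Layer by layer, \<open>level\<close> bounds the integral of
  \<open>\<phi> powr (1 + \<eta>)\<close> by the bottom layer plus a multiple of itself, with a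
  factor that tends to 0 with \<open>\<eta>\<close>. This multiple is absorbed on the left, which is
  possible because the integral is finite beforehand. As \<open>\<eta> \<le> 1\<close> and
  \<open>\<beta> \<le> 1\<close>, the power \<open>\<beta> powr (1 + \<eta>)\<close> may be replaced
  by the square of \<open>\<beta>\<close>.\<close>

lemma Gehring_self_improvement:
  fixes \<phi> :: "'b \<Rightarrow> real"
  assumes sp: "space M = UNIV" and meas: "\<phi> \<in> borel_measurable M" and nonneg: "\<And>z. 0 \<le> \<phi> z"
    and fin: "(\<integral>\<^sup>+z. ennreal (\<phi> z powr (1 + \<eta>)) \<partial>M) < \<infinity>"
    and level: "\<And>t. t0 \<le> t \<Longrightarrow>
      (\<integral>\<^sup>+z. ennreal (\<phi> z) * indicator {t<..} (\<phi> z) \<partial>M) \<le> ennreal (C * t) * emeasure M {z. \<beta> * t < \<phi> z}"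
    and const: "0 < t0" "0 < \<beta>" "\<beta> \<le> 1" "0 \<le> C" "0 < \<eta>" "\<eta> \<le> 1"
    and small: "(2 powr \<eta> - 1) * C * 2 / \<beta>\<^sup>2 \<le> 1 / 2"
  shows "(\<integral>\<^sup>+z. ennreal (\<phi> z powr (1 + \<eta>)) \<partial>M) \<le> ennreal (2 * t0 powr \<eta>) * (\<integral>\<^sup>+z. ennreal (\<phi> z) \<partial>M)"
proof -
  note [measurable] = meas
  let ?E = "\<integral>\<^sup>+z. ennreal (\<phi> z powr (1 + \<eta>)) \<partial>M" and ?F = "\<integral>\<^sup>+z. ennreal (\<phi> z) \<partial>M"
  define t where "t i = (2 powr \<eta> - 1) * (2 ^ i * t0) powr \<eta>" for i :: nat
  have k0: "0 \<le> 2 powr \<eta> - 1" using const by (simp add: ge_one_powr_ge_zero)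
  have tt: "0 \<le> t i" for i using k0 by (simp add: t_def)
  have "?E \<le> (\<integral>\<^sup>+z. ennreal (t0 powr \<eta>) * ennreal (\<phi> z)
      + (\<Sum>i. ennreal (t i) * (ennreal (\<phi> z) * indicator {2 ^ i * t0 <..} (\<phi> z))) \<partial>M)"
    using dyadic_layer_powr[OF const(1,5) nonneg] const nonneg
    by (intro nn_integral_mono) (simp add: t_def ennreal_mult')
  also have "\<dots> = ennreal (t0 powr \<eta>) * ?F
      + (\<Sum>i. ennreal (t i) * (\<integral>\<^sup>+z. ennreal (\<phi> z) * indicator {2 ^ i * t0 <..} (\<phi> z) \<partial>M))"
    by (subst nn_integral_add; (subst nn_integral_suminf)?; measurable?) (simp_all add: nn_integral_cmult)
  finally have layers: "?E \<le> ennreal (t0 powr \<eta>) * ?F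
      + (\<Sum>i. ennreal (t i) * (\<integral>\<^sup>+z. ennreal (\<phi> z) * indicator {2 ^ i * t0 <..} (\<phi> z) \<partial>M))" .
  have "(\<Sum>i. ennreal (t i) * (\<integral>\<^sup>+z. ennreal (\<phi> z) * indicator {2 ^ i * t0 <..} (\<phi> z) \<partial>M))
      \<le> (\<Sum>i. ennreal ((2 powr \<eta> - 1) * C) * (\<integral>\<^sup>+z. ennreal ((2 ^ i * t0) powr (1 + \<eta>)) *
           indicator {2 ^ i * t0 <..} (\<phi> z / \<beta>) \<partial>M))"
  proof (rule suminf_le)
    fix i :: nat
    let ?a = "2 ^ i * t0"
    have a: "0 < ?a" "t0 \<le> ?a" using const by auto
    have "ennreal (t i) * (\<integral>\<^sup>+z. ennreal (\<phi> z) * indicator {?a<..} (\<phi> z) \<partial>M)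
        \<le> ennreal (t i) * (ennreal (C * ?a) * emeasure M {z. \<beta> * ?a < \<phi> z})"
      by (intro mult_left_mono level a) auto
    also have "\<dots> = ennreal ((2 powr \<eta> - 1) * C * ?a powr (1 + \<eta>)) * emeasure M {z. \<beta> * ?a < \<phi> z}"
    proof -
      have eq: "t i * (C * ?a) = (2 powr \<eta> - 1) * C * ?a powr (1 + \<eta>)"
        using a by (simp add: t_def powr_add mult_ac)
      have "ennreal (t i) * (ennreal (C * ?a) * m) = ennreal (t i * (C * ?a)) * m" for m
        unfolding ennreal_mult'[OF tt] by (rule mult.assoc[symmetric])
      then show ?thesis unfolding eq .
    qed
    also have "emeasure M {z. \<beta> * ?a < \<phi> z} = (\<integral>\<^sup>+z. indicator {?a <..} (\<phi> z / \<beta>) \<partial>M)"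
    proof -
      have "{z. \<beta> * ?a < \<phi> z} = {z\<in>space M. \<beta> * ?a < \<phi> z}" using sp by auto
      moreover have "\<dots> \<in> sets M" by measurable
      ultimately have "emeasure M {z. \<beta> * ?a < \<phi> z} = (\<integral>\<^sup>+z. indicator {z. \<beta> * ?a < \<phi> z} z \<partial>M)"
        by (simp add: nn_integral_indicator)
      also have "\<dots> = (\<integral>\<^sup>+z. indicator {?a <..} (\<phi> z / \<beta>) \<partial>M)"
        using const by (intro nn_integral_cong) (auto simp: field_simps split: split_indicator)
      finally show ?thesis .
    qed
    also have "ennreal ((2 powr \<eta> - 1) * C * ?a powr (1 + \<eta>)) * (\<integral>\<^sup>+z. indicator {?a <..} (\<phi> z / \<beta>) \<partial>M)
        = ennreal ((2 powr \<eta> - 1) * C) * (\<integral>\<^sup>+z. ennreal (?a powr (1 + \<eta>)) * indicator {?a <..} (\<phi> z / \<beta>) \<partial>M)"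
      using k0 const by (simp add: nn_integral_cmult ennreal_mult' mult.assoc)
    finally show "ennreal (t i) * (\<integral>\<^sup>+z. ennreal (\<phi> z) * indicator {?a<..} (\<phi> z) \<partial>M)
      \<le> ennreal ((2 powr \<eta> - 1) * C) * (\<integral>\<^sup>+z. ennreal (?a powr (1 + \<eta>)) * indicator {?a <..} (\<phi> z / \<beta>) \<partial>M)" .
  qed auto
  also have "\<dots> = ennreal ((2 powr \<eta> - 1) * C) *
      (\<integral>\<^sup>+z. (\<Sum>i. ennreal ((2 ^ i * t0) powr (1 + \<eta>)) * indicator {2 ^ i * t0 <..} (\<phi> z / \<beta>)) \<partial>M)"
    by (subst nn_integral_suminf) simp_all
  also have "\<dots> \<le> ennreal ((2 powr \<eta> - 1) * C) * (\<integral>\<^sup>+z. ennreal (2 / \<beta>\<^sup>2) * ennreal (\<phi> z powr (1 + \<eta>)) \<partial>M)"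
  proof (intro mult_left_mono nn_integral_mono)
    fix z
    have "(\<Sum>i. ennreal ((2 ^ i * t0) powr (1 + \<eta>)) * indicator {2 ^ i * t0 <..} (\<phi> z / \<beta>))
        \<le> ennreal (2 * (\<phi> z / \<beta>) powr (1 + \<eta>))"
      using const nonneg by (intro dyadic_sum_powr_le) auto
    also have "2 * (\<phi> z / \<beta>) powr (1 + \<eta>) \<le> 2 / \<beta>\<^sup>2 * \<phi> z powr (1 + \<eta>)"
    proof -
      have "\<beta> powr 2 \<le> \<beta> powr (1 + \<eta>)" using const by (intro powr_mono') auto
      then have "\<phi> z powr (1 + \<eta>) / \<beta> powr (1 + \<eta>) \<le> \<phi> z powr (1 + \<eta>) / \<beta>\<^sup>2"
        using const by (intro divide_left_mono) auto
      then show ?thesis using const nonneg by (simp add: powr_divide)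
    qed
    then have "ennreal (2 * (\<phi> z / \<beta>) powr (1 + \<eta>)) \<le> ennreal (2 / \<beta>\<^sup>2) * ennreal (\<phi> z powr (1 + \<eta>))"
      by (simp add: ennreal_mult'[symmetric] ennreal_leI)
    finally show "(\<Sum>i. ennreal ((2 ^ i * t0) powr (1 + \<eta>)) * indicator {2 ^ i * t0 <..} (\<phi> z / \<beta>))
        \<le> ennreal (2 / \<beta>\<^sup>2) * ennreal (\<phi> z powr (1 + \<eta>))" .
  qed auto
  also have "\<dots> = ennreal ((2 powr \<eta> - 1) * C * 2 / \<beta>\<^sup>2) * ?E"
  proof -
    have "(\<integral>\<^sup>+z. ennreal (2 / \<beta>\<^sup>2) * ennreal (\<phi> z powr (1 + \<eta>)) \<partial>M) = ennreal (2 / \<beta>\<^sup>2) * ?E"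
      by (rule nn_integral_cmult) measurable
    moreover have "ennreal ((2 powr \<eta> - 1) * C * 2 / \<beta>\<^sup>2) = ennreal ((2 powr \<eta> - 1) * C) * ennreal (2 / \<beta>\<^sup>2)"
      using k0 const by (subst ennreal_mult[symmetric]) auto
    ultimately show ?thesis by (simp only: mult.assoc)
  qed
  also have "\<dots> \<le> ennreal (1 / 2) * ?E"
    using small by (intro mult_right_mono ennreal_leI) auto
  finally have main: "?E \<le> ennreal (t0 powr \<eta>) * ?F + ennreal (1 / 2) * ?E"
    using layers by (meson add_left_mono order_trans)
  show ?thesis
  proof (cases "?F < \<infinity>")
    case False
    then have "?F = \<infinity>" by (simp add: less_top[symmetric])
    then show ?thesis using const by (simp add: ennreal_mult_top)
  next
    case True
    obtain x where x: "0 \<le> x" "?F = ennreal x" using True by (cases ?F) auto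
    obtain y where y: "0 \<le> y" "?E = ennreal y" using fin by (cases ?E) auto
    have "y \<le> t0 powr \<eta> * x + 1 / 2 * y"
    proof -
      have nn: "0 \<le> t0 powr \<eta> * x" "0 \<le> 1 / 2 * y" using x y by auto
      have e: "ennreal (t0 powr \<eta> * x) = ennreal (t0 powr \<eta>) * ennreal x"
        "ennreal (1 / 2 * y) = ennreal (1 / 2) * ennreal y" by (rule ennreal_mult'; simp)+
      have "ennreal y \<le> ennreal (t0 powr \<eta> * x + 1 / 2 * y)"
        using main unfolding x y ennreal_plus[OF nn] e .
      moreover have "0 \<le> t0 powr \<eta> * x + 1 / 2 * y" using x y by simp
      ultimately show ?thesis by (simp only: ennreal_le_iff)
    qed
    then show ?thesis unfolding x y using x by (simp add: ennreal_mult'[symmetric] ennreal_leI)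
  qed
qed

text \<open>Generation, index of the cube, position of the time interval. Moving a rectangle by
  multiples of its own time side is then an operation on the last component.\<close>

type_synonym 'i rindex = "int \<times> 'i \<times> int"

section \<open>Dyadic grids of space-time rectangles\<close>

definition time_shift :: "int \<Rightarrow> 'i rindex \<Rightarrow> 'i rindex" where
  "time_shift m = (\<lambda>(k, \<alpha>, i). (k, \<alpha>, i + m))"

lemma time_shift_simps [simp]: "time_shift m (k, \<alpha>, i) = (k, \<alpha>, i + m)"
  by (simp add: time_shift_def)

lemma fst_time_shift [simp]: "fst (time_shift m u) = fst u"
  by (cases u) simp

lemma time_shift_time_shift [simp]: "time_shift m (time_shift n u) = time_shift (m + n) u"
  by (cases u) (simp add: algebra_simps)

lemma time_shift_0 [simp]: "time_shift 0 u = u"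
  by (cases u) simp

lemma emeasure_parabolic_times:
  assumes "A \<in> sets \<mu>" "J \<in> sets lebesgue"
  shows "emeasure (parabolic_measure \<mu>) (A \<times> J) = emeasure \<mu> A * emeasure lebesgue J"
proof -
  interpret sigma_finite_measure "lebesgue :: real measure"
  proof
    have "\<exists>n::nat. x \<in> {- real n..real n}" for x :: real
    proof -
      obtain n :: nat where "\<bar>x\<bar> \<le> real n" using real_arch_simple by blast
      then show ?thesis by (intro exI[of _ n]) auto
    qed
    then show "\<exists>A. countable A \<and> A \<subseteq> sets (lebesgue :: real measure) \<and> \<Union> A = space lebesgue
        \<and> (\<forall>a\<in>A. emeasure lebesgue a \<noteq> \<infinity>)"
      by (intro exI[of _ "range (\<lambda>n::nat. {- real n..real n})"]) auto
  qed
  show ?thesis unfolding parabolic_measure_def using assms by (rule emeasure_pair_measure_Times)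
qed

lemma sets_parabolic_times:
  assumes "A \<in> sets \<mu>" "J \<in> sets lebesgue"
  shows "A \<times> J \<in> sets (parabolic_measure \<mu>)"
  unfolding parabolic_measure_def using assms by simp

lemma space_parabolic: "space \<mu> = UNIV \<Longrightarrow> space (parabolic_measure \<mu>) = UNIV"
  by (simp add: parabolic_measure_def space_pair_measure)

text \<open>The time sides are powers of two, so that the time intervals of different generations are nested.\<close>

locale dyadic_grid =
  fixes \<mu> :: "'a measure" and I :: "int \<Rightarrow> 'i set" and Q :: "int \<Rightarrow> 'i \<Rightarrow> 'a set"
    and e :: "int \<Rightarrow> int" and cd :: real
  assumes space_mu: "space \<mu> = UNIV"
    and Q_sets: "\<And>k \<alpha>. \<alpha> \<in> I k \<Longrightarrow> Q k \<alpha> \<in> sets \<mu>"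
    and I_countable: "\<And>k. countable (I k)"
    and Q_cover: "\<And>k. (\<Union>\<alpha>\<in>I k. Q k \<alpha>) = UNIV"
    and Q_disj: "\<And>k. disjoint_family_on (Q k) (I k)"
    and Q_nested: "\<And>k l \<alpha> \<beta>. k \<le> l \<Longrightarrow> \<alpha> \<in> I k \<Longrightarrow> \<beta> \<in> I l \<Longrightarrow>
      Q l \<beta> \<subseteq> Q k \<alpha> \<or> Q l \<beta> \<inter> Q k \<alpha> = {}"
    and Q_pos: "\<And>k \<alpha>. \<alpha> \<in> I k \<Longrightarrow> 0 < emeasure \<mu> (Q k \<alpha>)"
    and Q_fin: "\<And>k \<alpha>. \<alpha> \<in> I k \<Longrightarrow> emeasure \<mu> (Q k \<alpha>) < \<infinity>"
    and e_less: "\<And>k. e k < e (k + 1)"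
    and child_ratio: "\<And>k \<alpha> \<beta>. \<alpha> \<in> I k \<Longrightarrow> \<beta> \<in> I (k + 1) \<Longrightarrow> Q (k + 1) \<beta> \<subseteq> Q k \<alpha> \<Longrightarrow>
      measure \<mu> (Q k \<alpha>) * 2 powi (e (k + 1) - e k) \<le> cd * measure \<mu> (Q (k + 1) \<beta>)"
begin

abbreviation "lam \<equiv> parabolic_measure \<mu>"

definition side :: "int \<Rightarrow> real" where "side k = 2 powi (- e k)"

fun rect :: "'i rindex \<Rightarrow> ('a \<times> real) set" where
  "rect (k, \<alpha>, i) = Q k \<alpha> \<times> {of_int i * side k ..< of_int (i + 1) * side k}"

definition valid :: "'i rindex \<Rightarrow> bool" where "valid u \<longleftrightarrow> fst (snd u) \<in> I (fst u)"

text \<open>The index of the only rectangle of generation \<open>g\<close> containing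
  \<open>z\<close>. Membership in a rectangle thereby becomes an equation
  (\<open>mem_rect_iff\<close>), and nesting becomes the implication from fine to coarse equations
  (\<open>idx_nested\<close>).\<close>

definition idx :: "int \<Rightarrow> 'a \<times> real \<Rightarrow> 'i rindex" where
  "idx g z = (g, THE \<alpha>. \<alpha> \<in> I g \<and> fst z \<in> Q g \<alpha>, \<lfloor>snd z / side g\<rfloor>)"

definition rmeas :: "'i rindex \<Rightarrow> real" where "rmeas u = measure lam (rect u)"

lemma valid_simps [simp]: "valid (k, \<alpha>, i) \<longleftrightarrow> \<alpha> \<in> I k" by (simp add: valid_def)
lemma valid_time_shift [simp]: "valid (time_shift m u) \<longleftrightarrow> valid u" by (cases u) simp
lemma fst_idx [simp]: "fst (idx g z) = g" by (simp add: idx_def)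

lemma countable_valid: "countable {u. valid u}"
proof -
  have "{u. valid u} = (SIGMA k:UNIV. I k \<times> UNIV)" by (auto simp: valid_def)
  moreover have "countable (SIGMA k:UNIV. I k \<times> (UNIV :: int set))" using I_countable by auto
  ultimately show ?thesis by simp
qed

lemma side_pos [simp]: "0 < side k" by (simp add: side_def)

lemma e_mono: "k \<le> l \<Longrightarrow> l - k \<le> e l - e k"
proof (induction l rule: int_ge_induct)
  case (step l) then show ?case using e_less[of l] by linarith
qed simp

lemma side_power:
  assumes "k \<le> l" obtains N :: nat where "side k = 2 ^ N * side l" "nat (l - k) \<le> N"
proof
  show "side k = 2 ^ nat (e l - e k) * side l"
  proof -
    have "side k = 2 powi (int (nat (e l - e k)) + (- e l))"
      using e_mono[OF assms] assms by (simp add: side_def)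
    also have "\<dots> = 2 ^ nat (e l - e k) * side l"
      by (subst power_int_add) (use e_mono[OF assms] assms in \<open>simp_all add: side_def power_int_def\<close>)
    finally show ?thesis .
  qed
  show "nat (l - k) \<le> nat (e l - e k)" using e_mono[OF assms] by simp
qed

lemma cube_unique:
  assumes "\<alpha> \<in> I k" "x \<in> Q k \<alpha>" shows "(THE \<alpha>. \<alpha> \<in> I k \<and> x \<in> Q k \<alpha>) = \<alpha>"
  using assms Q_disj[of k] by (intro the_equality) (auto simp: disjoint_family_on_def)

lemma mem_rect_iff: "valid u \<Longrightarrow> z \<in> rect u \<longleftrightarrow> idx (fst u) z = u"
proof (cases u)
  case (fields k \<alpha> i)
  assume "valid u"
  then have \<alpha>: "\<alpha> \<in> I k" using fields by simp
  obtain \<beta> where \<beta>: "\<beta> \<in> I k" "fst z \<in> Q k \<beta>" using Q_cover[of k] by blast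
  have "fst z \<in> Q k \<alpha> \<longleftrightarrow> (THE \<alpha>. \<alpha> \<in> I k \<and> fst z \<in> Q k \<alpha>) = \<alpha>"
    using cube_unique[OF \<beta>] cube_unique[OF \<alpha>, of "fst z"] \<beta> by auto
  moreover have "snd z \<in> {of_int i * side k ..< of_int (i + 1) * side k} \<longleftrightarrow> \<lfloor>snd z / side k\<rfloor> = i"
    by (simp add: floor_eq_iff pos_le_divide_eq pos_divide_less_eq)
  ultimately show ?thesis using fields by (cases z) (auto simp: idx_def)
qed

lemma valid_idx [simp]: "valid (idx g z)"
proof -
  obtain \<beta> where \<beta>: "\<beta> \<in> I g" "fst z \<in> Q g \<beta>" using Q_cover[of g] by blast
  then show ?thesis by (simp add: idx_def cube_unique[OF \<beta>])
qed

lemma mem_rect_idx [simp]: "z \<in> rect (idx g z)"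
  by (simp add: mem_rect_iff)

text \<open>In space this is the nesting of the cubes. In time, the coarse position is the integer
  quotient of the fine one by the power of two relating the two sides.\<close>

lemma idx_nested:
  assumes gl: "g \<le> l" and eq: "idx l z = idx l z'" shows "idx g z = idx g z'"
proof -
  obtain \<alpha> where \<alpha>: "\<alpha> \<in> I g" "fst z \<in> Q g \<alpha>" using Q_cover[of g] by blast
  obtain \<beta> where \<beta>: "\<beta> \<in> I l" "fst z \<in> Q l \<beta>" using Q_cover[of l] by blast
  obtain \<gamma> where \<gamma>: "\<gamma> \<in> I l" "fst z' \<in> Q l \<gamma>" using Q_cover[of l] by blast
  have "\<beta> = \<gamma>" using eq cube_unique[OF \<beta>] cube_unique[OF \<gamma>] by (simp add: idx_def)
  then have "fst z' \<in> Q g \<alpha>" using Q_nested[OF gl \<alpha>(1) \<beta>(1)] \<alpha> \<beta> \<gamma> by auto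
  then have 1: "(THE \<alpha>. \<alpha> \<in> I g \<and> fst z \<in> Q g \<alpha>) = (THE \<alpha>. \<alpha> \<in> I g \<and> fst z' \<in> Q g \<alpha>)"
    using cube_unique[OF \<alpha>] cube_unique[OF \<alpha>(1)] by simp
  obtain N where N: "side g = 2 ^ N * side l" using side_power[OF gl] by blast
  have fl: "\<lfloor>t / side g\<rfloor> = \<lfloor>t / side l\<rfloor> div 2 ^ N" for t
  proof -
    have "t / side g = (t / side l) / real_of_int (2 ^ N)" unfolding N by (simp add: field_simps)
    then show ?thesis using floor_divide_real_eq_div[of "2 ^ N" "t / side l"] by (simp only:) simp
  qed
  have "\<lfloor>snd z / side l\<rfloor> = \<lfloor>snd z' / side l\<rfloor>" using eq by (simp add: idx_def)
  then show ?thesis using 1 by (simp add: idx_def fl)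
qed

lemma rect_subset:
  assumes "valid u" "valid v" "fst u \<le> fst v" "rect u \<inter> rect v \<noteq> {}" shows "rect v \<subseteq> rect u"
proof
  obtain z where z: "z \<in> rect u" "z \<in> rect v" using assms by auto
  fix y assume "y \<in> rect v"
  then have "idx (fst v) y = idx (fst v) z" using z assms by (simp add: mem_rect_iff)
  then have "idx (fst u) y = idx (fst u) z" using assms idx_nested by blast
  then show "y \<in> rect u" using z assms by (simp add: mem_rect_iff)
qed

lemma rect_laminar:
  assumes "valid u" "valid v"
  shows "rect u \<subseteq> rect v \<or> rect v \<subseteq> rect u \<or> rect u \<inter> rect v = {}"
  using rect_subset[of u v] rect_subset[of v u] assms by (metis Int_commute linear)

lemma rect_eq_idx: "valid u \<Longrightarrow> z \<in> rect u \<Longrightarrow> u = idx (fst u) z"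
  by (simp add: mem_rect_iff)

lemma rect_sets: "valid u \<Longrightarrow> rect u \<in> sets lam"
  by (cases u) (auto intro!: sets_parabolic_times Q_sets)

lemma emeasure_box:
  assumes "\<alpha> \<in> I k" "a \<le> b"
  shows "emeasure lam (Q k \<alpha> \<times> {a..<b}) = ennreal (measure \<mu> (Q k \<alpha>) * (b - a))"
proof -
  have "emeasure lam (Q k \<alpha> \<times> {a..<b}) = emeasure \<mu> (Q k \<alpha>) * emeasure lebesgue {a..<b}"
    using assms by (intro emeasure_parabolic_times Q_sets) auto
  also have "\<dots> = ennreal (measure \<mu> (Q k \<alpha>)) * ennreal (b - a)"
    using assms Q_fin[OF assms(1)] by (simp add: emeasure_eq_ennreal_measure less_top)
  also have "\<dots> = ennreal (measure \<mu> (Q k \<alpha>) * (b - a))"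
    by (rule ennreal_mult'[symmetric]) simp
  finally show ?thesis .
qed

lemma measure_Q_pos: "\<alpha> \<in> I k \<Longrightarrow> 0 < measure \<mu> (Q k \<alpha>)"
  using Q_pos[of \<alpha> k] Q_fin[of \<alpha> k] by (simp add: measure_def enn2real_positive_iff)

lemma emeasure_rect: "\<alpha> \<in> I k \<Longrightarrow> emeasure lam (rect (k, \<alpha>, i)) = ennreal (measure \<mu> (Q k \<alpha>) * side k)"
proof -
  assume "\<alpha> \<in> I k"
  moreover have "real_of_int i * side k \<le> real_of_int (i + 1) * side k"
    by (intro mult_right_mono) (auto simp: less_imp_le)
  ultimately have "emeasure lam (rect (k, \<alpha>, i))
      = ennreal (measure \<mu> (Q k \<alpha>) * (real_of_int (i + 1) * side k - real_of_int i * side k))"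
    by (simp only: rect.simps) (rule emeasure_box)
  also have "real_of_int (i + 1) * side k - real_of_int i * side k = side k" by (simp add: algebra_simps)
  finally show ?thesis .
qed

lemma rmeas_eq: "\<alpha> \<in> I k \<Longrightarrow> rmeas (k, \<alpha>, i) = measure \<mu> (Q k \<alpha>) * side k"
  unfolding rmeas_def measure_def[of lam] by (simp only: emeasure_rect) (simp add: less_imp_le)

lemma emeasure_rect_rmeas: "valid u \<Longrightarrow> emeasure lam (rect u) = ennreal (rmeas u)"
  by (cases u) (simp add: emeasure_rect rmeas_eq del: rect.simps)

lemma rmeas_pos [simp]: "valid u \<Longrightarrow> 0 < rmeas u"
  by (cases u) (simp add: rmeas_eq measure_Q_pos)

lemma rmeas_time_shift [simp]: "valid u \<Longrightarrow> rmeas (time_shift m u) = rmeas u"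
  by (cases u) (simp add: rmeas_eq)

lemma rmeas_child: "rmeas (idx k z) \<le> cd * rmeas (idx (k + 1) z)"
proof -
  obtain \<alpha> i where u: "idx k z = (k, \<alpha>, i)" by (simp add: idx_def)
  obtain \<beta> j where v: "idx (k + 1) z = (k + 1, \<beta>, j)" by (simp add: idx_def)
  have ab: "\<alpha> \<in> I k" "\<beta> \<in> I (k + 1)" using valid_idx[of k z] valid_idx[of "k + 1" z] u v by auto
  have "fst z \<in> Q k \<alpha>" "fst z \<in> Q (k + 1) \<beta>"
    using mem_rect_idx[of z k] mem_rect_idx[of z "k + 1"] u v by (auto simp: mem_Times_iff)
  then have "Q (k + 1) \<beta> \<subseteq> Q k \<alpha>" using Q_nested[of k "k + 1" \<alpha> \<beta>] ab by auto
  note r = child_ratio[OF ab this]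
  have "side k = 2 powi (e (k + 1) - e k) * side (k + 1)"
    by (simp add: side_def power_int_add[symmetric])
  then have "rmeas (idx k z) = measure \<mu> (Q k \<alpha>) * 2 powi (e (k + 1) - e k) * side (k + 1)"
    using ab u by (simp add: rmeas_eq)
  also have "\<dots> \<le> cd * measure \<mu> (Q (k + 1) \<beta>) * side (k + 1)"
    using r by (intro mult_right_mono) (auto simp: less_imp_le)
  also have "\<dots> = cd * rmeas (idx (k + 1) z)" using ab v by (simp add: rmeas_eq)
  finally show ?thesis .
qed

lemma cd_pos: "0 < cd"
proof -
  have "0 < rmeas (idx 0 undefined)" "0 < rmeas (idx (0 + 1) undefined)" by simp_all
  then show ?thesis using rmeas_child[of 0 undefined]
    by (smt (verit) mult_nonpos_nonneg)
qed

lemma rmeas_descendant: "rmeas (idx k z) \<le> cd ^ n * rmeas (idx (k + int n) z)"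
proof (induction n)
  case (Suc n)
  have "rmeas (idx k z) \<le> cd ^ n * (cd * rmeas (idx (k + int n + 1) z))"
    using Suc rmeas_child[of "k + int n" z] cd_pos
    by (meson mult_left_mono order_trans less_imp_le zero_le_power)
  then show ?case by (simp add: algebra_simps)
qed simp

text \<open>If the translate of \<open>u\<close> lies in that of \<open>v\<close>, then the side of
  \<open>u\<close> is at most the side of \<open>v\<close>, so undoing both translations displaces
  \<open>u\<close> relative to \<open>v\<close> by at most \<open>\<bar>m\<bar>\<close> sides of
  \<open>v\<close>. All such \<open>u\<close> therefore lie in a band of
  \<open>2 * \<bar>m\<bar> + 1\<close> sides. This supplies the constant \<open>c\<close> of the
  overlap lemma.\<close>

lemma time_shift_band:
  assumes v: "valid v"
  shows "\<exists>D\<in>sets lam. (\<Union>u\<in>{u. valid u \<and> rect (time_shift m u) \<subseteq> rect (time_shift m v)}. rect u) \<subseteq> D \<and>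
    emeasure lam D \<le> ennreal (2 * \<bar>of_int m\<bar> + 1) * emeasure lam (rect v)"
proof (cases v)
  case (fields k \<alpha> i)
  have \<alpha>: "\<alpha> \<in> I k" using v fields by simp
  let ?D = "Q k \<alpha> \<times> {(of_int i - \<bar>of_int m\<bar>) * side k ..< (of_int i + \<bar>of_int m\<bar> + 1) * side k}"
  have "rect u \<subseteq> ?D" if u: "valid u" "rect (time_shift m u) \<subseteq> rect (time_shift m v)" for u
  proof (cases u)
    case (fields l \<beta> j)
    have \<beta>: "\<beta> \<in> I l" using u fields by simp
    then have "Q l \<beta> \<noteq> {}" using Q_pos[OF \<beta>] by auto
    then obtain x where x: "x \<in> Q l \<beta>" by auto
    have lt: "of_int (j + m) * side l < of_int (j + m + 1) * side l" by simp
    have sub: "Q l \<beta> \<times> {of_int (j + m) * side l ..< of_int (j + m + 1) * side l}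
        \<subseteq> Q k \<alpha> \<times> {of_int (i + m) * side k ..< of_int (i + m + 1) * side k}"
      using u(2) fields \<open>v = _\<close> by (simp add: add.assoc)
    have "(y, of_int (j + m) * side l) \<in> Q k \<alpha> \<times> {of_int (i + m) * side k ..< of_int (i + m + 1) * side k}"
      if "y \<in> Q l \<beta>" for y
    proof (rule subsetD[OF sub])
      show "(y, of_int (j + m) * side l) \<in> Q l \<beta> \<times> {of_int (j + m) * side l ..< of_int (j + m + 1) * side l}"
        using that lt by simp
    qed
    then have QQ: "Q l \<beta> \<subseteq> Q k \<alpha>" by auto
    have "{of_int (j + m) * side l ..< of_int (j + m + 1) * side l}
        \<subseteq> {of_int (i + m) * side k ..< of_int (i + m + 1) * side k}"
      using sub x by (auto simp: subset_iff)
    then have J: "of_int (i + m) * side k \<le> of_int (j + m) * side l"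
        "of_int (j + m + 1) * side l \<le> of_int (i + m + 1) * side k"
      using lt by (auto dest!: atLeastLessThan_subset_iff simp del: of_int_add)
    then have l: "side l \<le> side k" by (simp add: algebra_simps)
    have "\<bar>of_int m * (side k - side l)\<bar> \<le> \<bar>of_int m\<bar> * side k"
      using l by (simp add: abs_mult mult_left_mono less_imp_le)
    then have "(of_int i - \<bar>of_int m\<bar>) * side k \<le> of_int j * side l"
       "of_int (j + 1) * side l \<le> (of_int i + \<bar>of_int m\<bar> + 1) * side k"
      using J by (auto simp: algebra_simps abs_le_iff)
    then show ?thesis using QQ fields by auto
  qed
  moreover have "?D \<in> sets lam" using \<alpha> by (intro sets_parabolic_times Q_sets) auto
  moreover have "emeasure lam ?D \<le> ennreal (2 * \<bar>of_int m\<bar> + 1) * emeasure lam (rect v)"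
  proof -
    have "emeasure lam ?D = ennreal (measure \<mu> (Q k \<alpha>) *
        ((of_int i + \<bar>of_int m\<bar> + 1) * side k - (of_int i - \<bar>of_int m\<bar>) * side k))"
      using \<alpha> by (intro emeasure_box) (auto intro!: mult_right_mono simp: less_imp_le)
    also have "measure \<mu> (Q k \<alpha>) * ((of_int i + \<bar>of_int m\<bar> + 1) * side k - (of_int i - \<bar>of_int m\<bar>) * side k)
        = (2 * \<bar>of_int m\<bar> + 1) * (measure \<mu> (Q k \<alpha>) * side k)"
      by (simp add: algebra_simps)
    also have "ennreal \<dots> = ennreal (2 * \<bar>of_int m\<bar> + 1) * emeasure lam (rect v)"
      using \<alpha> fields by (simp only: emeasure_rect) (rule ennreal_mult', simp)
    finally show ?thesis by simp
  qed
  ultimately show ?thesis by (intro bexI[of _ ?D]) auto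
qed

text \<open>Small generations are coarse, so these are the maximal rectangles with property
  \<open>P\<close> among the generations from \<open>a\<close> to \<open>b\<close>. The bound
  \<open>a\<close> ensures that every rectangle with the property lies in a maximal one.\<close>

definition top_rects :: "int \<Rightarrow> int \<Rightarrow> ('i rindex \<Rightarrow> bool) \<Rightarrow> 'i rindex set" where
  "top_rects a b P = {u. valid u \<and> a \<le> fst u \<and> fst u \<le> b \<and> P u \<and>
     (\<forall>v. valid v \<longrightarrow> a \<le> fst v \<longrightarrow> fst v < fst u \<longrightarrow> rect u \<subseteq> rect v \<longrightarrow> \<not> P v)}"

lemma countable_top_rects: "countable (top_rects a b P)"
  by (rule countable_subset[OF _ countable_valid]) (auto simp: top_rects_def)

lemma top_rects_disjoint: "disjoint_family_on rect (top_rects a b P)"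
  unfolding disjoint_family_on_def
proof (intro ballI impI)
  have *: False if u: "u \<in> top_rects a b P" and v: "v \<in> top_rects a b P" and "u \<noteq> v"
      "fst u \<le> fst v" "rect u \<inter> rect v \<noteq> {}" for u v
  proof -
    have "rect v \<subseteq> rect u" using that by (intro rect_subset) (auto simp: top_rects_def)
    moreover have "fst u \<noteq> fst v"
    proof
      assume eq: "fst u = fst v"
      obtain z where "z \<in> rect u" "z \<in> rect v" using \<open>rect u \<inter> rect v \<noteq> {}\<close> by blast
      then show False using rect_eq_idx[of u z] rect_eq_idx[of v z] u v \<open>u \<noteq> v\<close> eq by (auto simp: top_rects_def)
    qed
    ultimately show False using that u v unfolding top_rects_def by fastforce
  qed
  fix u v assume "u \<in> top_rects a b P" "v \<in> top_rects a b P" "u \<noteq> v"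
  then show "rect u \<inter> rect v = {}" using *[of u v] *[of v u] by (metis Int_commute linear)
qed

lemma top_rects_cover:
  assumes "a \<le> g" "g \<le> b" "P (idx g z)" obtains u where "u \<in> top_rects a b P" "z \<in> rect u"
proof -
  define G where "G = {h \<in> {a..g}. P (idx h z)}"
  have G: "finite G" "g \<in> G" using assms unfolding G_def by (auto intro: finite_subset[of _ "{a..g}"])
  define h where "h = Min G"
  have h: "h \<in> G" using Min_in[OF G(1)] G(2) by (auto simp: h_def)
  have "\<not> P v" if "valid v" "a \<le> fst v" "fst v < h" "rect (idx h z) \<subseteq> rect v" for v
  proof -
    have "v = idx (fst v) z" using that mem_rect_idx[of z h] by (intro rect_eq_idx) auto
    moreover have "fst v \<notin> G" using Min_le[OF G(1), of "fst v"] that by (auto simp: h_def)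
    ultimately show ?thesis using that h by (auto simp: G_def)
  qed
  then have "idx h z \<in> top_rects a b P" using h assms by (auto simp: top_rects_def G_def)
  then show thesis using that mem_rect_idx by blast
qed

text \<open>A function of the cell takes countably many values, each on a union of
  rectangles.\<close>

lemma borel_measurable_idx:
  fixes f :: "'i rindex \<Rightarrow> real"
  shows "(\<lambda>z. f (idx g z)) \<in> borel_measurable lam"
proof (rule measurable_compose_countable'[where I = "{u. valid u}" and f = "\<lambda>u z. f u"])
  show "idx g \<in> measurable lam (count_space {u. valid u})"
  proof (subst measurable_count_space_eq_countable[OF countable_valid], intro conjI ballI)
    fix u assume "u \<in> {u. valid u}"
    then have "z \<in> idx g -` {u} \<longleftrightarrow> fst u = g \<and> z \<in> rect u" for z
      using mem_rect_iff[of u z] fst_idx[of g z] by (auto simp del: fst_idx)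
    then have "idx g -` {u} \<inter> space lam = (if fst u = g then rect u else {})"
      using space_parabolic[OF space_mu] by auto
    then show "idx g -` {u} \<inter> space lam \<in> sets lam" using \<open>u \<in> _\<close> rect_sets by auto
  qed auto
qed (auto simp: countable_valid)

end

lemma set_nn_integral_pos:
  fixes f :: "'b \<Rightarrow> real"
  assumes "E \<in> sets M" "0 < emeasure M E" "f \<in> borel_measurable M" "AE z in M. 0 < f z"
  shows "0 < (\<integral>\<^sup>+z\<in>E. ennreal (f z) \<partial>M)"
proof (rule ccontr)
  assume "\<not> ?thesis"
  then have "(\<integral>\<^sup>+z\<in>E. ennreal (f z) \<partial>M) = 0" by simp
  then have "AE z in M. ennreal (f z) * indicator E z = 0"
    using assms by (subst (asm) nn_integral_0_iff_AE) auto
  then have "AE z in M. z \<notin> E"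
    using assms(4) by eventually_elim (auto split: split_indicator_asm)
  then have "emeasure M E = 0" using assms(1) by (metis AE_iff_null_sets null_setsD1)
  then show False using assms(2) by simp
qed

section \<open>Averages over rectangles and conditional expectations\<close>

context dyadic_grid begin

declare rect.simps [simp del]

text \<open>Since \<open>enn2real\<close> sends infinity to 0, this is the average only if the
  integral is finite.\<close>

definition av :: "('a \<times> real \<Rightarrow> real) \<Rightarrow> 'i rindex \<Rightarrow> real" where
  "av f u = enn2real (\<integral>\<^sup>+z\<in>rect u. ennreal (f z) \<partial>lam) / rmeas u"

text \<open>The conditional expectation of \<open>f\<close> with respect to the cells of generation
  \<open>n\<close>.\<close>

definition cavg :: "int \<Rightarrow> ('a \<times> real \<Rightarrow> real) \<Rightarrow> 'a \<times> real \<Rightarrow> real" where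
  "cavg n f z = av f (idx n z)"

lemma av_nonneg: "valid u \<Longrightarrow> 0 \<le> av f u"
  by (simp add: av_def less_imp_le)

lemma cavg_nonneg: "0 \<le> cavg n f z"
  by (simp add: cavg_def av_nonneg)

lemma cavg_measurable [measurable]: "cavg n f \<in> borel_measurable lam"
  using borel_measurable_idx[of "av f" n] by (simp add: cavg_def[abs_def])

lemma cavg_eq: "valid u \<Longrightarrow> z \<in> rect u \<Longrightarrow> fst u = n \<Longrightarrow> cavg n f z = av f u"
  using rect_eq_idx[of u z] by (simp add: cavg_def)

lemma nn_integral_cells:
  assumes [measurable]: "F \<in> borel_measurable lam"
  shows "(\<integral>\<^sup>+z. F z \<partial>lam) = (\<integral>\<^sup>+u. (\<integral>\<^sup>+z\<in>rect u. F z \<partial>lam) \<partial>count_space {u. valid u \<and> fst u = n})"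
proof -
  have c: "countable {u. valid u \<and> fst u = n}" by (rule countable_subset[OF _ countable_valid]) auto
  have "(\<integral>\<^sup>+z. F z \<partial>lam) = (\<integral>\<^sup>+z. \<integral>\<^sup>+u. F z * indicator (rect u) z \<partial>count_space {u. valid u \<and> fst u = n} \<partial>lam)"
  proof (rule nn_integral_cong)
    fix z
    have "(\<integral>\<^sup>+u. F z * indicator (rect u) z \<partial>count_space {u. valid u \<and> fst u = n})
        = (\<integral>\<^sup>+u. F z * indicator {idx n z} u \<partial>count_space {u. valid u \<and> fst u = n})"
      by (intro nn_integral_cong) (auto simp: mem_rect_iff split: split_indicator)
    also have "\<dots> = F z" by (subst nn_integral_cmult_indicator) auto
    finally show "F z = (\<integral>\<^sup>+u. F z * indicator (rect u) z \<partial>count_space {u. valid u \<and> fst u = n})" by simp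
  qed
  also have "\<dots> = (\<integral>\<^sup>+u. (\<integral>\<^sup>+z\<in>rect u. F z \<partial>lam) \<partial>count_space {u. valid u \<and> fst u = n})"
    using c rect_sets by (intro nn_integral_count_space_nn_integral) auto
  finally show ?thesis .
qed

lemma nn_integral_cells_mono:
  assumes "F \<in> borel_measurable lam" "G \<in> borel_measurable lam"
    and "\<And>u. valid u \<Longrightarrow> fst u = n \<Longrightarrow> (\<integral>\<^sup>+z\<in>rect u. F z \<partial>lam) \<le> (\<integral>\<^sup>+z\<in>rect u. G z \<partial>lam)"
  shows "(\<integral>\<^sup>+z. F z \<partial>lam) \<le> (\<integral>\<^sup>+z. G z \<partial>lam)"
  unfolding nn_integral_cells[OF assms(1), of n] nn_integral_cells[OF assms(2), of n]
  by (rule nn_integral_mono) (simp add: assms(3))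

lemma nn_integral_rect_const:
  assumes "valid u" "0 \<le> c" shows "(\<integral>\<^sup>+z\<in>rect u. ennreal c \<partial>lam) = ennreal (c * rmeas u)"
  using assms rect_sets[OF assms(1)]
  by (simp add: nn_integral_cmult_indicator emeasure_rect_rmeas ennreal_mult')

lemma nn_integral_cavg_cell:
  assumes u: "valid u" "fst u = n" and fin: "(\<integral>\<^sup>+z\<in>rect u. ennreal (f z) \<partial>lam) < \<infinity>"
  shows "(\<integral>\<^sup>+z\<in>rect u. ennreal (cavg n f z) \<partial>lam) = (\<integral>\<^sup>+z\<in>rect u. ennreal (f z) \<partial>lam)"
proof -
  have "(\<integral>\<^sup>+z\<in>rect u. ennreal (cavg n f z) \<partial>lam) = (\<integral>\<^sup>+z\<in>rect u. ennreal (av f u) \<partial>lam)"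
    using cavg_eq[OF u(1) _ u(2)] by (intro nn_integral_cong) (auto split: split_indicator)
  also have "\<dots> = ennreal (av f u * rmeas u)" using u by (intro nn_integral_rect_const av_nonneg)
  also have "av f u * rmeas u = enn2real (\<integral>\<^sup>+z\<in>rect u. ennreal (f z) \<partial>lam)"
    using rmeas_pos[OF u(1)] by (simp add: av_def)
  finally show ?thesis using fin by simp
qed

text \<open>A rectangle of generation at most \<open>n\<close> is a union of cells of generation
  \<open>n\<close>, and on each cell the conditional expectation has the same integral as
  \<open>f\<close>.\<close>

lemma nn_integral_cavg_rect:
  assumes f: "f \<in> borel_measurable lam" and v: "valid v" "fst v \<le> n"
    and fin: "\<And>u. valid u \<Longrightarrow> (\<integral>\<^sup>+z\<in>rect u. ennreal (f z) \<partial>lam) < \<infinity>"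
  shows "(\<integral>\<^sup>+z\<in>rect v. ennreal (cavg n f z) \<partial>lam) = (\<integral>\<^sup>+z\<in>rect v. ennreal (f z) \<partial>lam)"
proof -
  have "(\<integral>\<^sup>+z\<in>rect u. (ennreal (cavg n f z) * indicator (rect v) z) \<partial>lam)
      = (\<integral>\<^sup>+z\<in>rect u. (ennreal (f z) * indicator (rect v) z) \<partial>lam)" if u: "valid u" "fst u = n" for u
  proof (cases "rect u \<inter> rect v = {}")
    case True
    then show ?thesis by (intro nn_integral_cong) (auto split: split_indicator)
  next
    case False
    then have sub: "rect u \<subseteq> rect v" using rect_subset[of v u] u v by blast
    have "(\<integral>\<^sup>+z\<in>rect u. (h z * indicator (rect v) z) \<partial>lam) = (\<integral>\<^sup>+z\<in>rect u. h z \<partial>lam)"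
      for h :: "_ \<Rightarrow> ennreal"
      using sub by (intro nn_integral_cong) (auto split: split_indicator)
    then show ?thesis using nn_integral_cavg_cell[OF u fin[OF u(1)]] by simp
  qed
  then have cell: "(\<integral>\<^sup>+z\<in>rect u. (ennreal (cavg n f z) * indicator (rect v) z) \<partial>lam)
      = (\<integral>\<^sup>+z\<in>rect u. (ennreal (f z) * indicator (rect v) z) \<partial>lam)" if "valid u" "fst u = n" for u
    using that by blast
  note [measurable] = f rect_sets[OF v(1)]
  show ?thesis
    by (rule antisym; rule nn_integral_cells_mono[where n = n]) (measurable, simp add: cell)+
qed

end

text \<open>The condition starts at lag 2, where a whole rectangle lies between the two that are
  compared; translates by one step touch each other, and no condition without a gap is available.
  The constant may depend on the lag.\<close>

locale weighted_dyadic_grid = dyadic_grid +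
  fixes \<omega> \<sigma> :: "'a \<times> real \<Rightarrow> real" and q :: real
  assumes \<omega>_meas [measurable]: "\<omega> \<in> borel_measurable lam"
    and \<sigma>_meas [measurable]: "\<sigma> \<in> borel_measurable lam"
    and \<omega>_pos: "AE z in lam. 0 < \<omega> z" and \<sigma>_eq: "AE z in lam. \<sigma> z = \<omega> z powr (-1 / (q - 1))"
    and q: "1 < q"
    and \<omega>_fin: "\<And>u. valid u \<Longrightarrow> (\<integral>\<^sup>+z\<in>rect u. ennreal (\<omega> z) \<partial>lam) < \<infinity>"
    and \<sigma>_fin: "\<And>u. valid u \<Longrightarrow> (\<integral>\<^sup>+z\<in>rect u. ennreal (\<sigma> z) \<partial>lam) < \<infinity>"
    and Aq: "\<And>s. 2 \<le> s \<Longrightarrow> \<exists>C. \<forall>u. valid u \<longrightarrow>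
      av \<omega> u * av \<sigma> (time_shift s u) powr (q - 1) \<le> C"
begin

lemma \<sigma>_pos: "AE z in lam. 0 < \<sigma> z"
  using \<omega>_pos \<sigma>_eq by eventually_elim simp

lemma av_\<sigma>_pos: assumes "valid u" shows "0 < av \<sigma> u"
proof -
  have "0 < (\<integral>\<^sup>+z\<in>rect u. ennreal (\<sigma> z) \<partial>lam)"
    using assms by (intro set_nn_integral_pos rect_sets \<sigma>_meas \<sigma>_pos) (auto simp: emeasure_rect_rmeas)
  then show ?thesis using \<sigma>_fin[OF assms] assms by (simp add: av_def enn2real_positive_iff)
qed

lemma integral_av:
  assumes "valid u" "(\<integral>\<^sup>+z\<in>rect u. ennreal (f z) \<partial>lam) < \<infinity>"
  shows "(\<integral>\<^sup>+z\<in>rect u. ennreal (f z) \<partial>lam) = ennreal (av f u * rmeas u)"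
  using assms rmeas_pos[OF assms(1)] by (simp add: av_def less_imp_neq[symmetric])

text \<open>Hoelder's inequality for the constant function 1. It runs against the A_q condition and
  holds on a single rectangle, without any lag.\<close>

lemma Aq_lower: assumes "valid u" shows "1 \<le> 2 powr q * av \<omega> u * av \<sigma> u powr (q - 1)"
proof -
  have e: "(\<integral>\<^sup>+z\<in>rect u. ennreal (1 powr q * \<omega> z) \<partial>lam) = ennreal (av \<omega> u * rmeas u)"
    using integral_av[OF assms \<omega>_fin[OF assms]] by simp
  have e1: "(\<integral>\<^sup>+z\<in>rect u. ennreal 1 \<partial>lam) = ennreal (rmeas u)"
    using nn_integral_rect_const[OF assms, of 1] by simp
  note r = rmeas_pos[OF assms]
  have "(rmeas u) powr q \<le> 2 powr q * (av \<omega> u * rmeas u) * (av \<sigma> u * rmeas u) powr (q - 1)"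
    using weighted_Holder(2)[OF q rect_sets[OF assms], of "\<lambda>_. 1" \<omega> \<sigma>] \<omega>_pos \<sigma>_eq \<sigma>_fin[OF assms]
      av_nonneg[OF assms, of \<omega>] av_nonneg[OF assms, of \<sigma>] r
    unfolding e e1 integral_av[OF assms \<sigma>_fin[OF assms]] by simp
  also have "\<dots> = rmeas u powr q * (2 powr q * av \<omega> u * av \<sigma> u powr (q - 1))"
  proof -
    have "rmeas u * rmeas u powr (q - 1) = rmeas u powr q"
      using r by (simp add: powr_diff)
    then show ?thesis using av_nonneg[OF assms, of \<sigma>] r by (simp add: powr_mult mult_ac)
  qed
  finally show ?thesis using r by simp
qed

text \<open>The constant at lag 2 is chosen once and for all, so that \<open>med\<close> and
  everything built from it depend neither on the rectangle nor on the generation \<open>n\<close> of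
  the cells.\<close>

definition past_const :: real where
  "past_const = (SOME C. 0 < C \<and> (\<forall>u. valid u \<longrightarrow> av \<omega> u * av \<sigma> (time_shift 2 u) powr (q - 1) \<le> C))"

lemma past_const: "0 < past_const"
  "valid u \<Longrightarrow> av \<omega> u * av \<sigma> (time_shift 2 u) powr (q - 1) \<le> past_const"
proof -
  obtain C where C: "\<forall>u. valid u \<longrightarrow> av \<omega> u * av \<sigma> (time_shift 2 u) powr (q - 1) \<le> C"
    using Aq[of 2] by auto
  then have "0 < max C 1 \<and> (\<forall>u. valid u \<longrightarrow> av \<omega> u * av \<sigma> (time_shift 2 u) powr (q - 1) \<le> max C 1)"
    by fastforce
  then have "0 < past_const \<and> (\<forall>u. valid u \<longrightarrow> av \<omega> u * av \<sigma> (time_shift 2 u) powr (q - 1) \<le> past_const)"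
    unfolding past_const_def by (rule someI)
  then show "0 < past_const" "valid u \<Longrightarrow> av \<omega> u * av \<sigma> (time_shift 2 u) powr (q - 1) \<le> past_const" by blast+
qed

text \<open>The solution of the equation in \<open>med_powr\<close>, which is what leaves at most
  half of the past rectangle to the points with a small average.\<close>

definition med :: real where "med = (1 / (2 powr q * past_const * 2)) powr (1 / (q - 1))"

lemma med_pos: "0 < med" using past_const by (simp add: med_def)

lemma med_powr: "2 powr q * med powr (q - 1) * past_const = 1 / 2"
  using past_const q by (simp add: med_def powr_powr)

text \<open>The one-sided substitute for the \<open>A\<^sub>\<infinity>\<close> property of the dual weight, which need not be doubling.\<close>

lemma past_median:
  assumes u: "valid u" "fst u \<le> n"
  shows "ennreal (1 / 2) * emeasure lam (rect (time_shift (-2) u))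
    \<le> emeasure lam (rect (time_shift (-2) u) \<inter> {z. med * av \<sigma> u < cavg n \<sigma> z})"
proof -
  define v where "v = time_shift (-2) u"
  have v: "valid v" "fst v \<le> n" "time_shift 2 v = u" "rmeas v = rmeas u" using u by (auto simp: v_def)
  define bad where "bad = {z \<in> rect v. cavg n \<sigma> z \<le> med * av \<sigma> u}"
  define K where "K = 2 powr q * (med * av \<sigma> u) powr (q - 1)"
  have K0: "0 \<le> K" by (simp add: K_def)
  have sp: "space lam = UNIV" by (rule space_parabolic[OF space_mu])
  have bad_sets: "bad \<in> sets lam"
  proof -
    have "bad = rect v \<inter> {z \<in> space lam. cavg n \<sigma> z \<le> med * av \<sigma> u}" by (auto simp: bad_def sp)
    also have "\<dots> \<in> sets lam" using rect_sets[OF v(1)] by measurable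
    finally show ?thesis .
  qed
  note [measurable] = bad_sets rect_sets[OF v(1)]
  have "emeasure lam bad = (\<integral>\<^sup>+z. indicator bad z \<partial>lam)" using bad_sets by simp
  also have "\<dots> \<le> (\<integral>\<^sup>+z. ennreal K * (ennreal (\<omega> z) * indicator (rect v) z) \<partial>lam)"
  proof (rule nn_integral_cells_mono[where n = n])
    fix c assume c: "valid c" "fst c = n"
    note [measurable] = rect_sets[OF c(1)]
    show "(\<integral>\<^sup>+z\<in>rect c. indicator bad z \<partial>lam)
        \<le> (\<integral>\<^sup>+z\<in>rect c. (ennreal K * (ennreal (\<omega> z) * indicator (rect v) z)) \<partial>lam)"
    proof (cases "rect c \<inter> bad = {}")
      case True
      then have "(\<integral>\<^sup>+z\<in>rect c. indicator bad z \<partial>lam) = (\<integral>\<^sup>+z. 0 \<partial>lam)"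
        by (intro nn_integral_cong) (auto split: split_indicator)
      then show ?thesis by simp
    next
      case False
      then obtain z where z: "z \<in> rect c" "z \<in> rect v" "cavg n \<sigma> z \<le> med * av \<sigma> u" by (auto simp: bad_def)
      then have sub: "rect c \<subseteq> rect v" using rect_subset[of v c] c v by blast
      have le: "av \<sigma> c \<le> med * av \<sigma> u" using z cavg_eq[OF c(1) z(1) c(2), of \<sigma>] by simp
      \<comment> \<open>Where the cell average of \<open>\<sigma>\<close> is small, this forces that
        of \<open>\<omega>\<close> to be large: the measure of such a cell is at most
        \<open>K\<close> times its \<open>\<omega>\<close>-mass.\<close>
      have "1 \<le> 2 powr q * av \<omega> c * av \<sigma> c powr (q - 1)" by (rule Aq_lower[OF c(1)])
      also have "\<dots> \<le> 2 powr q * av \<omega> c * (med * av \<sigma> u) powr (q - 1)"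
        using le q av_nonneg[OF c(1)] by (intro mult_left_mono powr_mono2) auto
      finally have 1: "1 * rmeas c \<le> K * av \<omega> c * rmeas c"
        using rmeas_pos[OF c(1)] by (intro mult_right_mono) (auto simp: K_def mult_ac)
      have "(\<integral>\<^sup>+z\<in>rect c. indicator bad z \<partial>lam) \<le> (\<integral>\<^sup>+z\<in>rect c. ennreal 1 \<partial>lam)"
        by (intro nn_integral_mono) (auto split: split_indicator)
      also have "\<dots> = ennreal (1 * rmeas c)" using c by (intro nn_integral_rect_const) auto
      also have "\<dots> \<le> ennreal (K * (av \<omega> c * rmeas c))" using 1 by (intro ennreal_leI) (simp add: mult.assoc)
      also have "\<dots> = ennreal K * (\<integral>\<^sup>+z\<in>rect c. ennreal (\<omega> z) \<partial>lam)"
        using K0 by (simp add: integral_av[OF c(1) \<omega>_fin[OF c(1)]] ennreal_mult')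
      also have "\<dots> = (\<integral>\<^sup>+z. ennreal K * (ennreal (\<omega> z) * indicator (rect c) z) \<partial>lam)"
        by (rule nn_integral_cmult[symmetric]) measurable
      also have "\<dots> = (\<integral>\<^sup>+z\<in>rect c. (ennreal K * (ennreal (\<omega> z) * indicator (rect v) z)) \<partial>lam)"
        using sub by (intro nn_integral_cong) (auto split: split_indicator)
      finally show ?thesis .
    qed
  qed measurable
  also have "\<dots> = ennreal K * (\<integral>\<^sup>+z\<in>rect v. ennreal (\<omega> z) \<partial>lam)"
    by (rule nn_integral_cmult) measurable
  also have "\<dots> = ennreal (K * (av \<omega> v * rmeas v))"
    using K0 by (simp add: integral_av[OF v(1) \<omega>_fin[OF v(1)]] ennreal_mult')
  also have "\<dots> \<le> ennreal (1 / 2 * rmeas v)"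
  proof (rule ennreal_leI)
    \<comment> \<open>The total \<open>\<omega>\<close>-mass of \<open>v\<close> is limited by the
      condition at lag 2, because \<open>u\<close> is the translate of \<open>v\<close> by two
      steps.\<close>
    have "K * av \<omega> v = 2 powr q * med powr (q - 1) * (av \<omega> v * av \<sigma> u powr (q - 1))"
      using med_pos av_nonneg[OF u(1), of \<sigma>] by (simp add: K_def powr_mult mult_ac)
    also have "\<dots> \<le> 2 powr q * med powr (q - 1) * past_const"
      using past_const(2)[OF v(1)] v(3) by (intro mult_left_mono) auto
    finally show "K * (av \<omega> v * rmeas v) \<le> 1 / 2 * rmeas v"
      using rmeas_pos[OF v(1)] med_powr by (simp add: mult.assoc[symmetric] mult_right_mono)
  qed
  finally have bad: "emeasure lam bad \<le> ennreal (1 / 2 * rmeas v)" .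
  have good_sets: "rect v \<inter> {z. med * av \<sigma> u < cavg n \<sigma> z} \<in> sets lam"
  proof -
    have "rect v \<inter> {z. med * av \<sigma> u < cavg n \<sigma> z} = rect v \<inter> {z \<in> space lam. med * av \<sigma> u < cavg n \<sigma> z}"
      by (auto simp: sp)
    also have "\<dots> \<in> sets lam" using rect_sets[OF v(1)] by measurable
    finally show ?thesis .
  qed
  have "rect v = bad \<union> (rect v \<inter> {z. med * av \<sigma> u < cavg n \<sigma> z})" by (auto simp: bad_def)
  then have "emeasure lam (rect v) \<le> emeasure lam bad + emeasure lam (rect v \<inter> {z. med * av \<sigma> u < cavg n \<sigma> z})"
    using emeasure_subadditive[OF bad_sets good_sets] by simp
  also have "\<dots> \<le> ennreal (1 / 2 * rmeas v) + emeasure lam (rect v \<inter> {z. med * av \<sigma> u < cavg n \<sigma> z})"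
    using bad by (intro add_right_mono)
  finally have *: "ennreal (rmeas v) \<le> ennreal (1 / 2 * rmeas v) + emeasure lam (rect v \<inter> {z. med * av \<sigma> u < cavg n \<sigma> z})"
    by (simp add: emeasure_rect_rmeas[OF v(1)])
  have "emeasure lam (rect v \<inter> {z. med * av \<sigma> u < cavg n \<sigma> z}) \<le> ennreal (rmeas v)"
    using emeasure_mono[of "rect v \<inter> {z. med * av \<sigma> u < cavg n \<sigma> z}" "rect v" lam] rect_sets[OF v(1)]
    by (simp add: emeasure_rect_rmeas[OF v(1)])
  then obtain x where x: "0 \<le> x" "emeasure lam (rect v \<inter> {z. med * av \<sigma> u < cavg n \<sigma> z}) = ennreal x"
    by (cases "emeasure lam (rect v \<inter> {z. med * av \<sigma> u < cavg n \<sigma> z})") (auto simp: top_unique)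
  have "rmeas v \<le> 1 / 2 * rmeas v + x"
    using * x rmeas_pos[OF v(1)] by (simp add: ennreal_plus[symmetric] del: ennreal_plus)
  then have "ennreal (1 / 2 * rmeas v) \<le> ennreal x" by (intro ennreal_leI) simp
  moreover have "ennreal (1 / 2 * rmeas v) = ennreal (1 / 2) * ennreal (rmeas v)" by (rule ennreal_mult') simp
  moreover have "emeasure lam (rect v) = ennreal (rmeas v)" by (rule emeasure_rect_rmeas[OF v(1)])
  ultimately show ?thesis unfolding v_def[symmetric] x(2) by (simp only:)
qed

end

lemma exists_small_exponent:
  fixes K :: real
  assumes "0 \<le> K" obtains \<eta> where "0 < \<eta>" "\<eta> \<le> 1" "(2 powr \<eta> - 1) * K \<le> 1 / 2"
proof
  define \<eta> where "\<eta> = log 2 (1 + 1 / (2 * K + 1))"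
  have p: "2 powr \<eta> = 1 + 1 / (2 * K + 1)" using assms by (simp add: \<eta>_def add_pos_nonneg)
  show "0 < \<eta>" using assms unfolding \<eta>_def by (subst zero_less_log_cancel_iff) (simp_all add: add_pos_pos)
  have "2 powr \<eta> \<le> 2 powr 1" using assms unfolding p by simp
  then show "\<eta> \<le> 1" by (subst (asm) powr_le_cancel_iff) auto
  show "(2 powr \<eta> - 1) * K \<le> 1 / 2" using assms unfolding p by (simp add: field_simps)
qed

lemma Ico_subset_Ico_D: "{a..<b} \<subseteq> {c..<d} \<Longrightarrow> a < b \<Longrightarrow> c \<le> a \<and> b \<le> d" for a b c d :: real
  by (auto dest!: atLeastLessThan_subset_iff)

lemma (in dyadic_grid) side_nonneg [simp]: "0 \<le> side k"
  by (simp add: less_imp_le)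

lemma (in dyadic_grid) side_neq_0 [simp]: "side k \<noteq> 0"
  using side_pos[of k] by (metis less_irrefl)

context weighted_dyadic_grid begin

text \<open>A dimension: passing to a child divides the measure by at most \<open>2 ^ gdim\<close>,
  while the time side is at least halved.\<close>

definition gdim :: nat where "gdim = (SOME D. cd \<le> 2 ^ D)"

lemma gdim: "cd \<le> 2 ^ gdim"
proof -
  obtain D :: nat where "cd < 2 ^ D" using real_arch_pow[of 2 cd] by auto
  then show ?thesis unfolding gdim_def by (rule someI[of "\<lambda>D. cd \<le> 2 ^ D", OF less_imp_le])
qed

text \<open>The factor \<open>med\<close> is lost in the cell averages and \<open>2 ^ gdim\<close>
  when the height is halved; the minimum with 1 meets the requirement \<open>\<beta> \<le> 1\<close>
  of Gehring's lemma.\<close>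

definition gehring_fraction :: real where "gehring_fraction = min med 1 / 2 ^ gdim"

lemma gehring_fraction: "0 < gehring_fraction" "gehring_fraction \<le> 1"
  using med_pos by (auto simp: gehring_fraction_def divide_le_eq_1 min_le_iff_disj)

end

section \<open>Self-improvement of the dual weight\<close>

text \<open>The column consists of the translates of \<open>(k, \<alpha>, i)\<close> by 2 up to
  \<open>m\<close> steps. The condition at these lags ties its dual mass to the weight on
  \<open>(k, \<alpha>, i)\<close>. The topmost translate is where higher integrability is wanted;
  \<open>3 \<le> m\<close> places it at height at least 1.\<close>

locale weighted_dyadic_column = weighted_dyadic_grid +
  fixes n k i m :: int and \<alpha>
  assumes \<alpha>: "\<alpha> \<in> I k" and kn: "k \<le> n" and m: "3 \<le> m"
begin

definition base :: real where "base = of_int (i + 2) * side k"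
definition col :: "('a \<times> real) set" where "col = Q k \<alpha> \<times> {base ..< of_int (i + m + 1) * side k}"
definition height :: "'a \<times> real \<Rightarrow> real" where "height z = (snd z - base) / side k"
definition rheight where "rheight u = (of_int (snd (snd u) + 1) * side (fst u) - base) / side k"
text \<open>The function to which Gehring's lemma is applied: the cell averages of the dual weight,
  damped towards the bottom of the column.\<close>

definition \<phi> :: "'a \<times> real \<Rightarrow> real" where
  "\<phi> z = indicator col z * (cavg n \<sigma> z * height z ^ gdim)"
text \<open>The height of the top edge is used for the whole rectangle, so this bounds the average
  of \<open>\<phi>\<close> over \<open>u\<close>, and also \<open>\<phi>\<close> itself if
  \<open>u\<close> is a cell of generation \<open>n\<close>.\<close>

definition stop where "stop u = av \<sigma> u * rheight u ^ gdim"
definition P0 :: real where "P0 = rmeas (k, \<alpha>, i)"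
definition smass :: real where "smass = (\<Sum>s\<in>{2..m}. av \<sigma> (k, \<alpha>, i + s)) * P0"
text \<open>The number \<open>m + 6\<close> exceeds both the greatest height \<open>m - 1\<close>,
  relevant for generation \<open>k\<close>, and the number 6 of sides that defines nearness to the
  bottom.\<close>

definition t0 :: real where "t0 = of_int (m + 6) ^ gdim * (smass / P0)"

lemma P0_pos: "0 < P0" using \<alpha> by (simp add: P0_def)

lemma col_iff: "z \<in> col \<longleftrightarrow> (\<exists>s\<in>{2..m}. z \<in> rect (k, \<alpha>, i + s))"
proof
  assume z: "z \<in> col"
  define s where "s = \<lfloor>snd z / side k\<rfloor> - i"
  have 1: "of_int (i + s) * side k \<le> snd z" "snd z < of_int (i + s + 1) * side k"
    unfolding s_def by (simp_all add: pos_le_divide_eq[symmetric] pos_divide_less_eq[symmetric])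
  have "of_int (i + 2) \<le> snd z / side k" "snd z / side k < of_int (i + m + 1)"
    using z by (auto simp: col_def base_def pos_le_divide_eq pos_divide_less_eq mem_Times_iff)
  then have "2 \<le> s" "s \<le> m" unfolding s_def by linarith+
  then show "\<exists>s\<in>{2..m}. z \<in> rect (k, \<alpha>, i + s)"
    using z 1 by (intro bexI[of _ s]) (auto simp: rect.simps col_def mem_Times_iff)
next
  assume "\<exists>s\<in>{2..m}. z \<in> rect (k, \<alpha>, i + s)"
  then obtain s where s: "2 \<le> s" "s \<le> m" "z \<in> rect (k, \<alpha>, i + s)" by auto
  have le: "of_int (i + 2) * side k \<le> of_int (i + s) * side k" "of_int (i + s + 1) * side k \<le> of_int (i + m + 1) * side k"
    using s by (auto intro!: mult_right_mono)
  have z: "fst z \<in> Q k \<alpha>" "of_int (i + s) * side k \<le> snd z" "snd z < of_int (i + s + 1) * side k"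
    using s(3) by (auto simp: rect.simps)
  show "z \<in> col" unfolding col_def base_def mem_Times_iff atLeastLessThan_iff
    using z(1) order_trans[OF le(1) z(2)] less_le_trans[OF z(3) le(2)] by blast
qed

lemma col_sets [measurable]: "col \<in> sets lam"
  unfolding col_def using \<alpha> by (intro sets_parabolic_times Q_sets) auto

lemma rect_subset_col:
  assumes u: "valid u" "k \<le> fst u" "rect u \<inter> col \<noteq> {}" shows "rect u \<subseteq> col"
proof -
  obtain z s where z: "z \<in> rect u" "s \<in> {2..m}" "z \<in> rect (k, \<alpha>, i + s)" using u(3) col_iff by blast
  then have "rect u \<subseteq> rect (k, \<alpha>, i + s)" using u \<alpha> by (intro rect_subset) auto
  then show ?thesis using z(2) col_iff by blast
qed

lemma rect_shift_subset_col: "s \<in> {2..m} \<Longrightarrow> rect (k, \<alpha>, i + s) \<subseteq> col"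
  using col_iff by blast

lemma rect_nonempty: "valid u \<Longrightarrow> rect u \<noteq> {}"
  using rmeas_pos[of u] by (auto simp: rmeas_def)

lemma subset_col_bounds:
  assumes u: "valid (g, \<gamma>, j)" "rect (g, \<gamma>, j) \<subseteq> col"
  shows "Q g \<gamma> \<subseteq> Q k \<alpha>" "base \<le> of_int j * side g" "of_int (j + 1) * side g \<le> of_int (i + m + 1) * side k"
proof -
  have lt: "of_int j * side g < of_int (j + 1) * side g" by simp
  have "Q g \<gamma> \<noteq> {}" using u(1) Q_pos[of \<gamma> g] by auto
  then obtain x where x: "x \<in> Q g \<gamma>" by auto
  have mem: "(y, t) \<in> col" if "y \<in> Q g \<gamma>" "of_int j * side g \<le> t" "t < of_int (j + 1) * side g" for y t
    using that u(2) by (auto simp: rect.simps)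
  show "Q g \<gamma> \<subseteq> Q k \<alpha>" using mem[of _ "of_int j * side g"] lt by (auto simp: col_def)
  have "{of_int j * side g ..< of_int (j + 1) * side g} \<subseteq> {base ..< of_int (i + m + 1) * side k}"
  proof
    fix t assume "t \<in> {of_int j * side g ..< of_int (j + 1) * side g}"
    then show "t \<in> {base ..< of_int (i + m + 1) * side k}"
      using mem[OF x, of t] by (simp add: col_def del: of_int_add)
  qed
  from Ico_subset_Ico_D[OF this lt]
  show "base \<le> of_int j * side g" "of_int (j + 1) * side g \<le> of_int (i + m + 1) * side k" by blast+
qed

lemma rheight_bounds:
  assumes u: "valid u" "rect u \<subseteq> col" shows "0 < rheight u" "rheight u \<le> of_int (m - 1)"
proof -
  obtain g \<gamma> j where f: "u = (g, \<gamma>, j)" by (cases u)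
  note b = subset_col_bounds[OF u[unfolded f]]
  have "of_int j * side g < of_int (j + 1) * side g" by simp
  then have "base < of_int (j + 1) * side g" using b(2) by linarith
  then show "0 < rheight u" by (simp add: rheight_def f)
  have "of_int (j + 1) * side g - base \<le> of_int (m - 1) * side k"
    using b(3) by (simp add: base_def algebra_simps)
  then show "rheight u \<le> of_int (m - 1)" by (simp add: rheight_def f pos_divide_le_eq)
qed

lemma height_in_rect:
  assumes u: "valid u" "rect u \<subseteq> col" "z \<in> rect u" shows "0 \<le> height z" "height z \<le> rheight u"
proof -
  obtain g \<gamma> j where f: "u = (g, \<gamma>, j)" by (cases u)
  have "z \<in> col" using u by auto
  then show "0 \<le> height z" by (auto simp: height_def col_def)
  have "snd z \<le> of_int (j + 1) * side g" using u(3) unfolding f by (auto simp: rect.simps)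
  then show "height z \<le> rheight u"
    unfolding height_def rheight_def f by (intro divide_right_mono) (auto simp: less_imp_le)
qed

lemma height_col: "z \<in> col \<Longrightarrow> 0 \<le> height z \<and> height z \<le> of_int (m - 1)"
proof -
  assume "z \<in> col"
  then have "base \<le> snd z" "snd z - base \<le> of_int (m - 1) * side k"
    by (auto simp: col_def base_def algebra_simps)
  then show ?thesis by (simp add: height_def pos_divide_le_eq)
qed

lemma \<phi>_nonneg: "0 \<le> \<phi> z"
  using height_col[of z] cavg_nonneg[of n \<sigma> z] by (auto simp: \<phi>_def split: split_indicator)

lemma height_measurable [measurable]: "height \<in> borel_measurable lam"
proof -
  have "snd \<in> measurable lam (lebesgue :: real measure)"
    unfolding parabolic_measure_def by simp
  then have "snd \<in> borel_measurable lam"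
    by (rule measurable_compose) (use measurable_completion[of "\<lambda>x. x" lborel borel] in simp)
  then show ?thesis unfolding height_def[abs_def] by simp
qed

lemma \<phi>_measurable [measurable]: "\<phi> \<in> borel_measurable lam"
  unfolding \<phi>_def[abs_def] by measurable

lemma smass_pos: "0 < smass"
proof -
  have "0 < (\<Sum>s\<in>{2..m}. av \<sigma> (k, \<alpha>, i + s))"
    using m \<alpha> by (intro sum_pos) (auto intro!: av_\<sigma>_pos)
  then show ?thesis using P0_pos by (simp add: smass_def)
qed

lemma t0_pos: "0 < t0" using smass_pos P0_pos m by (simp add: t0_def)

lemma nn_integral_col: "(\<integral>\<^sup>+z\<in>col. ennreal (\<sigma> z) \<partial>lam) \<le> ennreal smass"
  and nn_integral_cavg_col: "(\<integral>\<^sup>+z\<in>col. ennreal (cavg n \<sigma> z) \<partial>lam) \<le> ennreal smass"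
proof -
  have le: "(\<integral>\<^sup>+z\<in>col. ennreal (h z) \<partial>lam) \<le> ennreal smass"
    if h: "h \<in> borel_measurable lam"
      "\<And>s. (\<integral>\<^sup>+z\<in>rect (k, \<alpha>, i + s). ennreal (h z) \<partial>lam) = ennreal (av \<sigma> (k, \<alpha>, i + s) * P0)" for h
  proof -
    have "(\<integral>\<^sup>+z\<in>col. ennreal (h z) \<partial>lam)
        \<le> (\<integral>\<^sup>+z. (\<Sum>s\<in>{2..m}. ennreal (h z) * indicator (rect (k, \<alpha>, i + s)) z) \<partial>lam)"
    proof (rule nn_integral_mono)
      fix z
      show "ennreal (h z) * indicator col z \<le> (\<Sum>s\<in>{2..m}. ennreal (h z) * indicator (rect (k, \<alpha>, i + s)) z)"
      proof (cases "z \<in> col")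
        case True
        then obtain s where s: "s \<in> {2..m}" "z \<in> rect (k, \<alpha>, i + s)" using col_iff by auto
        then have "ennreal (h z) * indicator col z = ennreal (h z) * indicator (rect (k, \<alpha>, i + s)) z"
          using True by simp
        also have "\<dots> \<le> (\<Sum>s\<in>{2..m}. ennreal (h z) * indicator (rect (k, \<alpha>, i + s)) z)"
          using s by (intro member_le_sum) auto
        finally show ?thesis .
      qed simp
    qed
    also have "\<dots> = (\<Sum>s\<in>{2..m}. (\<integral>\<^sup>+z\<in>rect (k, \<alpha>, i + s). ennreal (h z) \<partial>lam))"
      using h(1) \<alpha> by (intro nn_integral_sum borel_measurable_times_ennreal borel_measurable_indicator rect_sets) auto
    also have "\<dots> = (\<Sum>s\<in>{2..m}. ennreal (av \<sigma> (k, \<alpha>, i + s) * P0))" using h(2) by simp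
    also have "\<dots> = ennreal (\<Sum>s\<in>{2..m}. av \<sigma> (k, \<alpha>, i + s) * P0)"
      using P0_pos \<alpha> by (intro sum_ennreal mult_nonneg_nonneg av_nonneg) auto
    also have "\<dots> = ennreal smass" by (simp add: smass_def sum_distrib_right)
    finally show ?thesis .
  qed
  have rm: "rmeas (k, \<alpha>, i + s) = P0" for s using \<alpha> by (simp add: P0_def rmeas_eq)
  have v: "valid (k, \<alpha>, i + s)" for s using \<alpha> by simp
  have 1: "(\<integral>\<^sup>+z\<in>rect (k, \<alpha>, i + s). ennreal (\<sigma> z) \<partial>lam) = ennreal (av \<sigma> (k, \<alpha>, i + s) * P0)" for s
    using integral_av[OF v \<sigma>_fin[OF v]] by (simp add: rm)
  show "(\<integral>\<^sup>+z\<in>col. ennreal (\<sigma> z) \<partial>lam) \<le> ennreal smass" by (rule le[OF \<sigma>_meas 1])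
  have "(\<integral>\<^sup>+z\<in>rect (k, \<alpha>, i + s). ennreal (cavg n \<sigma> z) \<partial>lam) = ennreal (av \<sigma> (k, \<alpha>, i + s) * P0)" for s
    using nn_integral_cavg_rect[OF \<sigma>_meas v, of s n] kn \<sigma>_fin 1[of s] by simp
  then show "(\<integral>\<^sup>+z\<in>col. ennreal (cavg n \<sigma> z) \<partial>lam) \<le> ennreal smass" by (intro le) auto
qed

lemma rmeas_in_col:
  assumes u: "valid u" "k \<le> fst u" "rect u \<subseteq> col" shows "P0 \<le> cd ^ nat (fst u - k) * rmeas u"
proof -
  obtain z where z: "z \<in> rect u" using rect_nonempty[OF u(1)] by auto
  then obtain s where s: "z \<in> rect (k, \<alpha>, i + s)" using u(3) col_iff by blast
  have "(k, \<alpha>, i + s) = idx k z" using rect_eq_idx[OF _ s] \<alpha> by simp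
  moreover have "rmeas (k, \<alpha>, i + s) = P0" using \<alpha> by (simp add: P0_def rmeas_eq)
  moreover have "u = idx (k + int (nat (fst u - k))) z" using rect_eq_idx[OF u(1) z] u(2) by simp
  ultimately show ?thesis using rmeas_descendant[of k z "nat (fst u - k)"] by simp
qed

text \<open>The dual mass of \<open>u\<close> is at most that of the column, and its measure is at
  least that of a rectangle of generation \<open>k\<close> divided by \<open>cd\<close> once per
  generation.\<close>

lemma av_in_col:
  assumes u: "valid u" "k \<le> fst u" "rect u \<subseteq> col" shows "av \<sigma> u \<le> cd ^ nat (fst u - k) * (smass / P0)"
proof -
  have "(\<integral>\<^sup>+z\<in>rect u. ennreal (\<sigma> z) \<partial>lam) \<le> (\<integral>\<^sup>+z\<in>col. ennreal (\<sigma> z) \<partial>lam)"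
    using u(3) by (intro nn_integral_mono) (auto split: split_indicator)
  also have "\<dots> \<le> ennreal smass" by (rule nn_integral_col)
  finally have "ennreal (av \<sigma> u * rmeas u) \<le> ennreal smass" using integral_av[OF u(1) \<sigma>_fin[OF u(1)]] by simp
  then have "av \<sigma> u * rmeas u \<le> smass" using smass_pos by (simp add: ennreal_le_iff)
  then have "av \<sigma> u * rmeas u * P0 \<le> smass * (cd ^ nat (fst u - k) * rmeas u)"
    using rmeas_in_col[OF u] smass_pos P0_pos by (intro mult_mono) auto
  then have "rmeas u * (av \<sigma> u * P0) \<le> rmeas u * (smass * cd ^ nat (fst u - k))" by (simp add: mult_ac)
  then have "av \<sigma> u * P0 \<le> smass * cd ^ nat (fst u - k)" using rmeas_pos[OF u(1)] by simp
  then show ?thesis using P0_pos by (simp add: field_simps)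
qed

text \<open>Rectangles near the bottom of the column are never selected: there the vanishing of the
  height compensates for the growth of the averages.\<close>

lemma stop_le_t0:
  assumes u: "valid u" "k \<le> fst u" "rect u \<subseteq> col"
    and near: "fst u = k \<or> rheight u * side k \<le> 6 * side (fst u)"
  shows "stop u \<le> t0"
  using near
proof
  assume k: "fst u = k"
  have "stop u \<le> (smass / P0) * of_int (m - 1) ^ gdim"
    unfolding stop_def using av_in_col[OF u] rheight_bounds[OF u(1,3)] k av_nonneg[OF u(1)] smass_pos P0_pos
    by (intro mult_mono power_mono) auto
  also have "\<dots> \<le> (smass / P0) * of_int (m + 6) ^ gdim"
    using m smass_pos P0_pos by (intro mult_left_mono power_mono) auto
  finally show ?thesis by (simp add: t0_def mult.commute)
next
  assume near: "rheight u * side k \<le> 6 * side (fst u)"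
  obtain N where N: "side k = 2 ^ N * side (fst u)" "nat (fst u - k) \<le> N" using side_power[OF u(2)] by blast
  have "rheight u * 2 ^ N * side (fst u) \<le> 6 * side (fst u)" using near N by (simp add: mult.assoc)
  then have "rheight u * 2 ^ N \<le> 6" by simp
  moreover have "rheight u * 2 ^ nat (fst u - k) \<le> rheight u * 2 ^ N"
    using N rheight_bounds[OF u(1,3)] by (intro mult_left_mono power_increasing) auto
  \<comment> \<open>A top edge within 6 sides of the bottom has height at most 6 divided by 2 once
    per generation. Raised to the power \<open>gdim\<close>, these factors cancel the growth of the
    averages by \<open>cd\<close> per generation.\<close>
  ultimately have r: "2 ^ nat (fst u - k) * rheight u \<le> 6" by (simp add: mult.commute)
  have "stop u \<le> (cd ^ nat (fst u - k) * (smass / P0)) * rheight u ^ gdim"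
    unfolding stop_def using av_in_col[OF u] rheight_bounds[OF u(1,3)] by (intro mult_right_mono) auto
  also have "\<dots> \<le> ((2 ^ gdim) ^ nat (fst u - k) * (smass / P0)) * rheight u ^ gdim"
    using gdim cd_pos smass_pos P0_pos rheight_bounds[OF u(1,3)] by (intro mult_right_mono power_mono) auto
  also have "\<dots> = (smass / P0) * (2 ^ nat (fst u - k) * rheight u) ^ gdim"
    by (simp add: power_mult_distrib power_mult[symmetric] mult.commute mult.left_commute)
  also have "\<dots> \<le> (smass / P0) * 6 ^ gdim"
    using r rheight_bounds[OF u(1,3)] smass_pos P0_pos by (intro mult_left_mono power_mono) auto
  also have "\<dots> \<le> (smass / P0) * of_int (m + 6) ^ gdim"
    using m smass_pos P0_pos by (intro mult_left_mono power_mono) auto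
  finally show ?thesis by (simp add: t0_def mult.commute)
qed

text \<open>The maximal rectangles with \<open>stop\<close> above \<open>t\<close> are selected. By
  maximality \<open>stop\<close> is at most \<open>cd * t\<close> on them, which limits the integral
  of \<open>\<phi>\<close> over each. By \<open>past_median\<close>, half of the translate two steps
  back lies in the set where \<open>\<phi>\<close> exceeds \<open>gehring_fraction * t\<close>, and
  the overlap lemma adds up these halves.\<close>

lemma level_bound:
  assumes t: "t0 \<le> t"
  shows "(\<integral>\<^sup>+z. ennreal (\<phi> z) * indicator {t<..} (\<phi> z) \<partial>lam)
    \<le> ennreal (80 * cd * t) * emeasure lam {z. gehring_fraction * t < \<phi> z}"
proof -
  define J where "J = top_rects k n (\<lambda>u. rect u \<subseteq> col \<and> t < stop u)"
  define H where "H = {z. gehring_fraction * t < \<phi> z}"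
  have tpos: "0 < t" using t t0_pos by simp
  have sp: "space lam = UNIV" by (rule space_parabolic[OF space_mu])
  have H_sets [measurable]: "H \<in> sets lam"
  proof -
    have "H = {z \<in> space lam. gehring_fraction * t < \<phi> z}" by (simp add: H_def sp)
    also have "\<dots> \<in> sets lam" by measurable
    finally show ?thesis .
  qed
  have J: "valid u" "k \<le> fst u" "fst u \<le> n" "rect u \<subseteq> col" "t < stop u" if "u \<in> J" for u
    using that by (auto simp: J_def top_rects_def)
  \<comment> \<open>No selected rectangle has generation \<open>k\<close>, so each has a parent
    inside the column; and its top edge lies more than 6 of its sides above the bottom.\<close>
  have far: "k < fst u" "6 * side (fst u) < rheight u * side k" if "u \<in> J" for u
    using stop_le_t0[OF J(1,2,4)[OF that]] J(2,5)[OF that] t by force+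
  have upper: "stop u \<le> cd * t" if u: "u \<in> J" for u
  proof -
    obtain z where z: "z \<in> rect u" using rect_nonempty[OF J(1)[OF u]] by auto
    define p where "p = idx (fst u - 1) z"
    have p: "valid p" "fst p = fst u - 1" "k \<le> fst p" "z \<in> rect p" using far(1)[OF u] by (auto simp: p_def)
    have pu: "rect p \<inter> rect u \<noteq> {}" using p(4) z by (meson disjoint_iff)
    have "fst p \<le> fst u" using p(2) by simp
    from rect_subset[OF p(1) J(1)[OF u] this pu] have up: "rect u \<subseteq> rect p" .
    have "rect p \<inter> col \<noteq> {}" using p(4) subsetD[OF J(4)[OF u] z] by (meson disjoint_iff)
    then have pc: "rect p \<subseteq> col" by (rule rect_subset_col[OF p(1,3)])
    have "\<not> t < stop p"
    proof -
      have "\<forall>v. valid v \<longrightarrow> k \<le> fst v \<longrightarrow> fst v < fst u \<longrightarrow> rect u \<subseteq> rect v \<longrightarrow> \<not> (rect v \<subseteq> col \<and> t < stop v)"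
        using u unfolding J_def top_rects_def mem_Collect_eq by (elim conjE)
      moreover have "fst p < fst u" using p(2) by linarith
      ultimately show ?thesis using p(1,3) up pc by blast
    qed
    have uz: "u = idx (fst p + 1) z" using rect_eq_idx[OF J(1)[OF u] z] p(2) by simp
    have "rmeas p \<le> cd * rmeas u" 
    proof -
      have "idx (fst p) z = p" unfolding p_def by simp
      then show ?thesis using rmeas_child[of "fst p" z] unfolding uz[symmetric] by simp
    qed
    moreover have "ennreal (av \<sigma> u * rmeas u) \<le> ennreal (av \<sigma> p * rmeas p)"
      unfolding integral_av[OF J(1)[OF u] \<sigma>_fin[OF J(1)[OF u]], symmetric]
        integral_av[OF p(1) \<sigma>_fin[OF p(1)], symmetric]
      by (rule nn_integral_mono) (use up in \<open>auto split: split_indicator\<close>)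
    then have "av \<sigma> u * rmeas u \<le> av \<sigma> p * rmeas p"
      using av_nonneg[OF p(1)] rmeas_pos[OF p(1)] by (simp add: ennreal_le_iff)
    ultimately have "av \<sigma> u * rmeas u \<le> av \<sigma> p * (cd * rmeas u)"
      using av_nonneg[OF p(1), of \<sigma>] by (meson mult_left_mono order_trans)
    then have avu: "av \<sigma> u \<le> cd * av \<sigma> p" using rmeas_pos[OF J(1)[OF u]] by (simp add: mult_ac)
    have "rheight u \<le> rheight p"
    proof -
      obtain g \<gamma> j where f: "u = (g, \<gamma>, j)" by (cases u)
      obtain g' \<gamma>' j' where f': "p = (g', \<gamma>', j')" by (cases p)
      have "{of_int j * side g ..< of_int (j + 1) * side g} \<subseteq> {of_int j' * side g' ..< of_int (j' + 1) * side g'}"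
      proof
        fix s assume s: "s \<in> {of_int j * side g ..< of_int (j + 1) * side g}"
        have "(fst z, s) \<in> rect u" using z s unfolding f rect.simps mem_Times_iff by simp
        then have "(fst z, s) \<in> rect p" using up by blast
        then show "s \<in> {of_int j' * side g' ..< of_int (j' + 1) * side g'}" unfolding f' rect.simps by simp
      qed
      then have "of_int (j + 1) * side g \<le> of_int (j' + 1) * side g'"
        by (rule Ico_subset_Ico_D[THEN conjunct2]) simp
      then show ?thesis unfolding rheight_def f f' by (intro divide_right_mono) (auto simp: less_imp_le)
    qed
    then have "stop u \<le> (cd * av \<sigma> p) * rheight p ^ gdim"
      unfolding stop_def using avu rheight_bounds[OF J(1,4)[OF u]] av_nonneg[OF p(1), of \<sigma>] cd_pos
      by (intro mult_mono power_mono) auto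
    also have "\<dots> = cd * stop p" by (simp add: stop_def)
    also have "\<dots> \<le> cd * t" using \<open>\<not> t < stop p\<close> cd_pos by simp
    finally show ?thesis .
  qed
  have half: "ennreal (1 / 2) * emeasure lam (rect (time_shift (-2) u)) \<le> (\<integral>\<^sup>+z\<in>rect (time_shift (-2) u). indicator H z \<partial>lam)"
    if u: "u \<in> J" for u
  proof -
    have v: "valid (time_shift (-2) u)" using J(1)[OF u] by simp
    note [measurable] = rect_sets[OF v]
    have sub: "rect (time_shift (-2) u) \<inter> {z. med * av \<sigma> u < cavg n \<sigma> z} \<subseteq> rect (time_shift (-2) u) \<inter> H"
    proof safe
      fix x s assume z: "(x, s) \<in> rect (time_shift (-2) u)" and c: "med * av \<sigma> u < cavg n \<sigma> (x, s)"
      obtain g \<gamma> j where f: "u = (g, \<gamma>, j)" by (cases u)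
      note b = subset_col_bounds[OF J(1,4)[OF u, unfolded f]]
      have s: "x \<in> Q g \<gamma>" "of_int (j - 2) * side g \<le> s" "s < of_int (j - 2 + 1) * side g"
        using z unfolding f by (auto simp: rect.simps)
      have rk: "rheight u * side k = of_int (j + 1) * side g - base" using side_pos[of k] by (simp add: rheight_def f)
      have farg: "6 * side g < of_int (j + 1) * side g - base" using far(2)[OF u] rk f by simp
      have "of_int (j - 2) * side g = of_int (j + 1) * side g - 3 * side g" by (simp add: algebra_simps)
      \<comment> \<open>Points of the translate lie at most three sides below the top edge of
        \<open>u\<close>, which is less than half of its height.\<close>
      then have low: "rheight u * side k / 2 \<le> s - base" using s(2) farg rk by simp
      have "s < of_int (i + m + 1) * side k"
      proof -
        have "of_int (j - 2 + 1) * side g \<le> of_int (j + 1) * side g" by (intro mult_right_mono) (auto simp: less_imp_le)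
        then show ?thesis using s(3) b(3) by linarith
      qed
      moreover have "base \<le> s" using low rheight_bounds[OF J(1,4)[OF u]] by (smt (verit) divide_nonneg_pos mult_pos_pos side_pos)
      ultimately have zc: "(x, s) \<in> col" using b(1) s(1) by (auto simp: col_def)
      have hz: "rheight u / 2 \<le> height (x, s)"
        using low by (simp add: height_def pos_le_divide_eq)
      have "gehring_fraction * t < gehring_fraction * stop u"
        using J(5)[OF u] gehring_fraction by simp
      also have "\<dots> = min med 1 * av \<sigma> u * (rheight u / 2) ^ gdim"
        by (simp add: gehring_fraction_def stop_def power_divide)
      also have "\<dots> \<le> cavg n \<sigma> (x, s) * height (x, s) ^ gdim"
      proof (intro mult_mono power_mono hz)
        have "min med 1 * av \<sigma> u \<le> med * av \<sigma> u" using av_nonneg[OF J(1)[OF u]] by (intro mult_right_mono) auto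
        then show "min med 1 * av \<sigma> u \<le> cavg n \<sigma> (x, s)" using c by simp
      qed (use rheight_bounds[OF J(1,4)[OF u]] cavg_nonneg in auto)
      also have "\<dots> = \<phi> (x, s)" using zc by (simp add: \<phi>_def)
      finally show "(x, s) \<in> H" by (simp add: H_def)
    qed
    have "ennreal (1 / 2) * emeasure lam (rect (time_shift (-2) u))
        \<le> emeasure lam (rect (time_shift (-2) u) \<inter> {z. med * av \<sigma> u < cavg n \<sigma> z})"
      by (rule past_median[OF J(1,3)[OF u]])
    also have "\<dots> \<le> emeasure lam (rect (time_shift (-2) u) \<inter> H)" using sub by (intro emeasure_mono) auto
    also have "\<dots> = (\<integral>\<^sup>+z\<in>rect (time_shift (-2) u). indicator H z \<partial>lam)"
    proof -
      have "emeasure lam (rect (time_shift (-2) u) \<inter> H) = (\<integral>\<^sup>+z. indicator (rect (time_shift (-2) u) \<inter> H) z \<partial>lam)"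
        by (rule nn_integral_indicator[symmetric]) measurable
      also have "\<dots> = (\<integral>\<^sup>+z\<in>rect (time_shift (-2) u). indicator H z \<partial>lam)"
        by (rule nn_integral_cong) (simp split: split_indicator)
      finally show ?thesis .
    qed
    finally show ?thesis .
  qed
  have em: "emeasure lam (rect (time_shift (-2) u)) = emeasure lam (rect u)" if "u \<in> J" for u
    using J(1)[OF that] by (simp add: emeasure_rect_rmeas)
  have Jc: "countable J" unfolding J_def by (rule countable_top_rects)
  have ind: "(indicator H :: _ \<Rightarrow> ennreal) \<in> borel_measurable lam" by simp
  have A: "rect u \<in> sets lam" and B: "rect (time_shift (-2) u) \<in> sets lam"
    and fin: "emeasure lam (rect u) < \<infinity>" if "u \<in> J" for u
    using J(1)[OF that] by (simp_all add: rect_sets emeasure_rect_rmeas)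
  have disj: "disjoint_family_on rect J" unfolding J_def by (rule top_rects_disjoint)
  have laminar: "rect (time_shift (-2) u) \<subseteq> rect (time_shift (-2) v) \<or> rect (time_shift (-2) v) \<subseteq> rect (time_shift (-2) u)
      \<or> rect (time_shift (-2) u) \<inter> rect (time_shift (-2) v) = {}" if "u \<in> J" "v \<in> J" for u v
    using J(1)[OF that(1)] J(1)[OF that(2)] by (intro rect_laminar) simp_all
  have band: "\<exists>D\<in>sets lam. (\<Union>w\<in>{w\<in>J. rect (time_shift (-2) w) \<subseteq> rect (time_shift (-2) u)}. rect w) \<subseteq> D \<and>
      emeasure lam D \<le> ennreal 5 * emeasure lam (rect u)" if u: "u \<in> J" for u
  proof -
    obtain D where D: "D \<in> sets lam"
      "(\<Union>w\<in>{w. valid w \<and> rect (time_shift (-2) w) \<subseteq> rect (time_shift (-2) u)}. rect w) \<subseteq> D"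
      "emeasure lam D \<le> ennreal (2 * \<bar>of_int (-2)\<bar> + 1) * emeasure lam (rect u)"
      using time_shift_band[OF J(1)[OF u], of "-2"] by blast
    have "{w\<in>J. rect (time_shift (-2) w) \<subseteq> rect (time_shift (-2) u)}
        \<subseteq> {w. valid w \<and> rect (time_shift (-2) w) \<subseteq> rect (time_shift (-2) u)}"
      using J(1) by blast
    then have "(\<Union>w\<in>{w\<in>J. rect (time_shift (-2) w) \<subseteq> rect (time_shift (-2) u)}. rect w) \<subseteq> D"
      by (rule order_trans[OF UN_mono D(2)]) simp
    then show ?thesis using D(1,3) by (intro bexI[of _ D]) simp_all
  qed
  have le1: "(\<integral>\<^sup>+z\<in>rect (time_shift (-2) u). indicator H z \<partial>lam) \<le> ennreal 1 * emeasure lam (rect (time_shift (-2) u))"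
    if "u \<in> J" for u
  proof -
    have "(\<integral>\<^sup>+z\<in>rect (time_shift (-2) u). indicator H z \<partial>lam) \<le> (\<integral>\<^sup>+z. indicator (rect (time_shift (-2) u)) z \<partial>lam)"
      by (rule nn_integral_mono) (simp split: split_indicator)
    then show ?thesis using B[OF that] by simp
  qed
  \<comment> \<open>The translates meet \<open>H\<close> in at least half (\<open>b\<close>) and at
    most all (\<open>a\<close>) of their measure, and the band for a shift by 2 has
    \<open>2 * 2 + 1 = 5\<close> sides (\<open>c\<close>); hence
    \<open>2 * a * c / b = 20\<close>.\<close>
  have num: "0 < (1 / 2 :: real)" "0 \<le> (1 :: real)" "0 \<le> (5 :: real)" "2 * 1 * 5 / (1 / 2) \<le> (20 :: real)" "0 < (20 :: real)"
    by simp_all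
  have eq: "emeasure lam (rect u) = emeasure lam (rect (time_shift (-2) u))" if "u \<in> J" for u
    using em[OF that] by simp
  obtain G where G: "\<And>u. u \<in> J \<Longrightarrow> G u \<in> sets lam" "\<And>u. u \<in> J \<Longrightarrow> G u \<subseteq> rect (time_shift (-2) u)"
    "\<And>u. u \<in> J \<Longrightarrow> (\<integral>\<^sup>+z\<in>rect (time_shift (-2) u). indicator H z \<partial>lam) \<le> 2 * (\<integral>\<^sup>+z\<in>G u. indicator H z \<partial>lam)"
    "\<And>h. h \<in> borel_measurable lam \<Longrightarrow>
      (\<integral>\<^sup>+u. (\<integral>\<^sup>+z\<in>G u. h z \<partial>lam) \<partial>count_space J) \<le> ennreal 20 * (\<integral>\<^sup>+z. h z \<partial>lam)"
  proof (rule laminar_bounded_overlap[where J = J and A = rect and B = "\<lambda>u. rect (time_shift (-2) u)"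
      and M = lam and f = "indicator H" and b = "1 / 2" and a = 1 and c = 5 and L = 20,
      OF Jc A B disj laminar eq fin band ind half le1 num])
    fix G assume G: "\<And>u. u \<in> J \<Longrightarrow> G u \<in> sets lam" "\<And>u. u \<in> J \<Longrightarrow> G u \<subseteq> rect (time_shift (-2) u)"
      "\<And>u. u \<in> J \<Longrightarrow> (\<integral>\<^sup>+z\<in>rect (time_shift (-2) u). indicator H z \<partial>lam) \<le> 2 * (\<integral>\<^sup>+z\<in>G u. indicator H z \<partial>lam)"
      "\<And>h. h \<in> borel_measurable lam \<Longrightarrow>
        (\<integral>\<^sup>+u. (\<integral>\<^sup>+z\<in>G u. h z \<partial>lam) \<partial>count_space J) \<le> ennreal 20 * (\<integral>\<^sup>+z. h z \<partial>lam)"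
    show thesis by (rule that[OF G])
  qed
  have sum_J: "(\<integral>\<^sup>+u. emeasure lam (rect u) \<partial>count_space J) \<le> ennreal 80 * emeasure lam H"
  proof -
    have each: "emeasure lam (rect u) \<le> 4 * (\<integral>\<^sup>+z\<in>G u. indicator H z \<partial>lam)" if u: "u \<in> J" for u
    proof -
      have "emeasure lam (rect u) = 2 * (ennreal (1 / 2) * emeasure lam (rect (time_shift (-2) u)))"
      proof -
        have "2 * (ennreal (1 / 2) * ennreal (rmeas u)) = ennreal 2 * ennreal (1 / 2 * rmeas u)"
          by (subst ennreal_mult') auto
        also have "\<dots> = ennreal (rmeas u)" by (subst ennreal_mult'[symmetric]) auto
        finally show ?thesis using em[OF u] emeasure_rect_rmeas[OF J(1)[OF u]] by simp
      qed
      also have "\<dots> \<le> 2 * (2 * (\<integral>\<^sup>+z\<in>G u. indicator H z \<partial>lam))"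
        using half[OF u] G(3)[OF u] by (intro mult_left_mono) auto
      finally show ?thesis by (simp add: mult.assoc[symmetric])
    qed
    have "(\<integral>\<^sup>+u. emeasure lam (rect u) \<partial>count_space J) \<le> (\<integral>\<^sup>+u. 4 * (\<integral>\<^sup>+z\<in>G u. indicator H z \<partial>lam) \<partial>count_space J)"
      using each by (intro nn_integral_mono) auto
    also have "\<dots> = 4 * (\<integral>\<^sup>+u. (\<integral>\<^sup>+z\<in>G u. indicator H z \<partial>lam) \<partial>count_space J)" by (simp add: nn_integral_cmult)
    also have "\<dots> \<le> 4 * (ennreal 20 * (\<integral>\<^sup>+z. indicator H z \<partial>lam))" by (intro mult_left_mono G(4) ind) auto
    also have "\<dots> = ennreal 80 * emeasure lam H"
      by (simp add: mult.assoc[symmetric])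
    finally show ?thesis .
  qed
  have "(\<integral>\<^sup>+z. ennreal (\<phi> z) * indicator {t<..} (\<phi> z) \<partial>lam)
      \<le> (\<integral>\<^sup>+z. \<integral>\<^sup>+u. ennreal (\<phi> z) * indicator (rect u) z \<partial>count_space J \<partial>lam)"
  proof (rule nn_integral_mono)
    fix z
    show "ennreal (\<phi> z) * indicator {t<..} (\<phi> z) \<le> (\<integral>\<^sup>+u. ennreal (\<phi> z) * indicator (rect u) z \<partial>count_space J)"
    proof (cases "t < \<phi> z")
      case True
      have zc: "z \<in> col" using True tpos by (auto simp: \<phi>_def split: split_indicator_asm)
      define c where "c = idx n z"
      have c: "valid c" "fst c = n" "z \<in> rect c" by (auto simp: c_def)
      have cc: "rect c \<subseteq> col" using c zc kn by (intro rect_subset_col) auto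
      \<comment> \<open>The value of \<open>\<phi>\<close> is controlled by its own cell of
        generation \<open>n\<close>, so the selection up to this generation covers the level set
        without an exceptional null set.\<close>
      have "\<phi> z \<le> stop c"
        using zc height_in_rect[OF c(1) cc c(3)] av_nonneg[OF c(1)] cavg_eq[OF c(1,3,2), of \<sigma>]
        by (auto simp: \<phi>_def stop_def intro!: mult_left_mono power_mono)
      then have "t < stop c" using True by simp
      then obtain u where u: "u \<in> J" "z \<in> rect u"
        using top_rects_cover[of k n n "\<lambda>u. rect u \<subseteq> col \<and> t < stop u" z] cc kn
        unfolding J_def c_def by blast
      have "ennreal (\<phi> z) * indicator {t<..} (\<phi> z) = (\<integral>\<^sup>+w. ennreal (\<phi> z) * indicator {u} w \<partial>count_space J)"
        using True u by (subst nn_integral_cmult_indicator) auto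
      also have "\<dots> \<le> (\<integral>\<^sup>+w. ennreal (\<phi> z) * indicator (rect w) z \<partial>count_space J)"
        using u by (intro nn_integral_mono) (auto split: split_indicator)
      finally show ?thesis .
    qed simp
  qed
  also have "\<dots> = (\<integral>\<^sup>+u. (\<integral>\<^sup>+z\<in>rect u. ennreal (\<phi> z) \<partial>lam) \<partial>count_space J)"
    using Jc J(1) rect_sets
    by (intro nn_integral_count_space_nn_integral borel_measurable_times_ennreal borel_measurable_indicator) auto
  also have "\<dots> \<le> (\<integral>\<^sup>+u. ennreal (cd * t) * emeasure lam (rect u) \<partial>count_space J)"
  proof (rule nn_integral_mono)
    fix u assume "u \<in> space (count_space J)"
    then have u: "u \<in> J" by simp
    note [measurable] = rect_sets[OF J(1)[OF u]]
    have "(\<integral>\<^sup>+z\<in>rect u. ennreal (\<phi> z) \<partial>lam) \<le> (\<integral>\<^sup>+z. ennreal (rheight u ^ gdim) * (ennreal (cavg n \<sigma> z) * indicator (rect u) z) \<partial>lam)"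
    proof (rule nn_integral_mono)
      fix z
      show "ennreal (\<phi> z) * indicator (rect u) z \<le> ennreal (rheight u ^ gdim) * (ennreal (cavg n \<sigma> z) * indicator (rect u) z)"
      proof (cases "z \<in> rect u")
        case True
        have zc: "z \<in> col" using True J(4)[OF u] by (rule subsetD[rotated])
        have "\<phi> z \<le> rheight u ^ gdim * cavg n \<sigma> z"
        proof -
          have "\<phi> z = height z ^ gdim * cavg n \<sigma> z" using zc by (simp add: \<phi>_def)
          also have "\<dots> \<le> rheight u ^ gdim * cavg n \<sigma> z"
            using height_in_rect[OF J(1,4)[OF u] True] cavg_nonneg[of n \<sigma> z] by (intro mult_right_mono power_mono) auto
          finally show ?thesis .
        qed
        then have "ennreal (\<phi> z) \<le> ennreal (rheight u ^ gdim) * ennreal (cavg n \<sigma> z)"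
          using rheight_bounds[OF J(1,4)[OF u]] by (subst ennreal_mult'[symmetric]) (auto intro: ennreal_leI)
        then show ?thesis using True by simp
      qed simp
    qed
    also have "\<dots> = ennreal (rheight u ^ gdim) * (\<integral>\<^sup>+z\<in>rect u. ennreal (cavg n \<sigma> z) \<partial>lam)"
      by (rule nn_integral_cmult) measurable
    also have "(\<integral>\<^sup>+z\<in>rect u. ennreal (cavg n \<sigma> z) \<partial>lam) = ennreal (av \<sigma> u * rmeas u)"
      using nn_integral_cavg_rect[OF \<sigma>_meas J(1,3)[OF u] \<sigma>_fin] integral_av[OF J(1)[OF u] \<sigma>_fin[OF J(1)[OF u]]] by simp
    also have "ennreal (rheight u ^ gdim) * ennreal (av \<sigma> u * rmeas u) = ennreal (stop u * rmeas u)"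
      using rheight_bounds[OF J(1,4)[OF u]] by (subst ennreal_mult'[symmetric]) (auto simp: stop_def mult_ac)
    also have "\<dots> \<le> ennreal (cd * t * rmeas u)"
      using upper[OF u] rmeas_pos[OF J(1)[OF u]] by (intro ennreal_leI mult_right_mono) auto
    also have "\<dots> = ennreal (cd * t) * emeasure lam (rect u)"
      using cd_pos tpos by (subst ennreal_mult') (auto simp: emeasure_rect_rmeas[OF J(1)[OF u]])
    finally show "(\<integral>\<^sup>+z\<in>rect u. ennreal (\<phi> z) \<partial>lam) \<le> ennreal (cd * t) * emeasure lam (rect u)" .
  qed
  also have "\<dots> = ennreal (cd * t) * (\<integral>\<^sup>+u. emeasure lam (rect u) \<partial>count_space J)" by (simp add: nn_integral_cmult)
  also have "\<dots> \<le> ennreal (cd * t) * (ennreal 80 * emeasure lam H)" using sum_J by (intro mult_left_mono) auto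
  also have "\<dots> = ennreal (80 * cd * t) * emeasure lam H"
  proof -
    have "ennreal (80 * cd * t) = ennreal (cd * t) * ennreal 80"
      using cd_pos tpos by (subst ennreal_mult[symmetric]) (auto simp: mult_ac)
    then show ?thesis by (simp only: mult.assoc)
  qed
  finally show ?thesis by (simp only: H_def)
qed

end

section \<open>Elementary sums of powers\<close>

lemma sum_powr_le:
  fixes a :: "'b \<Rightarrow> real"
  assumes S: "finite S" and a: "\<And>s. s \<in> S \<Longrightarrow> 0 \<le> a s" and p: "0 < p"
  shows "(\<Sum>s\<in>S. a s) powr p \<le> real (card S) powr p * (\<Sum>s\<in>S. a s powr p)"
proof (cases "S = {}")
  case False
  define M where "M = Max (a ` S)"
  have "M \<in> a ` S" unfolding M_def using S False by (intro Max_in) auto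
  then obtain s where s: "s \<in> S" "M = a s" by auto
  have "a x \<le> M" if "x \<in> S" for x unfolding M_def using S that by (intro Max_ge) auto
  then have "(\<Sum>s\<in>S. a s) \<le> real (card S) * M" using sum_bounded_above[of S a M] by simp
  then have "(\<Sum>s\<in>S. a s) powr p \<le> (real (card S) * M) powr p"
    using a p by (intro powr_mono2) (auto intro: sum_nonneg)
  also have "\<dots> = real (card S) powr p * a s powr p" using a s by (simp add: powr_mult)
  also have "\<dots> \<le> real (card S) powr p * (\<Sum>s\<in>S. a s powr p)"
    using S s by (intro mult_left_mono member_le_sum) auto
  finally show ?thesis .
qed (use p in simp)

text \<open>The sum extends over all powers of two below \<open>y\<close>, arbitrarily small ones
  included; downwards from the largest it is geometric with ratio \<open>2 powr (- p)\<close>, which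
  is less than 1 because \<open>0 < p\<close>.\<close>

lemma geometric_int_sum_le:
  fixes y p :: real
  assumes y: "0 \<le> y" and p: "0 < p"
  shows "(\<integral>\<^sup>+i. ennreal ((2 powr of_int i) powr p) * indicator {..<y} (2 powr of_int i) \<partial>count_space (UNIV :: int set))
    \<le> ennreal (1 / (1 - 2 powr (- p)) * y powr p)"
proof (cases "y = 0")
  case True
  have "(\<integral>\<^sup>+i. ennreal ((2 powr of_int i) powr p) * indicator {..<y} (2 powr of_int i) \<partial>count_space (UNIV :: int set))
      = (\<integral>\<^sup>+i. 0 \<partial>count_space (UNIV :: int set))"
    using True by (intro nn_integral_cong) (auto simp: not_less split: split_indicator)
  then show ?thesis by simp
next
  case False
  then have y0: "0 < y" using y by simp
  \<comment> \<open>The largest integer strictly below \<open>log 2 y\<close>; the ceiling minus 1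
    differs from the floor exactly when \<open>y\<close> is a power of two.\<close>
  define m :: int where "m = \<lceil>log 2 y\<rceil> - 1"
  have iff: "2 powr of_int i < y \<longleftrightarrow> i \<le> m" for i :: int
  proof -
    have "2 powr of_int i < y \<longleftrightarrow> real_of_int i < log 2 y" using y0 by (simp add: less_log_iff)
    also have "\<dots> \<longleftrightarrow> i \<le> m" unfolding m_def by linarith
    finally show ?thesis .
  qed
  have bij: "bij_betw (\<lambda>j::nat. m - int j) UNIV {..m}"
    by (rule bij_betwI[where g = "\<lambda>i. nat (m - i)"]) auto
  have r: "(2 powr of_int (m - int j)) powr p = (2 powr of_int m) powr p * (2 powr (- p)) ^ j" for j :: nat
  proof -
    have "(2 powr (- p)) ^ j = 2 powr (- p * real j)" by (simp add: powr_powr powr_realpow[symmetric])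
    then show ?thesis by (simp add: powr_powr powr_add[symmetric] algebra_simps)
  qed
  have lt1: "2 powr (- p) < 1" using p powr_less_mono[of "- p" 0 2] by simp
  have "(\<integral>\<^sup>+i. ennreal ((2 powr of_int i) powr p) * indicator {..<y} (2 powr of_int i) \<partial>count_space (UNIV :: int set))
      = (\<integral>\<^sup>+i. ennreal ((2 powr of_int i) powr p) * indicator {..m} i \<partial>count_space (UNIV :: int set))"
    using iff by (intro nn_integral_cong) (auto split: split_indicator)
  also have "\<dots> = (\<integral>\<^sup>+i. ennreal ((2 powr of_int i) powr p) \<partial>count_space {..m})"
    by (subst nn_integral_count_space_indicator) auto
  also have "\<dots> = (\<integral>\<^sup>+j. ennreal ((2 powr of_int (m - int j)) powr p) \<partial>count_space (UNIV :: nat set))"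
    by (subst nn_integral_bij_count_space[OF bij, symmetric]) simp
  also have "\<dots> = (\<Sum>j. ennreal ((2 powr of_int m) powr p * (2 powr (- p)) ^ j))"
    by (subst nn_integral_count_space_nat) (simp only: r)
  also have "\<dots> = ennreal ((2 powr of_int m) powr p * (1 / (1 - 2 powr (- p))))"
    using lt1 by (intro sums_unique[symmetric] sums_ennreal[THEN iffD2] sums_mult geometric_sums) auto
  also have "\<dots> \<le> ennreal (1 / (1 - 2 powr (- p)) * y powr p)"
  proof (rule ennreal_leI)
    have "(2 powr of_int m) powr p \<le> y powr p" using iff[of m] p by (intro powr_mono2) auto
    then show "(2 powr of_int m) powr p * (1 / (1 - 2 powr (- p))) \<le> 1 / (1 - 2 powr (- p)) * y powr p"
      using lt1 by (simp add: divide_right_mono)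
  qed
  finally show ?thesis .
qed

section \<open>The reverse Hoelder inequality and the improved condition\<close>

context weighted_dyadic_column begin

text \<open>On the topmost rectangle the height is at least 1, so \<open>\<phi>\<close> dominates
  the cell averages there, while it is at most \<open>M\<close> times them everywhere. Gehring's
  lemma thus bounds a higher power on the top by the mean over the entire column, which replaces the
  doubling of a classical reverse Hoelder inequality. One factor \<open>M\<close> comes from
  \<open>t0\<close> and one from the bound on \<open>\<phi>\<close>.\<close>

lemma reverse_Holder:
  assumes \<eta>: "0 < \<eta>" "\<eta> \<le> 1" and small: "(2 powr \<eta> - 1) * (80 * cd) * 2 / gehring_fraction\<^sup>2 \<le> 1 / 2"
  shows "(\<integral>\<^sup>+z\<in>rect (k, \<alpha>, i + m). ennreal (cavg n \<sigma> z powr (1 + \<eta>)) \<partial>lam)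
    \<le> ennreal (2 * (of_int (m + 6) ^ gdim)\<^sup>2 * (P0 * (smass / P0) powr (1 + \<eta>)))"
proof -
  have sp: "space lam = UNIV" by (rule space_parabolic[OF space_mu])
  define M where "M = (of_int (m + 6) :: real) ^ gdim"
  have M1: "1 \<le> M" using m by (simp add: M_def)
  have Mm: "of_int (m - 1) ^ gdim \<le> M" unfolding M_def using m by (intro power_mono) auto
  have \<phi>_le: "\<phi> z \<le> M * (cavg n \<sigma> z * indicator col z)" for z
  proof (cases "z \<in> col")
    case True
    have "height z ^ gdim \<le> M"
      using power_mono[of "height z" "of_int (m - 1)" gdim] height_col[OF True] Mm by linarith
    then show ?thesis using True cavg_nonneg[of n \<sigma> z] by (simp add: \<phi>_def mult.commute[of M] mult_left_mono)
  qed (simp add: \<phi>_def)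
  have fin: "(\<integral>\<^sup>+z. ennreal (\<phi> z powr (1 + \<eta>)) \<partial>lam) < \<infinity>"
  proof -
    \<comment> \<open>Cell averages of a fixed generation are bounded on the column. The bound
      depends on \<open>n\<close>, but only the finiteness that it yields is used.\<close>
    define B where "B = M * (cd ^ nat (n - k) * (smass / P0))"
    have "(\<integral>\<^sup>+z. ennreal (\<phi> z powr (1 + \<eta>)) \<partial>lam) \<le> (\<integral>\<^sup>+z. ennreal (B powr (1 + \<eta>)) * indicator col z \<partial>lam)"
    proof (rule nn_integral_mono)
      fix z
      show "ennreal (\<phi> z powr (1 + \<eta>)) \<le> ennreal (B powr (1 + \<eta>)) * indicator col z"
      proof (cases "z \<in> col")
        case True
        have "rect (idx n z) \<inter> col \<noteq> {}" using True mem_rect_idx[of z n] by (meson disjoint_iff)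
        then have c: "rect (idx n z) \<subseteq> col" using kn by (intro rect_subset_col) simp_all
        have "cavg n \<sigma> z \<le> cd ^ nat (n - k) * (smass / P0)"
          using av_in_col[OF _ _ c] kn by (simp add: cavg_def)
        then have "\<phi> z \<le> B"
          using \<phi>_le[of z] True M1 unfolding B_def by (smt (verit) indicator_simps(1) mult_left_mono mult_cancel_left2)
        then have "\<phi> z powr (1 + \<eta>) \<le> B powr (1 + \<eta>)" using \<phi>_nonneg \<eta> by (intro powr_mono2) auto
        then show ?thesis using True by (simp add: ennreal_leI)
      qed (use \<eta> in \<open>simp add: \<phi>_def\<close>)
    qed
    also have "\<dots> = ennreal (B powr (1 + \<eta>)) * emeasure lam col" by (simp add: nn_integral_cmult_indicator)
    also have "\<dots> < \<infinity>"
    proof -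
      have "base \<le> of_int (i + m + 1) * side k" unfolding base_def using m by (intro mult_right_mono) auto
      then show ?thesis using emeasure_box[OF \<alpha>, of base] unfolding col_def
        by (simp add: ennreal_mult_less_top)
    qed
    finally show ?thesis .
  qed
  have rm: "rmeas (k, \<alpha>, i + m) = P0" using \<alpha> by (simp add: P0_def rmeas_eq)
  have "(\<integral>\<^sup>+z\<in>rect (k, \<alpha>, i + m). ennreal (cavg n \<sigma> z powr (1 + \<eta>)) \<partial>lam) \<le> (\<integral>\<^sup>+z. ennreal (\<phi> z powr (1 + \<eta>)) \<partial>lam)"
  proof (rule nn_integral_mono)
    fix z
    show "ennreal (cavg n \<sigma> z powr (1 + \<eta>)) * indicator (rect (k, \<alpha>, i + m)) z \<le> ennreal (\<phi> z powr (1 + \<eta>))"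
    proof (cases "z \<in> rect (k, \<alpha>, i + m)")
      case True
      have zc: "z \<in> col" using True rect_shift_subset_col[of m] m by auto
      have "of_int (i + m) * side k \<le> snd z" using True by (auto simp: rect.simps)
      moreover have "base + 1 * side k \<le> of_int (i + m) * side k"
        unfolding base_def distrib_right[symmetric] using m by (intro mult_right_mono) auto
      ultimately have "1 \<le> height z" by (simp add: height_def pos_le_divide_eq)
      then have "cavg n \<sigma> z * 1 \<le> \<phi> z"
        using zc cavg_nonneg[of n \<sigma> z] by (simp add: \<phi>_def mult_le_cancel_left1)
      then have "cavg n \<sigma> z powr (1 + \<eta>) \<le> \<phi> z powr (1 + \<eta>)"
        using cavg_nonneg[of n \<sigma> z] \<eta> by (intro powr_mono2) auto
      then show ?thesis using True by (simp add: ennreal_leI)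
    qed simp
  qed
  also have "\<dots> \<le> ennreal (2 * t0 powr \<eta>) * (\<integral>\<^sup>+z. ennreal (\<phi> z) \<partial>lam)"
  proof (rule Gehring_self_improvement[OF sp \<phi>_measurable \<phi>_nonneg fin level_bound t0_pos gehring_fraction _ \<eta> small])
    show "0 \<le> 80 * cd" using cd_pos by simp
  qed
  also have "\<dots> \<le> ennreal (2 * t0 powr \<eta>) * ennreal (M * smass)"
  proof (rule mult_left_mono)
    have "(\<integral>\<^sup>+z. ennreal (\<phi> z) \<partial>lam) \<le> (\<integral>\<^sup>+z. ennreal M * (ennreal (cavg n \<sigma> z) * indicator col z) \<partial>lam)"
    proof (rule nn_integral_mono)
      fix z
      have "ennreal (\<phi> z) \<le> ennreal (M * (cavg n \<sigma> z * indicator col z))" by (rule ennreal_leI[OF \<phi>_le])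
      also have "\<dots> = ennreal M * (ennreal (cavg n \<sigma> z) * indicator col z)"
        using M1 by (auto simp: ennreal_mult' split: split_indicator)
      finally show "ennreal (\<phi> z) \<le> ennreal M * (ennreal (cavg n \<sigma> z) * indicator col z)" .
    qed
    also have "\<dots> = ennreal M * (\<integral>\<^sup>+z\<in>col. ennreal (cavg n \<sigma> z) \<partial>lam)"
      by (rule nn_integral_cmult) measurable
    also have "\<dots> \<le> ennreal M * ennreal smass" using nn_integral_cavg_col by (rule mult_left_mono) simp
    also have "\<dots> = ennreal (M * smass)" using M1 by (simp add: ennreal_mult')
    finally show "(\<integral>\<^sup>+z. ennreal (\<phi> z) \<partial>lam) \<le> ennreal (M * smass)" .
  qed simp
  also have "\<dots> = ennreal (2 * t0 powr \<eta> * (M * smass))" by (rule ennreal_mult'[symmetric]) simp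
  also have "\<dots> \<le> ennreal (2 * M\<^sup>2 * (P0 * (smass / P0) powr (1 + \<eta>)))"
  proof (rule ennreal_leI)
    have "M powr \<eta> \<le> M powr 1" using M1 \<eta> by (intro powr_mono) auto
    then have "t0 powr \<eta> \<le> M * (smass / P0) powr \<eta>"
      using M1 smass_pos P0_pos unfolding t0_def M_def[symmetric] by (subst powr_mult) (auto intro!: mult_right_mono)
    then have "2 * t0 powr \<eta> * (M * smass) \<le> 2 * (M * (smass / P0) powr \<eta>) * (M * smass)"
      using M1 smass_pos by (intro mult_right_mono mult_left_mono) auto
    also have "\<dots> = 2 * M\<^sup>2 * (P0 * ((smass / P0) powr \<eta> * (smass / P0)))"
      using P0_pos by (simp add: power2_eq_square)
    also have "(smass / P0) powr \<eta> * (smass / P0) = (smass / P0) powr (1 + \<eta>)"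
      using smass_pos P0_pos by (simp add: powr_add mult.commute)
    finally show "2 * t0 powr \<eta> * (M * smass) \<le> 2 * M\<^sup>2 * (P0 * (smass / P0) powr (1 + \<eta>))" .
  qed
  finally show ?thesis by (simp only: M_def)
qed

end

context weighted_dyadic_grid begin

text \<open>The constants do not depend on the generation \<open>n\<close> at which the dual weight is averaged. Letting
  \<open>n\<close> tend to infinity at the end replaces a differentiation theorem.\<close>

lemma improved_Aq:
  assumes m: "3 \<le> m"
  obtains \<eta> C where "0 < \<eta>" "\<eta> \<le> 1" "0 < C"
    "\<And>n v. valid v \<Longrightarrow> fst v \<le> n \<Longrightarrow>
      (\<integral>\<^sup>+z\<in>rect (time_shift m v). ennreal (cavg n \<sigma> z powr (1 + \<eta>)) \<partial>lam) < \<infinity>"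
    "\<And>n v. valid v \<Longrightarrow> fst v \<le> n \<Longrightarrow>
      av \<omega> v * av (\<lambda>z. cavg n \<sigma> z powr (1 + \<eta>)) (time_shift m v) powr ((q - 1) / (1 + \<eta>)) \<le> C"
proof -
  obtain \<eta> where \<eta>: "0 < \<eta>" "\<eta> \<le> 1" "(2 powr \<eta> - 1) * (80 * cd * 2 / gehring_fraction\<^sup>2) \<le> 1 / 2"
    using exists_small_exponent[of "80 * cd * 2 / gehring_fraction\<^sup>2"] cd_pos by auto
  have "\<forall>s\<in>{2..m}. \<exists>C. \<forall>u. valid u \<longrightarrow> av \<omega> u * av \<sigma> (time_shift s u) powr (q - 1) \<le> C"
    using Aq by auto
  then obtain Cs where Cs: "\<And>s u. s \<in> {2..m} \<Longrightarrow> valid u \<Longrightarrow> av \<omega> u * av \<sigma> (time_shift s u) powr (q - 1) \<le> Cs s"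
    by metis
  define M where "M = 2 * ((of_int (m + 6) :: real) ^ gdim)\<^sup>2"
  have M1: "1 \<le> M"
  proof -
    have "1 \<le> (of_int (m + 6) :: real) ^ gdim" using m by simp
    then have "1 \<le> ((of_int (m + 6) :: real) ^ gdim)\<^sup>2" by (rule one_le_power)
    then show ?thesis by (simp add: M_def)
  qed
  define K where "K = M powr ((q - 1) / (1 + \<eta>)) * (real (card {2..m}) powr (q - 1) * (\<Sum>s\<in>{2..m}. Cs s))"
  have key: "(\<integral>\<^sup>+z\<in>rect (time_shift m v). ennreal (cavg n \<sigma> z powr (1 + \<eta>)) \<partial>lam) < \<infinity> \<and>
      av \<omega> v * av (\<lambda>z. cavg n \<sigma> z powr (1 + \<eta>)) (time_shift m v) powr ((q - 1) / (1 + \<eta>)) \<le> K"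
    if v: "valid v" "fst v \<le> n" for n v
  proof -
    obtain k \<alpha> i where f: "v = (k, \<alpha>, i)" by (cases v)
    interpret weighted_dyadic_column \<mu> I Q e cd \<omega> \<sigma> q n k i m \<alpha>
      by unfold_locales (use v m f in auto)
    let ?X = "\<integral>\<^sup>+z\<in>rect (time_shift m v). ennreal (cavg n \<sigma> z powr (1 + \<eta>)) \<partial>lam"
    have X: "?X \<le> ennreal (M * (P0 * (smass / P0) powr (1 + \<eta>)))"
      using reverse_Holder[OF \<eta>(1,2)] \<eta>(3) by (simp add: f M_def mult.assoc)
    have fin: "?X < \<infinity>" by (rule le_less_trans[OF X]) simp
    have "enn2real ?X \<le> M * (P0 * (smass / P0) powr (1 + \<eta>))"
      using X M1 P0_pos by (intro enn2real_leI) auto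
    then have avX: "av (\<lambda>z. cavg n \<sigma> z powr (1 + \<eta>)) (time_shift m v) \<le> M * (smass / P0) powr (1 + \<eta>)"
      using P0_pos v unfolding av_def rmeas_time_shift[OF v(1)] unfolding f P0_def[symmetric]
      by (simp add: pos_divide_le_eq mult_ac)
    have sm: "smass / P0 = (\<Sum>s\<in>{2..m}. av \<sigma> (time_shift s v))"
      using P0_pos by (simp add: smass_def f)
    have "av (\<lambda>z. cavg n \<sigma> z powr (1 + \<eta>)) (time_shift m v) powr ((q - 1) / (1 + \<eta>))
        \<le> (M * (smass / P0) powr (1 + \<eta>)) powr ((q - 1) / (1 + \<eta>))"
      using avX v q \<eta> by (intro powr_mono2 av_nonneg) auto
    \<comment> \<open>The exponents cancel and leave the power \<open>q - 1\<close> of a sum of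
      averages of \<open>\<sigma>\<close> over the translates by 2 up to \<open>m\<close> steps,
      each of which is covered by the original condition.\<close>
    also have "\<dots> = M powr ((q - 1) / (1 + \<eta>)) * (smass / P0) powr (q - 1)"
      using M1 \<eta> by (simp add: powr_mult powr_powr)
    also have "\<dots> \<le> M powr ((q - 1) / (1 + \<eta>)) *
        (real (card {2..m}) powr (q - 1) * (\<Sum>s\<in>{2..m}. av \<sigma> (time_shift s v) powr (q - 1)))"
      unfolding sm using v q by (intro mult_left_mono sum_powr_le av_nonneg) auto
    finally have "av \<omega> v * av (\<lambda>z. cavg n \<sigma> z powr (1 + \<eta>)) (time_shift m v) powr ((q - 1) / (1 + \<eta>))
        \<le> av \<omega> v * (M powr ((q - 1) / (1 + \<eta>)) *
        (real (card {2..m}) powr (q - 1) * (\<Sum>s\<in>{2..m}. av \<sigma> (time_shift s v) powr (q - 1))))"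
      using v by (intro mult_left_mono av_nonneg)
    also have "\<dots> = M powr ((q - 1) / (1 + \<eta>)) *
        (real (card {2..m}) powr (q - 1) * (\<Sum>s\<in>{2..m}. av \<omega> v * av \<sigma> (time_shift s v) powr (q - 1)))"
      by (simp add: sum_distrib_left mult_ac)
    also have "\<dots> \<le> K"
      unfolding K_def using Cs[OF _ v(1)] by (intro mult_left_mono sum_mono) auto
    finally show ?thesis using fin by blast
  qed
  have "0 < max K 1" by simp
  moreover have "av \<omega> v * av (\<lambda>z. cavg n \<sigma> z powr (1 + \<eta>)) (time_shift m v) powr ((q - 1) / (1 + \<eta>)) \<le> max K 1"
    if "valid v" "fst v \<le> n" for n v using key[OF that, THEN conjunct2] by (rule max.coboundedI1)
  ultimately show thesis using key \<eta>(1,2) that[of \<eta> "max K 1"] by blast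
qed

section \<open>The shifted dyadic maximal function\<close>

text \<open>Restricting the generations to a finite range makes the maximum attained and measurable;
  the estimates are uniform in \<open>a\<close> and \<open>n\<close>.\<close>

definition Tmax :: "int \<Rightarrow> int \<Rightarrow> int \<Rightarrow> ('a \<times> real \<Rightarrow> real) \<Rightarrow> 'a \<times> real \<Rightarrow> real" where
  "Tmax a n m f z = Max ((\<lambda>g. av f (time_shift m (idx g z))) ` {a..n})"

lemma Tmax_measurable [measurable]: "Tmax a n m f \<in> borel_measurable lam"
  unfolding Tmax_def[abs_def] by (intro borel_measurable_Max borel_measurable_idx) simp

lemma Tmax_ge: "a \<le> g \<Longrightarrow> g \<le> n \<Longrightarrow> av f (time_shift m (idx g z)) \<le> Tmax a n m f z"
  unfolding Tmax_def by (intro Max_ge) auto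

lemma Tmax_attained:
  assumes "a \<le> n" obtains g where "a \<le> g" "g \<le> n" "Tmax a n m f z = av f (time_shift m (idx g z))"
proof -
  have "Tmax a n m f z \<in> (\<lambda>g. av f (time_shift m (idx g z))) ` {a..n}"
    unfolding Tmax_def using assms by (intro Max_in) auto
  then show thesis using that by auto
qed

lemma Tmax_nonneg: assumes "a \<le> n" shows "0 \<le> Tmax a n m f z"
  using Tmax_attained[OF assms, of m f z] by (metis av_nonneg valid_idx valid_time_shift)

text \<open>Local integrability of the dual weight passes, by Hoelder's inequality, to all functions
  in the weighted space.\<close>

lemma weighted_L_local_integrable:
  assumes f: "f \<in> borel_measurable lam" "\<And>z. 0 \<le> f z" and fin: "(\<integral>\<^sup>+z. ennreal (f z powr q * \<omega> z) \<partial>lam) < \<infinity>"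
    and u: "valid u"
  shows "(\<integral>\<^sup>+z\<in>rect u. ennreal (f z) \<partial>lam) < \<infinity>"
    and "av f u powr q \<le> 2 powr q * av (\<lambda>z. f z powr q * \<omega> z) u * av \<sigma> u powr (q - 1)"
    and "(\<integral>\<^sup>+z\<in>rect u. ennreal (f z powr q * \<omega> z) \<partial>lam) < \<infinity>"
proof -
  have "(\<integral>\<^sup>+z\<in>rect u. ennreal (f z powr q * \<omega> z) \<partial>lam) \<le> (\<integral>\<^sup>+z. ennreal (f z powr q * \<omega> z) \<partial>lam)"
    by (rule nn_integral_mono) (simp split: split_indicator)
  then show A: "(\<integral>\<^sup>+z\<in>rect u. ennreal (f z powr q * \<omega> z) \<partial>lam) < \<infinity>" using fin by (rule le_less_trans)
  note H = weighted_Holder[OF q rect_sets[OF u] f(1) \<omega>_meas \<sigma>_meas f(2) \<omega>_pos \<sigma>_eq A \<sigma>_fin[OF u]]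
  show F: "(\<integral>\<^sup>+z\<in>rect u. ennreal (f z) \<partial>lam) < \<infinity>" by (rule H(1))
  let ?r = "rmeas u"
  have r: "0 < ?r" by (rule rmeas_pos[OF u])
  have e: "enn2real (\<integral>\<^sup>+z\<in>rect u. ennreal (h z) \<partial>lam) = av h u * ?r" for h
    using r by (simp add: av_def)
  have "(av f u * ?r) powr q \<le> 2 powr q * (av (\<lambda>z. f z powr q * \<omega> z) u * ?r) * (av \<sigma> u * ?r) powr (q - 1)"
    using H(2) unfolding e .
  also have "\<dots> = (?r * ?r powr (q - 1)) * (2 powr q * av (\<lambda>z. f z powr q * \<omega> z) u * av \<sigma> u powr (q - 1))"
    using r av_nonneg[OF u] by (simp add: powr_mult)
  also have "?r * ?r powr (q - 1) = ?r powr q" using r by (simp add: powr_diff)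
  finally have "?r powr q * av f u powr q \<le> ?r powr q * (2 powr q * av (\<lambda>z. f z powr q * \<omega> z) u * av \<sigma> u powr (q - 1))"
    using r av_nonneg[OF u] by (simp add: powr_mult mult.commute)
  then show "av f u powr q \<le> 2 powr q * av (\<lambda>z. f z powr q * \<omega> z) u * av \<sigma> u powr (q - 1)"
    using r by simp
qed

lemma cavg_\<sigma>_pos: "0 < cavg n \<sigma> z"
  by (simp add: cavg_def av_\<sigma>_pos)

text \<open>After discretisation the part of \<open>\<omega>\<close> is played by the power
  \<open>- (q - 1)\<close> of the averaged dual weight. Hoelder's inequality on each cell shows that
  the norm formed with it grows at most by a constant, so the level sets may be estimated with
  functions that are constant on cells.\<close>

lemma discretised_norm_le:
  assumes f: "f \<in> borel_measurable lam" "\<And>z. 0 \<le> f z" and fin: "(\<integral>\<^sup>+z. ennreal (f z powr q * \<omega> z) \<partial>lam) < \<infinity>"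
  shows "(\<integral>\<^sup>+z. ennreal (cavg n f z powr q * cavg n \<sigma> z powr (- (q - 1))) \<partial>lam)
    \<le> ennreal (2 powr q) * (\<integral>\<^sup>+z. ennreal (f z powr q * \<omega> z) \<partial>lam)"
proof -
  note [measurable] = f(1)
  have "(\<integral>\<^sup>+z. ennreal (cavg n f z powr q * cavg n \<sigma> z powr (- (q - 1))) \<partial>lam)
    \<le> (\<integral>\<^sup>+z. ennreal (2 powr q) * ennreal (f z powr q * \<omega> z) \<partial>lam)"
  proof (rule nn_integral_cells_mono[where n = n])
    fix u assume u: "valid u" "fst u = n"
    note [measurable] = rect_sets[OF u(1)]
    have "(\<integral>\<^sup>+z\<in>rect u. ennreal (cavg n f z powr q * cavg n \<sigma> z powr (- (q - 1))) \<partial>lam)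
        = (\<integral>\<^sup>+z\<in>rect u. ennreal (av f u powr q * av \<sigma> u powr (- (q - 1))) \<partial>lam)"
      by (rule nn_integral_cong) (simp add: cavg_eq[OF u(1) _ u(2)] split: split_indicator)
    also have "\<dots> = ennreal (av f u powr q * av \<sigma> u powr (- (q - 1)) * rmeas u)"
      by (rule nn_integral_rect_const[OF u(1)]) simp
    also have "\<dots> \<le> ennreal (2 powr q * (av (\<lambda>z. f z powr q * \<omega> z) u * rmeas u))"
    proof (rule ennreal_leI)
      have "av f u powr q * av \<sigma> u powr (- (q - 1))
          \<le> 2 powr q * av (\<lambda>z. f z powr q * \<omega> z) u * av \<sigma> u powr (q - 1) * av \<sigma> u powr (- (q - 1))"
        by (rule mult_right_mono[OF weighted_L_local_integrable(2)[OF f fin u(1)]]) simp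
      also have "\<dots> = 2 powr q * av (\<lambda>z. f z powr q * \<omega> z) u"
      proof -
        have "av \<sigma> u powr (q - 1) * av \<sigma> u powr (- (q - 1)) = 1"
          using av_\<sigma>_pos[OF u(1)] unfolding powr_add[symmetric] by simp
        then show ?thesis by (simp only: mult.assoc mult_1_right)
      qed
      finally show "av f u powr q * av \<sigma> u powr (- (q - 1)) * rmeas u \<le> 2 powr q * (av (\<lambda>z. f z powr q * \<omega> z) u * rmeas u)"
        using rmeas_pos[OF u(1)] by (simp add: mult.assoc[symmetric] mult_right_mono)
    qed
    also have "\<dots> = ennreal (2 powr q) * (\<integral>\<^sup>+z\<in>rect u. ennreal (f z powr q * \<omega> z) \<partial>lam)"
      unfolding integral_av[OF u(1) weighted_L_local_integrable(3)[OF f fin u(1)]] by (rule ennreal_mult') simp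
    also have "\<dots> = (\<integral>\<^sup>+z. ennreal (2 powr q) * (ennreal (f z powr q * \<omega> z) * indicator (rect u) z) \<partial>lam)"
      by (rule nn_integral_cmult[symmetric]) measurable
    finally show "(\<integral>\<^sup>+z\<in>rect u. ennreal (cavg n f z powr q * cavg n \<sigma> z powr (- (q - 1))) \<partial>lam)
        \<le> (\<integral>\<^sup>+z\<in>rect u. (ennreal (2 powr q) * ennreal (f z powr q * \<omega> z)) \<partial>lam)"
      by (simp only: mult.assoc)
  qed measurable
  also have "\<dots> = ennreal (2 powr q) * (\<integral>\<^sup>+z. ennreal (f z powr q * \<omega> z) \<partial>lam)"
    by (rule nn_integral_cmult) measurable
  finally show ?thesis .
qed

text \<open>An instance of \<open>laminar_level_estimate\<close> in which \<open>B\<close> consists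
  of the translates of the selected rectangles and the dual pair is
  \<open>v = cavg n \<sigma> z powr (- (q - 1))\<close> and
  \<open>s = cavg n \<sigma> z powr (1 + \<eta>)\<close>. The exponent \<open>r\<close> is
  determined by \<open>(q - 1) / (r - 1) = 1 + \<eta>\<close>. The cut at \<open>4 * t\<close>
  provides the upper bound for the averages, because every selected rectangle meets the level
  set.\<close>

lemma level_set_estimate:
  fixes f m n \<eta> C
  defines "r \<equiv> 1 + (q - 1) / (1 + \<eta>)"
  assumes \<eta>: "0 < \<eta>" and C: "0 < C"
    and fin: "\<And>v. valid v \<Longrightarrow> fst v \<le> n \<Longrightarrow>
      (\<integral>\<^sup>+z\<in>rect (time_shift m v). ennreal (cavg n \<sigma> z powr (1 + \<eta>)) \<partial>lam) < \<infinity>"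
    and bd: "\<And>v. valid v \<Longrightarrow> fst v \<le> n \<Longrightarrow>
      av \<omega> v * av (\<lambda>z. cavg n \<sigma> z powr (1 + \<eta>)) (time_shift m v) powr ((q - 1) / (1 + \<eta>)) \<le> C"
    and an: "a \<le> n" and f: "f \<in> borel_measurable lam" "\<And>z. 0 \<le> f z"
      "(\<integral>\<^sup>+z. ennreal (f z powr q * \<omega> z) \<partial>lam) < \<infinity>"
    and t: "0 < t"
  shows "ennreal (t powr r) * (\<integral>\<^sup>+z. ennreal (\<omega> z) * indicator {2 * t<..4 * t} (Tmax a n m f z) \<partial>lam)
    \<le> ennreal (4 powr r * C * (8 * (2 * \<bar>of_int m\<bar> + 1) + 1)) *
      (\<integral>\<^sup>+z. ennreal (cavg n f z powr r * cavg n \<sigma> z powr (- (q - 1))) * indicator {t<..} (cavg n f z) \<partial>lam)"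
proof -
  note [measurable] = f(1)
  have sp: "space lam = UNIV" by (rule space_parabolic[OF space_mu])
  define E where "E = {z. 2 * t < Tmax a n m f z \<and> Tmax a n m f z \<le> 4 * t}"
  define J where "J = top_rects a n (\<lambda>u. 2 * t < av f (time_shift m u) \<and> rect u \<inter> E \<noteq> {})"
  \<comment> \<open>Discarding the values up to \<open>t\<close> lowers an average by at most
    \<open>t\<close>, so averages above \<open>2 * t\<close> stay above \<open>t\<close>. In return
    only the set where \<open>cavg n f\<close> exceeds \<open>t\<close> enters the right-hand side,
    as the summation over levels requires.\<close>
  define g where "g z = cavg n f z * indicator {t<..} (cavg n f z)" for z
  define W where "W = density lam (\<lambda>z. ennreal (\<omega> z))"
  have W: "emeasure W A = (\<integral>\<^sup>+z\<in>A. ennreal (\<omega> z) \<partial>lam)" if "A \<in> sets lam" for A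
    unfolding W_def using that by (rule emeasure_density[rotated]) measurable
  have J: "valid u" "a \<le> fst u" "fst u \<le> n" "2 * t < av f (time_shift m u)" "rect u \<inter> E \<noteq> {}" if "u \<in> J" for u
    using that unfolding J_def top_rects_def by simp_all
  have sv: "valid (time_shift m u)" "fst (time_shift m u) \<le> n" if "u \<in> J" for u
    using J(1,3)[OF that] by simp_all
  have Jc: "countable J" unfolding J_def by (rule countable_top_rects)
  have r1: "1 < r" using q \<eta> by (simp add: r_def)
  have g0: "0 \<le> g z" for z using cavg_nonneg[of n f z] by (simp add: g_def)
  have gm [measurable]: "g \<in> borel_measurable lam" unfolding g_def[abs_def] by measurable
  have A: "rect u \<in> sets lam" and B: "rect (time_shift m u) \<in> sets lam"
    and efin: "emeasure lam (rect u) < \<infinity>" and epos: "0 < emeasure lam (rect u)"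
    and eq: "emeasure lam (rect u) = emeasure lam (rect (time_shift m u))" if "u \<in> J" for u
    using J(1)[OF that] by (simp_all add: rect_sets emeasure_rect_rmeas)
  have disj: "disjoint_family_on rect J" unfolding J_def by (rule top_rects_disjoint)
  have laminar: "rect (time_shift m u) \<subseteq> rect (time_shift m v) \<or> rect (time_shift m v) \<subseteq> rect (time_shift m u)
      \<or> rect (time_shift m u) \<inter> rect (time_shift m v) = {}" if "u \<in> J" "v \<in> J" for u v
    using J(1)[OF that(1)] J(1)[OF that(2)] by (intro rect_laminar) simp_all
  have band: "\<exists>D\<in>sets lam. (\<Union>w\<in>{w\<in>J. rect (time_shift m w) \<subseteq> rect (time_shift m u)}. rect w) \<subseteq> D \<and>
      emeasure lam D \<le> ennreal (2 * \<bar>of_int m\<bar> + 1) * emeasure lam (rect u)" if u: "u \<in> J" for u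
  proof -
    obtain D where D: "D \<in> sets lam"
      "(\<Union>w\<in>{w. valid w \<and> rect (time_shift m w) \<subseteq> rect (time_shift m u)}. rect w) \<subseteq> D"
      "emeasure lam D \<le> ennreal (2 * \<bar>of_int m\<bar> + 1) * emeasure lam (rect u)"
      using time_shift_band[OF J(1)[OF u], of m] by blast
    have "{w\<in>J. rect (time_shift m w) \<subseteq> rect (time_shift m u)}
        \<subseteq> {w. valid w \<and> rect (time_shift m w) \<subseteq> rect (time_shift m u)}"
      using J(1) by blast
    then have "(\<Union>w\<in>{w\<in>J. rect (time_shift m w) \<subseteq> rect (time_shift m u)}. rect w) \<subseteq> D"
      by (rule order_trans[OF UN_mono D(2)]) simp
    then show ?thesis using D(1,3) by (intro bexI[of _ D]) simp_all
  qed
  have cint: "(\<integral>\<^sup>+z\<in>rect (time_shift m u). ennreal (cavg n f z) \<partial>lam) = ennreal (av f (time_shift m u) * rmeas u)"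
    if u: "u \<in> J" for u
    using nn_integral_cavg_rect[OF f(1) sv[OF u] weighted_L_local_integrable(1)[OF f]]
      integral_av[OF sv(1)[OF u] weighted_L_local_integrable(1)[OF f sv(1)[OF u]]] J(1)[OF u] by simp
  have lower: "ennreal t * emeasure lam (rect (time_shift m u)) \<le> (\<integral>\<^sup>+z\<in>rect (time_shift m u). ennreal (g z) \<partial>lam)"
    if u: "u \<in> J" for u
  proof -
    note [measurable] = B[OF u]
    let ?x = "\<integral>\<^sup>+z\<in>rect (time_shift m u). ennreal (g z) \<partial>lam"
    have "ennreal (2 * t * rmeas u) \<le> ennreal (av f (time_shift m u) * rmeas u)"
      using J(1,4)[OF u] by (intro ennreal_leI mult_right_mono) (simp_all add: less_imp_le)
    also have "\<dots> = (\<integral>\<^sup>+z\<in>rect (time_shift m u). ennreal (cavg n f z) \<partial>lam)" by (rule cint[OF u, symmetric])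
    also have "\<dots> \<le> (\<integral>\<^sup>+z. ennreal (g z) * indicator (rect (time_shift m u)) z + ennreal t * indicator (rect (time_shift m u)) z \<partial>lam)"
    proof (rule nn_integral_mono)
      fix z
      have "cavg n f z \<le> g z + t" using t by (simp add: g_def split: split_indicator)
      then have "ennreal (cavg n f z) \<le> ennreal (g z) + ennreal t"
        using g0[of z] t by (simp add: ennreal_plus[symmetric] ennreal_leI del: ennreal_plus)
      then show "ennreal (cavg n f z) * indicator (rect (time_shift m u)) z
          \<le> ennreal (g z) * indicator (rect (time_shift m u)) z + ennreal t * indicator (rect (time_shift m u)) z"
        by (simp split: split_indicator)
    qed
    also have "\<dots> = ?x + ennreal (t * rmeas u)"
      using t nn_integral_rect_const[OF sv(1)[OF u], of t] J(1)[OF u] by (subst nn_integral_add) simp_all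
    finally have le: "ennreal (2 * t * rmeas u) \<le> ?x + ennreal (t * rmeas u)" .
    have "ennreal (t * rmeas u) \<le> ?x"
    proof (cases "?x = \<infinity>")
      case False
      then obtain x where x: "0 \<le> x" "?x = ennreal x" by (cases ?x) auto
      have "0 \<le> t * rmeas u" using t rmeas_pos[OF J(1)[OF u]] by simp
      then have "2 * t * rmeas u \<le> x + t * rmeas u"
        using le x by (simp add: ennreal_plus[symmetric] ennreal_le_iff del: ennreal_plus)
      then have "t * rmeas u \<le> x" by simp
      then show ?thesis unfolding x(2) by (rule ennreal_leI)
    qed simp
    moreover have "ennreal t * emeasure lam (rect (time_shift m u)) = ennreal (t * rmeas u)"
      using t J(1)[OF u] by (simp add: emeasure_rect_rmeas ennreal_mult')
    ultimately show ?thesis by simp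
  qed
  have upper: "(\<integral>\<^sup>+z\<in>rect (time_shift m u). ennreal (g z) \<partial>lam) \<le> ennreal (4 * t) * emeasure lam (rect (time_shift m u))"
    if u: "u \<in> J" for u
  proof -
    have "(\<integral>\<^sup>+z\<in>rect (time_shift m u). ennreal (g z) \<partial>lam) \<le> (\<integral>\<^sup>+z\<in>rect (time_shift m u). ennreal (cavg n f z) \<partial>lam)"
      using cavg_nonneg[of n f]
      by (intro nn_integral_mono mult_right_mono ennreal_leI) (simp_all add: g_def split: split_indicator)
    also have "\<dots> = ennreal (av f (time_shift m u) * rmeas u)" by (rule cint[OF u])
    also have "\<dots> \<le> ennreal (4 * t * rmeas u)"
    proof (intro ennreal_leI mult_right_mono)
      obtain z where z: "z \<in> rect u" "z \<in> E" using J(5)[OF u] by (meson disjoint_iff)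
      have "u = idx (fst u) z" by (rule rect_eq_idx[OF J(1)[OF u] z(1)])
      then have "av f (time_shift m u) \<le> Tmax a n m f z" using Tmax_ge[OF J(2,3)[OF u], of f m z] by simp
      also have "\<dots> \<le> 4 * t" using z(2) by (simp add: E_def)
      finally show "av f (time_shift m u) \<le> 4 * t" .
    qed (use rmeas_pos[OF J(1)[OF u]] in simp)
    also have "\<dots> = ennreal (4 * t) * emeasure lam (rect (time_shift m u))"
      using t J(1)[OF u] by (simp add: emeasure_rect_rmeas ennreal_mult')
    finally show ?thesis .
  qed
  have Wfin: "emeasure W (rect u) < \<infinity>" if "u \<in> J" for u
    using W[OF A[OF that]] \<omega>_fin[OF J(1)[OF that]] by simp
  have WS: "measure W (rect u) * enn2real (\<integral>\<^sup>+z\<in>rect (time_shift m u). ennreal (cavg n \<sigma> z powr (1 + \<eta>)) \<partial>lam) powr (r - 1)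
      \<le> C * measure lam (rect (time_shift m u)) powr r" if u: "u \<in> J" for u
  proof -
    let ?r = "rmeas u"
    have r0: "0 < ?r" by (rule rmeas_pos[OF J(1)[OF u]])
    have e: "measure W (rect u) = av \<omega> u * ?r" unfolding measure_def W[OF A[OF u]] using r0 by (simp add: av_def)
    have e2: "enn2real (\<integral>\<^sup>+z\<in>rect (time_shift m u). ennreal (cavg n \<sigma> z powr (1 + \<eta>)) \<partial>lam)
        = av (\<lambda>z. cavg n \<sigma> z powr (1 + \<eta>)) (time_shift m u) * ?r"
      using r0[THEN less_imp_neq, symmetric] by (simp add: av_def rmeas_time_shift[OF J(1)[OF u]])
    have e3: "measure lam (rect (time_shift m u)) = ?r"
      using rmeas_time_shift[OF J(1)[OF u], of m] by (simp add: rmeas_def)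
    have e4: "r - 1 = (q - 1) / (1 + \<eta>)" by (simp add: r_def)
    have "av \<omega> u * ?r * (av (\<lambda>z. cavg n \<sigma> z powr (1 + \<eta>)) (time_shift m u) * ?r) powr (r - 1)
        = (av \<omega> u * av (\<lambda>z. cavg n \<sigma> z powr (1 + \<eta>)) (time_shift m u) powr ((q - 1) / (1 + \<eta>))) * (?r * ?r powr (r - 1))"
      unfolding e4 using r0 av_nonneg[OF sv(1)[OF u]] by (simp add: powr_mult mult_ac)
    also have "\<dots> \<le> C * (?r * ?r powr (r - 1))"
      using bd[OF J(1,3)[OF u]] r0 by (intro mult_right_mono) simp_all
    also have "?r * ?r powr (r - 1) = ?r powr r" using r0 by (simp add: powr_diff)
    finally show ?thesis unfolding e e2 e3 .
  qed
  have svs: "(\<lambda>z. cavg n \<sigma> z powr (- (q - 1))) \<in> borel_measurable lam" "(\<lambda>z. cavg n \<sigma> z powr (1 + \<eta>)) \<in> borel_measurable lam"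
    by measurable
  have vpos: "AE z in lam. 0 < cavg n \<sigma> z powr (- (q - 1))"
    by (rule AE_I2) (simp add: cavg_\<sigma>_pos[THEN less_imp_neq, symmetric])
  have veq: "AE z in lam. cavg n \<sigma> z powr (1 + \<eta>) = (cavg n \<sigma> z powr (- (q - 1))) powr (-1 / (r - 1))"
  proof (rule AE_I2)
    fix z
    have "- (q - 1) * (-1 / (r - 1)) = 1 + \<eta>" using q \<eta> by (simp add: r_def divide_simps) (simp add: algebra_simps)
    then show "cavg n \<sigma> z powr (1 + \<eta>) = (cavg n \<sigma> z powr (- (q - 1))) powr (-1 / (r - 1))"
      by (simp only: powr_powr)
  qed
  have nums: "0 \<le> (4 :: real)" "0 \<le> (2 * \<bar>of_int m\<bar> + 1 :: real)" by simp_all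
  have est: "ennreal (t powr r) * (\<integral>\<^sup>+u. emeasure W (rect u) \<partial>count_space J)
      \<le> ennreal (4 powr r * C * (2 * 4 * (2 * \<bar>of_int m\<bar> + 1) + 1)) *
        (\<integral>\<^sup>+z. ennreal (g z powr r * cavg n \<sigma> z powr (- (q - 1))) \<partial>lam)"
    by (rule laminar_level_estimate[where A = rect and B = "\<lambda>u. rect (time_shift m u)",
        OF Jc A B disj laminar eq efin epos band gm g0 svs vpos veq lower upper Wfin fin WS t nums r1 C])
      (use J(1,3) in simp_all)
  have "(\<integral>\<^sup>+z. ennreal (\<omega> z) * indicator {2 * t<..4 * t} (Tmax a n m f z) \<partial>lam) \<le> (\<integral>\<^sup>+u. emeasure W (rect u) \<partial>count_space J)"
  proof -
    have "(\<integral>\<^sup>+z. ennreal (\<omega> z) * indicator {2 * t<..4 * t} (Tmax a n m f z) \<partial>lam) \<le> (\<integral>\<^sup>+z\<in>(\<Union>u\<in>J. rect u). ennreal (\<omega> z) \<partial>lam)"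
    proof (rule nn_integral_mono)
      fix z
      show "ennreal (\<omega> z) * indicator {2 * t<..4 * t} (Tmax a n m f z) \<le> ennreal (\<omega> z) * indicator (\<Union>u\<in>J. rect u) z"
      proof (cases "Tmax a n m f z \<in> {2 * t<..4 * t}")
        case True
        then have zE: "z \<in> E" by (simp add: E_def)
        obtain h where h: "a \<le> h" "h \<le> n" "Tmax a n m f z = av f (time_shift m (idx h z))"
          using Tmax_attained[OF an, of m f z] by blast
        have "rect (idx h z) \<inter> E \<noteq> {}" using zE mem_rect_idx[of z h] by (meson disjoint_iff)
        then have "2 * t < av f (time_shift m (idx h z)) \<and> rect (idx h z) \<inter> E \<noteq> {}"
          using True h(3) by simp
        then obtain u where "u \<in> J" "z \<in> rect u"
          unfolding J_def by (rule top_rects_cover[OF h(1,2), where P = "\<lambda>u. 2 * t < av f (time_shift m u) \<and> rect u \<inter> E \<noteq> {}"])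
        then have "z \<in> (\<Union>u\<in>J. rect u)" by blast
        then show ?thesis using True by simp
      qed simp
    qed
    also have "\<dots> = emeasure W (\<Union>u\<in>J. rect u)"
      using A Jc by (intro W[symmetric] sets.countable_UN') auto
    also have "\<dots> = (\<integral>\<^sup>+u. emeasure W (rect u) \<partial>count_space J)"
    proof (rule emeasure_UN_countable[OF _ Jc disj])
      show "rect u \<in> sets W" if "u \<in> J" for u using A[OF that] by (simp add: W_def)
    qed
    finally show ?thesis .
  qed
  then have "ennreal (t powr r) * (\<integral>\<^sup>+z. ennreal (\<omega> z) * indicator {2 * t<..4 * t} (Tmax a n m f z) \<partial>lam)
      \<le> ennreal (t powr r) * (\<integral>\<^sup>+u. emeasure W (rect u) \<partial>count_space J)" by (rule mult_left_mono) simp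
  also note est
  also have "(\<integral>\<^sup>+z. ennreal (g z powr r * cavg n \<sigma> z powr (- (q - 1))) \<partial>lam)
      = (\<integral>\<^sup>+z. ennreal (cavg n f z powr r * cavg n \<sigma> z powr (- (q - 1))) * indicator {t<..} (cavg n f z) \<partial>lam)"
    using r1 by (intro nn_integral_cong) (simp add: g_def split: split_indicator)
  finally show ?thesis by simp
qed

text \<open>The level \<open>2 * t < T \<le> 4 * t\<close> contributes about \<open>t powr q\<close>
  times its \<open>\<omega>\<close>-mass, which by the level estimate is at most a multiple of
  \<open>t powr (q - r)\<close> times an integral over the set where \<open>cavg n f\<close> exceeds
  \<open>t\<close>. Summing over the powers of two \<open>t\<close> below \<open>cavg n f\<close>
  restores the exponent \<open>q\<close>, and \<open>discretised_norm_le\<close> returns to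
  \<open>f\<close> and \<open>\<omega>\<close>.\<close>

theorem dyadic_strong_type:
  assumes m: "3 \<le> m"
  obtains C where "0 \<le> C"
    "\<And>a n f. a \<le> n \<Longrightarrow> f \<in> borel_measurable lam \<Longrightarrow> (\<And>z. 0 \<le> f z) \<Longrightarrow>
      (\<integral>\<^sup>+z. ennreal (f z powr q * \<omega> z) \<partial>lam) < \<infinity> \<Longrightarrow>
      (\<integral>\<^sup>+z. ennreal (Tmax a n m f z powr q * \<omega> z) \<partial>lam)
        \<le> ennreal C * (\<integral>\<^sup>+z. ennreal (f z powr q * \<omega> z) \<partial>lam)"
proof (rule improved_Aq[OF m])
  fix \<eta> C :: real
  assume \<eta>: "0 < \<eta>" "\<eta> \<le> 1" and C: "0 < C"
    and fin: "\<And>n v. valid v \<Longrightarrow> fst v \<le> n \<Longrightarrow>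
      (\<integral>\<^sup>+z\<in>rect (time_shift m v). ennreal (cavg n \<sigma> z powr (1 + \<eta>)) \<partial>lam) < \<infinity>"
    and bd: "\<And>n v. valid v \<Longrightarrow> fst v \<le> n \<Longrightarrow>
      av \<omega> v * av (\<lambda>z. cavg n \<sigma> z powr (1 + \<eta>)) (time_shift m v) powr ((q - 1) / (1 + \<eta>)) \<le> C"
  define r where "r = 1 + (q - 1) / (1 + \<eta>)"
  \<comment> \<open>The gain in the exponent; it is positive because \<open>0 < \<eta>\<close>, and
    it makes the sum over small levels converge.\<close>
  define p where "p = q - r"
  have p: "0 < p" using q \<eta> by (simp add: p_def r_def field_simps)
  define K where "K = 4 powr r * C * (8 * (2 * \<bar>of_int m\<bar> + 1) + 1)"
  have K: "0 \<le> K" using C by (simp add: K_def)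
  define S where "S = 1 / (1 - 2 powr (- p))"
  have S: "0 \<le> S" using p powr_less_mono[of "- p" 0 2] by (simp add: S_def)
  define D where "D = 4 powr q * K * S * 2 powr q"
  have main: "(\<integral>\<^sup>+z. ennreal (Tmax a n m f z powr q * \<omega> z) \<partial>lam) \<le> ennreal D * (\<integral>\<^sup>+z. ennreal (f z powr q * \<omega> z) \<partial>lam)"
    if an: "a \<le> n" and f: "f \<in> borel_measurable lam" "\<And>z. 0 \<le> f z" "(\<integral>\<^sup>+z. ennreal (f z powr q * \<omega> z) \<partial>lam) < \<infinity>" for a n f
  proof -
    note [measurable] = f(1)
    let ?T = "Tmax a n m f" and ?g = "cavg n f" and ?v = "\<lambda>z. cavg n \<sigma> z powr (- (q - 1))"
    define t where "t i = (2 :: real) powr of_int i" for i :: int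
    have t: "0 < t i" for i by (simp add: t_def)
    have c: "countable (UNIV :: int set)" by simp
    have "(\<integral>\<^sup>+z. ennreal (?T z powr q * \<omega> z) \<partial>lam)
        \<le> (\<integral>\<^sup>+z. \<integral>\<^sup>+i. ennreal ((4 * t i) powr q) * (ennreal (\<omega> z) * indicator {2 * t i<..4 * t i} (?T z)) \<partial>count_space UNIV \<partial>lam)"
    proof (rule nn_integral_mono)
      fix z
      show "ennreal (?T z powr q * \<omega> z)
          \<le> (\<integral>\<^sup>+i. ennreal ((4 * t i) powr q) * (ennreal (\<omega> z) * indicator {2 * t i<..4 * t i} (?T z)) \<partial>count_space UNIV)"
      proof (cases "?T z = 0")
        case True
        then show ?thesis using q by simp
      next
        case False
        then have T0: "0 < ?T z" using Tmax_nonneg[OF an, of m f z] by simp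
        \<comment> \<open>Subtracting 2 from the ceiling gives a strict lower and a weak upper
          inequality, matching the half-open levels.\<close>
        define j where "j = \<lceil>log 2 (?T z)\<rceil> - 2"
        have j: "of_int (j + 1) < log 2 (?T z)" "log 2 (?T z) \<le> of_int (j + 2)" unfolding j_def by linarith+
        have e: "2 powr of_int (j + 1) = 2 * t j" "2 powr of_int (j + 2) = 4 * t j"
          by (simp_all add: t_def powr_add)
        have "2 powr of_int (j + 1) < ?T z" using j(1) T0 by (simp add: less_log_iff)
        moreover have "?T z \<le> 2 powr of_int (j + 2)" using j(2) T0 by (simp add: log_le_iff)
        ultimately have T: "2 * t j < ?T z" "?T z \<le> 4 * t j" unfolding e by blast+
        have "ennreal (?T z powr q * \<omega> z) = ennreal (?T z powr q) * ennreal (\<omega> z)" by (rule ennreal_mult') simp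
        also have "\<dots> \<le> ennreal ((4 * t j) powr q) * ennreal (\<omega> z)"
          using T T0 q by (intro mult_right_mono ennreal_leI powr_mono2) auto
        also have "\<dots> = ennreal ((4 * t j) powr q) * (ennreal (\<omega> z) * indicator {2 * t j<..4 * t j} (?T z))"
          using T by simp
        also have "\<dots> = (\<integral>\<^sup>+i. ennreal ((4 * t j) powr q) * (ennreal (\<omega> z) * indicator {2 * t j<..4 * t j} (?T z)) * indicator {j} i \<partial>count_space UNIV)"
          by (subst nn_integral_cmult_indicator) simp_all
        also have "\<dots> \<le> (\<integral>\<^sup>+i. ennreal ((4 * t i) powr q) * (ennreal (\<omega> z) * indicator {2 * t i<..4 * t i} (?T z)) \<partial>count_space UNIV)"
          by (rule nn_integral_mono) (simp split: split_indicator)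
        finally show ?thesis .
      qed
    qed
    also have "\<dots> = (\<integral>\<^sup>+i. \<integral>\<^sup>+z. ennreal ((4 * t i) powr q) * (ennreal (\<omega> z) * indicator {2 * t i<..4 * t i} (?T z)) \<partial>lam \<partial>count_space UNIV)"
      by (rule nn_integral_count_space_nn_integral[OF c]) measurable
    also have "\<dots> \<le> (\<integral>\<^sup>+i. \<integral>\<^sup>+z. ennreal (4 powr q * K) * (ennreal (?g z powr r * ?v z) * (ennreal (t i powr p) * indicator {..<?g z} (t i))) \<partial>lam \<partial>count_space UNIV)"
    proof (rule nn_integral_mono)
      fix i :: int
      have e: "(4 * t i) powr q = 4 powr q * t i powr p * t i powr r"
        using t[of i] by (simp add: powr_mult p_def powr_add[symmetric])
      have "(\<integral>\<^sup>+z. ennreal ((4 * t i) powr q) * (ennreal (\<omega> z) * indicator {2 * t i<..4 * t i} (?T z)) \<partial>lam)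
          = ennreal ((4 * t i) powr q) * (\<integral>\<^sup>+z. ennreal (\<omega> z) * indicator {2 * t i<..4 * t i} (?T z) \<partial>lam)"
        by (rule nn_integral_cmult) measurable
      also have "\<dots> = ennreal (4 powr q * t i powr p) * (ennreal (t i powr r) * (\<integral>\<^sup>+z. ennreal (\<omega> z) * indicator {2 * t i<..4 * t i} (?T z) \<partial>lam))"
        unfolding e by (subst ennreal_mult') (simp_all add: mult.assoc)
      also have "\<dots> \<le> ennreal (4 powr q * t i powr p) * (ennreal K *
          (\<integral>\<^sup>+z. ennreal (?g z powr r * ?v z) * indicator {t i<..} (?g z) \<partial>lam))"
        unfolding K_def r_def by (rule mult_left_mono[OF level_set_estimate[OF \<eta>(1) C fin bd an f t]]) simp_all
      also have "\<dots> = ennreal (4 powr q * K) * (ennreal (t i powr p) *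
          (\<integral>\<^sup>+z. ennreal (?g z powr r * ?v z) * indicator {t i<..} (?g z) \<partial>lam))"
        using K by (simp add: ennreal_mult' mult_ac)
      also have "\<dots> = (\<integral>\<^sup>+z. ennreal (4 powr q * K) * (ennreal (t i powr p) * (ennreal (?g z powr r * ?v z) * indicator {t i<..} (?g z))) \<partial>lam)"
      proof -
        have m1: "(\<lambda>z. ennreal (?g z powr r * ?v z) * indicator {t i<..} (?g z)) \<in> borel_measurable lam"
          by measurable
        then have m2: "(\<lambda>z. ennreal (t i powr p) * (ennreal (?g z powr r * ?v z) * indicator {t i<..} (?g z))) \<in> borel_measurable lam"
          by (rule borel_measurable_times_ennreal[OF borel_measurable_const])
        show ?thesis unfolding nn_integral_cmult[OF m2] nn_integral_cmult[OF m1] ..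
      qed
      also have "\<dots> = (\<integral>\<^sup>+z. ennreal (4 powr q * K) * (ennreal (?g z powr r * ?v z) * (ennreal (t i powr p) * indicator {..<?g z} (t i))) \<partial>lam)"
        by (rule nn_integral_cong) (simp add: mult_ac split: split_indicator)
      finally show "(\<integral>\<^sup>+z. ennreal ((4 * t i) powr q) * (ennreal (\<omega> z) * indicator {2 * t i<..4 * t i} (?T z)) \<partial>lam)
        \<le> (\<integral>\<^sup>+z. ennreal (4 powr q * K) * (ennreal (?g z powr r * ?v z) * (ennreal (t i powr p) * indicator {..<?g z} (t i))) \<partial>lam)" .
    qed
    also have "\<dots> = (\<integral>\<^sup>+z. \<integral>\<^sup>+i. ennreal (4 powr q * K) * (ennreal (?g z powr r * ?v z) * (ennreal (t i powr p) * indicator {..<?g z} (t i))) \<partial>count_space UNIV \<partial>lam)"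
    proof (rule nn_integral_count_space_nn_integral[OF c, symmetric])
      fix i
      have "(\<lambda>z. indicator {..<?g z} (t i)) = (\<lambda>z. indicator {t i<..} (?g z) :: ennreal)"
        by (auto split: split_indicator)
      moreover have "(\<lambda>z. indicator {t i<..} (?g z) :: ennreal) \<in> borel_measurable lam" by measurable
      ultimately have [measurable]: "(\<lambda>z. indicator {..<?g z} (t i) :: ennreal) \<in> borel_measurable lam" by simp
      show "(\<lambda>z. ennreal (4 powr q * K) * (ennreal (?g z powr r * ?v z) * (ennreal (t i powr p) * indicator {..<?g z} (t i)))) \<in> borel_measurable lam"
        by measurable
    qed
    also have "\<dots> \<le> (\<integral>\<^sup>+z. ennreal (4 powr q * K * S) * ennreal (?g z powr q * ?v z) \<partial>lam)"
    proof (rule nn_integral_mono)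
      fix z
      have g0: "0 \<le> ?g z" by (rule cavg_nonneg)
      have "(\<integral>\<^sup>+i. ennreal (4 powr q * K) * (ennreal (?g z powr r * ?v z) * (ennreal (t i powr p) * indicator {..<?g z} (t i))) \<partial>count_space UNIV)
          = ennreal (4 powr q * K) * (ennreal (?g z powr r * ?v z) * (\<integral>\<^sup>+i. ennreal (t i powr p) * indicator {..<?g z} (t i) \<partial>count_space UNIV))"
        by (simp add: nn_integral_cmult)
      also have "\<dots> \<le> ennreal (4 powr q * K) * (ennreal (?g z powr r * ?v z) * ennreal (S * ?g z powr p))"
        unfolding t_def S_def by (intro mult_left_mono geometric_int_sum_le[OF g0 p]) simp_all
      also have "\<dots> = ennreal (4 powr q * K * (?g z powr r * ?v z * (S * ?g z powr p)))"
        using K by (simp add: ennreal_mult'[symmetric])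
      also have "4 powr q * K * (?g z powr r * ?v z * (S * ?g z powr p)) = 4 powr q * K * S * (?g z powr q * ?v z)"
      proof -
        have "?g z powr r * ?g z powr p = ?g z powr q" by (simp add: p_def powr_add[symmetric])
        then have "?g z powr q = ?g z powr r * ?g z powr p" by simp
        then show ?thesis by (simp only: mult_ac)
      qed
      also have "ennreal \<dots> = ennreal (4 powr q * K * S) * ennreal (?g z powr q * ?v z)"
        using K S by (intro ennreal_mult') simp
      finally show "(\<integral>\<^sup>+i. ennreal (4 powr q * K) * (ennreal (?g z powr r * ?v z) * (ennreal (t i powr p) * indicator {..<?g z} (t i))) \<partial>count_space UNIV)
        \<le> ennreal (4 powr q * K * S) * ennreal (?g z powr q * ?v z)" .
    qed
    also have "\<dots> = ennreal (4 powr q * K * S) * (\<integral>\<^sup>+z. ennreal (?g z powr q * ?v z) \<partial>lam)"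
      by (rule nn_integral_cmult) measurable
    also have "\<dots> \<le> ennreal (4 powr q * K * S) * (ennreal (2 powr q) * (\<integral>\<^sup>+z. ennreal (f z powr q * \<omega> z) \<partial>lam))"
      by (rule mult_left_mono[OF discretised_norm_le[OF f]]) simp
    also have "\<dots> = ennreal D * (\<integral>\<^sup>+z. ennreal (f z powr q * \<omega> z) \<partial>lam)"
      using K S by (simp add: D_def ennreal_mult' mult.assoc)
    finally show ?thesis .
  qed
  have "0 \<le> D" using K S by (simp add: D_def)
  then show thesis by (rule that[OF _ main])
qed

end

section \<open>Time lags and chains of boxes\<close>

lemma finite_cover_le:
  assumes "finite J" "\<And>j. j \<in> J \<Longrightarrow> A j \<in> sets M" "E \<subseteq> (\<Union>j\<in>J. A j)" "h \<in> borel_measurable M"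
  shows "(\<integral>\<^sup>+z\<in>E. h z \<partial>M) \<le> (\<Sum>j\<in>J. \<integral>\<^sup>+z\<in>A j. h z \<partial>M)"
proof -
  have "(\<integral>\<^sup>+z\<in>E. h z \<partial>M) \<le> (\<integral>\<^sup>+z. (\<Sum>j\<in>J. h z * indicator (A j) z) \<partial>M)"
  proof (rule nn_integral_mono)
    fix z
    show "h z * indicator E z \<le> (\<Sum>j\<in>J. h z * indicator (A j) z)"
    proof (cases "z \<in> E")
      case True
      then obtain j where j: "j \<in> J" "z \<in> A j" using assms(3) by auto
      then have "h z * indicator E z = h z * indicator (A j) z" using True by simp
      also have "\<dots> \<le> (\<Sum>j\<in>J. h z * indicator (A j) z)" using j assms(1) by (intro member_le_sum) auto
      finally show ?thesis .
    qed simp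
  qed
  also have "\<dots> = (\<Sum>j\<in>J. \<integral>\<^sup>+z\<in>A j. h z \<partial>M)"
    using assms(2,4) by (intro nn_integral_sum borel_measurable_times_ennreal borel_measurable_indicator) auto
  finally show ?thesis .
qed

text \<open>Pigeonhole: one of at most \<open>n\<close> terms carries at least the
  \<open>n\<close>-th part. Singling out one index suits conditions that are stated for pairs of
  sets.\<close>

lemma enn2real_sum_le:
  assumes J: "finite J" and le: "X \<le> (\<Sum>j\<in>J. Y j)" and Y: "\<And>j. j \<in> J \<Longrightarrow> Y j < \<infinity>" and nz: "J \<noteq> {}"
    and card: "card J \<le> n"
  obtains j where "j \<in> J" "X < \<infinity>" "enn2real X \<le> real n * enn2real (Y j)"
proof -
  define M where "M = Max ((\<lambda>j. enn2real (Y j)) ` J)"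
  have "M \<in> (\<lambda>j. enn2real (Y j)) ` J" unfolding M_def using J nz by (intro Max_in) auto
  then obtain j where j: "j \<in> J" "M = enn2real (Y j)" by auto
  have "(\<Sum>j\<in>J. Y j) = (\<Sum>j\<in>J. ennreal (enn2real (Y j)))" using Y by (intro sum.cong) auto
  also have "\<dots> = ennreal (\<Sum>j\<in>J. enn2real (Y j))" by (rule sum_ennreal) simp
  finally have X: "X \<le> ennreal (\<Sum>j\<in>J. enn2real (Y j))" using le by simp
  then have "enn2real X \<le> (\<Sum>j\<in>J. enn2real (Y j))" by (intro enn2real_leI) (auto intro: sum_nonneg)
  also have "\<dots> \<le> real (card J) * M"
    unfolding M_def using J by (intro sum_bounded_above Max_ge) auto
  also have "\<dots> \<le> real n * M" using card j by (intro mult_right_mono) auto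
  finally have "enn2real X \<le> real n * enn2real (Y j)" using j by simp
  moreover have "X < \<infinity>" by (rule le_less_trans[OF X]) simp
  ultimately show thesis using that j by blast
qed

text \<open>Open intervals of length \<open>h\<close> at distance \<open>h\<close> would miss their
  end points, hence the distance \<open>h / 2\<close>. Keeping the offsets below \<open>H\<close>
  controls the time differences between pieces later on.\<close>

lemma interval_cover:
  fixes h t H :: real
  assumes h: "0 < h" and H: "H \<le> real M * (h / 2)"
  shows "{t<..<t + H} \<subseteq> (\<Union>j\<in>{j. j \<le> M \<and> real j * (h / 2) < H}. {t + real j * (h / 2)<..<t + real j * (h / 2) + h})"
proof
  fix y assume y: "y \<in> {t<..<t + H}"
  define j where "j = nat (\<lceil>(y - t) / (h / 2)\<rceil> - 1)"
  have pos: "0 < (y - t) / (h / 2)" using y h by simp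
  have j: "real j < (y - t) / (h / 2)" "(y - t) / (h / 2) \<le> real j + 1"
    using pos unfolding j_def by linarith+
  have j1: "real j * (h / 2) < y - t" using j(1) h by (subst (asm) pos_less_divide_eq) simp_all
  have j2: "y - t \<le> (real j + 1) * (h / 2)" using j(2) h by (subst (asm) pos_divide_le_eq) simp_all
  have "real j * (h / 2) < H" using j1 y by simp
  moreover have "real j * (h / 2) < real M * (h / 2)" using calculation H by linarith
  then have "j \<le> M" using h by simp
  moreover have "y < t + real j * (h / 2) + h" using j2 h by (simp add: algebra_simps)
  ultimately show "y \<in> (\<Union>j\<in>{j. j \<le> M \<and> real j * (h / 2) < H}. {t + real j * (h / 2)<..<t + real j * (h / 2) + h})"
    using j1 by (intro UN_I[of j]) auto
qed

text \<open>At scale \<open>\<epsilon> * r\<close> a chain of \<open>O(1 / \<epsilon>)\<close> steps suffices to cross a ball of radius \<open>r\<close>, and these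
  steps consume time \<open>O(\<epsilon> powr (p - 1))\<close> relative to \<open>r powr p\<close>. As \<open>p > 1\<close>, this is less than any
  prescribed lag; the excess time is spent by resting at the final ball.\<close>

lemma small_scale_exists:
  fixes p \<kappa> c A :: real
  assumes p: "1 < p" and "0 < \<kappa>" "0 < c" "0 < A"
  obtains \<epsilon> where "0 < \<epsilon>" "\<epsilon> \<le> 1" "c * \<epsilon> powr p * (A / \<epsilon> + A) \<le> \<kappa>"
proof
  define \<epsilon> where "\<epsilon> = min 1 ((\<kappa> / (2 * c * A)) powr (1 / (p - 1)))"
  show e: "0 < \<epsilon>" "\<epsilon> \<le> 1" using assms by (auto simp: \<epsilon>_def)
  have "\<epsilon> powr (p - 1) \<le> ((\<kappa> / (2 * c * A)) powr (1 / (p - 1))) powr (p - 1)"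
    using p e by (intro powr_mono2) (auto simp: \<epsilon>_def)
  also have "\<dots> = \<kappa> / (2 * c * A)" using p assms by (simp add: powr_powr)
  finally have *: "\<epsilon> powr (p - 1) \<le> \<kappa> / (2 * c * A)" .
  have "\<epsilon> powr p * (A / \<epsilon> + A) = \<epsilon> powr (p - 1) * (A + A * \<epsilon>)"
    using e by (simp add: powr_diff field_simps)
  also have "\<dots> \<le> \<epsilon> powr (p - 1) * (2 * A)" using e assms by (intro mult_left_mono) auto
  also have "\<dots> \<le> \<kappa> / (2 * c * A) * (2 * A)" using * assms by (intro mult_right_mono) auto
  finally have "c * (\<epsilon> powr p * (A / \<epsilon> + A)) \<le> c * (\<kappa> / (2 * c * A) * (2 * A))"
    using assms by (intro mult_left_mono) auto
  then show "c * \<epsilon> powr p * (A / \<epsilon> + A) \<le> \<kappa>" using assms by (simp add: mult.assoc)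
qed

section \<open>Volumes, chains and nets in the space of homogeneous type\<close>

locale weighted_parabolic_space =
  fixes \<rho> :: "'a \<Rightarrow> 'a \<Rightarrow> real" and K0 p q :: real and \<mu> :: "'a measure" and \<omega> :: "'a \<times> real \<Rightarrow> real"
  assumes homog: "homogeneous_type \<rho> K0 \<mu>" and basic: "basic_assumptions \<rho> \<mu>"
    and geodesic: "monotone_geodesic \<rho>" and p: "1 < p" and q: "1 < q" and weight: "weight \<rho> \<mu> p \<omega>"
begin

abbreviation "lam \<equiv> parabolic_measure \<mu>"

definition \<sigma> :: "'a \<times> real \<Rightarrow> real" where "\<sigma> z = \<omega> z powr (-1 / (q - 1))"

lemma K0: "1 \<le> K0" and rho_nonneg: "0 \<le> \<rho> x y" and rho_self [simp]: "\<rho> x x = 0"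
  and rho_sym: "\<rho> x y = \<rho> y x" and rho_tri: "\<rho> x y \<le> K0 * (\<rho> x z + \<rho> z y)"
  using homog by (auto simp: homogeneous_type_def quasi_metric_def)

lemma space_mu: "space \<mu> = UNIV" using homog by (simp add: homogeneous_type_def)
lemma space_lam: "space lam = UNIV" by (rule space_parabolic[OF space_mu])

lemma ball_sets: "0 < r \<Longrightarrow> qball \<rho> x r \<in> sets \<mu>" using homog by (simp add: homogeneous_type_def)

lemma \<omega>_meas [measurable]: "\<omega> \<in> borel_measurable lam" and \<omega>_pos: "AE z in lam. 0 < \<omega> z"
  using weight by (simp_all add: weight_def)

lemma \<sigma>_meas [measurable]: "\<sigma> \<in> borel_measurable lam" unfolding \<sigma>_def[abs_def] by measurable
lemma \<sigma>_eq: "AE z in lam. \<sigma> z = \<omega> z powr (-1 / (q - 1))" by (simp add: \<sigma>_def)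
lemma \<sigma>_pos: "AE z in lam. 0 < \<sigma> z" using \<omega>_pos by eventually_elim (simp add: \<sigma>_def)

definition V :: "'a \<Rightarrow> real \<Rightarrow> real" where "V x r = measure \<mu> (qball \<rho> x r)"

lemma emeasure_ball: "0 < r \<Longrightarrow> emeasure \<mu> (qball \<rho> x r) = ennreal (V x r)"
  and V_pos: "0 < r \<Longrightarrow> 0 < V x r"
proof -
  assume "0 < r"
  then have "0 < emeasure \<mu> (qball \<rho> x r)" "emeasure \<mu> (qball \<rho> x r) < \<infinity>"
    using basic by (auto simp: basic_assumptions_def)
  then show "emeasure \<mu> (qball \<rho> x r) = ennreal (V x r)" "0 < V x r"
    by (simp_all add: V_def measure_def enn2real_positive_iff)
qed

lemma ball_mono: "r \<le> s \<Longrightarrow> qball \<rho> x r \<subseteq> qball \<rho> x s" by (auto simp: qball_def)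

lemma V_le: assumes "0 < r" "0 < s" "qball \<rho> x r \<subseteq> qball \<rho> y s" shows "V x r \<le> V y s"
proof -
  have "ennreal (V x r) \<le> ennreal (V y s)"
    using emeasure_mono[OF assms(3) ball_sets[OF assms(2)]] by (simp add: emeasure_ball assms)
  then show ?thesis using V_pos[OF assms(2), of y] by (simp add: ennreal_le_iff)
qed

lemma V_double: obtains C where "1 \<le> C" "\<And>x r. 0 < r \<Longrightarrow> V x (2 * r) \<le> C * V x r"
proof -
  obtain C :: real where C: "\<And>x r. 0 < r \<Longrightarrow> emeasure \<mu> (qball \<rho> x (2 * r)) \<le> ennreal C * emeasure \<mu> (qball \<rho> x r)"
    using homog by (auto simp: homogeneous_type_def)
  have "V x (2 * r) \<le> max C 1 * V x r" if r: "0 < r" for x r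
  proof -
    have "ennreal (V x (2 * r)) \<le> ennreal C * ennreal (V x r)" using C[OF r, of x] r by (simp add: emeasure_ball)
    also have "\<dots> \<le> ennreal (max C 1) * ennreal (V x r)" by (intro mult_right_mono ennreal_leI) auto
    also have "\<dots> = ennreal (max C 1 * V x r)" by (rule ennreal_mult'[symmetric]) simp
    finally show ?thesis using V_pos[OF r, of x] by (subst (asm) ennreal_le_iff) auto
  qed
  then show thesis using that[of "max C 1"] by simp
qed

text \<open>The quasi-triangle inequality puts the ball around \<open>y\<close> into one around
  \<open>x\<close> of radius \<open>2 ^ n * r\<close>, and doubling is applied \<open>n\<close>
  times; \<open>n\<close> depends on \<open>K0\<close> and \<open>L\<close> only.\<close>

lemma V_compare:
  obtains C where "1 \<le> C" "\<And>x y r R. 0 < r \<Longrightarrow> 0 < R \<Longrightarrow> R \<le> L * r \<Longrightarrow> \<rho> x y \<le> L * r \<Longrightarrow> V y R \<le> C * V x r"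
proof -
  obtain D where D: "1 \<le> D" "\<And>x r. 0 < r \<Longrightarrow> V x (2 * r) \<le> D * V x r" using V_double by blast
  obtain n :: nat where n: "2 * K0 * L < 2 ^ n" using real_arch_pow[of 2 "2 * K0 * L"] by auto
  have it: "V x (2 ^ k * r) \<le> D ^ k * V x r" if "0 < r" for x r and k :: nat
  proof (induction k)
    case (Suc k)
    have "V x (2 * (2 ^ k * r)) \<le> D * V x (2 ^ k * r)" using that by (intro D(2)) simp
    also have "\<dots> \<le> D * (D ^ k * V x r)" using Suc D(1) by (intro mult_left_mono) auto
    finally show ?case by (simp add: mult.assoc)
  qed simp
  have "V y R \<le> D ^ n * V x r" if h: "0 < r" "0 < R" "R \<le> L * r" "\<rho> x y \<le> L * r" for x y r R
  proof -
    have "qball \<rho> y R \<subseteq> qball \<rho> x (2 ^ n * r)"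
    proof
      fix z assume "z \<in> qball \<rho> y R"
      then have "\<rho> y z < R" by (simp add: qball_def)
      then have "\<rho> x y + \<rho> y z \<le> 2 * L * r" using h by simp
      then have "K0 * (\<rho> x y + \<rho> y z) \<le> K0 * (2 * L * r)" using K0 by (intro mult_left_mono) auto
      also have "\<dots> < 2 ^ n * r" using n h(1) by (simp add: mult.assoc[symmetric] mult.commute[of _ 2])
      finally show "z \<in> qball \<rho> x (2 ^ n * r)" using rho_tri[of x z y] by (simp add: qball_def)
    qed
    then have "V y R \<le> V x (2 ^ n * r)" using h by (intro V_le) auto
    also have "\<dots> \<le> D ^ n * V x r" by (rule it[OF h(1)])
    finally show ?thesis .
  qed
  moreover have "1 \<le> D ^ n" using D(1) by (rule one_le_power)
  ultimately show thesis using that by blast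
qed

definition Kt :: real where
  "Kt = (SOME k. 0 < k \<and> (\<forall>s>0. \<forall>x y. s \<le> \<rho> x y \<longrightarrow>
        (\<exists>(m::nat) u. u 0 = x \<and> u m = y \<and>
           (\<forall>i<m. \<rho> (u i) (u (Suc i)) \<le> k * s \<and> \<rho> (u (Suc i)) (u m) \<le> \<rho> (u i) (u m) - s))))"

lemma Kt: "0 < Kt"
  and Kt_geodesic: "0 < s \<Longrightarrow> s \<le> \<rho> x y \<Longrightarrow> \<exists>(m::nat) u. u 0 = x \<and> u m = y \<and>
     (\<forall>i<m. \<rho> (u i) (u (Suc i)) \<le> Kt * s \<and> \<rho> (u (Suc i)) (u m) \<le> \<rho> (u i) (u m) - s)"
proof -
  have "0 < Kt \<and> (\<forall>s>0. \<forall>x y. s \<le> \<rho> x y \<longrightarrow>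
        (\<exists>(m::nat) u. u 0 = x \<and> u m = y \<and>
           (\<forall>i<m. \<rho> (u i) (u (Suc i)) \<le> Kt * s \<and> \<rho> (u (Suc i)) (u m) \<le> \<rho> (u i) (u m) - s)))"
    unfolding Kt_def by (rule someI_ex) (use geodesic in \<open>unfold monotone_geodesic_def, blast\<close>)
  then show "0 < Kt" "0 < s \<Longrightarrow> s \<le> \<rho> x y \<Longrightarrow> \<exists>(m::nat) u. u 0 = x \<and> u m = y \<and>
     (\<forall>i<m. \<rho> (u i) (u (Suc i)) \<le> Kt * s \<and> \<rho> (u (Suc i)) (u m) \<le> \<rho> (u i) (u m) - s)"
    by blast+
qed

text \<open>The penultimate point of a monotone chain ending at \<open>z\<close> works; this is how balls are shown to
  have diameter comparable to their radius.\<close>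

lemma annulus_point: assumes s: "0 < s" obtains u where "s \<le> \<rho> u z" "\<rho> u z \<le> Kt * s"
proof -
  have "\<exists>y. s \<le> \<rho> y z"
  proof (rule ccontr)
    assume "\<not> ?thesis"
    then have lt: "\<rho> y z < s" for y by (simp add: not_le)
    have "\<rho> x y \<le> 2 * K0 * s" for x y
    proof -
      have "K0 * (\<rho> x z + \<rho> z y) \<le> K0 * (2 * s)"
        using lt[of x] lt[of y] rho_sym[of z y] K0 by (intro mult_left_mono) auto
      then show ?thesis using rho_tri[of x y z] by simp
    qed
    then have "qdiam \<rho> UNIV \<le> ennreal (2 * K0 * s)" unfolding qdiam_def by (auto intro!: SUP_least ennreal_leI)
    moreover have "qdiam \<rho> UNIV = \<infinity>" using basic by (simp add: basic_assumptions_def)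
    ultimately show False by (simp add: top_unique)
  qed
  then obtain y where y: "s \<le> \<rho> y z" by blast
  obtain m :: nat and u where u: "u 0 = y" "u m = z"
    "\<And>i. i < m \<Longrightarrow> \<rho> (u i) (u (Suc i)) \<le> Kt * s \<and> \<rho> (u (Suc i)) (u m) \<le> \<rho> (u i) (u m) - s"
    using Kt_geodesic[OF s y] by blast
  have "m \<noteq> 0" using u(1,2) y s by (metis not_le rho_self)
  then obtain k where k: "m = Suc k" by (cases m) auto
  have "\<rho> (u k) z \<le> Kt * s" "s \<le> \<rho> (u k) z" using u(3)[of k] u(2) k by auto
  then show thesis using that by blast
qed

text \<open>Each step of a monotone chain lowers the distance by at least \<open>s\<close>, so there
  are at most \<open>\<rho> x y / s\<close> steps; resting at \<open>y\<close> extends the chain to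
  exactly \<open>n\<close>. Points closer than \<open>s\<close> are not covered by the geodesic
  property and are joined by one jump, whence \<open>max 1 Kt\<close>.\<close>

lemma chain_exists:
  assumes s: "0 < s" and n: "\<rho> x y / s + 1 \<le> real n"
  obtains v where "v 0 = x" "v n = y" "\<And>i. i < n \<Longrightarrow> \<rho> (v i) (v (Suc i)) \<le> max 1 Kt * s"
proof (cases "s \<le> \<rho> x y")
  case False
  have "0 \<le> \<rho> x y / s" using rho_nonneg[of x y] s by simp
  then have n0: "0 < n" using n by (cases n) auto
  define v where "v i = (if i = 0 then x else y)" for i :: nat
  have "\<rho> (v i) (v (Suc i)) \<le> max 1 Kt * s" for i
  proof -
    have "\<rho> (v i) (v (Suc i)) \<le> 1 * s" using False s by (auto simp: v_def)
    also have "\<dots> \<le> max 1 Kt * s" using s by (intro mult_right_mono) auto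
    finally show ?thesis .
  qed
  then show thesis using n0 by (intro that[of v]) (auto simp: v_def)
next
  case True
  obtain m :: nat and u where u: "u 0 = x" "u m = y"
    "\<And>i. i < m \<Longrightarrow> \<rho> (u i) (u (Suc i)) \<le> Kt * s \<and> \<rho> (u (Suc i)) (u m) \<le> \<rho> (u i) (u m) - s"
    using Kt_geodesic[OF s True] by blast
  have "\<rho> (u i) (u m) \<le> \<rho> x y - real i * s" if "i \<le> m" for i
    using that
  proof (induction i)
    case 0 then show ?case using u by simp
  next
    case (Suc i)
    then have "\<rho> (u (Suc i)) (u m) \<le> \<rho> (u i) (u m) - s" using u(3)[of i] by simp
    then show ?case using Suc by (simp add: algebra_simps)
  qed
  from this[of m] have "real m * s \<le> \<rho> x y" by simp
  then have "real m \<le> \<rho> x y / s" using s by (simp add: pos_le_divide_eq)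
  then have mn: "m \<le> n" using n by simp
  define v where "v i = u (min i m)" for i
  have "\<rho> (v i) (v (Suc i)) \<le> max 1 Kt * s" for i
  proof (cases "i < m")
    case True
    then have "\<rho> (v i) (v (Suc i)) \<le> Kt * s" using u(3)[of i] by (simp add: v_def min_def)
    also have "\<dots> \<le> max 1 Kt * s" using s by (intro mult_right_mono) auto
    finally show ?thesis .
  next
    case False
    then show ?thesis using s by (simp add: v_def min_def)
  qed
  then show thesis using mn u by (intro that[of v]) (auto simp: v_def)
qed

text \<open>A separated subset of a ball of maximal cardinality is a net; its cardinality is bounded by
  comparing volumes of disjoint small balls.\<close>

lemma finite_net:
  assumes \<epsilon>: "0 < \<epsilon>" "\<epsilon> \<le> 1"
  obtains N :: nat where "\<And>x r. 0 < r \<Longrightarrow> \<exists>F. finite F \<and> card F \<le> N \<and> F \<subseteq> qball \<rho> x r \<and>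
    qball \<rho> x r \<subseteq> (\<Union>y\<in>F. qball \<rho> y (\<epsilon> * r))"
proof -
  \<comment> \<open>With \<open>h = \<epsilon> * r / (2 * K0)\<close> this makes
    \<open>L * h\<close> equal to \<open>2 * K0 * r\<close>, the radius of a ball around
    \<open>x\<close> containing all the small balls.\<close>
  define L where "L = 4 * K0\<^sup>2 / \<epsilon>"
  obtain C where C: "1 \<le> C" "\<And>x y r R. 0 < r \<Longrightarrow> 0 < R \<Longrightarrow> R \<le> L * r \<Longrightarrow> \<rho> x y \<le> L * r \<Longrightarrow> V y R \<le> C * V x r"
    using V_compare[of L] by blast
  have "\<exists>F. finite F \<and> card F \<le> nat \<lceil>C\<rceil> \<and> F \<subseteq> qball \<rho> x r \<and> qball \<rho> x r \<subseteq> (\<Union>y\<in>F. qball \<rho> y (\<epsilon> * r))"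
    if r: "0 < r" for x r
  proof -
    define s where "s = \<epsilon> * r"
    have s: "0 < s" "s \<le> r" using \<epsilon> r by (auto simp: s_def)
    define h where "h = s / (2 * K0)"
    have h: "0 < h" "h \<le> s" using s K0 by (auto simp: h_def pos_divide_le_eq)
    have Lh: "L * h = 2 * K0 * r" using \<epsilon> K0 by (simp add: L_def h_def s_def power2_eq_square)
    define sep where "sep F \<longleftrightarrow> finite F \<and> F \<subseteq> qball \<rho> x r \<and> (\<forall>y\<in>F. \<forall>z\<in>F. y \<noteq> z \<longrightarrow> s \<le> \<rho> y z)" for F
    have bound: "card F \<le> nat \<lceil>C\<rceil>" if F: "sep F" for F
    proof -
      have disj: "disjoint_family_on (\<lambda>y. qball \<rho> y h) F"
        unfolding disjoint_family_on_def
      proof (intro ballI impI)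
        fix y z assume yz: "y \<in> F" "z \<in> F" "y \<noteq> z"
        show "qball \<rho> y h \<inter> qball \<rho> z h = {}"
        proof (rule ccontr)
          assume "qball \<rho> y h \<inter> qball \<rho> z h \<noteq> {}"
          then obtain w where w: "\<rho> y w < h" "\<rho> z w < h" by (auto simp: qball_def)
          have "\<rho> y z \<le> K0 * (\<rho> y w + \<rho> w z)" by (rule rho_tri)
          also have "\<dots> < K0 * (h + h)" using w rho_sym[of w z] K0 by (intro mult_strict_left_mono) auto
          also have "\<dots> = s" using K0 by (simp add: h_def field_simps)
          finally show False using F yz by (fastforce simp: sep_def)
        qed
      qed
      have sub: "qball \<rho> y h \<subseteq> qball \<rho> x (2 * K0 * r)" if "y \<in> F" for y
      proof
        fix z assume "z \<in> qball \<rho> y h"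
        then have "\<rho> x y + \<rho> y z < r + r" using F that h s by (auto simp: sep_def qball_def)
        then have "K0 * (\<rho> x y + \<rho> y z) < K0 * (r + r)" using K0 by (intro mult_strict_left_mono) auto
        then show "z \<in> qball \<rho> x (2 * K0 * r)" using rho_tri[of x z y] by (simp add: qball_def)
      qed
      let ?V = "V x (2 * K0 * r)"
      have V0: "0 < ?V" using K0 r by (intro V_pos) simp
      have each: "?V \<le> C * V y h" if "y \<in> F" for y
      proof (rule C(2)[OF h(1)])
        show "0 < 2 * K0 * r" using K0 r by simp
        show "2 * K0 * r \<le> L * h" using Lh by simp
        have "\<rho> y x < r" using F that rho_sym[of x y] by (auto simp: sep_def qball_def)
        also have "r \<le> 2 * K0 * r" using K0 r by simp
        finally show "\<rho> y x \<le> L * h" using Lh by simp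
      qed
      have "ennreal (\<Sum>y\<in>F. V y h) = (\<Sum>y\<in>F. emeasure \<mu> (qball \<rho> y h))"
        using h V_pos[OF h(1)] by (simp add: emeasure_ball less_imp_le)
      also have "\<dots> = emeasure \<mu> (\<Union>y\<in>F. qball \<rho> y h)"
        using F disj h by (intro sum_emeasure) (auto simp: sep_def ball_sets)
      also have "\<dots> \<le> emeasure \<mu> (qball \<rho> x (2 * K0 * r))"
        using sub K0 r by (intro emeasure_mono ball_sets) auto
      also have "\<dots> = ennreal ?V" using K0 r by (intro emeasure_ball) simp
      finally have le: "(\<Sum>y\<in>F. V y h) \<le> ?V" using V0 by (simp add: ennreal_le_iff)
      have "real (card F) * ?V = (\<Sum>y\<in>F. ?V)" by simp
      also have "\<dots> \<le> (\<Sum>y\<in>F. C * V y h)" using each by (intro sum_mono)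
      also have "\<dots> \<le> C * ?V" unfolding sum_distrib_left[symmetric] using le C(1) by (intro mult_left_mono) auto
      finally have "real (card F) \<le> C" using V0 by simp
      then show ?thesis by linarith
    qed
    have "sep {}" by (simp add: sep_def)
    then obtain F where F: "sep F" "\<And>G. sep G \<Longrightarrow> card G \<le> card F"
    proof -
      have "\<forall>G. sep G \<longrightarrow> card G < Suc (nat \<lceil>C\<rceil>)" using bound by (simp add: less_Suc_eq_le)
      from ex_has_greatest_nat[of sep "{}" card, OF \<open>sep {}\<close> this] show ?thesis using that by blast
    qed
    have "qball \<rho> x r \<subseteq> (\<Union>y\<in>F. qball \<rho> y s)"
    proof (rule ccontr)
      assume "\<not> ?thesis"
      then obtain z where z: "z \<in> qball \<rho> x r" "\<And>y. y \<in> F \<Longrightarrow> s \<le> \<rho> y z"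
        by (fastforce simp: qball_def not_less)
      have "z \<notin> F" using z(2)[of z] s by auto
      moreover have "sep (insert z F)" using F(1) z rho_sym[of z] by (auto simp: sep_def)
      ultimately show False using F(2)[of "insert z F"] F(1) by (simp add: sep_def)
    qed
    then show ?thesis using F(1) bound[OF F(1)] by (intro exI[of _ F]) (simp add: sep_def s_def)
  qed
  then show thesis by (rule that)
qed

section \<open>Pairs of sets under the one-sided condition\<close>

definition W where "W E = (\<integral>\<^sup>+z\<in>E. ennreal (\<omega> z) \<partial>lam)"
definition S where "S E = (\<integral>\<^sup>+z\<in>E. ennreal (\<sigma> z) \<partial>lam)"

text \<open>The A_q product without normalisation: for two boxes of equal measure, \<open>N\<close>
  is a constant times the \<open>q\<close>-th power of that measure. Finiteness is demanded
  explicitly because \<open>enn2real\<close> would turn an infinite mass into 0.\<close>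

definition Apair :: "('a \<times> real) set \<Rightarrow> ('a \<times> real) set \<Rightarrow> real \<Rightarrow> bool" where
  "Apair E E' N \<longleftrightarrow> W E < \<infinity> \<and> S E' < \<infinity> \<and> enn2real (W E) * enn2real (S E') powr (q - 1) \<le> N"

lemma W_mono: "E \<subseteq> F \<Longrightarrow> W E \<le> W F" and S_mono: "E \<subseteq> F \<Longrightarrow> S E \<le> S F"
  unfolding W_def S_def by (auto intro!: nn_integral_mono split: split_indicator)

lemma Apair_mono:
  assumes "Apair E E' N" "F \<subseteq> E" "F' \<subseteq> E'" "N \<le> N'" shows "Apair F F' N'"
proof -
  have fin: "W E < \<infinity>" "S E' < \<infinity>" using assms(1) by (auto simp: Apair_def)
  have "enn2real (W F) * enn2real (S F') powr (q - 1) \<le> enn2real (W E) * enn2real (S E') powr (q - 1)"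
    using fin W_mono[OF assms(2)] S_mono[OF assms(3)] q
    by (intro mult_mono powr_mono2 enn2real_mono) auto
  then show ?thesis using assms fin W_mono[OF assms(2)] S_mono[OF assms(3)]
    by (auto simp: Apair_def intro: le_less_trans)
qed

lemma Holder_one:
  assumes F: "F \<in> sets lam" "emeasure lam F = ennreal f" "0 \<le> f" and fin: "W F < \<infinity>" "S F < \<infinity>"
  shows "f powr q \<le> 2 powr q * enn2real (W F) * enn2real (S F) powr (q - 1)"
proof -
  have "(\<integral>\<^sup>+z\<in>F. ennreal (1 powr q * \<omega> z) \<partial>lam) = W F" by (simp add: W_def)
  moreover have "(\<integral>\<^sup>+z\<in>F. ennreal 1 \<partial>lam) = ennreal f" using F by simp
  ultimately show ?thesis
    using weighted_Holder(2)[OF q F(1), of "\<lambda>_. 1" \<omega> \<sigma>] \<omega>_pos \<sigma>_eq fin F(3) unfolding S_def W_def by simp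
qed

text \<open>By Hoelder's inequality the dual mass of \<open>F\<close> cannot be small unless its
  \<open>\<omega>\<close>-mass is large. Inserted into the condition this bounds the
  \<open>\<omega>\<close>-mass of \<open>E\<close> by that of a part of \<open>E'\<close>: doubling
  forward in time, the link from which chains are built.\<close>

lemma Apair_double:
  assumes A: "Apair E E' N" and F: "F \<in> sets lam" "F \<subseteq> E'" "emeasure lam F = ennreal f" "0 < f" "W F < \<infinity>"
  shows "enn2real (W E) \<le> 2 powr q * N / f powr q * enn2real (W F)"
proof -
  have fin: "S E' < \<infinity>" "S F < \<infinity>" using A S_mono[OF F(2)] by (auto simp: Apair_def intro: le_less_trans)
  have "enn2real (W E) * f powr q \<le> enn2real (W E) * (2 powr q * enn2real (W F) * enn2real (S F) powr (q - 1))"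
    using Holder_one[OF F(1,3) _ F(5) fin(2)] F(4) by (intro mult_left_mono) auto
  also have "\<dots> \<le> enn2real (W E) * (2 powr q * enn2real (W F) * enn2real (S E') powr (q - 1))"
    using fin S_mono[OF F(2)] q by (intro mult_left_mono powr_mono2 enn2real_mono) auto
  also have "\<dots> = 2 powr q * enn2real (W F) * (enn2real (W E) * enn2real (S E') powr (q - 1))" by (simp add: mult_ac)
  also have "\<dots> \<le> 2 powr q * enn2real (W F) * N"
    using A by (intro mult_left_mono) (auto simp: Apair_def)
  finally show ?thesis using F(4) by (simp add: field_simps)
qed

lemma W_pos: "E \<in> sets lam \<Longrightarrow> 0 < emeasure lam E \<Longrightarrow> 0 < W E"
  and S_pos: "E \<in> sets lam \<Longrightarrow> 0 < emeasure lam E \<Longrightarrow> 0 < S E"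
  unfolding W_def S_def by (auto intro!: set_nn_integral_pos \<omega>_pos \<sigma>_pos)

text \<open>On either side the piece of largest mass represents the whole up to the factor
  \<open>n\<close>; the two factors combine to \<open>n powr q\<close>.\<close>

lemma Apair_cover:
  assumes J: "finite J" "J \<noteq> {}" "card J \<le> n" "\<And>j. j \<in> J \<Longrightarrow> A j \<in> sets lam" "E \<subseteq> (\<Union>j\<in>J. A j)"
    and J': "finite J'" "J' \<noteq> {}" "card J' \<le> n" "\<And>j. j \<in> J' \<Longrightarrow> A' j \<in> sets lam" "E' \<subseteq> (\<Union>j\<in>J'. A' j)"
    and pair: "\<And>i j. i \<in> J \<Longrightarrow> j \<in> J' \<Longrightarrow> Apair (A i) (A' j) N"
  shows "Apair E E' (real n powr q * N)"
proof -
  have fin: "W (A i) < \<infinity>" "S (A' j) < \<infinity>" if "i \<in> J" "j \<in> J'" for i j using pair[OF that] by (auto simp: Apair_def)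
  obtain i0 j0 where ij: "i0 \<in> J" "j0 \<in> J'" using J(2) J'(2) by blast
  have "W E \<le> (\<Sum>j\<in>J. W (A j))" unfolding W_def by (rule finite_cover_le[OF J(1,4,5)]) measurable
  from enn2real_sum_le[OF J(1) this _ J(2,3)] fin(1)[OF _ ij(2)]
  obtain i where i: "i \<in> J" "W E < \<infinity>" "enn2real (W E) \<le> real n * enn2real (W (A i))" by blast
  have "S E' \<le> (\<Sum>j\<in>J'. S (A' j))" unfolding S_def by (rule finite_cover_le[OF J'(1,4,5)]) measurable
  from enn2real_sum_le[OF J'(1) this _ J'(2,3)] fin(2)[OF ij(1)]
  obtain j where j: "j \<in> J'" "S E' < \<infinity>" "enn2real (S E') \<le> real n * enn2real (S (A' j))" by blast
  have "enn2real (W E) * enn2real (S E') powr (q - 1)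
      \<le> (real n * enn2real (W (A i))) * (real n * enn2real (S (A' j))) powr (q - 1)"
    using i j q by (intro mult_mono powr_mono2) auto
  also have "\<dots> = (real n * real n powr (q - 1)) * (enn2real (W (A i)) * enn2real (S (A' j)) powr (q - 1))"
    by (simp add: powr_mult mult_ac)
  also have "real n * real n powr (q - 1) = real n powr q"
    by (cases "n = 0") (use q in \<open>simp_all add: powr_diff\<close>)
  also have "real n powr q * (enn2real (W (A i)) * enn2real (S (A' j)) powr (q - 1)) \<le> real n powr q * N"
    using pair[OF i(1) j(1)] by (intro mult_left_mono) (auto simp: Apair_def)
  finally show ?thesis using i j by (simp add: Apair_def)
qed

definition box :: "'a \<Rightarrow> real \<Rightarrow> real \<Rightarrow> real \<Rightarrow> ('a \<times> real) set" where
  "box x r t h = qball \<rho> x r \<times> {t<..<t + h}"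

lemma box_sets: "0 < r \<Longrightarrow> box x r t h \<in> sets lam"
  unfolding box_def by (intro sets_parabolic_times ball_sets) auto

lemma emeasure_box: assumes "0 < r" "0 \<le> h" shows "emeasure lam (box x r t h) = ennreal (V x r * h)"
proof -
  have "emeasure lam (box x r t h) = emeasure \<mu> (qball \<rho> x r) * emeasure lebesgue {t<..<t + h}"
    unfolding box_def using assms by (intro emeasure_parabolic_times ball_sets) auto
  also have "\<dots> = ennreal (V x r) * ennreal h" using assms by (simp add: emeasure_ball)
  also have "\<dots> = ennreal (V x r * h)" using V_pos[OF assms(1), of x] by (simp add: ennreal_mult')
  finally show ?thesis .
qed

text \<open>Both boxes last \<open>a * r powr p\<close>, and their beginnings are
  \<open>b * r powr p\<close> apart. The two numbers are independent because the A_q condition and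
  the weak type estimate lead to different ones.\<close>

definition lag_cond :: "real \<Rightarrow> real \<Rightarrow> real \<Rightarrow> bool" where
  "lag_cond a b C \<longleftrightarrow> (\<forall>x t r. 0 < r \<longrightarrow>
     Apair (box x r t (a * r powr p)) (box x r (t + b * r powr p) (a * r powr p)) (C * (V x r * r powr p) powr q))"

text \<open>Halving the duration creates room: the distance of the beginnings may deviate from
  \<open>b * r powr p\<close> by half a duration in either direction. If \<open>d\<close> is too
  short, the first of the long boxes is moved back by \<open>e\<close>.\<close>

lemma lag_step:
  assumes lc: "lag_cond a b C" and r: "0 < r" and a: "0 < a"
    and d: "(b - a / 2) * r powr p \<le> d" "d \<le> (b + a / 2) * r powr p"
  shows "Apair (box x r u (a / 2 * r powr p)) (box x r (u + d) (a / 2 * r powr p)) (C * (V x r * r powr p) powr q)"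
proof -
  let ?S = "r powr p"
  define e where "e = max 0 (b * ?S - d)"
  have "Apair (box x r (u - e) (a * ?S)) (box x r (u - e + b * ?S) (a * ?S)) (C * (V x r * ?S) powr q)"
    using lc r by (auto simp: lag_cond_def)
  moreover have "box x r u (a / 2 * ?S) \<subseteq> box x r (u - e) (a * ?S)"
    using d unfolding box_def e_def by (auto simp: algebra_simps max_def)
  moreover have "box x r (u + d) (a / 2 * ?S) \<subseteq> box x r (u - e + b * ?S) (a * ?S)"
    using d unfolding box_def e_def by (auto simp: algebra_simps max_def)
  ultimately show ?thesis using Apair_mono by blast
qed

text \<open>All links but the last pass \<open>\<omega>\<close>-mass on by doubling; only the last
  one involves the dual weight.\<close>

lemma Apair_chain:
  assumes D: "1 \<le> D" and fin: "W (G 0) < \<infinity>"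
    and dbl: "\<And>i. i < m \<Longrightarrow> enn2real (W (G i)) \<le> D * enn2real (W (G (Suc i)))"
    and last: "Apair (G m) (G (Suc m)) N"
  shows "Apair (G 0) (G (Suc m)) (D ^ m * N)"
proof -
  have "enn2real (W (G 0)) \<le> D ^ k * enn2real (W (G k))" if "k \<le> m" for k
    using that
  proof (induction k)
    case (Suc k)
    then have "enn2real (W (G 0)) \<le> D ^ k * enn2real (W (G k))" by simp
    also have "\<dots> \<le> D ^ k * (D * enn2real (W (G (Suc k))))"
      using Suc D by (intro mult_left_mono dbl) auto
    finally show ?case by (simp add: algebra_simps)
  qed simp
  then have "enn2real (W (G 0)) * enn2real (S (G (Suc m))) powr (q - 1)
      \<le> (D ^ m * enn2real (W (G m))) * enn2real (S (G (Suc m))) powr (q - 1)"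
    by (intro mult_right_mono) auto
  also have "\<dots> \<le> D ^ m * N" unfolding mult.assoc using last D by (intro mult_left_mono) (auto simp: Apair_def)
  finally show ?thesis using last fin by (auto simp: Apair_def)
qed

text \<open>Here \<open>\<kappa>\<close> measures the gap between the end of the first box and the
  beginning of the second, not the distance of their beginnings.\<close>

definition wide_cond :: "real \<Rightarrow> real \<Rightarrow> real \<Rightarrow> bool" where
  "wide_cond \<Lambda> \<kappa> C \<longleftrightarrow> (\<forall>x t r. 0 < r \<longrightarrow>
     Apair (box x r t (\<Lambda> * r powr p)) (box x r (t + (\<Lambda> + \<kappa>) * r powr p) (\<Lambda> * r powr p)) (C * (V x r * r powr p) powr q))"

text \<open>Both wide boxes are covered by boxes over balls of radius \<open>\<epsilon> * r\<close>,
  every small box of the first is joined to every small box of the second by a chain that advances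
  in space and time together, and \<open>Apair_cover\<close> recombines the pairs. The time
  difference prescribes the number of steps; \<open>\<epsilon>\<close> is so small that even the
  shortest difference leaves enough steps to cross the ball.\<close>

lemma lag_imp_wide:
  assumes lc: "lag_cond a b C" and ab: "0 < a" "a < b" and \<Lambda>: "0 < \<Lambda>" "0 < \<kappa>"
  obtains C' where "0 < C'" "wide_cond \<Lambda> \<kappa> C'"
proof -
  define k where "k = max 1 Kt"
  have k: "1 \<le> k" by (simp add: k_def)
  \<comment> \<open>The ball of radius \<open>L * s\<close> around a point contains the balls of
    radius \<open>s\<close> around all points within distance \<open>k * s\<close>, so one use of
    the condition at radius \<open>L * s\<close> serves two consecutive points of a chain.\<close>
  define L where "L = K0 * (k + 1)"
  have L1: "1 \<le> L" using mult_mono[of 1 K0 1 "k + 1"] K0 k by (simp add: L_def)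
  \<comment> \<open>Two points of the ball are at distance at most \<open>2 * K0 * r\<close>, which
    accounts for \<open>2 * K0 / \<epsilon> + 1\<close> steps in space. With at least
    \<open>2 * b / a\<close> steps, rounding their number to an integer changes the time step by no
    more than \<open>lag_step\<close> tolerates.\<close>
  define A where "A = 2 * K0 + 2 + 2 * b / a"
  have A0: "0 < A" using K0 ab by (auto simp: A_def intro!: add_pos_nonneg)
  have "0 < b * L powr p" using ab L1 by simp
  then obtain \<epsilon> where \<epsilon>: "0 < \<epsilon>" "\<epsilon> \<le> 1" "b * L powr p * \<epsilon> powr p * (A / \<epsilon> + A) \<le> \<kappa>"
    using small_scale_exists[OF p \<Lambda>(2) _ A0] by blast
  \<comment> \<open>One step of a chain takes about \<open>b * \<theta> * r powr p\<close> of
    time.\<close>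
  define \<theta> where "\<theta> = (L * \<epsilon>) powr p"
  have \<theta>: "0 < \<theta>" using L1 \<epsilon> by (simp add: \<theta>_def)
  have \<theta>\<kappa>: "A / \<epsilon> + A \<le> \<kappa> / (b * \<theta>)"
    using \<epsilon>(3) \<theta> ab L1 \<epsilon> by (simp add: pos_le_divide_eq \<theta>_def powr_mult mult_ac)
  obtain CL where CL: "1 \<le> CL" "\<And>x y r R. 0 < r \<Longrightarrow> 0 < R \<Longrightarrow> R \<le> L * r \<Longrightarrow> \<rho> x y \<le> L * r \<Longrightarrow> V y R \<le> CL * V x r"
    using V_compare[of L] by blast
  obtain C2 where C2: "1 \<le> C2" "\<And>x y r R. 0 < r \<Longrightarrow> 0 < R \<Longrightarrow> R \<le> 1 * r \<Longrightarrow> \<rho> x y \<le> 1 * r \<Longrightarrow> V y R \<le> C2 * V x r"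
    using V_compare[of 1] by blast
  obtain Nn :: nat where Nn: "\<And>x r. 0 < r \<Longrightarrow> \<exists>F. finite F \<and> card F \<le> Nn \<and> F \<subseteq> qball \<rho> x r \<and>
    qball \<rho> x r \<subseteq> (\<Union>y\<in>F. qball \<rho> y (\<epsilon> * r))"
    using finite_net[OF \<epsilon>(1,2)] by blast
  define C0 where "C0 = max C 1"
  have C0: "0 < C0" "C \<le> C0" by (simp_all add: C0_def)
  define D where "D = max 1 (2 powr q * C0 * (CL * (2 / a)) powr q)"
  have D: "1 \<le> D" by (simp add: D_def)
  \<comment> \<open>\<open>M\<close> half-lengths of small boxes fill a wide box, and
    \<open>nmax\<close> bounds the number of steps for the largest time difference,
    \<open>(2 * \<Lambda> + \<kappa>) * r powr p\<close>.\<close>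
  define M where "M = nat \<lceil>4 * \<Lambda> / (a * \<theta>)\<rceil>"
  define nmax where "nmax = nat \<lceil>(2 * \<Lambda> + \<kappa>) / (b * \<theta>)\<rceil>"
  define N where "N = D ^ nmax * (C0 * (CL * (C2 * \<theta>)) powr q)"
  have N0: "0 < N" using D C0 CL C2 \<theta> by (simp add: N_def)
  define n0 where "n0 = Nn * Suc M + 1"
  have main: "Apair (box x r t (\<Lambda> * r powr p)) (box x r (t + (\<Lambda> + \<kappa>) * r powr p) (\<Lambda> * r powr p))
      (real n0 powr q * (N * (V x r * r powr p) powr q))" if r: "0 < r" for x t r
  proof -
    define s where "s = \<epsilon> * r"
    have s: "0 < s" "s \<le> r" using \<epsilon> r by (auto simp: s_def)
    define T where "T = (L * s) powr p"
    have T: "T = \<theta> * r powr p" using L1 \<epsilon> r by (simp add: T_def s_def \<theta>_def powr_mult mult_ac)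
    have T0: "0 < T" using T \<theta> r by simp
    define h where "h = a / 2 * T"
    have h0: "0 < h" using ab T0 by (simp add: h_def)
    have Ls: "0 < L * s" using L1 s by simp
    have sL: "s \<le> L * s" using L1 s by simp
    have sub: "qball \<rho> y' s \<subseteq> qball \<rho> y (L * s)" if "\<rho> y y' \<le> k * s" for y y'
    proof
      fix z assume "z \<in> qball \<rho> y' s"
      then have "\<rho> y y' + \<rho> y' z < k * s + s" using that by (simp add: qball_def)
      then have "K0 * (\<rho> y y' + \<rho> y' z) < K0 * (k * s + s)" using K0 by (intro mult_strict_left_mono) auto
      also have "\<dots> = L * s" by (simp add: L_def algebra_simps)
      finally show "z \<in> qball \<rho> y (L * s)" using rho_tri[of y z y'] by (simp add: qball_def)
    qed
    have stepA: "Apair (box y s u h) (box y' s (u + d) h) (C0 * (V y (L * s) * T) powr q)"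
      if y: "\<rho> y y' \<le> k * s" and d: "(b - a / 2) * T \<le> d" "d \<le> (b + a / 2) * T" for y y' u d
    proof (rule Apair_mono[OF lag_step[OF lc Ls ab(1)]])
      show "(b - a / 2) * (L * s) powr p \<le> d" "d \<le> (b + a / 2) * (L * s) powr p" using d by (simp_all add: T_def)
      show "box y s u h \<subseteq> box y (L * s) u (a / 2 * (L * s) powr p)"
        unfolding box_def h_def T_def using ball_mono[OF sL] by auto
      show "box y' s (u + d) h \<subseteq> box y (L * s) (u + d) (a / 2 * (L * s) powr p)"
        unfolding box_def h_def T_def using sub[OF y] by auto
      show "C * (V y (L * s) * (L * s) powr p) powr q \<le> C0 * (V y (L * s) * T) powr q"
        unfolding T_def using C0 by (intro mult_right_mono) auto
    qed
    have stepD: "enn2real (W (box y s u h)) \<le> D * enn2real (W (box y' s (u + d) h))"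
      if y: "\<rho> y y' \<le> k * s" and d: "(b - a / 2) * T \<le> d" "d \<le> (b + a / 2) * T" for y y' u d
    proof -
      \<comment> \<open>Finiteness comes from a step that starts at this very box and rests at
        \<open>y'\<close>.\<close>
      have Wf: "W (box y' s (u + d) h) < \<infinity>"
        using stepA[of y' y' d "u + d"] stepA[OF _ d, of y' y' "u + d"] k s by (auto simp: Apair_def)
      have Vp: "0 < V y' s" using s by (intro V_pos)
      have "enn2real (W (box y s u h)) \<le> 2 powr q * (C0 * (V y (L * s) * T) powr q) / (V y' s * h) powr q
          * enn2real (W (box y' s (u + d) h))"
      proof (rule Apair_double[OF stepA[OF y d]])
        show "emeasure lam (box y' s (u + d) h) = ennreal (V y' s * h)" using s h0 by (intro emeasure_box) auto
      qed (use s Vp h0 Wf box_sets in auto)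
      also have "\<dots> \<le> D * enn2real (W (box y' s (u + d) h))"
      proof (rule mult_right_mono)
        have "\<rho> y' y \<le> L * s"
        proof -
          have "k * s \<le> L * s" using s k K0 mult_mono[of 1 K0 k "k + 1"] by (intro mult_right_mono) (auto simp: L_def)
          then show ?thesis using y rho_sym[of y y'] by simp
        qed
        then have "V y (L * s) \<le> CL * V y' s" using s Ls by (intro CL(2)) auto
        then have "V y (L * s) * T \<le> CL * V y' s * T" using T0 by (intro mult_right_mono) auto
        also have "\<dots> = (CL * (2 / a)) * (V y' s * h)" using ab by (simp add: h_def)
        finally have "(V y (L * s) * T) powr q \<le> ((CL * (2 / a)) * (V y' s * h)) powr q"
          using q T0 V_pos[OF Ls, of y] by (intro powr_mono2) auto
        also have "\<dots> = (CL * (2 / a)) powr q * (V y' s * h) powr q"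
          using CL ab Vp h0 by (subst powr_mult) auto
        finally have "2 powr q * (C0 * (V y (L * s) * T) powr q) \<le> 2 powr q * (C0 * ((CL * (2 / a)) powr q * (V y' s * h) powr q))"
          using C0 by (intro mult_left_mono) auto
        also have "\<dots> = 2 powr q * C0 * (CL * (2 / a)) powr q * (V y' s * h) powr q" by simp
        also have "\<dots> \<le> D * (V y' s * h) powr q" unfolding D_def by (intro mult_right_mono) auto
        finally show "2 powr q * (C0 * (V y (L * s) * T) powr q) / (V y' s * h) powr q \<le> D"
          using Vp h0 by (simp add: pos_divide_le_eq)
      qed simp
      finally show ?thesis .
    qed
    have far: "Apair (box y s u h) (box y' s (u + l) h) (N * (V x r * r powr p) powr q)"
      if y: "y \<in> qball \<rho> x r" "y' \<in> qball \<rho> x r" and l: "\<kappa> * r powr p \<le> l" "l \<le> (2 * \<Lambda> + \<kappa>) * r powr p" for y y' u l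
    proof -
      \<comment> \<open>The least number of equal steps for which the time step
        \<open>d = l / n\<close> is at most \<open>b * T\<close>; as \<open>n\<close> is large,
        \<open>d\<close> stays above \<open>(b - a / 2) * T\<close>.\<close>
      define n where "n = nat \<lceil>l / (b * T)\<rceil>"
      have bT: "0 < b * T" using ab T0 by simp
      have rp: "0 < r powr p" using r by simp
      have l0: "0 < l" using l(1) \<Lambda> rp by (meson less_le_trans mult_pos_pos)
      have nl: "l / (b * T) \<le> real n" "real n < l / (b * T) + 1"
      proof -
        have "0 < l / (b * T)" using l0 bT by simp
        then show "l / (b * T) \<le> real n" "real n < l / (b * T) + 1" unfolding n_def by linarith+
      qed
      have "\<kappa> / (b * \<theta>) = \<kappa> * r powr p / (b * T)" using T rp by simp
      also have "\<dots> \<le> l / (b * T)" using l(1) bT by (intro divide_right_mono) auto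
      finally have nA: "A / \<epsilon> + A \<le> real n" using \<theta>\<kappa> nl(1) by linarith
      have Ae: "0 < A / \<epsilon>" "0 \<le> 2 * K0 / \<epsilon>" using A0 K0 \<epsilon> by auto
      have n_big: "2 * b / a \<le> real n" using nA Ae(1) K0 unfolding A_def by linarith
      have "\<rho> y y' / s + 1 \<le> real n"
      proof -
        have "\<rho> y y' \<le> K0 * (\<rho> y x + \<rho> x y')" by (rule rho_tri)
        also have "\<dots> \<le> K0 * (r + r)" using y K0 rho_sym[of y x] by (intro mult_left_mono) (auto simp: qball_def)
        finally have "\<rho> y y' / s \<le> 2 * K0 * r / s" using s by (intro divide_right_mono) auto
        also have "\<dots> = 2 * K0 / \<epsilon>" using r by (simp add: s_def)
        also have "\<dots> \<le> A / \<epsilon>" using \<epsilon> ab by (intro divide_right_mono) (auto simp: A_def)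
        finally have "\<rho> y y' / s \<le> A / \<epsilon>" .
        moreover have "0 \<le> 2 * b / a" using ab by simp
        then have "1 \<le> A" using K0 unfolding A_def by linarith
        ultimately show ?thesis using nA by linarith
      qed
      then obtain v where v: "v 0 = y" "v n = y'" "\<And>i. i < n \<Longrightarrow> \<rho> (v i) (v (Suc i)) \<le> k * s"
        using chain_exists[OF s(1)] unfolding k_def by blast
      have n1: "0 < n" using nl(1) l0 bT by (cases n) (auto simp: divide_le_0_iff not_le[symmetric] zero_less_divide_iff)
      define d where "d = l / real n"
      have nd: "real n * d = l" using n1 by (simp add: d_def)
      have dle: "d \<le> b * T" using nl(1) n1 bT by (simp add: d_def pos_divide_le_eq mult.commute)
      have dge: "(b - a / 2) * T \<le> d"
      proof -
        have "real n - 1 < l / (b * T)" using nl(2) by simp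
        then have "(real n - 1) * (b * T) < l" using bT by (simp only: pos_less_divide_eq)
        moreover have "b * T \<le> real n * (a / 2 * T)"
        proof -
          have "b \<le> real n * (a / 2)" using n_big ab by (simp add: pos_divide_le_eq)
          then have "b * T \<le> real n * (a / 2) * T" using T0 by (intro mult_right_mono) auto
          then show ?thesis by (simp add: mult.assoc)
        qed
        ultimately have "real n * ((b - a / 2) * T) \<le> l" by (simp add: algebra_simps)
        then show ?thesis using n1 by (simp add: d_def pos_le_divide_eq mult.commute)
      qed
      have dle': "d \<le> (b + a / 2) * T" using dle ab T0 by (simp add: algebra_simps add_increasing2)
      define B where "B = C0 * (CL * (C2 * V x r) * T) powr q"
      have tot: "C0 * (V (v i) (L * s) * T) powr q \<le> B" if i: "i < n" "V (v i) (L * s) \<le> CL * (C2 * V x r)" for i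
        unfolding B_def using i(2) C0 T0 q V_pos[OF Ls, of "v i"] by (intro mult_left_mono powr_mono2 mult_right_mono) auto
      show ?thesis
      proof -
        obtain m where m: "n = Suc m" using n1 by (cases n) auto
        have yV: "V y' s \<le> C2 * V x r"
          using y(2) s r rho_sym[of x y'] by (intro C2(2)) (auto simp: qball_def)
        have "\<rho> (v (Suc m)) (v m) \<le> L * s"
        proof -
          have "k * s \<le> L * s" using s k K0 mult_mono[of 1 K0 k "k + 1"] by (intro mult_right_mono) (auto simp: L_def)
          then show ?thesis using v(3)[of m] m rho_sym[of "v m" "v (Suc m)"] by simp
        qed
        then have "V (v m) (L * s) \<le> CL * V y' s" using s Ls v(2) m by (intro CL(2)) auto
        also have "\<dots> \<le> CL * (C2 * V x r)" using yV CL(1) by (intro mult_left_mono) auto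
        finally have Vm: "V (v m) (L * s) \<le> CL * (C2 * V x r)" .
        have last: "Apair (box (v m) s (u + real m * d) h) (box y' s (u + l) h) B"
        proof -
          have e: "u + real m * d + d = u + l" "v (Suc m) = y'" using nd m v(2) by (simp_all add: algebra_simps)
          have "m < n" using m by simp
          then have "Apair (box (v m) s (u + real m * d) h) (box (v (Suc m)) s (u + real m * d + d) h) B"
            by (intro Apair_mono[OF stepA[OF v(3) dge dle'] order_refl order_refl tot] Vm)
          then show ?thesis unfolding e .
        qed
        define G where "G i = box (v i) s (u + real i * d) h" for i
        have "Apair (G 0) (G (Suc m)) (D ^ m * B)"
        proof (rule Apair_chain[OF D])
          show "W (G 0) < \<infinity>"
            using stepA[of y y "b * T" u] ab T0 k s by (simp add: G_def v Apair_def algebra_simps)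
          show "enn2real (W (G i)) \<le> D * enn2real (W (G (Suc i)))" if "i < m" for i
          proof -
            have "i < n" using that m by simp
            from stepD[OF v(3)[OF this] dge dle', of "u + real i * d"] show ?thesis
              by (simp add: G_def algebra_simps)
          qed
          show "Apair (G m) (G (Suc m)) B" using last nd m v(2) by (simp add: G_def)
        qed
        then have pair: "Apair (box y s u h) (box y' s (u + l) h) (D ^ m * B)"
          using nd m v by (simp add: G_def)
        have "D ^ m * B \<le> D ^ nmax * B"
        proof -
          have "l / (b * T) \<le> (2 * \<Lambda> + \<kappa>) * r powr p / (b * T)" using l(2) bT by (intro divide_right_mono) auto
          also have "\<dots> = (2 * \<Lambda> + \<kappa>) / (b * \<theta>)" using T rp by simp
          finally have "n \<le> nmax" unfolding n_def nmax_def by (intro nat_mono ceiling_mono)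
          then show ?thesis using D m C0 by (intro mult_right_mono power_increasing) (auto simp: B_def)
        qed
        also have "D ^ nmax * B = N * (V x r * r powr p) powr q"
        proof -
          have "CL * (C2 * V x r) * T = (CL * (C2 * \<theta>)) * (V x r * r powr p)" by (simp add: T)
          then have "(CL * (C2 * V x r) * T) powr q = (CL * (C2 * \<theta>)) powr q * (V x r * r powr p) powr q"
            using CL C2 \<theta> V_pos[OF r, of x] rp by (simp only: powr_mult)
          then show ?thesis by (simp add: B_def N_def)
        qed
        finally show ?thesis using pair Apair_mono[OF pair order_refl order_refl] by blast
      qed
    qed
    obtain F where F: "finite F" "card F \<le> Nn" "F \<subseteq> qball \<rho> x r" "qball \<rho> x r \<subseteq> (\<Union>y\<in>F. qball \<rho> y s)"
      using Nn[OF r, of x] unfolding s_def by blast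
    define H where "H = \<Lambda> * r powr p"
    have H0: "0 < H" using \<Lambda> r by (simp add: H_def)
    have HM: "H \<le> real M * (h / 2)"
    proof -
      have "4 * \<Lambda> / (a * \<theta>) \<le> real M" unfolding M_def by linarith
      then have "4 * \<Lambda> / (a * \<theta>) * (a * \<theta> * r powr p / 4) \<le> real M * (a * \<theta> * r powr p / 4)"
        using ab \<theta> by (intro mult_right_mono) auto
      then show ?thesis using ab \<theta> by (simp add: H_def h_def T)
    qed
    define J where "J = F \<times> {j. j \<le> M \<and> real j * (h / 2) < H}"
    have xF: "F \<noteq> {}"
    proof -
      have "x \<in> qball \<rho> x r" using r by (simp add: qball_def)
      then show ?thesis using F(4) by auto
    qed
    have fj: "finite {j. j \<le> M \<and> real j * (h / 2) < H}" by (rule finite_subset[of _ "{..M}"]) auto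
    have J: "finite J" "J \<noteq> {}" "card J \<le> n0"
    proof -
      show "finite J" unfolding J_def using F(1) fj by simp
      have "(0::nat) \<in> {j. j \<le> M \<and> real j * (h / 2) < H}" using H0 by simp
      then show "J \<noteq> {}" unfolding J_def using xF by blast
      have "card {j. j \<le> M \<and> real j * (h / 2) < H} \<le> card {..M}" by (rule card_mono) auto
      then show "card J \<le> n0" unfolding J_def n0_def card_cartesian_product using F(2)
        by (simp add: mult_le_mono le_SucI del: mult_Suc_right)
    qed
    have cov: "box x r t' H \<subseteq> (\<Union>(y, j)\<in>J. box y s (t' + real j * (h / 2)) h)" for t'
    proof
      fix z assume z: "z \<in> box x r t' H"
      obtain y where y: "y \<in> F" "fst z \<in> qball \<rho> y s" using z F(4) by (auto simp: box_def)
      have "snd z \<in> {t'<..<t' + H}" using z by (auto simp: box_def)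
      then obtain j where j: "j \<in> {j. j \<le> M \<and> real j * (h / 2) < H}"
          "snd z \<in> {t' + real j * (h / 2)<..<t' + real j * (h / 2) + h}"
        using subsetD[OF interval_cover[OF h0 HM, of t']] by blast
      have "(y, j) \<in> J" using y j by (simp add: J_def)
      moreover have "z \<in> box y s (t' + real j * (h / 2)) h"
        using y j by (cases z) (simp add: box_def)
      ultimately show "z \<in> (\<Union>(y, j)\<in>J. box y s (t' + real j * (h / 2)) h)" by (intro UN_I[of "(y, j)"]) simp_all
    qed
    have "Apair (box x r t H) (box x r (t + (\<Lambda> + \<kappa>) * r powr p) H) (real n0 powr q * (N * (V x r * r powr p) powr q))"
    proof (rule Apair_cover[OF J _ cov J _ cov])
      fix i j assume ij: "i \<in> J" "j \<in> J"
      obtain y l where i: "i = (y, l)" by (cases i)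
      obtain y' l' where j: "j = (y', l')" by (cases j)
      have yl: "y \<in> qball \<rho> x r" "y' \<in> qball \<rho> x r" "real l * (h / 2) < H" "real l' * (h / 2) < H"
        using ij F(3) by (auto simp: J_def i j)
      have nn: "0 \<le> real l * (h / 2)" "0 \<le> real l' * (h / 2)" using h0 by auto
      define u where "u = t + real l * (h / 2)"
      \<comment> \<open>All offsets are nonnegative and less than
        \<open>\<Lambda> * r powr p\<close>, so the difference of the beginnings lies between
        \<open>\<kappa> * r powr p\<close> and
        \<open>(2 * \<Lambda> + \<kappa>) * r powr p\<close>.\<close>
      define lag where "lag = t + (\<Lambda> + \<kappa>) * r powr p + real l' * (h / 2) - u"
      have "Apair (box y s u h) (box y' s (u + lag) h) (N * (V x r * r powr p) powr q)"
        using nn yl unfolding lag_def u_def by (intro far) (simp_all add: H_def algebra_simps)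
      then show "Apair (case i of (y, j) \<Rightarrow> box y s (t + real j * (h / 2)) h)
          (case j of (y, j) \<Rightarrow> box y s (t + (\<Lambda> + \<kappa>) * r powr p + real j * (h / 2)) h) (N * (V x r * r powr p) powr q)"
        by (simp add: i j u_def lag_def add.assoc)
    qed (use s box_sets in \<open>auto split: prod.split\<close>)
    then show ?thesis by (simp only: H_def)
  qed
  have "wide_cond \<Lambda> \<kappa> (real n0 powr q * N)"
    unfolding wide_cond_def using main by (simp add: mult.assoc)
  moreover have "0 < n0" by (simp add: n0_def)
  then have "0 < real n0 powr q * N" using N0 by simp
  ultimately show thesis using that by blast
qed

end

section \<open>From products of averages to pairs of sets\<close>

lemma epowr_ennreal [simp]: "0 \<le> x \<Longrightarrow> epowr (ennreal x) a = ennreal (x powr a)"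
  by (simp add: epowr_def)

lemma epowr_infinity [simp]: "epowr top a = top"
  by (simp add: epowr_def)

lemma epowr_mono: "x \<le> y \<Longrightarrow> 0 \<le> a \<Longrightarrow> epowr x a \<le> epowr y a"
  by (cases x; cases y) (auto simp: powr_mono2 ennreal_leI top_unique)

lemma epowr_less_top_iff: "epowr x a < top \<longleftrightarrow> x < top"
  by (cases x) auto

lemma epowr_pos: "0 < x \<Longrightarrow> 0 < epowr x a"
  by (cases x) auto

text \<open>As both masses are positive, no product of 0 and infinity can hide an infinite mass. The
  denominators \<open>d\<close> and \<open>d powr (q - 1)\<close> combine to
  \<open>d powr q\<close>.\<close>

lemma averages_product_le_iff:
  fixes X Y :: ennreal
  assumes d: "0 < d" and pos: "0 < X" "0 < Y" and c: "0 \<le> c" and q: "1 < q"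
  shows "X / ennreal d * epowr (Y / ennreal d) (q - 1) \<le> ennreal c \<longleftrightarrow>
    X < \<infinity> \<and> Y < \<infinity> \<and> enn2real X * enn2real Y powr (q - 1) \<le> c * d powr q"
proof (cases "X < \<infinity> \<and> Y < \<infinity>")
  case True
  then obtain x y where xy: "X = ennreal x" "0 < x" "Y = ennreal y" "0 < y"
    using pos by (cases X; cases Y) auto
  have "X / ennreal d * epowr (Y / ennreal d) (q - 1) = ennreal (x / d * (y / d) powr (q - 1))"
    using xy d by (simp add: divide_ennreal ennreal_mult'[symmetric])
  also have "x / d * (y / d) powr (q - 1) = x * y powr (q - 1) / d powr q"
    using xy d by (simp add: powr_divide powr_diff)
  finally show ?thesis using xy c d by (simp add: ennreal_le_iff pos_divide_le_eq)
next
  case False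
  have "0 < X / ennreal d" "0 < Y / ennreal d"
    using pos d by (auto simp: ennreal_divide_eq_0_iff zero_less_iff_neq_zero)
  then have p: "0 < X / ennreal d" "0 < epowr (Y / ennreal d) (q - 1)" using epowr_pos by auto
  have "X = \<infinity> \<or> Y = \<infinity>" using False by (simp add: less_top[symmetric])
  then have "X / ennreal d * epowr (Y / ennreal d) (q - 1) = top"
    using p d by (auto simp: ennreal_top_divide ennreal_top_mult ennreal_mult_top)
  then have "\<not> X / ennreal d * epowr (Y / ennreal d) (q - 1) \<le> ennreal c" by (simp add: top_unique)
  then show ?thesis using False by blast
qed

context weighted_parabolic_space begin

lemma \<sigma>_conj: "\<omega> z powr (1 - conjugate_exponent q) = \<sigma> z"
proof -
  have "1 - conjugate_exponent q = -1 / (q - 1)"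
    using q by (simp add: conjugate_exponent_def divide_simps)
  then show ?thesis by (simp only: \<sigma>_def)
qed

lemma cylinder_minus_box: "cylinder_minus \<rho> p \<gamma> x t l = box x l (t - l powr p) ((1 - \<gamma>) * l powr p)"
  and cylinder_plus_box: "cylinder_plus \<rho> p \<gamma> x t l = box x l (t + \<gamma> * l powr p) ((1 - \<gamma>) * l powr p)"
  by (simp_all add: cylinder_minus_def cylinder_plus_def box_def algebra_simps)

lemma A_plus_product_iff:
  assumes \<gamma>: "0 < \<gamma>" "\<gamma> < 1" and l: "0 < l" and c: "0 \<le> c"
  shows "average lam (cylinder_minus \<rho> p \<gamma> x t l) (\<lambda>z. ennreal (\<omega> z)) *
      epowr (average lam (cylinder_plus \<rho> p \<gamma> x t l) (\<lambda>z. ennreal (\<omega> z powr (1 - conjugate_exponent q)))) (q - 1)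
      \<le> ennreal c \<longleftrightarrow>
    Apair (box x l (t - l powr p) ((1 - \<gamma>) * l powr p)) (box x l (t + \<gamma> * l powr p) ((1 - \<gamma>) * l powr p))
      (c * (V x l * ((1 - \<gamma>) * l powr p)) powr q)"
proof -
  have h: "0 < (1 - \<gamma>) * l powr p" using \<gamma> l by simp
  have m: "emeasure lam (box x l s ((1 - \<gamma>) * l powr p)) = ennreal (V x l * ((1 - \<gamma>) * l powr p))" for s
    using emeasure_box[OF l, of "(1 - \<gamma>) * l powr p" x s] h by simp
  have d: "0 < V x l * ((1 - \<gamma>) * l powr p)" using V_pos[OF l] h by simp
  have pos: "0 < W (box x l s ((1 - \<gamma>) * l powr p))" "0 < S (box x l s ((1 - \<gamma>) * l powr p))" for s
    using d by (auto intro!: W_pos S_pos box_sets l simp: m)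
  show ?thesis
    unfolding average_def cylinder_minus_box cylinder_plus_box \<sigma>_conj m
      W_def[symmetric] S_def[symmetric] averages_product_le_iff[OF d pos c q] Apair_def ..
qed

text \<open>The lower part of a cylinder begins at \<open>t - l powr p\<close> and the upper one at
  \<open>t + \<gamma> * l powr p\<close>, so the beginnings are
  \<open>(1 + \<gamma>) * l powr p\<close> apart.\<close>

lemma A_plus_imp_lag:
  assumes \<gamma>: "0 < \<gamma>" "\<gamma> < 1" and A: "\<omega> \<in> A_plus \<rho> \<mu> p q \<gamma>"
  obtains C where "lag_cond (1 - \<gamma>) (1 + \<gamma>) C"
proof -
  define B where "B = (SUP (x, t, l) \<in> UNIV \<times> UNIV \<times> {0<..}.
          average lam (cylinder_minus \<rho> p \<gamma> x t l) (\<lambda>z. ennreal (\<omega> z)) *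
          epowr (average lam (cylinder_plus \<rho> p \<gamma> x t l)
                   (\<lambda>z. ennreal (\<omega> z powr (1 - conjugate_exponent q)))) (q - 1))"
  have "B < \<infinity>" using A by (simp add: A_plus_def B_def)
  then obtain c where c: "0 \<le> c" "B = ennreal c" by (cases B) auto
  have "Apair (box x l t ((1 - \<gamma>) * l powr p)) (box x l (t + (1 + \<gamma>) * l powr p) ((1 - \<gamma>) * l powr p))
      (c * (1 - \<gamma>) powr q * (V x l * l powr p) powr q)" if l: "0 < l" for x t l
  proof -
    have "average lam (cylinder_minus \<rho> p \<gamma> x (t + l powr p) l) (\<lambda>z. ennreal (\<omega> z)) *
      epowr (average lam (cylinder_plus \<rho> p \<gamma> x (t + l powr p) l) (\<lambda>z. ennreal (\<omega> z powr (1 - conjugate_exponent q)))) (q - 1)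
      \<le> ennreal c"
      unfolding c(2)[symmetric] B_def using l by (intro SUP_upper2[of "(x, t + l powr p, l)"]) auto
    then have "Apair (box x l (t + l powr p - l powr p) ((1 - \<gamma>) * l powr p))
        (box x l (t + l powr p + \<gamma> * l powr p) ((1 - \<gamma>) * l powr p)) (c * (V x l * ((1 - \<gamma>) * l powr p)) powr q)"
      by (simp only: A_plus_product_iff[OF \<gamma> l c(1)])
    moreover have "(V x l * ((1 - \<gamma>) * l powr p)) powr q = (1 - \<gamma>) powr q * (V x l * l powr p) powr q"
      using V_pos[OF l, of x] \<gamma> by (subst powr_mult[symmetric]) (auto simp: mult_ac)
    ultimately show ?thesis by (simp add: algebra_simps)
  qed
  then show thesis using that unfolding lag_cond_def by blast
qed

text \<open>The gap between the two parts of a cylinder extends from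
  \<open>t - \<gamma> * l powr p\<close> to \<open>t + \<gamma> * l powr p\<close>.\<close>

lemma wide_imp_A_plus:
  assumes \<gamma>: "0 < \<gamma>" "\<gamma> < 1" and w: "wide_cond (1 - \<gamma>) (2 * \<gamma>) C" and C: "0 < C"
  shows "\<omega> \<in> A_plus \<rho> \<mu> p q \<gamma>"
proof -
  define c where "c = C / (1 - \<gamma>) powr q"
  have c: "0 \<le> c" using C by (simp add: c_def)
  have "average lam (cylinder_minus \<rho> p \<gamma> x t l) (\<lambda>z. ennreal (\<omega> z)) *
      epowr (average lam (cylinder_plus \<rho> p \<gamma> x t l) (\<lambda>z. ennreal (\<omega> z powr (1 - conjugate_exponent q)))) (q - 1)
      \<le> ennreal c" if l: "0 < l" for x t l
  proof -
    have "Apair (box x l (t - l powr p) ((1 - \<gamma>) * l powr p))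
      (box x l (t - l powr p + (1 - \<gamma> + 2 * \<gamma>) * l powr p) ((1 - \<gamma>) * l powr p)) (C * (V x l * l powr p) powr q)"
      using w l unfolding wide_cond_def by blast
    moreover have "t - l powr p + (1 - \<gamma> + 2 * \<gamma>) * l powr p = t + \<gamma> * l powr p" by (simp add: algebra_simps)
    moreover have "C * (V x l * l powr p) powr q = c * (V x l * ((1 - \<gamma>) * l powr p)) powr q"
    proof -
      have "(V x l * ((1 - \<gamma>) * l powr p)) powr q = (1 - \<gamma>) powr q * (V x l * l powr p) powr q"
        using V_pos[OF l, of x] \<gamma> by (subst powr_mult[symmetric]) (auto simp: mult_ac)
      then show ?thesis using \<gamma> by (simp add: c_def)
    qed
    ultimately show ?thesis unfolding A_plus_product_iff[OF \<gamma> l c] by (simp only:)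
  qed
  then have "(SUP (x, t, l) \<in> UNIV \<times> UNIV \<times> {0<..}.
          average lam (cylinder_minus \<rho> p \<gamma> x t l) (\<lambda>z. ennreal (\<omega> z)) *
          epowr (average lam (cylinder_plus \<rho> p \<gamma> x t l)
                   (\<lambda>z. ennreal (\<omega> z powr (1 - conjugate_exponent q)))) (q - 1)) \<le> ennreal c"
    by (intro SUP_least) auto
  then have "(SUP (x, t, l) \<in> UNIV \<times> UNIV \<times> {0<..}.
          average lam (cylinder_minus \<rho> p \<gamma> x t l) (\<lambda>z. ennreal (\<omega> z)) *
          epowr (average lam (cylinder_plus \<rho> p \<gamma> x t l)
                   (\<lambda>z. ennreal (\<omega> z powr (1 - conjugate_exponent q)))) (q - 1)) < \<infinity>"
    by (rule le_less_trans) simp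
  then show ?thesis using weight by (simp add: A_plus_def)
qed

end

section \<open>Testing the weak type estimate\<close>

locale weighted_parabolic_dyadic_space = weighted_parabolic_space \<rho> K0 p q \<mu> \<omega>
  for \<rho> :: "'a \<Rightarrow> 'a \<Rightarrow> real" and K0 p q :: real and \<mu> :: "'a measure" and \<omega> :: "'a \<times> real \<Rightarrow> real" +
  fixes \<delta> c0 C0 :: real and K :: nat and I :: "nat \<Rightarrow> int \<Rightarrow> 'i set"
    and zc :: "nat \<Rightarrow> int \<Rightarrow> 'i \<Rightarrow> 'a" and Q :: "nat \<Rightarrow> int \<Rightarrow> 'i \<Rightarrow> 'a set"
  assumes adj: "adjacent_dyadic_systems \<rho> K0 \<mu> \<delta> c0 C0 K I zc Q"
begin

definition "c1 = c0 / (3 * K0\<^sup>2)"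
definition "C1 = 2 * K0 * C0"

lemma \<delta>: "0 < \<delta>" "\<delta> < 1" "96 * K0 ^ 6 * \<delta> \<le> 1" and c0: "0 < c0" "c0 \<le> C0"
  using adj by (auto simp: adjacent_dyadic_systems_def Let_def)

lemma c1_pos: "0 < c1" and C1_pos: "0 < C1"
  using c0 K0 by (auto simp: c1_def C1_def)

lemma cube_sets: "\<tau> \<in> {1..K} \<Longrightarrow> \<alpha> \<in> I \<tau> k \<Longrightarrow> Q \<tau> k \<alpha> \<in> sets \<mu>"
  and centres_separated: "\<tau> \<in> {1..K} \<Longrightarrow> \<alpha> \<in> I \<tau> k \<Longrightarrow> \<beta> \<in> I \<tau> k \<Longrightarrow> \<alpha> \<noteq> \<beta> \<Longrightarrow>
    c0 * \<delta> powi k \<le> \<rho> (zc \<tau> k \<alpha>) (zc \<tau> k \<beta>)"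
  and cubes_nested: "\<tau> \<in> {1..K} \<Longrightarrow> k \<le> l \<Longrightarrow> \<alpha> \<in> I \<tau> k \<Longrightarrow> \<beta> \<in> I \<tau> l \<Longrightarrow>
    Q \<tau> l \<beta> \<subseteq> Q \<tau> k \<alpha> \<or> Q \<tau> l \<beta> \<inter> Q \<tau> k \<alpha> = {}"
  and cubes_cover: "\<tau> \<in> {1..K} \<Longrightarrow> (\<Union>\<alpha>\<in>I \<tau> k. Q \<tau> k \<alpha>) = UNIV"
  and cubes_disjoint: "\<tau> \<in> {1..K} \<Longrightarrow> disjoint_family_on (Q \<tau> k) (I \<tau> k)"
  and ball_in_cube: "\<tau> \<in> {1..K} \<Longrightarrow> \<alpha> \<in> I \<tau> k \<Longrightarrow> qball \<rho> (zc \<tau> k \<alpha>) (c1 * \<delta> powi k) \<subseteq> Q \<tau> k \<alpha>"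
  and cube_in_ball: "\<tau> \<in> {1..K} \<Longrightarrow> \<alpha> \<in> I \<tau> k \<Longrightarrow> Q \<tau> k \<alpha> \<subseteq> qball \<rho> (zc \<tau> k \<alpha>) (C1 * \<delta> powi k)"
proof -
  note * = adj[unfolded adjacent_dyadic_systems_def Let_def, folded c1_def C1_def]
  note A = *[THEN conjunct2, THEN conjunct2, THEN conjunct2, THEN conjunct2, THEN conjunct2, THEN conjunct2,
      THEN conjunct1, THEN bspec]
  note A1 = A[THEN conjunct1] and A2 = A[THEN conjunct2, THEN conjunct1]
    and A3 = A[THEN conjunct2, THEN conjunct2, THEN conjunct2, THEN conjunct1]
    and A4 = A[THEN conjunct2, THEN conjunct2, THEN conjunct2, THEN conjunct2, THEN conjunct1]
    and A5 = A[THEN conjunct2, THEN conjunct2, THEN conjunct2, THEN conjunct2, THEN conjunct2, THEN conjunct1]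
  show "\<tau> \<in> {1..K} \<Longrightarrow> \<alpha> \<in> I \<tau> k \<Longrightarrow> Q \<tau> k \<alpha> \<in> sets \<mu>" by (drule A1) simp
  show "\<tau> \<in> {1..K} \<Longrightarrow> \<alpha> \<in> I \<tau> k \<Longrightarrow> \<beta> \<in> I \<tau> k \<Longrightarrow> \<alpha> \<noteq> \<beta> \<Longrightarrow>
    c0 * \<delta> powi k \<le> \<rho> (zc \<tau> k \<alpha>) (zc \<tau> k \<beta>)" by (drule A2) simp
  show "\<tau> \<in> {1..K} \<Longrightarrow> k \<le> l \<Longrightarrow> \<alpha> \<in> I \<tau> k \<Longrightarrow> \<beta> \<in> I \<tau> l \<Longrightarrow>
    Q \<tau> l \<beta> \<subseteq> Q \<tau> k \<alpha> \<or> Q \<tau> l \<beta> \<inter> Q \<tau> k \<alpha> = {}" by (drule A3) simp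
  show "\<tau> \<in> {1..K} \<Longrightarrow> (\<Union>\<alpha>\<in>I \<tau> k. Q \<tau> k \<alpha>) = UNIV" by (drule A4) simp
  show "\<tau> \<in> {1..K} \<Longrightarrow> disjoint_family_on (Q \<tau> k) (I \<tau> k)" by (drule A4) simp
  show "\<tau> \<in> {1..K} \<Longrightarrow> \<alpha> \<in> I \<tau> k \<Longrightarrow> qball \<rho> (zc \<tau> k \<alpha>) (c1 * \<delta> powi k) \<subseteq> Q \<tau> k \<alpha>"
    by (drule A5) simp
  show "\<tau> \<in> {1..K} \<Longrightarrow> \<alpha> \<in> I \<tau> k \<Longrightarrow> Q \<tau> k \<alpha> \<subseteq> qball \<rho> (zc \<tau> k \<alpha>) (C1 * \<delta> powi k)"
    by (drule A5) simp
qed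

lemma cube_around_ball: "\<exists>Cs>0. \<forall>x. \<forall>r>0. \<exists>\<tau>\<in>{1..K}. \<exists>k. \<exists>\<alpha>\<in>I \<tau> k.
    qball \<rho> x r \<subseteq> Q \<tau> k \<alpha> \<and> qdiam \<rho> (Q \<tau> k \<alpha>) \<le> ennreal (Cs * r)"
  using adj[unfolded adjacent_dyadic_systems_def Let_def] by (elim conjE)

definition dside :: "int \<Rightarrow> real" where "dside k = \<delta> powr (of_int k * p)"

lemma dside_eq: "dside k = (\<delta> powi k) powr p"
  using \<delta> by (simp add: dside_def powr_powr powr_real_of_int'[symmetric])

lemma \<delta>_powi_pos: "0 < \<delta> powi k" using \<delta> by simp

lemma dside_pos: "0 < dside k" using \<delta> by (simp add: dside_def)

lemma centre_in_cube: "\<tau> \<in> {1..K} \<Longrightarrow> \<alpha> \<in> I \<tau> k \<Longrightarrow> zc \<tau> k \<alpha> \<in> Q \<tau> k \<alpha>"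
  using ball_in_cube[of \<tau> \<alpha> k] c1_pos \<delta>_powi_pos[of k] by (auto simp: qball_def)

lemma cube_measure:
  assumes "\<tau> \<in> {1..K}" "\<alpha> \<in> I \<tau> k"
  shows "emeasure \<mu> (Q \<tau> k \<alpha>) = ennreal (measure \<mu> (Q \<tau> k \<alpha>))"
    and "V (zc \<tau> k \<alpha>) (c1 * \<delta> powi k) \<le> measure \<mu> (Q \<tau> k \<alpha>)"
    and "measure \<mu> (Q \<tau> k \<alpha>) \<le> V (zc \<tau> k \<alpha>) (C1 * \<delta> powi k)"
    and "0 < measure \<mu> (Q \<tau> k \<alpha>)"
proof -
  have r: "0 < c1 * \<delta> powi k" "0 < C1 * \<delta> powi k" using c1_pos C1_pos \<delta>_powi_pos[of k] by auto
  have up: "emeasure \<mu> (Q \<tau> k \<alpha>) \<le> ennreal (V (zc \<tau> k \<alpha>) (C1 * \<delta> powi k))"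
    using emeasure_mono[OF cube_in_ball[OF assms] ball_sets[OF r(2)]] by (simp add: emeasure_ball[OF r(2)])
  have low: "ennreal (V (zc \<tau> k \<alpha>) (c1 * \<delta> powi k)) \<le> emeasure \<mu> (Q \<tau> k \<alpha>)"
    using emeasure_mono[OF ball_in_cube[OF assms] cube_sets[OF assms]] by (simp add: emeasure_ball[OF r(1)])
  have "emeasure \<mu> (Q \<tau> k \<alpha>) < \<infinity>" using up by (rule le_less_trans) simp
  then show e: "emeasure \<mu> (Q \<tau> k \<alpha>) = ennreal (measure \<mu> (Q \<tau> k \<alpha>))"
    by (simp add: emeasure_eq_ennreal_measure less_top)
  show 1: "V (zc \<tau> k \<alpha>) (c1 * \<delta> powi k) \<le> measure \<mu> (Q \<tau> k \<alpha>)"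
    using low unfolding e by (simp add: ennreal_le_iff)
  show "measure \<mu> (Q \<tau> k \<alpha>) \<le> V (zc \<tau> k \<alpha>) (C1 * \<delta> powi k)"
    using up V_pos[OF r(2), of "zc \<tau> k \<alpha>"] unfolding e by (simp add: ennreal_le_iff)
  show "0 < measure \<mu> (Q \<tau> k \<alpha>)" using V_pos[OF r(1), of "zc \<tau> k \<alpha>"] 1 by linarith
qed

text \<open>What is given is a bound for the diameter of the cube, not for its generation. The cube
  contains a ball of radius \<open>c1 * \<delta> powi k\<close>, whose diameter is bounded below by
  \<open>annulus_point\<close>, so \<open>\<delta> powi k\<close> is not too large; and it contains
  the given ball, so \<open>\<delta> powi k\<close> is not too small.\<close>

lemma comparable_cube:
  obtains \<kappa>1 \<kappa>2 Cv where "0 < \<kappa>1" "0 < \<kappa>2" "0 < Cv"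
    "\<And>x r. 0 < r \<Longrightarrow> \<exists>\<tau>\<in>{1..K}. \<exists>k. \<exists>\<alpha>\<in>I \<tau> k. qball \<rho> x r \<subseteq> Q \<tau> k \<alpha> \<and>
      \<kappa>1 * r powr p \<le> dside k \<and> dside k \<le> \<kappa>2 * r powr p \<and> measure \<mu> (Q \<tau> k \<alpha>) \<le> Cv * V x r"
proof -
  obtain Cs where Cs: "0 < Cs" "\<And>x r. 0 < r \<Longrightarrow> \<exists>\<tau>\<in>{1..K}. \<exists>k. \<exists>\<alpha>\<in>I \<tau> k.
      qball \<rho> x r \<subseteq> Q \<tau> k \<alpha> \<and> qdiam \<rho> (Q \<tau> k \<alpha>) \<le> ennreal (Cs * r)"
    using cube_around_ball by blast
  define A2 where "A2 = 2 * Kt * Cs / c1"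
  define A1 where "A1 = 4 * Kt * K0 * C1"
  have A: "0 < A2" "0 < A1" using Cs Kt c1_pos C1_pos K0 by (auto simp: A1_def A2_def)
  obtain Cv where Cv: "1 \<le> Cv" "\<And>x y r R. 0 < r \<Longrightarrow> 0 < R \<Longrightarrow> R \<le> C1 * A2 * r \<Longrightarrow> \<rho> x y \<le> C1 * A2 * r \<Longrightarrow> V y R \<le> Cv * V x r"
    using V_compare[of "C1 * A2"] by blast
  have "\<exists>\<tau>\<in>{1..K}. \<exists>k. \<exists>\<alpha>\<in>I \<tau> k. qball \<rho> x r \<subseteq> Q \<tau> k \<alpha> \<and>
      (1 / A1) powr p * r powr p \<le> dside k \<and> dside k \<le> A2 powr p * r powr p \<and> measure \<mu> (Q \<tau> k \<alpha>) \<le> Cv * V x r"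
    if r: "0 < r" for x r
  proof -
    obtain \<tau> k \<alpha> where i: "\<tau> \<in> {1..K}" "\<alpha> \<in> I \<tau> k" "qball \<rho> x r \<subseteq> Q \<tau> k \<alpha>" "qdiam \<rho> (Q \<tau> k \<alpha>) \<le> ennreal (Cs * r)"
      using Cs(2)[OF r] by blast
    let ?z = "zc \<tau> k \<alpha>" and ?d = "\<delta> powi k"
    have d: "0 < ?d" by (rule \<delta>_powi_pos)
    have "?d \<le> A2 * r"
    proof -
      obtain u where u: "c1 * ?d / (2 * Kt) \<le> \<rho> u ?z" "\<rho> u ?z \<le> Kt * (c1 * ?d / (2 * Kt))"
        using annulus_point[of "c1 * ?d / (2 * Kt)" ?z] c1_pos d Kt by auto
      have "Kt * (c1 * ?d / (2 * Kt)) < c1 * ?d" using Kt c1_pos d by simp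
      then have "u \<in> Q \<tau> k \<alpha>" using u(2) ball_in_cube[OF i(1,2)] rho_sym[of u ?z] by (auto simp: qball_def)
      then have "ennreal (\<rho> u ?z) \<le> qdiam \<rho> (Q \<tau> k \<alpha>)"
        unfolding qdiam_def using centre_in_cube[OF i(1,2)] by (intro SUP_upper2[of "(u, ?z)"]) auto
      then have "ennreal (\<rho> u ?z) \<le> ennreal (Cs * r)" using i(4) by (rule order_trans)
      then have "\<rho> u ?z \<le> Cs * r" using Cs r by (simp add: ennreal_le_iff)
      then have "c1 * ?d / (2 * Kt) \<le> Cs * r" using u(1) by linarith
      then show ?thesis using Kt c1_pos by (simp add: A2_def field_simps)
    qed
    moreover have "r \<le> A1 * ?d"
    proof -
      obtain u where u: "r / (2 * Kt) \<le> \<rho> u x" "\<rho> u x \<le> Kt * (r / (2 * Kt))"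
        using annulus_point[of "r / (2 * Kt)" x] r Kt by auto
      have "Kt * (r / (2 * Kt)) < r" using Kt r by simp
      then have "u \<in> qball \<rho> x r" "x \<in> qball \<rho> x r" using u(2) r rho_sym[of u x] by (auto simp: qball_def)
      then have "u \<in> qball \<rho> ?z (C1 * ?d)" "x \<in> qball \<rho> ?z (C1 * ?d)"
        using i(3) cube_in_ball[OF i(1,2)] by blast+
      then have "\<rho> ?z u < C1 * ?d" "\<rho> ?z x < C1 * ?d" by (simp_all add: qball_def)
      then have "K0 * (\<rho> u ?z + \<rho> ?z x) \<le> K0 * (2 * (C1 * ?d))"
        using K0 rho_sym[of u ?z] by (intro mult_left_mono) auto
      then have "r / (2 * Kt) \<le> K0 * (2 * (C1 * ?d))" using u(1) rho_tri[of u x ?z] by linarith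
      then show ?thesis using Kt by (simp add: A1_def field_simps)
    qed
    moreover have "measure \<mu> (Q \<tau> k \<alpha>) \<le> Cv * V x r"
    proof -
      have "x \<in> Q \<tau> k \<alpha>" using i(3) r by (auto simp: qball_def)
      then have xz: "\<rho> x ?z < C1 * ?d" using cube_in_ball[OF i(1,2)] rho_sym[of x ?z] by (auto simp: qball_def)
      have le: "C1 * ?d \<le> C1 * A2 * r" using \<open>?d \<le> A2 * r\<close> C1_pos by (simp add: mult.assoc)
      have "V ?z (C1 * ?d) \<le> Cv * V x r"
        using xz le by (intro Cv(2)[OF r mult_pos_pos[OF C1_pos d] le]) linarith
      then show ?thesis using cube_measure(3)[OF i(1,2)] by linarith
    qed
    moreover have "(1 / A1) powr p * r powr p = (r / A1) powr p" using A r by (simp add: powr_mult[symmetric])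
    moreover have "A2 powr p * r powr p = (A2 * r) powr p" using A r by (simp add: powr_mult)
    ultimately have "qball \<rho> x r \<subseteq> Q \<tau> k \<alpha> \<and> (1 / A1) powr p * r powr p \<le> dside k \<and>
        dside k \<le> A2 powr p * r powr p \<and> measure \<mu> (Q \<tau> k \<alpha>) \<le> Cv * V x r"
      using i(3) A r d p unfolding dside_eq by (auto intro!: powr_mono2 simp: pos_divide_le_eq mult.commute)
    then show ?thesis using i(1,2) by blast
  qed
  then show thesis using that[of "(1 / A1) powr p" "A2 powr p" Cv] A Cv(1) by auto
qed

end

lemma epowr_0 [simp]: "epowr 0 a = 0"
  by (simp add: epowr_def)

context weighted_parabolic_dyadic_space begin

definition cbox :: "nat \<Rightarrow> int \<Rightarrow> 'i \<Rightarrow> real \<Rightarrow> real \<Rightarrow> ('a \<times> real) set" where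
  "cbox \<tau> k \<alpha> t h = Q \<tau> k \<alpha> \<times> {t<..<t + h}"

lemma cbox_sets: "\<tau> \<in> {1..K} \<Longrightarrow> \<alpha> \<in> I \<tau> k \<Longrightarrow> cbox \<tau> k \<alpha> t h \<in> sets lam"
  unfolding cbox_def by (intro sets_parabolic_times cube_sets) auto

lemma emeasure_cbox:
  assumes "\<tau> \<in> {1..K}" "\<alpha> \<in> I \<tau> k" "0 \<le> h"
  shows "emeasure lam (cbox \<tau> k \<alpha> t h) = ennreal (measure \<mu> (Q \<tau> k \<alpha>) * h)"
proof -
  have "emeasure lam (cbox \<tau> k \<alpha> t h) = emeasure \<mu> (Q \<tau> k \<alpha>) * emeasure lebesgue {t<..<t + h}"
    unfolding cbox_def using assms by (intro emeasure_parabolic_times cube_sets) auto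
  also have "\<dots> = ennreal (measure \<mu> (Q \<tau> k \<alpha>)) * ennreal h"
    using assms cube_measure(1)[OF assms(1,2)] by simp
  also have "\<dots> = ennreal (measure \<mu> (Q \<tau> k \<alpha>) * h)" by (rule ennreal_mult'[symmetric]) simp
  finally show ?thesis .
qed

lemma rectangle_plus_cbox:
  "rectangle_plus p \<delta> Q \<gamma> \<tau> k \<alpha> t = cbox \<tau> k \<alpha> (t + \<gamma> * dside k) ((1 - \<gamma>) * dside k)"
  by (simp add: rectangle_plus_def cbox_def dside_def algebra_simps)

text \<open>Almost everywhere \<open>\<sigma> z powr q * \<omega> z = \<sigma> z\<close>, so the
  norm of the truncated dual weight is again governed by its integral. The truncation makes it
  admissible before \<open>\<sigma>\<close> is known to be locally integrable.\<close>

lemma truncated_norm: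
  assumes "E \<in> sets lam"
  shows "(\<integral>\<^sup>+z. epowr (ennreal \<bar>\<sigma> z * indicator (E \<inter> {z. \<sigma> z \<le> N}) z\<bar>) q * ennreal (\<omega> z) \<partial>lam)
    = (\<integral>\<^sup>+z. ennreal (\<sigma> z * indicator (E \<inter> {z. \<sigma> z \<le> N}) z) \<partial>lam)"
proof (rule nn_integral_cong_AE)
  show "AE z in lam. epowr (ennreal \<bar>\<sigma> z * indicator (E \<inter> {z. \<sigma> z \<le> N}) z\<bar>) q * ennreal (\<omega> z)
      = ennreal (\<sigma> z * indicator (E \<inter> {z. \<sigma> z \<le> N}) z)"
    using \<omega>_pos
  proof eventually_elim
    case (elim z)
    have s0: "0 \<le> \<sigma> z" by (simp add: \<sigma>_def)
    show ?case
    proof (cases "z \<in> E \<inter> {z. \<sigma> z \<le> N}")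
      case True
      have "\<sigma> z powr q * \<omega> z = \<omega> z powr (-1 / (q - 1) * q) * \<omega> z powr 1"
        using elim by (simp add: \<sigma>_def powr_powr)
      also have "\<dots> = \<omega> z powr (-1 / (q - 1) * q + 1)" by (rule powr_add[symmetric])
      also have "-1 / (q - 1) * q + 1 = -1 / (q - 1)" using q by (simp add: divide_simps)
      finally have "\<sigma> z powr q * \<omega> z = \<sigma> z" by (simp add: \<sigma>_def)
      then show ?thesis using True s0 by (simp add: ennreal_mult'[symmetric])
    next
      case False
      then have "indicator (E \<inter> {z. \<sigma> z \<le> N}) z = (0 :: real)" by simp
      then show ?thesis using q by (simp only:) simp
    qed
  qed
qed

text \<open>The bounds on \<open>d\<close>, with margins \<open>(1 - \<gamma>) / 4\<close>, say that
  for every point of the first box the upper part of the rectangle at that point contains the second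
  box. Hence the maximal function of the truncated dual weight is large on the entire first
  box.\<close>

lemma weak_local_estimate:
  assumes \<gamma>: "0 < \<gamma>" "\<gamma> < 1" and c: "0 < c"
    and weak: "\<And>f. f \<in> Lq_space lam \<omega> q \<Longrightarrow>
      weak_Lq_norm lam \<omega> q (parabolic_maximal \<mu> p \<delta> K I Q \<gamma> f) \<le> ennreal c * Lq_norm lam \<omega> q (\<lambda>z. ennreal \<bar>f z\<bar>)"
    and i: "\<tau> \<in> {1..K}" "\<alpha> \<in> I \<tau> k"
    and d: "(\<gamma> + (1 - \<gamma>) / 4) * dside k \<le> d" "d \<le> (1 - (1 - \<gamma>) / 4) * dside k"
  shows "Apair (cbox \<tau> k \<alpha> t ((1 - \<gamma>) / 4 * dside k)) (cbox \<tau> k \<alpha> (t + d) ((1 - \<gamma>) / 4 * dside k))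
    ((2 * c * (1 - \<gamma>) * (measure \<mu> (Q \<tau> k \<alpha>) * dside k)) powr q)"
proof -
  define a where "a = (1 - \<gamma>) / 4"
  define R where "R = dside k"
  define m where "m = measure \<mu> (Q \<tau> k \<alpha>) * ((1 - \<gamma>) * R)"
  define E where "E = cbox \<tau> k \<alpha> t (a * R)"
  define E' where "E' = cbox \<tau> k \<alpha> (t + d) (a * R)"
  have R: "0 < R" by (simp add: R_def dside_pos)
  have a: "0 < a" "a < 1" using \<gamma> by (auto simp: a_def)
  have m: "0 < m" using cube_measure(4)[OF i] \<gamma> R by (simp add: m_def)
  have E_sets: "E \<in> sets lam" and E'_sets [measurable]: "E' \<in> sets lam"
    by (simp_all add: E_def E'_def cbox_sets[OF i])
  have E'_fin: "emeasure lam E' < \<infinity>"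
    unfolding E'_def using a R by (subst emeasure_cbox[OF i]) auto
  have "0 < emeasure lam E" "0 < emeasure lam E'"
    unfolding E_def E'_def using a R cube_measure(4)[OF i] by (auto simp: emeasure_cbox[OF i])
  then have pos: "0 < W E" "0 < S E'" using E_sets E'_sets by (auto intro: W_pos S_pos)
  define f where "f N z = \<sigma> z * indicator (E' \<inter> {z. \<sigma> z \<le> N}) z" for N :: real and z
  define F where "F N = (\<integral>\<^sup>+z. ennreal (f N z) \<partial>lam)" for N
  have s0: "0 \<le> \<sigma> z" for z by (simp add: \<sigma>_def)
  have f0: "0 \<le> f N z" for N z using s0 by (simp add: f_def)
  have f_meas [measurable]: "f N \<in> borel_measurable lam" for N
  proof -
    have "E' \<inter> {z. \<sigma> z \<le> N} = E' \<inter> {z \<in> space lam. \<sigma> z \<le> N}" by (simp add: space_lam)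
    then have "E' \<inter> {z. \<sigma> z \<le> N} \<in> sets lam" by simp
    then show ?thesis unfolding f_def[abs_def] by measurable
  qed
  have F_fin: "F N < \<infinity>" if "0 \<le> N" for N
  proof -
    have "F N \<le> (\<integral>\<^sup>+z. ennreal N * indicator E' z \<partial>lam)"
      unfolding F_def using that by (intro nn_integral_mono) (auto simp: f_def ennreal_leI split: split_indicator)
    also have "\<dots> < \<infinity>" using E'_fin E'_sets by (simp add: nn_integral_cmult_indicator ennreal_mult_less_top)
    finally show ?thesis .
  qed
  have norm: "(\<integral>\<^sup>+z. epowr (ennreal \<bar>f N z\<bar>) q * ennreal (\<omega> z) \<partial>lam) = F N" for N
    unfolding f_def F_def by (rule truncated_norm[OF E'_sets])
  have key: "W E < \<infinity>" "enn2real (W E) * enn2real (F N) powr (q - 1) \<le> (2 * c * m) powr q"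
    if N: "0 \<le> N" "0 < F N" for N
  proof -
    obtain x where x: "0 < x" "F N = ennreal x" using F_fin[OF N(1)] N(2) by (cases "F N") auto
    have mem: "f N \<in> Lq_space lam \<omega> q"
      unfolding Lq_space_def Lq_norm_def using norm[of N] x by simp
    \<comment> \<open>Half of the lower bound for the average, because the weak norm asks for a
      strict inequality.\<close>
    define \<xi> where "\<xi> = x / (2 * m)"
    have \<xi>: "0 < \<xi>" using x m by (simp add: \<xi>_def)
    have low: "ennreal \<xi> < parabolic_maximal \<mu> p \<delta> K I Q \<gamma> (f N) z" if z: "z \<in> E" for z
    proof -
      obtain y s where ys: "z = (y, s)" by (cases z)
      have y: "y \<in> Q \<tau> k \<alpha>" and s: "t < s" "s < t + a * R" using z by (auto simp: ys E_def cbox_def)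
      have sub: "E' \<subseteq> rectangle_plus p \<delta> Q \<gamma> \<tau> k \<alpha> s"
        unfolding rectangle_plus_cbox E'_def cbox_def R_def[symmetric]
        using s d unfolding R_def[symmetric] a_def[symmetric] by (auto simp: algebra_simps)
      have em: "emeasure lam (rectangle_plus p \<delta> Q \<gamma> \<tau> k \<alpha> s) = ennreal m"
        unfolding rectangle_plus_cbox using \<gamma> R by (subst emeasure_cbox[OF i]) (auto simp: m_def R_def)
      have "ennreal x = F N" using x by simp
      also have "\<dots> \<le> (\<integral>\<^sup>+z\<in>rectangle_plus p \<delta> Q \<gamma> \<tau> k \<alpha> s. ennreal \<bar>f N z\<bar> \<partial>lam)"
        unfolding F_def using sub f0 by (intro nn_integral_mono) (auto simp: f_def split: split_indicator)
      finally have "ennreal x / ennreal m \<le> average lam (rectangle_plus p \<delta> Q \<gamma> \<tau> k \<alpha> s) (\<lambda>z. ennreal \<bar>f N z\<bar>)"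
        unfolding average_def em by (rule divide_right_mono_ennreal)
      also have "\<dots> \<le> parabolic_maximal \<mu> p \<delta> K I Q \<gamma> (f N) z"
        unfolding parabolic_maximal_def ys using i y by (auto intro!: SUP_upper2[of "(\<tau>, k, \<alpha>)"])
      finally have "ennreal (x / m) \<le> parabolic_maximal \<mu> p \<delta> K I Q \<gamma> (f N) z"
        using x m by (simp add: divide_ennreal)
      moreover have "ennreal \<xi> < ennreal (x / m)" using x m \<xi> unfolding \<xi>_def by (intro ennreal_lessI) (auto simp: divide_simps)
      ultimately show ?thesis by (rule less_le_trans[rotated])
    qed
    have "ennreal \<xi> * epowr (W E) (1 / q) \<le> ennreal \<xi> * epowr
        (\<integral>\<^sup>+z\<in>{z. ennreal \<xi> < parabolic_maximal \<mu> p \<delta> K I Q \<gamma> (f N) z}. ennreal (\<omega> z) \<partial>lam) (1 / q)"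
      unfolding W_def using low q
      by (intro mult_left_mono epowr_mono nn_integral_mono) (auto split: split_indicator)
    also have "\<dots> \<le> weak_Lq_norm lam \<omega> q (parabolic_maximal \<mu> p \<delta> K I Q \<gamma> (f N))"
      unfolding weak_Lq_norm_def using \<xi> by (intro SUP_upper) auto
    also have "\<dots> \<le> ennreal c * epowr (ennreal x) (1 / q)"
      using weak[OF mem] unfolding Lq_norm_def norm x(2) .
    also have "\<dots> = ennreal (c * x powr (1 / q))" using x c by (simp add: ennreal_mult')
    finally have le: "ennreal \<xi> * epowr (W E) (1 / q) \<le> ennreal (c * x powr (1 / q))" .
    show Wfin: "W E < \<infinity>"
    proof (rule ccontr)
      assume "\<not> ?thesis"
      then have "W E = top" by (simp add: less_top[symmetric])
      then have "ennreal \<xi> * epowr (W E) (1 / q) = top" using \<xi> by (simp add: ennreal_mult_top)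
      then show False using le by (simp add: top_unique)
    qed
    then obtain w where w: "0 \<le> w" "W E = ennreal w" by (cases "W E") auto
    have "ennreal (\<xi> * w powr (1 / q)) \<le> ennreal (c * x powr (1 / q))"
      using le w \<xi> by (simp add: ennreal_mult')
    then have "\<xi> * w powr (1 / q) \<le> c * x powr (1 / q)" using c by (simp add: ennreal_le_iff)
    then have "(\<xi> * w powr (1 / q)) powr q \<le> (c * x powr (1 / q)) powr q"
      using \<xi> q by (intro powr_mono2) auto
    then have "\<xi> powr q * w \<le> c powr q * x" using \<xi> w c x q by (simp add: powr_mult powr_powr)
    then have "x powr q * w \<le> (2 * m) powr q * (c powr q * x)"
      using x m unfolding \<xi>_def by (simp add: powr_divide pos_divide_le_eq mult.commute)
    also have "x powr q = x powr (q - 1) * x" using x by (simp add: powr_diff)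
    \<comment> \<open>The truncated mass \<open>x\<close> occurs on both sides and cancels, being
      finite and positive.\<close>
    finally have "x * (w * x powr (q - 1)) \<le> x * ((2 * m) powr q * c powr q)" by (simp add: mult_ac)
    then have "w * x powr (q - 1) \<le> (2 * m) powr q * c powr q" using x by simp
    also have "\<dots> = (2 * c * m) powr q" using m c by (subst powr_mult[symmetric]) (auto simp: mult_ac)
    finally show "enn2real (W E) * enn2real (F N) powr (q - 1) \<le> (2 * c * m) powr q" using w x by simp
  qed
  \<comment> \<open>The bound does not depend on the level of truncation, so it passes to the full
    dual weight by monotone convergence.\<close>
  have SE: "S E' = (SUP N::nat. F (real N))"
  proof -
    have "S E' = (\<integral>\<^sup>+z. (SUP N::nat. ennreal (f (real N) z)) \<partial>lam)"
      unfolding S_def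
    proof (rule nn_integral_cong)
      fix z
      show "ennreal (\<sigma> z) * indicator E' z = (SUP N::nat. ennreal (f (real N) z))"
      proof (rule antisym)
        obtain N :: nat where "\<sigma> z \<le> real N" using real_arch_simple by blast
        then show "ennreal (\<sigma> z) * indicator E' z \<le> (SUP N::nat. ennreal (f (real N) z))"
          by (intro SUP_upper2[of N]) (auto simp: f_def split: split_indicator)
        show "(SUP N::nat. ennreal (f (real N) z)) \<le> ennreal (\<sigma> z) * indicator E' z"
          by (intro SUP_least) (auto simp: f_def split: split_indicator)
      qed
    qed
    also have "\<dots> = (SUP N::nat. F (real N))"
      unfolding F_def
    proof (rule nn_integral_monotone_convergence_SUP)
      show "incseq (\<lambda>N z. ennreal (f (real N) z))"
        using s0 by (auto simp: f_def incseq_def le_fun_def ennreal_leI split: split_indicator)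
    qed measurable
    finally show ?thesis .
  qed
  obtain N0 :: nat where N0: "0 < F (real N0)" using pos(2) unfolding SE less_SUP_iff by blast
  have WE: "W E < \<infinity>" by (rule key(1)[OF _ N0]) simp
  define w where "w = enn2real (W E)"
  have w: "0 < w" using WE pos(1) by (simp add: w_def enn2real_positive_iff)
  define B where "B = ((2 * c * m) powr q / w) powr (1 / (q - 1))"
  have Fle: "F (real N) \<le> ennreal B" for N :: nat
  proof (cases "0 < F (real N)")
    case True
    obtain x where x: "0 \<le> x" "F (real N) = ennreal x" using F_fin[of "real N"] by (cases "F (real N)") auto
    have "w * x powr (q - 1) \<le> (2 * c * m) powr q" using key(2)[OF _ True] x by (simp add: w_def)
    then have "x powr (q - 1) \<le> (2 * c * m) powr q / w" using w by (simp add: pos_le_divide_eq mult.commute)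
    then have "(x powr (q - 1)) powr (1 / (q - 1)) \<le> B" unfolding B_def using q by (intro powr_mono2) auto
    then have "x \<le> B" using x q by (simp add: powr_powr)
    then show ?thesis using x by (simp add: ennreal_leI)
  qed (auto simp: not_less)
  then have SB: "S E' \<le> ennreal B" unfolding SE by (rule SUP_least)
  then have "enn2real (S E') \<le> B" by (intro enn2real_leI) (auto simp: B_def)
  then have "enn2real (S E') powr (q - 1) \<le> B powr (q - 1)" using q by (intro powr_mono2) auto
  also have "\<dots> = (2 * c * m) powr q / w" using q w by (simp add: B_def powr_powr)
  finally have "w * enn2real (S E') powr (q - 1) \<le> (2 * c * m) powr q"
    using w by (simp add: pos_le_divide_eq mult.commute)
  moreover have "S E' < \<infinity>" using SB by (rule le_less_trans) simp
  moreover have "2 * c * m = 2 * c * (1 - \<gamma>) * (measure \<mu> (Q \<tau> k \<alpha>) * R)" by (simp add: m_def)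
  ultimately have "Apair E E' ((2 * c * (1 - \<gamma>) * (measure \<mu> (Q \<tau> k \<alpha>) * R)) powr q)"
    using WE unfolding Apair_def w_def by simp
  then show ?thesis unfolding E_def E'_def a_def R_def .
qed

text \<open>The time side of a cube around a ball is known only up to the constants
  \<open>\<kappa>1\<close> and \<open>\<kappa>2\<close>, whereas one \<open>b\<close> has to serve
  all balls. Chains of boxes over one and the same cube make up for this: a step may take anything
  between \<open>d1\<close> and \<open>d2\<close> sides, so every sufficiently long time splits into
  equal admissible steps.\<close>

lemma weak_imp_lag:
  assumes \<gamma>: "0 < \<gamma>" "\<gamma> < 1"
    and weak: "bounded_Lq_weak_Lq lam \<omega> q (parabolic_maximal \<mu> p \<delta> K I Q \<gamma>)"
  obtains a b C where "0 < a" "a < b" "lag_cond a b C"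
proof -
  obtain c' :: real where c': "\<And>f. f \<in> Lq_space lam \<omega> q \<Longrightarrow>
      weak_Lq_norm lam \<omega> q (parabolic_maximal \<mu> p \<delta> K I Q \<gamma> f) \<le> ennreal c' * Lq_norm lam \<omega> q (\<lambda>z. ennreal \<bar>f z\<bar>)"
    using weak by (auto simp: bounded_Lq_weak_Lq_def)
  define c where "c = max c' 1"
  have c: "0 < c" by (simp add: c_def)
  have wk: "weak_Lq_norm lam \<omega> q (parabolic_maximal \<mu> p \<delta> K I Q \<gamma> f) \<le> ennreal c * Lq_norm lam \<omega> q (\<lambda>z. ennreal \<bar>f z\<bar>)"
    if "f \<in> Lq_space lam \<omega> q" for f
    by (rule order_trans[OF c'[OF that] mult_right_mono]) (auto simp: c_def intro: ennreal_leI)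
  obtain \<kappa>1 \<kappa>2 Cv where \<kappa>: "0 < \<kappa>1" "0 < \<kappa>2" "0 < Cv"
    and cube: "\<And>x r. 0 < r \<Longrightarrow> \<exists>\<tau>\<in>{1..K}. \<exists>k. \<exists>\<alpha>\<in>I \<tau> k. qball \<rho> x r \<subseteq> Q \<tau> k \<alpha> \<and>
      \<kappa>1 * r powr p \<le> dside k \<and> dside k \<le> \<kappa>2 * r powr p \<and> measure \<mu> (Q \<tau> k \<alpha>) \<le> Cv * V x r"
    using comparable_cube by blast
  define a0 where "a0 = (1 - \<gamma>) / 4"
  define d1 where "d1 = \<gamma> + a0"
  define d2 where "d2 = 1 - a0"
  have a0: "0 < a0" "a0 < d2" "0 < d1" "d1 < d2" 
  proof -
    have "\<gamma> = 1 - 4 * a0" unfolding a0_def by (simp add: field_simps)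
    then have "0 < a0" "a0 < 1 / 4" "d1 = 1 - 3 * a0" using \<gamma> by (simp_all add: d1_def)
    then show "0 < a0" "a0 < d2" "0 < d1" "d1 < d2" by (simp_all add: d2_def)
  qed
  \<comment> \<open>From \<open>n \<ge> d2 / (d2 - d1)\<close> it follows that
    \<open>(n - 1) * d2 \<ge> n * d1\<close>, so rounding the number of steps up does not make them
    shorter than \<open>d1\<close> sides.\<close>
  define nmin where "nmin = d2 / (d2 - d1)"
  have nmin: "0 < nmin" using a0 by (simp add: nmin_def)
  define a where "a = a0 * \<kappa>1"
  \<comment> \<open>Large enough that at least \<open>nmin\<close> steps are made even when the side
    is as long as \<open>\<kappa>2 * r powr p\<close>.\<close>
  define b where "b = (\<kappa>1 + \<kappa>2) * d2 * (nmin + 1)"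
  have a: "0 < a" using a0 \<kappa> by (simp add: a_def)
  have ab: "a < b"
  proof -
    have "a0 * \<kappa>1 < d2 * (\<kappa>1 + \<kappa>2)" using a0 \<kappa> by (intro mult_strict_mono) auto
    also have "d2 * (\<kappa>1 + \<kappa>2) * 1 \<le> d2 * (\<kappa>1 + \<kappa>2) * (nmin + 1)"
      using nmin a0 \<kappa> by (intro mult_left_mono) auto
    then have "d2 * (\<kappa>1 + \<kappa>2) \<le> d2 * (\<kappa>1 + \<kappa>2) * (nmin + 1)" by simp
    finally show ?thesis by (simp add: a_def b_def mult_ac)
  qed
  define D where "D = max 1 (2 powr q * (2 * c * (1 - \<gamma>)) powr q / a0 powr q)"
  define M where "M = nat \<lceil>b / (d2 * \<kappa>1)\<rceil>"
  define C where "C = D ^ M * (2 * c * (1 - \<gamma>) * (Cv * \<kappa>2)) powr q"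
  have "Apair (box x r t (a * r powr p)) (box x r (t + b * r powr p) (a * r powr p)) (C * (V x r * r powr p) powr q)"
    if r: "0 < r" for x t r
  proof -
    obtain \<tau> k \<alpha> where i: "\<tau> \<in> {1..K}" "\<alpha> \<in> I \<tau> k" "qball \<rho> x r \<subseteq> Q \<tau> k \<alpha>"
      "\<kappa>1 * r powr p \<le> dside k" "dside k \<le> \<kappa>2 * r powr p" "measure \<mu> (Q \<tau> k \<alpha>) \<le> Cv * V x r"
      using cube[OF r] by blast
    define R where "R = dside k"
    have R: "0 < R" by (simp add: R_def dside_pos)
    have rp: "0 < r powr p" using r by simp
    define mR where "mR = measure \<mu> (Q \<tau> k \<alpha>) * R"
    have mR: "0 < mR" using cube_measure(4)[OF i(1,2)] R by (simp add: mR_def)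
    define l where "l = b * r powr p"
    have b0: "0 < b" using a ab by simp
    have l0: "0 < l" using b0 rp by (simp add: l_def)
    have d2R: "0 < d2 * R" using a0 R by simp
    define n where "n = nat \<lceil>l / (d2 * R)\<rceil>"
    have nl: "l / (d2 * R) \<le> real n" "real n < l / (d2 * R) + 1"
    proof -
      have "0 < l / (d2 * R)" using l0 d2R by simp
      then show "l / (d2 * R) \<le> real n" "real n < l / (d2 * R) + 1" unfolding n_def by linarith+
    qed
    have n_big: "nmin \<le> real n"
    proof -
      have "R \<le> (\<kappa>1 + \<kappa>2) * r powr p" using i(5) \<kappa> rp unfolding R_def distrib_right by (simp add: add_increasing)
      then have "nmin * (d2 * R) \<le> nmin * (d2 * ((\<kappa>1 + \<kappa>2) * r powr p))"
        using nmin a0 by (intro mult_left_mono) auto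
      also have "\<dots> \<le> (nmin + 1) * (d2 * ((\<kappa>1 + \<kappa>2) * r powr p))"
        using a0 \<kappa> rp by (intro mult_right_mono) auto
      also have "\<dots> = l" by (simp add: l_def b_def mult_ac)
      finally have "nmin \<le> l / (d2 * R)" using d2R by (simp only: pos_le_divide_eq)
      then show ?thesis using nl(1) by linarith
    qed
    have n0: "0 < n" using n_big nmin by (cases n) auto
    define d where "d = l / real n"
    have nd: "real n * d = l" using n0 by (simp add: d_def)
    have dle: "d \<le> d2 * R" using nl(1) n0 d2R by (simp add: d_def pos_divide_le_eq mult.commute)
    have dge: "d1 * R \<le> d"
    proof -
      have "real n - 1 < l / (d2 * R)" using nl(2) by simp
      then have 1: "(real n - 1) * (d2 * R) < l" using d2R by (simp only: pos_less_divide_eq)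
      have "d2 \<le> real n * (d2 - d1)" using n_big a0 by (simp add: nmin_def pos_divide_le_eq)
      then have "d2 * R \<le> real n * (d2 - d1) * R" using R by (intro mult_right_mono) auto
      then have "real n * (d1 * R) \<le> l" using 1 by (simp add: algebra_simps)
      then show ?thesis using n0 by (simp add: d_def pos_le_divide_eq mult.commute)
    qed
    have step: "Apair (cbox \<tau> k \<alpha> u (a0 * R)) (cbox \<tau> k \<alpha> (u + d) (a0 * R)) ((2 * c * (1 - \<gamma>) * mR) powr q)" for u
      using weak_local_estimate[OF \<gamma> c wk i(1,2), of d u] dge dle
      unfolding a0_def[symmetric] R_def[symmetric] mR_def d1_def d2_def by simp
    have Wf: "W (cbox \<tau> k \<alpha> u (a0 * R)) < \<infinity>" for u using step[of u] by (simp add: Apair_def)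
    have dbl: "enn2real (W (cbox \<tau> k \<alpha> u (a0 * R))) \<le> D * enn2real (W (cbox \<tau> k \<alpha> (u + d) (a0 * R)))" for u
    proof -
      have "emeasure lam (cbox \<tau> k \<alpha> (u + d) (a0 * R)) = ennreal (a0 * mR)"
        using a0 R by (subst emeasure_cbox[OF i(1,2)]) (auto simp: mR_def mult_ac)
      then have "enn2real (W (cbox \<tau> k \<alpha> u (a0 * R))) \<le> 2 powr q * (2 * c * (1 - \<gamma>) * mR) powr q / (a0 * mR) powr q
          * enn2real (W (cbox \<tau> k \<alpha> (u + d) (a0 * R)))"
        using a0 mR Wf by (intro Apair_double[OF step cbox_sets[OF i(1,2)]]) auto
      also have "2 powr q * (2 * c * (1 - \<gamma>) * mR) powr q / (a0 * mR) powr q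
          = 2 powr q * (2 * c * (1 - \<gamma>)) powr q / a0 powr q"
        using a0 mR c \<gamma> by (simp add: powr_mult)
      also have "\<dots> * enn2real (W (cbox \<tau> k \<alpha> (u + d) (a0 * R))) \<le> D * enn2real (W (cbox \<tau> k \<alpha> (u + d) (a0 * R)))"
        unfolding D_def by (intro mult_right_mono) auto
      finally show ?thesis .
    qed
    obtain j where j: "n = Suc j" using n0 by (cases n) auto
    define G where "G i = cbox \<tau> k \<alpha> (t + real i * d) (a0 * R)" for i
    have "Apair (G 0) (G (Suc j)) (D ^ j * (2 * c * (1 - \<gamma>) * mR) powr q)"
    proof (rule Apair_chain)
      show "1 \<le> D" by (simp add: D_def)
      show "W (G 0) < \<infinity>" unfolding G_def by (rule Wf)
      show "enn2real (W (G i)) \<le> D * enn2real (W (G (Suc i)))" for i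
        using dbl[of "t + real i * d"] by (simp add: G_def algebra_simps)
      show "Apair (G j) (G (Suc j)) ((2 * c * (1 - \<gamma>) * mR) powr q)"
        using step[of "t + real j * d"] by (simp add: G_def algebra_simps)
    qed
    then have pair: "Apair (cbox \<tau> k \<alpha> t (a0 * R)) (cbox \<tau> k \<alpha> (t + l) (a0 * R)) (D ^ j * (2 * c * (1 - \<gamma>) * mR) powr q)"
      using nd j by (simp add: G_def)
    show ?thesis
    proof (rule Apair_mono[OF pair])
      have aR: "a * r powr p \<le> a0 * R" using i(4) a0 unfolding a_def R_def by (simp add: mult.assoc)
      show "box x r t (a * r powr p) \<subseteq> cbox \<tau> k \<alpha> t (a0 * R)"
        "box x r (t + b * r powr p) (a * r powr p) \<subseteq> cbox \<tau> k \<alpha> (t + l) (a0 * R)"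
        using i(3) aR by (auto simp: box_def cbox_def l_def)
      have "D ^ j \<le> D ^ M"
      proof (rule power_increasing)
        have "l / (d2 * R) \<le> b / (d2 * \<kappa>1)"
        proof -
          have "l * (d2 * \<kappa>1) \<le> b * (d2 * R)"
            using i(4) b0 a0 unfolding l_def R_def by (simp add: mult_ac)
          moreover have "0 < d2 * \<kappa>1" using a0 \<kappa> by simp
          ultimately show ?thesis using d2R
            by (simp only: pos_divide_le_eq times_divide_eq_left pos_le_divide_eq)
        qed
        then have "n \<le> M" unfolding n_def M_def by (intro nat_mono ceiling_mono)
        then show "j \<le> M" using j by simp
      qed (simp add: D_def)
      moreover have "(2 * c * (1 - \<gamma>) * mR) powr q \<le> (2 * c * (1 - \<gamma>) * (Cv * \<kappa>2)) powr q * (V x r * r powr p) powr q"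
      proof -
        have "mR \<le> (Cv * V x r) * (\<kappa>2 * r powr p)"
          unfolding mR_def R_def using i(5,6) dside_pos[of k] \<kappa> V_pos[OF r, of x] by (intro mult_mono) auto
        then have "2 * c * (1 - \<gamma>) * mR \<le> 2 * c * (1 - \<gamma>) * ((Cv * V x r) * (\<kappa>2 * r powr p))"
          using c \<gamma> by (intro mult_left_mono) auto
        then have "(2 * c * (1 - \<gamma>) * mR) powr q \<le> (2 * c * (1 - \<gamma>) * ((Cv * V x r) * (\<kappa>2 * r powr p))) powr q"
          using c \<gamma> mR q by (intro powr_mono2) auto
        also have "2 * c * (1 - \<gamma>) * ((Cv * V x r) * (\<kappa>2 * r powr p)) = (2 * c * (1 - \<gamma>) * (Cv * \<kappa>2)) * (V x r * r powr p)"
          by (simp add: mult_ac)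
        also have "\<dots> powr q = (2 * c * (1 - \<gamma>) * (Cv * \<kappa>2)) powr q * (V x r * r powr p) powr q"
          by (rule powr_mult)
        finally show ?thesis .
      qed
      ultimately show "D ^ j * (2 * c * (1 - \<gamma>) * mR) powr q \<le> C * (V x r * r powr p) powr q"
        unfolding C_def mult.assoc by (intro mult_mono) (auto simp: D_def mult.assoc)
    qed
  qed
  then have "lag_cond a b C" unfolding lag_cond_def by blast
  then show thesis using that a ab by blast
qed

end

section \<open>Weak and strong norms of functions that need not be measurable\<close>

lemma epowr_SUP_le:
  assumes a: "0 < a" and le: "\<And>i. i \<in> A \<Longrightarrow> epowr (g i) a \<le> b"
  shows "epowr (SUP i\<in>A. g i) a \<le> b"
proof (cases b)
  case (real y)
  have "g i \<le> ennreal (y powr (1 / a))" if "i \<in> A" for i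
  proof (cases "g i")
    case (real x)
    have "ennreal (x powr a) \<le> ennreal y" using le[OF that] real \<open>b = ennreal y\<close> by simp
    then have "x powr a \<le> y" using \<open>0 \<le> y\<close> by (simp add: ennreal_le_iff)
    then have "(x powr a) powr (1 / a) \<le> y powr (1 / a)" using a by (intro powr_mono2) auto
    then show ?thesis using real a by (simp add: powr_powr ennreal_leI)
  next
    case top
    then show ?thesis using le[OF that] real by (simp add: top_unique)
  qed
  then have "(SUP i\<in>A. g i) \<le> ennreal (y powr (1 / a))" by (rule SUP_least)
  then have "epowr (SUP i\<in>A. g i) a \<le> epowr (ennreal (y powr (1 / a))) a" using a by (intro epowr_mono) auto
  also have "\<dots> = ennreal y" using a real by (simp add: powr_powr)
  finally show ?thesis using real by simp
qed simp

lemma epowr_cmult: "0 \<le> c \<Longrightarrow> x < \<infinity> \<Longrightarrow> epowr (ennreal c * x) a = ennreal (c powr a) * epowr x a"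
  by (cases x) (auto simp: ennreal_mult'[symmetric] powr_mult)

text \<open>The integral is a supremum over simple functions below the integrand, so this half of
  homogeneity holds for every integrand. It is applied to level sets of the maximal function, whose
  measurability is not established.\<close>

lemma nn_integral_cmult_ge: "ennreal c * (\<integral>\<^sup>+z. f z \<partial>M) \<le> (\<integral>\<^sup>+z. ennreal c * f z \<partial>M)"
proof -
  have "ennreal c * (\<integral>\<^sup>+z. f z \<partial>M) = (SUP g\<in>{g. simple_function M g \<and> g \<le> f}. ennreal c * integral\<^sup>S M g)"
    unfolding nn_integral_def by (rule SUP_mult_left_ennreal)
  also have "\<dots> \<le> (\<integral>\<^sup>+z. ennreal c * f z \<partial>M)"
  proof (rule SUP_least)
    fix g assume "g \<in> {g. simple_function M g \<and> g \<le> f}"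
    then have g: "simple_function M g" "g \<le> f" by auto
    have "ennreal c * integral\<^sup>S M g = (\<integral>\<^sup>+z. ennreal c * g z \<partial>M)"
      using g(1) by (simp add: nn_integral_eq_simple_integral[symmetric] nn_integral_cmult borel_measurable_simple_function)
    also have "\<dots> \<le> (\<integral>\<^sup>+z. ennreal c * f z \<partial>M)"
      using g(2) by (intro nn_integral_mono mult_left_mono) (auto simp: le_fun_def)
    finally show "ennreal c * integral\<^sup>S M g \<le> (\<integral>\<^sup>+z. ennreal c * f z \<partial>M)" .
  qed
  finally show ?thesis .
qed

text \<open>The function \<open>g\<close> need not be measurable, in which case the integrals are lower integrals.\<close>

lemma weak_Lq_norm_le:
  assumes q: "0 < q" shows "weak_Lq_norm M \<omega> q g \<le> Lq_norm M \<omega> q g"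
  unfolding weak_Lq_norm_def Lq_norm_def
proof (rule SUP_least)
  fix \<xi> :: real assume "\<xi> \<in> {0<..}"
  then have \<xi>: "0 < \<xi>" by simp
  let ?X = "\<integral>\<^sup>+z\<in>{z. ennreal \<xi> < g z}. ennreal (\<omega> z) \<partial>M"
  have "ennreal (\<xi> powr q) * ?X \<le> (\<integral>\<^sup>+z. ennreal (\<xi> powr q) * (ennreal (\<omega> z) * indicator {z. ennreal \<xi> < g z} z) \<partial>M)"
    by (rule nn_integral_cmult_ge)
  also have "\<dots> \<le> (\<integral>\<^sup>+z. epowr (g z) q * ennreal (\<omega> z) \<partial>M)"
  proof (rule nn_integral_mono)
    fix z
    show "ennreal (\<xi> powr q) * (ennreal (\<omega> z) * indicator {z. ennreal \<xi> < g z} z) \<le> epowr (g z) q * ennreal (\<omega> z)"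
    proof (cases "ennreal \<xi> < g z")
      case True
      then have "epowr (ennreal \<xi>) q \<le> epowr (g z) q" using q by (intro epowr_mono) auto
      then show ?thesis using True \<xi> by (simp add: mult_right_mono)
    qed simp
  qed
  finally have le: "ennreal (\<xi> powr q) * ?X \<le> (\<integral>\<^sup>+z. epowr (g z) q * ennreal (\<omega> z) \<partial>M)" .
  have "ennreal \<xi> * epowr ?X (1 / q) \<le> epowr (ennreal (\<xi> powr q) * ?X) (1 / q)"
  proof (cases "?X < \<infinity>")
    case True
    then show ?thesis using q \<xi> by (simp add: epowr_cmult powr_powr)
  next
    case False
    then have "?X = top" by (simp add: less_top[symmetric])
    then show ?thesis using \<xi> by (simp add: ennreal_mult_top)
  qed
  also have "\<dots> \<le> epowr (\<integral>\<^sup>+z. epowr (g z) q * ennreal (\<omega> z) \<partial>M) (1 / q)"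
    using le q by (intro epowr_mono) auto
  finally show "ennreal \<xi> * epowr ?X (1 / q) \<le> epowr (\<integral>\<^sup>+z. epowr (g z) q * ennreal (\<omega> z) \<partial>M) (1 / q)" .
qed

lemma bounded_Lq_imp_weak:
  assumes "0 < q" "bounded_Lq_Lq M \<omega> q T" shows "bounded_Lq_weak_Lq M \<omega> q T"
  using assms(2) order_trans[OF weak_Lq_norm_le[OF assms(1)]]
  unfolding bounded_Lq_Lq_def bounded_Lq_weak_Lq_def by blast

context weighted_parabolic_dyadic_space begin

section \<open>The parabolic maximal function\<close>

text \<open>\<open>2 powi (- gexp \<theta> k)\<close> is the largest power of two not exceeding
  \<open>\<theta> * dside k\<close>; the rounding costs less than a factor 2.\<close>

definition gexp :: "real \<Rightarrow> int \<Rightarrow> int" where "gexp \<theta> k = \<lceil>- log 2 (\<theta> * dside k)\<rceil>"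

lemma gside_bounds:
  assumes "0 < \<theta>"
  shows "\<theta> * dside k / 2 < 2 powi (- gexp \<theta> k)" "2 powi (- gexp \<theta> k) \<le> \<theta> * dside k"
proof -
  let ?X = "\<theta> * dside k"
  have X: "0 < ?X" using assms dside_pos by simp
  have e: "(2 :: real) powi (- gexp \<theta> k) = 2 powr (- of_int (gexp \<theta> k))"
    using powr_real_of_int'[of 2 "- gexp \<theta> k"] by simp
  have "- log 2 ?X \<le> of_int (gexp \<theta> k)" "of_int (gexp \<theta> k) < - log 2 ?X + 1"
    unfolding gexp_def by linarith+
  then have b: "- of_int (gexp \<theta> k) \<le> log 2 ?X" "log 2 ?X - 1 < - of_int (gexp \<theta> k)" by linarith+
  have "2 powr (- of_int (gexp \<theta> k)) \<le> 2 powr (log 2 ?X)" using b(1) by (intro powr_mono) auto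
  then show "2 powi (- gexp \<theta> k) \<le> ?X" using X e by simp
  have "2 powr (log 2 ?X - 1) < 2 powr (- of_int (gexp \<theta> k))" using b(2) by (intro powr_less_mono) auto
  then show "?X / 2 < 2 powi (- gexp \<theta> k)" using X e by (simp add: powr_diff)
qed

text \<open>The smallness of \<open>\<delta>\<close> makes the time sides at least halve from one
  generation to the next, which survives the rounding as strict monotonicity of
  \<open>gexp\<close>.\<close>

lemma dside_Suc: "dside (k + 1) = \<delta> powr p * dside k" and \<delta>_powr_le: "\<delta> powr p \<le> 1 / 2"
proof -
  show "dside (k + 1) = \<delta> powr p * dside k"
  proof -
    have "of_int (k + 1) * p = p + of_int k * p" by (simp add: distrib_right)
    then show ?thesis unfolding dside_def by (simp only: powr_add)
  qed
  have "1 ^ 6 \<le> K0 ^ 6" using K0 by (intro power_mono) auto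
  then have "96 * 1 * \<delta> \<le> 96 * K0 ^ 6 * \<delta>" using \<delta>(1) by (intro mult_right_mono) auto
  then have "\<delta> \<le> 1 / 2" using \<delta>(1,3) by linarith
  moreover have "\<delta> powr p \<le> \<delta> powr 1" using p \<delta> by (intro powr_mono') auto
  ultimately show "\<delta> powr p \<le> 1 / 2" using \<delta>(1) by simp
qed

text \<open>The centres of one generation are separated, and a ball is covered by finitely many
  balls too small to contain two of them.\<close>

lemma countable_cubes: assumes \<tau>: "\<tau> \<in> {1..K}" shows "countable (I \<tau> k)"
proof -
  let ?d = "\<delta> powi k"
  have d: "0 < ?d" by (rule \<delta>_powi_pos)
  define x0 :: 'a where "x0 = undefined"
  define J where "J n = {\<alpha> \<in> I \<tau> k. zc \<tau> k \<alpha> \<in> qball \<rho> x0 (real (Suc n))}" for n :: nat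
  have "finite (J n)" for n
  proof -
    define r where "r = real (Suc n)"
    have r: "0 < r" by (simp add: r_def)
    define \<epsilon> where "\<epsilon> = min 1 (c0 * ?d / (2 * K0 * r))"
    have \<epsilon>: "0 < \<epsilon>" "\<epsilon> \<le> 1" using c0 d K0 r by (auto simp: \<epsilon>_def)
    have "\<epsilon> \<le> c0 * ?d / (2 * K0 * r)" by (simp add: \<epsilon>_def)
    then have sr: "K0 * (\<epsilon> * r + \<epsilon> * r) \<le> c0 * ?d" using K0 r by (simp add: pos_le_divide_eq mult_ac)
    obtain F where F: "finite F" "qball \<rho> x0 r \<subseteq> (\<Union>y\<in>F. qball \<rho> y (\<epsilon> * r))"
    proof (rule finite_net[OF \<epsilon>])
      fix N :: nat
      assume "\<And>x r. 0 < r \<Longrightarrow> \<exists>F. finite F \<and> card F \<le> N \<and> F \<subseteq> qball \<rho> x r \<and>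
        qball \<rho> x r \<subseteq> (\<Union>y\<in>F. qball \<rho> y (\<epsilon> * r))"
      from this[OF r, of x0] show thesis by (elim exE conjE) (rule that)
    qed
    have "\<exists>y\<in>F. \<rho> y (zc \<tau> k \<alpha>) < \<epsilon> * r" if "\<alpha> \<in> J n" for \<alpha>
      using F(2) that by (auto simp: J_def r_def qball_def)
    then obtain h where h: "\<And>\<alpha>. \<alpha> \<in> J n \<Longrightarrow> h \<alpha> \<in> F \<and> \<rho> (h \<alpha>) (zc \<tau> k \<alpha>) < \<epsilon> * r" by metis
    have "inj_on h (J n)"
    proof (rule inj_onI)
      fix \<alpha> \<beta> assume ab: "\<alpha> \<in> J n" "\<beta> \<in> J n" "h \<alpha> = h \<beta>"
      show "\<alpha> = \<beta>"
      proof (rule ccontr)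
        assume "\<alpha> \<noteq> \<beta>"
        then have "c0 * ?d \<le> \<rho> (zc \<tau> k \<alpha>) (zc \<tau> k \<beta>)" using ab centres_separated[OF \<tau>] by (simp add: J_def)
        also have "\<dots> \<le> K0 * (\<rho> (zc \<tau> k \<alpha>) (h \<alpha>) + \<rho> (h \<alpha>) (zc \<tau> k \<beta>))" by (rule rho_tri)
        also have "\<dots> < K0 * (\<epsilon> * r + \<epsilon> * r)"
          using h[OF ab(1)] h[OF ab(2)] ab(3) rho_sym[of "zc \<tau> k \<alpha>" "h \<alpha>"] K0
          by (intro mult_strict_left_mono) auto
        finally show False using sr by simp
      qed
    qed
    then show ?thesis using h F(1) by (meson finite_imageD finite_subset image_subsetI)
  qed
  then have "countable (\<Union>n. J n)" by (intro countable_UN) (auto intro: countable_finite)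
  moreover have "I \<tau> k \<subseteq> (\<Union>n. J n)"
  proof
    fix \<alpha> assume "\<alpha> \<in> I \<tau> k"
    obtain n :: nat where "\<rho> x0 (zc \<tau> k \<alpha>) < real n" using reals_Archimedean2 by blast
    then show "\<alpha> \<in> (\<Union>n. J n)" using \<open>\<alpha> \<in> I \<tau> k\<close> by (auto simp: J_def qball_def intro!: exI[of _ n])
  qed
  ultimately show ?thesis by (rule countable_subset[rotated])
qed

text \<open>For the ratio between parent and child, doubling compares the outer ball of the parent
  with the inner ball of the child; the ratio of the time sides is at most
  \<open>2 / \<delta> powr p\<close>, the 2 being due to rounding.\<close>

lemma dyadic_grid_system:
  assumes \<tau>: "\<tau> \<in> {1..K}" and \<theta>: "0 < \<theta>"
  obtains cd where "dyadic_grid \<mu> (I \<tau>) (Q \<tau>) (gexp \<theta>) cd"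
proof -
  define L where "L = C1 / (c1 * \<delta>)"
  obtain CV where CV: "1 \<le> CV" "\<And>x y r R. 0 < r \<Longrightarrow> 0 < R \<Longrightarrow> R \<le> L * r \<Longrightarrow> \<rho> x y \<le> L * r \<Longrightarrow> V y R \<le> CV * V x r"
    using V_compare[of L] by blast
  have dp: "0 < \<delta> powr p" using \<delta> by simp
  have "dyadic_grid \<mu> (I \<tau>) (Q \<tau>) (gexp \<theta>) (CV * (2 / \<delta> powr p))"
  proof
    show "space \<mu> = UNIV" by (rule space_mu)
    show "Q \<tau> k \<alpha> \<in> sets \<mu>" if "\<alpha> \<in> I \<tau> k" for k \<alpha> by (rule cube_sets[OF \<tau> that])
    show "countable (I \<tau> k)" for k by (rule countable_cubes[OF \<tau>])
    show "(\<Union>\<alpha>\<in>I \<tau> k. Q \<tau> k \<alpha>) = UNIV" for k by (rule cubes_cover[OF \<tau>])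
    show "disjoint_family_on (Q \<tau> k) (I \<tau> k)" for k by (rule cubes_disjoint[OF \<tau>])
    show "Q \<tau> l \<beta> \<subseteq> Q \<tau> k \<alpha> \<or> Q \<tau> l \<beta> \<inter> Q \<tau> k \<alpha> = {}" if "k \<le> l" "\<alpha> \<in> I \<tau> k" "\<beta> \<in> I \<tau> l" for k l \<alpha> \<beta>
      by (rule cubes_nested[OF \<tau> that])
    show "0 < emeasure \<mu> (Q \<tau> k \<alpha>)" "emeasure \<mu> (Q \<tau> k \<alpha>) < \<infinity>" if "\<alpha> \<in> I \<tau> k" for k \<alpha>
      using cube_measure(4)[OF \<tau> that] unfolding cube_measure(1)[OF \<tau> that] by simp_all
    show "gexp \<theta> k < gexp \<theta> (k + 1)" for k
    proof -
      have X: "0 < \<theta> * dside k" using \<theta> dside_pos by simp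
      have "log 2 (\<theta> * dside (k + 1)) \<le> log 2 (\<theta> * dside k / 2)"
        using \<delta>_powr_le X dp \<theta> dside_pos[of "k + 1"] dside_pos[of k] unfolding dside_Suc
        by (intro log_mono) (auto simp: mult_ac)
      also have "\<dots> = log 2 (\<theta> * dside k) - 1" by (subst log_divide) (use X in auto)
      finally show ?thesis unfolding gexp_def by linarith
    qed
    show "measure \<mu> (Q \<tau> k \<alpha>) * 2 powi (gexp \<theta> (k + 1) - gexp \<theta> k)
        \<le> CV * (2 / \<delta> powr p) * measure \<mu> (Q \<tau> (k + 1) \<beta>)"
      if ab: "\<alpha> \<in> I \<tau> k" "\<beta> \<in> I \<tau> (k + 1)" and sub: "Q \<tau> (k + 1) \<beta> \<subseteq> Q \<tau> k \<alpha>" for k \<alpha> \<beta>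
    proof -
      have d: "0 < \<delta> powi k" by (rule \<delta>_powi_pos)
      have d1: "\<delta> powi (k + 1) = \<delta> * \<delta> powi k" using \<delta>(1) by (simp add: power_int_add mult.commute)
      have Lr: "L * (c1 * \<delta> powi (k + 1)) = C1 * \<delta> powi k"
        using c1_pos \<delta>(1) unfolding d1 L_def by simp
      have "zc \<tau> (k + 1) \<beta> \<in> qball \<rho> (zc \<tau> k \<alpha>) (C1 * \<delta> powi k)"
        using centre_in_cube[OF \<tau> ab(2)] sub cube_in_ball[OF \<tau> ab(1)] by blast
      then have "\<rho> (zc \<tau> (k + 1) \<beta>) (zc \<tau> k \<alpha>) \<le> C1 * \<delta> powi k"
        using rho_sym[of "zc \<tau> k \<alpha>"] by (simp add: qball_def)
      then have "V (zc \<tau> k \<alpha>) (C1 * \<delta> powi k) \<le> CV * V (zc \<tau> (k + 1) \<beta>) (c1 * \<delta> powi (k + 1))"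
        using c1_pos C1_pos d \<delta>_powi_pos[of "k + 1"] by (intro CV(2)) (simp_all add: Lr)
      also have "\<dots> \<le> CV * measure \<mu> (Q \<tau> (k + 1) \<beta>)"
        using CV(1) cube_measure(2)[OF \<tau> ab(2)] by (intro mult_left_mono) auto
      finally have 1: "measure \<mu> (Q \<tau> k \<alpha>) \<le> CV * measure \<mu> (Q \<tau> (k + 1) \<beta>)"
        using cube_measure(3)[OF \<tau> ab(1)] by linarith
      have 2: "(2 :: real) powi (gexp \<theta> (k + 1) - gexp \<theta> k) \<le> 2 / \<delta> powr p"
      proof -
        have g: "\<theta> * dside (k + 1) / 2 < 2 powi (- gexp \<theta> (k + 1))" "2 powi (- gexp \<theta> k) \<le> \<theta> * dside k"
          using gside_bounds[OF \<theta>] by auto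
        have "(2 :: real) powi (gexp \<theta> (k + 1) - gexp \<theta> k) = 2 powi (- gexp \<theta> k) / 2 powi (- gexp \<theta> (k + 1))"
          by (simp add: power_int_diff power_int_minus field_simps)
        also have "\<dots> \<le> \<theta> * dside k / (\<theta> * dside (k + 1) / 2)"
          using g \<theta> dside_pos[of k] dside_pos[of "k + 1"] by (intro frac_le) auto
        also have "\<dots> = 2 / \<delta> powr p" using \<theta> dside_pos[of k] by (simp add: dside_Suc)
        finally show ?thesis .
      qed
      have "measure \<mu> (Q \<tau> k \<alpha>) * 2 powi (gexp \<theta> (k + 1) - gexp \<theta> k)
          \<le> (CV * measure \<mu> (Q \<tau> (k + 1) \<beta>)) * (2 / \<delta> powr p)"
        using 1 2 CV(1) by (intro mult_mono) auto
      then show ?thesis by (simp add: mult_ac)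
    qed
  qed
  then show thesis by (rule that)
qed

text \<open>The form of the condition to which all others are reduced: it refers neither to a lag
  \<open>\<gamma>\<close> nor to a grid.\<close>

definition wide_conds :: bool where "wide_conds \<longleftrightarrow> (\<forall>\<Lambda>>0. \<forall>\<kappa>>0. \<exists>C>0. wide_cond \<Lambda> \<kappa> C)"

lemma lag_imp_wide_conds: "0 < a \<Longrightarrow> a < b \<Longrightarrow> lag_cond a b C \<Longrightarrow> wide_conds"
  unfolding wide_conds_def using lag_imp_wide by metis

text \<open>Both rectangles are placed in a pair of wide boxes over the outer ball of the cube, the
  first box ending together with \<open>u\<close>. As \<open>2 \<le> s\<close>, a whole time side
  separates the rectangles, and by the rounding bound it exceeds the gap
  \<open>\<kappa> * r powr p\<close>.\<close>

lemma dyadic_Apair: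
  assumes w: wide_conds and \<tau>: "\<tau> \<in> {1..K}" and \<theta>: "0 < \<theta>" and s: "2 \<le> s"
    and grid: "dyadic_grid \<mu> (I \<tau>) (Q \<tau>) (gexp \<theta>) cd"
  shows "\<exists>C. \<forall>u. dyadic_grid.valid (I \<tau>) u \<longrightarrow>
    Apair (dyadic_grid.rect (Q \<tau>) (gexp \<theta>) u) (dyadic_grid.rect (Q \<tau>) (gexp \<theta>) (time_shift s u))
      (C * dyadic_grid.rmeas \<mu> (Q \<tau>) (gexp \<theta>) u powr q)"
proof -
  interpret g: dyadic_grid \<mu> "I \<tau>" "Q \<tau>" "gexp \<theta>" cd by (rule grid)
  define \<theta>2 where "\<theta>2 = \<theta> / C1 powr p"
  have \<theta>2: "0 < \<theta>2" using \<theta> C1_pos by (simp add: \<theta>2_def)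
  define \<kappa> where "\<kappa> = \<theta>2 / 2"
  define \<Lambda> where "\<Lambda> = (of_int s + 2) * \<theta>2"
  have "0 < \<kappa>" "0 < \<Lambda>" using \<theta>2 s by (auto simp: \<kappa>_def \<Lambda>_def)
  then obtain C where C: "0 < C" "wide_cond \<Lambda> \<kappa> C" using w unfolding wide_conds_def by blast
  obtain CV where CV: "1 \<le> CV" "\<And>x y r R. 0 < r \<Longrightarrow> 0 < R \<Longrightarrow> R \<le> C1 / c1 * r \<Longrightarrow> \<rho> x y \<le> C1 / c1 * r \<Longrightarrow> V y R \<le> CV * V x r"
    using V_compare[of "C1 / c1"] by blast
  have "Apair (g.rect u) (g.rect (time_shift s u)) (C * (2 * CV / \<theta>2) powr q * g.rmeas u powr q)"
    if u: "g.valid u" for u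
  proof -
    obtain k \<alpha> i where f: "u = (k, \<alpha>, i)" by (cases u)
    have \<alpha>: "\<alpha> \<in> I \<tau> k" using u f by simp
    define r where "r = C1 * \<delta> powi k"
    let ?z = "zc \<tau> k \<alpha>" and ?l = "g.side k"
    have d: "0 < \<delta> powi k" by (rule \<delta>_powi_pos)
    have r: "0 < r" using C1_pos d by (simp add: r_def)
    have ds: "\<theta> * dside k = \<theta>2 * r powr p"
      using C1_pos d unfolding dside_eq r_def \<theta>2_def by (simp add: powr_mult)
    have l: "\<theta>2 * r powr p / 2 < ?l" "?l \<le> \<theta>2 * r powr p"
      using gside_bounds[OF \<theta>, of k] unfolding g.side_def ds by auto
    have l0: "0 < ?l" by simp
    define T0 where "T0 = of_int (i + 1) * ?l - \<Lambda> * r powr p"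
    have s2: "2 \<le> real_of_int s" using s by simp
    have Lr: "(of_int s + 2) * ?l \<le> \<Lambda> * r powr p"
      using l(2) s2 mult_left_mono[OF l(2), of "of_int s + 2"] by (simp add: \<Lambda>_def mult.assoc)
    have kr: "\<kappa> * r powr p < ?l" "0 < \<kappa> * r powr p" using l(1) \<open>0 < \<kappa>\<close> r by (auto simp: \<kappa>_def)
    have sl: "2 * ?l \<le> of_int s * ?l" using s2 by (intro mult_right_mono) auto
    have sub1: "g.rect u \<subseteq> box ?z r T0 (\<Lambda> * r powr p)"
      unfolding f g.rect.simps box_def
    proof (rule Sigma_mono)
      show "Q \<tau> k \<alpha> \<subseteq> qball \<rho> ?z r" using cube_in_ball[OF \<tau> \<alpha>] by (simp add: r_def)
      show "{of_int i * ?l..<of_int (i + 1) * ?l} \<subseteq> {T0<..<T0 + \<Lambda> * r powr p}"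
      proof -
        have l1: "of_int (i + 1) * ?l = of_int i * ?l + ?l" by (simp add: algebra_simps)
        have "of_int s * ?l + 2 * ?l \<le> \<Lambda> * r powr p" using Lr by (simp add: distrib_right)
        then have "?l < \<Lambda> * r powr p" using sl l0 by (smt (verit))
        then have "T0 < of_int i * ?l" "of_int (i + 1) * ?l \<le> T0 + \<Lambda> * r powr p"
          unfolding T0_def l1 by simp_all
        then show ?thesis by (smt (verit) atLeastLessThan_iff greaterThanLessThan_iff subsetI)
      qed
    qed
    have sub2: "g.rect (time_shift s u) \<subseteq> box ?z r (T0 + (\<Lambda> + \<kappa>) * r powr p) (\<Lambda> * r powr p)"
      unfolding f time_shift_simps g.rect.simps box_def
    proof (rule Sigma_mono)
      show "Q \<tau> k \<alpha> \<subseteq> qball \<rho> ?z r" using cube_in_ball[OF \<tau> \<alpha>] by (simp add: r_def)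
      show "{of_int (i + s) * ?l..<of_int (i + s + 1) * ?l}
          \<subseteq> {T0 + (\<Lambda> + \<kappa>) * r powr p<..<T0 + (\<Lambda> + \<kappa>) * r powr p + \<Lambda> * r powr p}"
      proof -
        have e: "of_int (i + 1) * ?l = of_int i * ?l + ?l" "of_int (i + s) * ?l = of_int i * ?l + of_int s * ?l"
          "of_int (i + s + 1) * ?l = of_int i * ?l + of_int s * ?l + ?l"
          "(\<Lambda> + \<kappa>) * r powr p = \<Lambda> * r powr p + \<kappa> * r powr p"
          by (simp_all add: algebra_simps)
        have "of_int s * ?l + 2 * ?l \<le> \<Lambda> * r powr p" using Lr by (simp add: distrib_right)
        then have "T0 + (\<Lambda> + \<kappa>) * r powr p < of_int (i + s) * ?l"
          "of_int (i + s + 1) * ?l \<le> T0 + (\<Lambda> + \<kappa>) * r powr p + \<Lambda> * r powr p"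
          unfolding T0_def e using sl l0 kr by (smt (verit))+
        then show ?thesis by (smt (verit) atLeastLessThan_iff greaterThanLessThan_iff subsetI)
      qed
    qed
    have "Apair (box ?z r T0 (\<Lambda> * r powr p)) (box ?z r (T0 + (\<Lambda> + \<kappa>) * r powr p) (\<Lambda> * r powr p))
        (C * (V ?z r * r powr p) powr q)"
      using C(2) r unfolding wide_cond_def by blast
    then show ?thesis
    proof (rule Apair_mono[OF _ sub1 sub2])
      have "V ?z r \<le> CV * V ?z (c1 * \<delta> powi k)"
        using c1_pos C1_pos d r by (intro CV(2)) (simp_all add: r_def)
      also have "\<dots> \<le> CV * measure \<mu> (Q \<tau> k \<alpha>)"
        using cube_measure(2)[OF \<tau> \<alpha>] CV(1) by (intro mult_left_mono) auto
      finally have 1: "V ?z r \<le> CV * measure \<mu> (Q \<tau> k \<alpha>)" .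
      have 2: "r powr p \<le> 2 / \<theta>2 * ?l" using l(1) \<theta>2 by (simp add: field_simps)
      have "V ?z r * r powr p \<le> (CV * measure \<mu> (Q \<tau> k \<alpha>)) * (2 / \<theta>2 * ?l)"
        using 1 2 CV(1) r V_pos[OF r, of ?z] by (intro mult_mono) auto
      also have "\<dots> = 2 * CV / \<theta>2 * g.rmeas u" using \<alpha> by (simp add: f g.rmeas_eq)
      finally have "(V ?z r * r powr p) powr q \<le> (2 * CV / \<theta>2 * g.rmeas u) powr q"
        using V_pos[OF r, of ?z] q by (intro powr_mono2) auto
      also have "\<dots> = (2 * CV / \<theta>2) powr q * g.rmeas u powr q" by (rule powr_mult)
      finally show "C * (V ?z r * r powr p) powr q \<le> C * (2 * CV / \<theta>2) powr q * g.rmeas u powr q"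
        using C(1) unfolding mult.assoc by (intro mult_left_mono) auto
    qed
  qed
  then show ?thesis by blast
qed

lemma weighted_dyadic_grid_system:
  assumes w: wide_conds and \<tau>: "\<tau> \<in> {1..K}" and \<theta>: "0 < \<theta>"
  obtains cd where "weighted_dyadic_grid \<mu> (I \<tau>) (Q \<tau>) (gexp \<theta>) cd \<omega> \<sigma> q"
proof -
  obtain cd where grid: "dyadic_grid \<mu> (I \<tau>) (Q \<tau>) (gexp \<theta>) cd" using dyadic_grid_system[OF \<tau> \<theta>] by blast
  interpret g: dyadic_grid \<mu> "I \<tau>" "Q \<tau>" "gexp \<theta>" cd by (rule grid)
  have pair: "\<exists>C. \<forall>u. g.valid u \<longrightarrow> Apair (g.rect u) (g.rect (time_shift s u)) (C * g.rmeas u powr q)"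
    if "2 \<le> s" for s using dyadic_Apair[OF w \<tau> \<theta> that grid] .
  have fin: "W (g.rect u) < \<infinity> \<and> S (g.rect u) < \<infinity>" if u: "g.valid u" for u
  proof -
    obtain C where C: "\<And>u. g.valid u \<Longrightarrow> Apair (g.rect u) (g.rect (time_shift 2 u)) (C * g.rmeas u powr q)"
      using pair[OF order_refl] by metis
    \<comment> \<open>The pair that begins with \<open>u\<close> makes the
      \<open>\<omega>\<close>-mass of \<open>u\<close> finite, the pair that ends with
      \<open>u\<close> its dual mass.\<close>
    have "g.valid (time_shift (-2) u)" using u by simp
    from C[OF this] C[OF u] show ?thesis by (simp add: Apair_def)
  qed
  have "weighted_dyadic_grid \<mu> (I \<tau>) (Q \<tau>) (gexp \<theta>) cd \<omega> \<sigma> q"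
  proof
    show "(\<integral>\<^sup>+z\<in>g.rect u. ennreal (\<omega> z) \<partial>lam) < \<infinity>" if "g.valid u" for u using fin[OF that] by (simp add: W_def)
    show "(\<integral>\<^sup>+z\<in>g.rect u. ennreal (\<sigma> z) \<partial>lam) < \<infinity>" if "g.valid u" for u using fin[OF that] by (simp add: S_def)
    show "\<exists>C. \<forall>u. g.valid u \<longrightarrow> g.av \<omega> u * g.av \<sigma> (time_shift s u) powr (q - 1) \<le> C" if s: "2 \<le> s" for s
    proof -
      obtain C where C: "\<And>u. g.valid u \<Longrightarrow> Apair (g.rect u) (g.rect (time_shift s u)) (C * g.rmeas u powr q)"
        using pair[OF s] by blast
      have "g.av \<omega> u * g.av \<sigma> (time_shift s u) powr (q - 1) \<le> C" if u: "g.valid u" for u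
      proof -
        let ?r = "g.rmeas u"
        have r: "0 < ?r" by (rule g.rmeas_pos[OF u])
        have "g.av \<omega> u * g.av \<sigma> (time_shift s u) powr (q - 1)
            = enn2real (W (g.rect u)) * enn2real (S (g.rect (time_shift s u))) powr (q - 1) / ?r powr q"
          using r unfolding g.av_def g.rmeas_time_shift[OF u] W_def S_def by (simp add: powr_divide powr_diff)
        also have "\<dots> \<le> C" using C[OF u] r by (simp add: Apair_def pos_divide_le_eq)
        finally show ?thesis .
      qed
      then show ?thesis by blast
    qed
  qed (use \<omega>_meas \<sigma>_meas \<omega>_pos \<sigma>_eq q in auto)
  then show thesis by (rule that)
qed

text \<open>With \<open>\<theta> = \<gamma> / 4\<close>, four sides of the grid fit into the waiting
  time of the upper rectangle, which is therefore covered by the translates from step 4 on; a side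
  exceeds \<open>\<gamma> / 8\<close> of the height, so \<open>\<lceil>8 / \<gamma>\<rceil>\<close>
  steps reach the top. Its average is thus dominated by finitely many functions \<open>Tmax\<close>.
  The measurable functions \<open>F n\<close> increase with the range of generations and stand in
  for the maximal function in the integrals.\<close>

lemma system_domination:
  assumes w: wide_conds and \<tau>: "\<tau> \<in> {1..K}" and \<gamma>: "0 < \<gamma>" "\<gamma> < 1"
  shows "\<exists>C\<ge>0. \<forall>f. f \<in> borel_measurable lam \<longrightarrow> (\<forall>z. 0 \<le> f z) \<longrightarrow>
      (\<integral>\<^sup>+z. ennreal (f z powr q * \<omega> z) \<partial>lam) < \<infinity> \<longrightarrow>
    (\<exists>F :: nat \<Rightarrow> 'a \<times> real \<Rightarrow> ennreal. (\<forall>n. F n \<in> borel_measurable lam) \<and> incseq F \<and>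
      (\<forall>n. (\<integral>\<^sup>+z. F n z * ennreal (\<omega> z) \<partial>lam) \<le> ennreal C * (\<integral>\<^sup>+z. ennreal (f z powr q * \<omega> z) \<partial>lam)) \<and>
      (\<forall>k \<alpha> x t. \<alpha> \<in> I \<tau> k \<longrightarrow> x \<in> Q \<tau> k \<alpha> \<longrightarrow>
        epowr (average lam (rectangle_plus p \<delta> Q \<gamma> \<tau> k \<alpha> t) (\<lambda>z. ennreal (f z))) q \<le> (SUP n. F n (x, t))))"
proof -
  define \<theta> where "\<theta> = \<gamma> / 4"
  have \<theta>: "0 < \<theta>" using \<gamma> by (simp add: \<theta>_def)
  obtain cd where "weighted_dyadic_grid \<mu> (I \<tau>) (Q \<tau>) (gexp \<theta>) cd \<omega> \<sigma> q"
    using weighted_dyadic_grid_system[OF w \<tau> \<theta>] by blast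
  then interpret g: weighted_dyadic_grid \<mu> "I \<tau>" "Q \<tau>" "gexp \<theta>" cd \<omega> \<sigma> q .
  define N where "N = \<lceil>8 / \<gamma>\<rceil>"
  define B where "B = \<theta> / (1 - \<gamma>)"
  have B: "0 < B" using \<theta> \<gamma> by (simp add: B_def)
  define E where "E m C \<longleftrightarrow> (\<forall>a n f. a \<le> n \<longrightarrow> f \<in> borel_measurable lam \<longrightarrow> (\<forall>z. 0 \<le> f z) \<longrightarrow>
      (\<integral>\<^sup>+z. ennreal (f z powr q * \<omega> z) \<partial>lam) < \<infinity> \<longrightarrow>
      (\<integral>\<^sup>+z. ennreal (g.Tmax a n m f z powr q * \<omega> z) \<partial>lam) \<le> ennreal C * (\<integral>\<^sup>+z. ennreal (f z powr q * \<omega> z) \<partial>lam))"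
    for m :: int and C :: real
  have "\<forall>m\<in>{4..N}. \<exists>C. 0 \<le> C \<and> E m C"
  proof
    fix m :: int assume "m \<in> {4..N}"
    then have "3 \<le> m" by simp
    then show "\<exists>C. 0 \<le> C \<and> E m C"
    proof (rule g.dyadic_strong_type)
      fix C :: real
      assume C: "0 \<le> C" and E: "\<And>a n f. a \<le> n \<Longrightarrow> f \<in> borel_measurable lam \<Longrightarrow> (\<And>z. 0 \<le> f z) \<Longrightarrow>
        (\<integral>\<^sup>+z. ennreal (f z powr q * \<omega> z) \<partial>lam) < \<infinity> \<Longrightarrow>
        (\<integral>\<^sup>+z. ennreal (g.Tmax a n m f z powr q * \<omega> z) \<partial>lam) \<le> ennreal C * (\<integral>\<^sup>+z. ennreal (f z powr q * \<omega> z) \<partial>lam)"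
      have "E m C" unfolding E_def by (intro allI impI, rule E) (assumption | erule spec)+
      then show ?thesis using C by blast
    qed
  qed
  then obtain Cm where Cm: "\<forall>m\<in>{4..N}. 0 \<le> Cm m \<and> E m (Cm m)" by (rule bchoice[THEN exE])
  then have Cm0: "\<And>m. m \<in> {4..N} \<Longrightarrow> 0 \<le> Cm m" by blast
  have CmE: "(\<integral>\<^sup>+z. ennreal (g.Tmax a n m f z powr q * \<omega> z) \<partial>lam) \<le> ennreal (Cm m) * (\<integral>\<^sup>+z. ennreal (f z powr q * \<omega> z) \<partial>lam)"
    if "m \<in> {4..N}" "a \<le> n" "f \<in> borel_measurable lam" "\<forall>z. 0 \<le> f z"
      "(\<integral>\<^sup>+z. ennreal (f z powr q * \<omega> z) \<partial>lam) < \<infinity>" for m a n f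
    using Cm[unfolded E_def, rule_format, OF that(1), THEN conjunct2, rule_format, OF that(2,3) _ that(5)] that(4) by blast
  define A where "A = B powr q * real (card {4..N}) powr q"
  have A0: "0 \<le> A" by (simp add: A_def)
  define C where "C = A * (\<Sum>m\<in>{4..N}. Cm m)"
  have "0 \<le> C" unfolding C_def using A0 Cm0 by (intro mult_nonneg_nonneg sum_nonneg) auto
  moreover have "\<exists>F :: nat \<Rightarrow> 'a \<times> real \<Rightarrow> ennreal. (\<forall>n. F n \<in> borel_measurable lam) \<and> incseq F \<and>
      (\<forall>n. (\<integral>\<^sup>+z. F n z * ennreal (\<omega> z) \<partial>lam) \<le> ennreal C * (\<integral>\<^sup>+z. ennreal (f z powr q * \<omega> z) \<partial>lam)) \<and>
      (\<forall>k \<alpha> x t. \<alpha> \<in> I \<tau> k \<longrightarrow> x \<in> Q \<tau> k \<alpha> \<longrightarrow>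
        epowr (average lam (rectangle_plus p \<delta> Q \<gamma> \<tau> k \<alpha> t) (\<lambda>z. ennreal (f z))) q \<le> (SUP n. F n (x, t)))"
    if f: "f \<in> borel_measurable lam" "\<forall>z. 0 \<le> f z" "(\<integral>\<^sup>+z. ennreal (f z powr q * \<omega> z) \<partial>lam) < \<infinity>" for f
  proof -
    note [measurable] = f(1)
    have f0: "0 \<le> f z" for z using f(2) by blast
    \<comment> \<open>The range of generations is symmetric, so each generation \<open>k\<close> is
      reached as soon as \<open>n\<close> is at least \<open>\<bar>k\<bar>\<close>.\<close>
    define F where "F n z = ennreal (A * (\<Sum>m\<in>{4..N}. g.Tmax (- int n) (int n) m f z powr q))" for n z
    have F_meas [measurable]: "F n \<in> borel_measurable lam" for n unfolding F_def[abs_def] by measurable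
    have inc: "incseq F"
    proof (rule incseq_SucI, rule le_funI)
      fix n z
      have "g.Tmax (- int n) (int n) m f z \<le> g.Tmax (- int (Suc n)) (int (Suc n)) m f z" for m
        unfolding g.Tmax_def by (rule Max_mono) auto
      moreover have "0 \<le> g.Tmax (- int n) (int n) m f z" for m by (rule g.Tmax_nonneg) simp
      ultimately show "F n z \<le> F (Suc n) z"
        unfolding F_def using A0 q by (intro ennreal_leI mult_left_mono sum_mono powr_mono2) auto
    qed
    have int: "(\<integral>\<^sup>+z. F n z * ennreal (\<omega> z) \<partial>lam) \<le> ennreal C * (\<integral>\<^sup>+z. ennreal (f z powr q * \<omega> z) \<partial>lam)" for n
    proof -
      let ?X = "\<integral>\<^sup>+z. ennreal (f z powr q * \<omega> z) \<partial>lam"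
      have "(\<integral>\<^sup>+z. F n z * ennreal (\<omega> z) \<partial>lam)
          = (\<integral>\<^sup>+z. ennreal A * (\<Sum>m\<in>{4..N}. ennreal (g.Tmax (- int n) (int n) m f z powr q * \<omega> z)) \<partial>lam)"
      proof (rule nn_integral_cong)
        fix z
        have "F n z * ennreal (\<omega> z) = ennreal A * ((\<Sum>m\<in>{4..N}. ennreal (g.Tmax (- int n) (int n) m f z powr q)) * ennreal (\<omega> z))"
          unfolding F_def using A0 by (simp add: ennreal_mult' sum_ennreal mult.assoc)
        also have "(\<Sum>m\<in>{4..N}. ennreal (g.Tmax (- int n) (int n) m f z powr q)) * ennreal (\<omega> z)
            = (\<Sum>m\<in>{4..N}. ennreal (g.Tmax (- int n) (int n) m f z powr q * \<omega> z))"
          unfolding sum_distrib_right by (intro sum.cong ennreal_mult'[symmetric]) auto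
        finally show "F n z * ennreal (\<omega> z) = ennreal A * (\<Sum>m\<in>{4..N}. ennreal (g.Tmax (- int n) (int n) m f z powr q * \<omega> z))" .
      qed
      also have "\<dots> = ennreal A * (\<Sum>m\<in>{4..N}. \<integral>\<^sup>+z. ennreal (g.Tmax (- int n) (int n) m f z powr q * \<omega> z) \<partial>lam)"
        by (subst nn_integral_cmult; (subst nn_integral_sum)?; measurable?)
      also have "\<dots> \<le> ennreal A * (\<Sum>m\<in>{4..N}. ennreal (Cm m) * ?X)"
        using f by (intro mult_left_mono sum_mono CmE) auto
      also have "\<dots> = ennreal C * ?X"
      proof -
        have "(\<Sum>m\<in>{4..N}. ennreal (Cm m)) = ennreal (\<Sum>m\<in>{4..N}. Cm m)" by (rule sum_ennreal) (rule Cm0)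
        then show ?thesis
          unfolding sum_distrib_right[symmetric] C_def ennreal_mult'[OF A0] by (simp only: mult.assoc)
      qed
      finally show ?thesis .
    qed
    have dom: "epowr (average lam (rectangle_plus p \<delta> Q \<gamma> \<tau> k \<alpha> t) (\<lambda>z. ennreal (f z))) q \<le> (SUP n. F n (x, t))"
      if \<alpha>: "\<alpha> \<in> I \<tau> k" and x: "x \<in> Q \<tau> k \<alpha>" for k \<alpha> x t
    proof -
      let ?l = "g.side k" and ?D = "dside k"
      define i where "i = \<lfloor>t / ?l\<rfloor>"
      have l: "\<theta> * ?D / 2 < ?l" "?l \<le> \<theta> * ?D" using gside_bounds[OF \<theta>, of k] unfolding g.side_def by auto
      have l0: "0 < ?l" by simp
      have D: "0 < ?D" by (rule dside_pos)
      have idx: "g.idx k (x, t) = (k, \<alpha>, i)" by (simp add: g.idx_def i_def g.cube_unique[OF \<alpha> x])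
      have it: "of_int i * ?l \<le> t" "t < of_int (i + 1) * ?l"
        unfolding i_def by (simp_all add: pos_le_divide_eq[symmetric] pos_divide_less_eq[symmetric])
      have v: "g.valid (k, \<alpha>, j)" for j using \<alpha> by simp
      let ?R = "rectangle_plus p \<delta> Q \<gamma> \<tau> k \<alpha> t"
      have cov: "?R \<subseteq> (\<Union>m\<in>{4..N}. g.rect (k, \<alpha>, i + m))"
      proof
        fix z assume "z \<in> ?R"
        then have z: "fst z \<in> Q \<tau> k \<alpha>" "t + \<gamma> * ?D < snd z" "snd z < t + ?D"
          by (auto simp: rectangle_plus_def dside_def)
        define j where "j = \<lfloor>snd z / ?l\<rfloor>"
        have jz: "of_int j * ?l \<le> snd z" "snd z < of_int (j + 1) * ?l"
          unfolding j_def by (simp_all add: pos_le_divide_eq[symmetric] pos_divide_less_eq[symmetric])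
        have "\<gamma> * ?D = 4 * (\<theta> * ?D)" by (simp add: \<theta>_def)
        then have "4 * ?l \<le> \<gamma> * ?D" using l(2) by linarith
        then have "of_int (i + 4) * ?l < of_int (j + 1) * ?l" using it z(2) jz(2) by (simp add: algebra_simps)
        then have 1: "i + 4 < j + 1" using l0 by (simp only: mult_less_cancel_right_pos of_int_less_iff)
        have "?D < 8 / \<gamma> * ?l" using l(1) \<gamma> by (simp add: \<theta>_def field_simps)
        also have "\<dots> \<le> of_int N * ?l" unfolding N_def by (intro mult_right_mono) auto
        finally have "of_int j * ?l < of_int (i + 1 + N) * ?l" using it z(3) jz(1) by (simp add: algebra_simps)
        then have 2: "j < i + 1 + N" using l0 by (simp only: mult_less_cancel_right_pos of_int_less_iff)
        have "z \<in> g.rect (k, \<alpha>, i + (j - i))"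
          using z(1) jz unfolding g.rect.simps mem_Times_iff by simp
        then show "z \<in> (\<Union>m\<in>{4..N}. g.rect (k, \<alpha>, i + m))" using 1 2 by (intro UN_I[of "j - i"]) auto
      qed
      let ?m = "measure \<mu> (Q \<tau> k \<alpha>)"
      have m0: "0 < ?m" by (rule cube_measure(4)[OF \<tau> \<alpha>])
      have eR: "emeasure lam ?R = ennreal (?m * ((1 - \<gamma>) * ?D))"
        unfolding rectangle_plus_cbox using \<gamma> D by (intro emeasure_cbox[OF \<tau> \<alpha>]) simp
      have pd: "0 < ?m * ((1 - \<gamma>) * ?D)" using m0 \<gamma> D by simp
      have loc: "(\<integral>\<^sup>+z\<in>g.rect (k, \<alpha>, i + m). ennreal (f z) \<partial>lam) = ennreal (g.av f (k, \<alpha>, i + m) * (?m * ?l))" for m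
        using g.integral_av[OF v g.weighted_L_local_integrable(1)[OF f(1) f0 f(3) v]] \<alpha> by (simp add: g.rmeas_eq)
      define s where "s = (\<Sum>m\<in>{4..N}. g.av f (k, \<alpha>, i + m))"
      have s0: "0 \<le> s" unfolding s_def by (intro sum_nonneg g.av_nonneg v)
      have "(\<integral>\<^sup>+z\<in>?R. ennreal (f z) \<partial>lam) \<le> (\<Sum>m\<in>{4..N}. \<integral>\<^sup>+z\<in>g.rect (k, \<alpha>, i + m). ennreal (f z) \<partial>lam)"
        by (rule finite_cover_le[OF _ g.rect_sets[OF v] cov]) simp_all
      also have "\<dots> = ennreal (\<Sum>m\<in>{4..N}. g.av f (k, \<alpha>, i + m) * (?m * ?l))"
        unfolding loc using m0 l0 by (intro sum_ennreal mult_nonneg_nonneg g.av_nonneg v) auto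
      also have "\<dots> = ennreal (s * (?m * ?l))" by (simp add: s_def sum_distrib_right)
      finally have le: "(\<integral>\<^sup>+z\<in>?R. ennreal (f z) \<partial>lam) \<le> ennreal (s * (?m * ?l))" .
      have "average lam ?R (\<lambda>z. ennreal (f z)) \<le> ennreal (s * (?m * ?l)) / ennreal (?m * ((1 - \<gamma>) * ?D))"
        unfolding average_def eR by (rule divide_right_mono_ennreal[OF le])
      also have "\<dots> = ennreal (s * (?m * ?l) / (?m * ((1 - \<gamma>) * ?D)))"
        using s0 m0 l0 pd by (intro divide_ennreal) auto
      also have "\<dots> \<le> ennreal (B * s)"
      proof (rule ennreal_leI)
        have "s * (?m * ?l) \<le> s * (?m * (\<theta> * ?D))" using l(2) m0 s0 by (intro mult_left_mono) auto
        also have "\<dots> = B * s * (?m * ((1 - \<gamma>) * ?D))" using \<gamma> by (simp add: B_def)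
        finally show "s * (?m * ?l) / (?m * ((1 - \<gamma>) * ?D)) \<le> B * s" using pd by (simp only: pos_divide_le_eq)
      qed
      finally have avg: "average lam ?R (\<lambda>z. ennreal (f z)) \<le> ennreal (B * s)" .
      define n where "n = nat \<bar>k\<bar>"
      have kn: "- int n \<le> k" "k \<le> int n" by (auto simp: n_def)
      have "epowr (average lam ?R (\<lambda>z. ennreal (f z))) q \<le> ennreal ((B * s) powr q)"
        using epowr_mono[OF avg, of q] q B s0 by simp
      also have "\<dots> \<le> F n (x, t)"
        unfolding F_def
      proof (rule ennreal_leI)
        have "(B * s) powr q = B powr q * s powr q" by (rule powr_mult)
        also have "\<dots> \<le> B powr q * (real (card {4..N}) powr q * (\<Sum>m\<in>{4..N}. g.av f (k, \<alpha>, i + m) powr q))"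
          unfolding s_def using q by (intro mult_left_mono sum_powr_le g.av_nonneg v) auto
        also have "\<dots> = A * (\<Sum>m\<in>{4..N}. g.av f (k, \<alpha>, i + m) powr q)" by (simp add: A_def)
        also have "\<dots> \<le> A * (\<Sum>m\<in>{4..N}. g.Tmax (- int n) (int n) m f (x, t) powr q)"
        proof (intro mult_left_mono[OF _ A0] sum_mono powr_mono2)
          fix m
          show "g.av f (k, \<alpha>, i + m) \<le> g.Tmax (- int n) (int n) m f (x, t)"
            using g.Tmax_ge[OF kn, of f m "(x, t)"] unfolding idx by simp
        qed (use q g.av_nonneg[OF v] in auto)
        finally show "(B * s) powr q \<le> A * (\<Sum>m\<in>{4..N}. g.Tmax (- int n) (int n) m f (x, t) powr q)" .
      qed
      also have "\<dots> \<le> (SUP n. F n (x, t))" by (rule SUP_upper) simp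
      finally show ?thesis .
    qed
    show ?thesis using F_meas inc int dom by blast
  qed
  ultimately show ?thesis by blast
qed

text \<open>The finite sum over the dyadic systems dominates the supremum, and as the bounds are
  uniform in the range of generations, monotone convergence applies to each summand.\<close>

lemma wide_conds_imp_strong:
  assumes w: wide_conds and \<gamma>: "0 < \<gamma>" "\<gamma> < 1"
  shows "bounded_Lq_Lq lam \<omega> q (parabolic_maximal \<mu> p \<delta> K I Q \<gamma>)"
proof -
  define P where "P f c F \<tau> \<longleftrightarrow> (\<forall>n. F n \<in> borel_measurable lam) \<and> incseq F \<and>
      (\<forall>n. (\<integral>\<^sup>+z. F n z * ennreal (\<omega> z) \<partial>lam) \<le> ennreal c * (\<integral>\<^sup>+z. ennreal (f z powr q * \<omega> z) \<partial>lam)) \<and>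
      (\<forall>k \<alpha> x t. \<alpha> \<in> I \<tau> k \<longrightarrow> x \<in> Q \<tau> k \<alpha> \<longrightarrow>
        epowr (average lam (rectangle_plus p \<delta> Q \<gamma> \<tau> k \<alpha> t) (\<lambda>z. ennreal (f z))) q \<le> (SUP n. F n (x, t)))"
    for f c \<tau> and F :: "nat \<Rightarrow> 'a \<times> real \<Rightarrow> ennreal"
  define E where "E c \<tau> \<longleftrightarrow> (\<forall>f. f \<in> borel_measurable lam \<longrightarrow> (\<forall>z. 0 \<le> f z) \<longrightarrow>
      (\<integral>\<^sup>+z. ennreal (f z powr q * \<omega> z) \<partial>lam) < \<infinity> \<longrightarrow> (\<exists>F. P f c F \<tau>))" for c \<tau>
  have "\<forall>\<tau>\<in>{1..K}. \<exists>c. 0 \<le> c \<and> E c \<tau>"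
    using system_domination[OF w _ \<gamma>] unfolding E_def P_def by blast
  then obtain C where C: "\<forall>\<tau>\<in>{1..K}. 0 \<le> C \<tau> \<and> E (C \<tau>) \<tau>" by (rule bchoice[THEN exE])
  then have C0: "\<And>\<tau>. \<tau> \<in> {1..K} \<Longrightarrow> 0 \<le> C \<tau>" and CE: "\<And>\<tau>. \<tau> \<in> {1..K} \<Longrightarrow> E (C \<tau>) \<tau>" by blast+
  define D where "D = (\<Sum>\<tau>\<in>{1..K}. C \<tau>)"
  have D: "0 \<le> D" unfolding D_def by (intro sum_nonneg C0)
  have "Lq_norm lam \<omega> q (parabolic_maximal \<mu> p \<delta> K I Q \<gamma> f) \<le> ennreal (D powr (1 / q)) * Lq_norm lam \<omega> q (\<lambda>z. ennreal \<bar>f z\<bar>)"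
    if "f \<in> Lq_space lam \<omega> q" for f
  proof -
    let ?f = "\<lambda>z. \<bar>f z\<bar>"
    have fm [measurable]: "f \<in> borel_measurable lam" using that by (simp add: Lq_space_def)
    let ?X = "\<integral>\<^sup>+z. ennreal (?f z powr q * \<omega> z) \<partial>lam"
    have X: "(\<integral>\<^sup>+z. epowr (ennreal \<bar>f z\<bar>) q * ennreal (\<omega> z) \<partial>lam) = ?X"
      by (intro nn_integral_cong) (simp add: ennreal_mult')
    have Xfin: "?X < \<infinity>"
    proof -
      have "epowr ?X (1 / q) < \<infinity>" using that unfolding Lq_space_def Lq_norm_def mem_Collect_eq X by (rule conjunct2)
      then show ?thesis unfolding infinity_ennreal_def by (rule iffD1[OF epowr_less_top_iff])
    qed
    have am: "?f \<in> borel_measurable lam" "\<forall>z. 0 \<le> ?f z" by simp_all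
    have "\<forall>\<tau>\<in>{1..K}. \<exists>F. P ?f (C \<tau>) F \<tau>"
      using CE am Xfin unfolding E_def by blast
    then obtain F where "\<forall>\<tau>\<in>{1..K}. P ?f (C \<tau>) (F \<tau>) \<tau>" by (rule bchoice[THEN exE])
    then have FP: "P ?f (C \<tau>) (F \<tau>) \<tau>" if "\<tau> \<in> {1..K}" for \<tau> using that by blast
    note F = FP[unfolded P_def]
    have Fm: "F \<tau> n \<in> borel_measurable lam" if "\<tau> \<in> {1..K}" for \<tau> n using F[OF that] by blast
    have "(\<integral>\<^sup>+z. epowr (parabolic_maximal \<mu> p \<delta> K I Q \<gamma> f z) q * ennreal (\<omega> z) \<partial>lam)
        \<le> (\<integral>\<^sup>+z. (\<Sum>\<tau>\<in>{1..K}. (SUP n. F \<tau> n z * ennreal (\<omega> z))) \<partial>lam)"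
    proof (rule nn_integral_mono)
      fix z :: "'a \<times> real"
      obtain x t where z: "z = (x, t)" by (cases z)
      have "epowr (parabolic_maximal \<mu> p \<delta> K I Q \<gamma> f z) q \<le> (\<Sum>\<tau>\<in>{1..K}. (SUP n. F \<tau> n z))"
        unfolding parabolic_maximal_def z prod.case
      proof (rule epowr_SUP_le)
        fix i assume "i \<in> {(\<tau>, k, \<alpha>). \<tau> \<in> {1..K} \<and> \<alpha> \<in> I \<tau> k \<and> x \<in> Q \<tau> k \<alpha>}"
        then obtain \<tau> k \<alpha> where i: "i = (\<tau>, k, \<alpha>)" "\<tau> \<in> {1..K}" "\<alpha> \<in> I \<tau> k" "x \<in> Q \<tau> k \<alpha>" by blast
        have "epowr (average lam (rectangle_plus p \<delta> Q \<gamma> \<tau> k \<alpha> t) (\<lambda>z. ennreal \<bar>f z\<bar>)) q \<le> (SUP n. F \<tau> n (x, t))"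
          using F[OF i(2)] i(3,4) by blast
        also have "\<dots> \<le> (\<Sum>\<tau>\<in>{1..K}. (SUP n. F \<tau> n (x, t)))" using i(2) by (intro member_le_sum) auto
        finally show "epowr (case i of (\<tau>, k, \<alpha>) \<Rightarrow> average lam (rectangle_plus p \<delta> Q \<gamma> \<tau> k \<alpha> t) (\<lambda>z. ennreal \<bar>f z\<bar>)) q
            \<le> (\<Sum>\<tau>\<in>{1..K}. (SUP n. F \<tau> n (x, t)))" by (simp add: i(1))
      qed (use q in simp)
      then have "epowr (parabolic_maximal \<mu> p \<delta> K I Q \<gamma> f z) q * ennreal (\<omega> z)
          \<le> (\<Sum>\<tau>\<in>{1..K}. (SUP n. F \<tau> n z)) * ennreal (\<omega> z)" by (rule mult_right_mono) simp
      also have "\<dots> = (\<Sum>\<tau>\<in>{1..K}. (SUP n. F \<tau> n z * ennreal (\<omega> z)))"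
        by (simp add: sum_distrib_right SUP_mult_right_ennreal)
      finally show "epowr (parabolic_maximal \<mu> p \<delta> K I Q \<gamma> f z) q * ennreal (\<omega> z)
          \<le> (\<Sum>\<tau>\<in>{1..K}. (SUP n. F \<tau> n z * ennreal (\<omega> z)))" .
    qed
    also have "\<dots> = (\<Sum>\<tau>\<in>{1..K}. \<integral>\<^sup>+z. (SUP n. F \<tau> n z * ennreal (\<omega> z)) \<partial>lam)"
      using Fm by (intro nn_integral_sum borel_measurable_SUP borel_measurable_times_ennreal) auto
    also have "\<dots> \<le> (\<Sum>\<tau>\<in>{1..K}. ennreal (C \<tau>) * ?X)"
    proof (rule sum_mono)
      fix \<tau> assume \<tau>: "\<tau> \<in> {1..K}"
      have "(\<integral>\<^sup>+z. (SUP n. F \<tau> n z * ennreal (\<omega> z)) \<partial>lam) = (SUP n. \<integral>\<^sup>+z. F \<tau> n z * ennreal (\<omega> z) \<partial>lam)"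
      proof (rule nn_integral_monotone_convergence_SUP)
        have "incseq (F \<tau>)" using F[OF \<tau>] by blast
        then show "incseq (\<lambda>n z. F \<tau> n z * ennreal (\<omega> z))"
          by (auto simp: incseq_def le_fun_def intro!: mult_right_mono)
        show "(\<lambda>z. F \<tau> n z * ennreal (\<omega> z)) \<in> borel_measurable lam" for n
          using Fm[OF \<tau>] by (intro borel_measurable_times_ennreal) auto
      qed
      also have "\<dots> \<le> ennreal (C \<tau>) * ?X" using F[OF \<tau>] by (intro SUP_least) blast
      finally show "(\<integral>\<^sup>+z. (SUP n. F \<tau> n z * ennreal (\<omega> z)) \<partial>lam) \<le> ennreal (C \<tau>) * ?X" .
    qed
    also have "\<dots> = ennreal D * ?X"
    proof -
      have "(\<Sum>\<tau>\<in>{1..K}. ennreal (C \<tau>)) = ennreal D" unfolding D_def by (rule sum_ennreal) (rule C0)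
      then show ?thesis by (simp only: sum_distrib_right[symmetric])
    qed
    finally have "(\<integral>\<^sup>+z. epowr (parabolic_maximal \<mu> p \<delta> K I Q \<gamma> f z) q * ennreal (\<omega> z) \<partial>lam) \<le> ennreal D * ?X" .
    then have "epowr (\<integral>\<^sup>+z. epowr (parabolic_maximal \<mu> p \<delta> K I Q \<gamma> f z) q * ennreal (\<omega> z) \<partial>lam) (1 / q)
        \<le> epowr (ennreal D * ?X) (1 / q)" using q by (intro epowr_mono) auto
    also have "\<dots> = ennreal (D powr (1 / q)) * epowr ?X (1 / q)" by (rule epowr_cmult[OF D Xfin])
    finally show ?thesis unfolding Lq_norm_def X .
  qed
  then show ?thesis unfolding bounded_Lq_Lq_def by blast
qed

end

theorem theorem6p8:
  fixes \<rho> :: "'a \<Rightarrow> 'a \<Rightarrow> real" and \<mu> :: "'a measure"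
    and K0 p q \<gamma>1 \<gamma>2 \<gamma>3 \<delta> c0 C0 :: real
    and K :: nat
    and I :: "nat \<Rightarrow> int \<Rightarrow> 'i set"
    and zc :: "nat \<Rightarrow> int \<Rightarrow> 'i \<Rightarrow> 'a"
    and Q :: "nat \<Rightarrow> int \<Rightarrow> 'i \<Rightarrow> 'a set"
    and \<omega> :: "'a \<times> real \<Rightarrow> real"
  assumes "homogeneous_type \<rho> K0 \<mu>"
    and "basic_assumptions \<rho> \<mu>"
    and "monotone_geodesic \<rho>"
    and "1 < p"
    and "basic_assumptions (parabolic_dist \<rho> p) (parabolic_measure \<mu>)"
    and "adjacent_dyadic_systems \<rho> K0 \<mu> \<delta> c0 C0 K I zc Q"
    and "1 < q"
    and "0 < \<gamma>1" "\<gamma>1 < 1" "0 < \<gamma>2" "\<gamma>2 < 1" "0 < \<gamma>3" "\<gamma>3 < 1"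
    and "weight \<rho> \<mu> p \<omega>"
  shows "(\<omega> \<in> A_plus \<rho> \<mu> p q \<gamma>1 \<longleftrightarrow>
           bounded_Lq_weak_Lq (parabolic_measure \<mu>) \<omega> q (parabolic_maximal \<mu> p \<delta> K I Q \<gamma>2)) \<and>
         (bounded_Lq_weak_Lq (parabolic_measure \<mu>) \<omega> q (parabolic_maximal \<mu> p \<delta> K I Q \<gamma>2) \<longleftrightarrow>
           bounded_Lq_Lq (parabolic_measure \<mu>) \<omega> q (parabolic_maximal \<mu> p \<delta> K I Q \<gamma>3))"
proof -
  interpret weighted_parabolic_dyadic_space \<rho> K0 p q \<mu> \<omega> \<delta> c0 C0 K I zc Q
    by unfold_locales (use assms in auto)
  \<comment> \<open>Every statement is compared with \<open>wide_conds\<close>: the A_q condition is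
    equivalent to it for each lag, the weak type estimate implies it for each lag, and it implies
    the strong type estimate for each lag. This is how the three lags become independent of one
    another.\<close>
  have A: "\<omega> \<in> A_plus \<rho> \<mu> p q \<gamma>1 \<longleftrightarrow> wide_conds"
  proof
    assume "\<omega> \<in> A_plus \<rho> \<mu> p q \<gamma>1"
    then obtain C where "lag_cond (1 - \<gamma>1) (1 + \<gamma>1) C" using A_plus_imp_lag assms by blast
    then show wide_conds using assms by (intro lag_imp_wide_conds[of "1 - \<gamma>1" "1 + \<gamma>1" C]) auto
  next
    assume wide_conds
    then obtain C where "0 < C" "wide_cond (1 - \<gamma>1) (2 * \<gamma>1) C"
      using assms unfolding wide_conds_def by (meson diff_gt_0_iff_gt mult_pos_pos zero_less_numeral)
    then show "\<omega> \<in> A_plus \<rho> \<mu> p q \<gamma>1" using wide_imp_A_plus assms by blast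
  qed
  have weak: wide_conds
    if "bounded_Lq_weak_Lq lam \<omega> q (parabolic_maximal \<mu> p \<delta> K I Q \<gamma>)" "0 < \<gamma>" "\<gamma> < 1" for \<gamma>
    using weak_imp_lag[OF that(2,3,1)] lag_imp_wide_conds by metis
  have strong_weak: "bounded_Lq_weak_Lq lam \<omega> q (parabolic_maximal \<mu> p \<delta> K I Q \<gamma>)"
    if "bounded_Lq_Lq lam \<omega> q (parabolic_maximal \<mu> p \<delta> K I Q \<gamma>)" for \<gamma>
    using that assms by (intro bounded_Lq_imp_weak) auto
  show ?thesis
    using A weak[of \<gamma>2] weak[of \<gamma>3] strong_weak[of \<gamma>2] strong_weak[of \<gamma>3]
      wide_conds_imp_strong[of \<gamma>2] wide_conds_imp_strong[of \<gamma>3] assms by blast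
qed

end
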